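(* Let $g_{\alpha\beta}(y;\epsilon)$ be a family of Riemannian metrics on the 3-sphere $\mathbb{S}^3$ whose components are smooth functions of the local coordinates $y^\alpha$, $\alpha=1,2,3$, and of the small real parameter $\epsilon$, and such that $g_{\alpha\beta}(y;0)=(g_0)_{\alpha\beta}(y)$ is the standard (round) metric on the unit 3-sphere. Let $\lambda_+(\epsilon)$ and $\lambda_-(\epsilon)$ be the lowest, in terms of absolute value, positive and negative eigenvalues of the massless Dirac operator $W(\epsilon)$ corresponding to the metric $g_{\alpha\beta}(y;\epsilon)$, with asymptotic expansions $$\lambda_\pm(\epsilon)=\pm\tfrac32+\lambda_\pm^{(1)}\epsilon+\lambda_\pm^{(2)}\epsilon^2+O(\epsilon^3)\quad\text{as }\epsilon\to0.$$ Let $V(\epsilon)=\int_{\mathbb{S}^3}\sqrt{\det g_{\mu\nu}(y;\epsilon)}\,dy$ be the Riemannian volume, with expansion $V(\epsilon)=V^{(0)}+V^{(1)}\epsilon+O(\epsilon^2)$ as $\epsilon\to0$. Then $$\lambda_\pm^{(1)}=\mp\frac{1}{4\pi^2}V^{(1)}.$$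
   Context: Here $dy=dy^1dy^2dy^3$, and repeated indices are summed over. $\mathbb{S}^3=\{\mathbf{x}\in\mathbb{R}^4:\|\mathbf{x}\|=1\}$; the standard metric $g_0$ is the restriction of the Euclidean metric of $\mathbb{R}^4$. $\mathbb{S}^3$ is oriented so that the spherical coordinates $\mathbf{x}=(\cos y^1,\ \sin y^1\cos y^2,\ \sin y^1\sin y^2\cos y^3,\ \sin y^1\sin y^2\sin y^3)$, $y^1,y^2\in(0,\pi)$, $y^3\in[0,2\pi)$, are positively oriented. Only positively oriented local coordinates are used. Massless Dirac operator. Given a Riemannian metric $g$ on $\mathbb{S}^3$, choose a smooth frame $e_1,e_2,e_3$ of real vector fields on $\mathbb{S}^3$ which is orthonormal with respect to $g$ and positively oriented, i.e. $\det e_j{}^\alpha>0$, where $e_j{}^\alpha$ are the coordinate components of $e_j$. Put $\sigma^\alpha(y)=s^j e_j{}^\alpha(y)$, $\sigma_\beta=g_{\beta\gamma}\sigma^\gamma$, where $$s^1=\begin{pmatrix}0&1\\1&0\end{pmatrix},\quad s^2=\begin{pmatrix}0&-i\\i&0\end{pmatrix},\quad s^3=\begin{pmatrix}1&0\\0&-1\end{pmatrix}.$$ The massless Dirac operator acts on 2-columns of complex-valued scalar fields as $$W=-i\sigma^\alpha\left(\frac{\partial}{\partial y^\alpha}+\frac14\sigma_\beta\left(\frac{\partial\sigma^\beta}{\partial y^\alpha}+\Gamma^\beta{}_{\alpha\gamma}\sigma^\gamma\right)\right),$$ where $\Gamma^\beta{}_{\alpha\gamma}$ are the Christoffel symbols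 of $g$. A different choice of frame replaces $W$ by $R^*WR$ with a smooth $R:\mathbb{S}^3\to\mathrm{SU}(2)$, so the spectrum depends only on $g$. $W$ is self-adjoint in $L^2(\mathbb{S}^3;\mathbb{C}^2)$, with inner product $\langle v,w\rangle=\int_{\mathbb{S}^3}w^*v\,\sqrt{\det g_{\alpha\beta}}\,dy$ and domain $H^1(\mathbb{S}^3;\mathbb{C}^2)$. Its spectrum is discrete and all its eigenvalues have even multiplicity. For the standard metric the eigenvalues are $\pm(k+\frac12)$, $k=1,2,\ldots$, with multiplicity $k(k+1)$, so $\lambda_\pm(0)=\pm\frac32$ are double eigenvalues. For small $\epsilon$ the eigenvalues $\lambda_\pm(\epsilon)$ remain double, and it is known a priori that the stated asymptotic expansions of $\lambda_\pm(\epsilon)$ exist; they define $\lambda_\pm^{(1)}$ and $\lambda_\pm^{(2)}$. One has $V^{(0)}=2\pi^2$ and $V^{(1)}=\frac12\int_{\mathbb{S}^3}h_{\alpha\beta}(g_0)^{\alpha\beta}\sqrt{\det(g_0)_{\mu\nu}}\,dy$, where $h_{\alpha\beta}=\left.\partial g_{\alpha\beta}/\partial\epsilon\right|_{\epsilon=0}$. *)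

theory Defs
  imports "HOL-Analysis.Analysis" "HOL-Library.Landau_Symbols"
begin

section \<open>Smooth functions on open sets\<close>

fun Ck_on :: "nat \<Rightarrow> ('a::real_normed_vector \<Rightarrow> 'b::real_normed_vector) \<Rightarrow> 'a set \<Rightarrow> bool"
  where
    "Ck_on 0 f S \<longleftrightarrow> continuous_on S f"
  | "Ck_on (Suc n) f S \<longleftrightarrow> (\<forall>x\<in>S. f differentiable (at x)) \<and>
       (\<forall>v. Ck_on n (\<lambda>x. frechet_derivative f (at x) v) S)"

text \<open>Used only for open \<open>S\<close> in finite-dimensional spaces, where it is the usual notion.\<close>

definition Cinf_on :: "('a::real_normed_vector \<Rightarrow> 'b::real_normed_vector) \<Rightarrow> 'a set \<Rightarrow> bool"
  where "Cinf_on f S \<longleftrightarrow> (\<forall>n. Ck_on n f S)"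

definition pd :: "(real^3 \<Rightarrow> 'b::real_normed_vector) \<Rightarrow> 3 \<Rightarrow> real^3 \<Rightarrow> 'b"
  where "pd f \<alpha> y = frechet_derivative f (at y) (axis \<alpha> 1)"


section \<open>The 3-sphere and its positively oriented local coordinates\<close>

definition S3 :: "(real^4) set"
  where "S3 = sphere 0 1"

definition tangent_S3 :: "real^4 \<Rightarrow> (real^4) set"
  where "tangent_S3 x = {v. x \<bullet> v = 0}"

text \<open>Local coordinates \<open>y\<close> on the open subset \<open>\<phi> ` U\<close> of the sphere are given by their inverse, the
  local parametrization \<open>\<phi>\<close>.\<close>

definition local_coords :: "(real^3 \<Rightarrow> real^4) \<Rightarrow> (real^3) set \<Rightarrow> bool"
  where "local_coords \<phi> U \<longleftrightarrow>
    open U \<and> Cinf_on \<phi> U \<and> openin (top_of_set S3) (\<phi> ` U) \<and>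
    (\<exists>\<psi>. homeomorphism U (\<phi> ` U) \<phi> \<psi>) \<and>
    (\<forall>y\<in>U. inj (frechet_derivative \<phi> (at y)))"

text \<open>Orientation convention: at \<open>x\<close> the triple \<open>u\<close> of tangent vectors is positive iff \<open>(x, u 1, u 2, u 3)\<close>
  is positively oriented in \<open>real^4\<close>. By \<open>det_spherical\<close> below this is the orientation in which the
  spherical coordinates are positively oriented.\<close>

definition orientation_matrix :: "real^4 \<Rightarrow> (3 \<Rightarrow> real^4) \<Rightarrow> real^4^4"
  where "orientation_matrix x u = vector [x, u 1, u 2, u 3]"

definition pos_coords :: "(real^3 \<Rightarrow> real^4) \<Rightarrow> (real^3) set \<Rightarrow> bool"
  where "pos_coords \<phi> U \<longleftrightarrow> local_coords \<phi> U \<and>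
    (\<forall>y\<in>U. det (orientation_matrix (\<phi> y) (\<lambda>\<alpha>. pd \<phi> \<alpha> y)) > 0)"

definition spherical :: "real^3 \<Rightarrow> real^4"
  where "spherical y = vector [cos (y$1), sin (y$1) * cos (y$2),
     sin (y$1) * sin (y$2) * cos (y$3), sin (y$1) * sin (y$2) * sin (y$3)]"

definition spherical_domain :: "(real^3) set"
  where "spherical_domain =
    {y. 0 < y$1 \<and> y$1 < pi \<and> 0 < y$2 \<and> y$2 < pi \<and> 0 \<le> y$3 \<and> y$3 < 2 * pi}"

lemma vector_4:
  "(vector [a, b, c, d] :: 'a::zero^4) $ 1 = a" "(vector [a, b, c, d] :: 'a^4) $ 2 = b"
  "(vector [a, b, c, d] :: 'a^4) $ 3 = c" "(vector [a, b, c, d] :: 'a^4) $ 4 = d"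
  by (simp_all add: vector_def)

lemma spherical_has_derivative:
  "(spherical has_derivative (\<lambda>h. vector
     [- sin (y$1) * h$1,
      cos (y$1) * cos (y$2) * h$1 - sin (y$1) * sin (y$2) * h$2,
      cos (y$1) * sin (y$2) * cos (y$3) * h$1 + sin (y$1) * cos (y$2) * cos (y$3) * h$2
        - sin (y$1) * sin (y$2) * sin (y$3) * h$3,
      cos (y$1) * sin (y$2) * sin (y$3) * h$1 + sin (y$1) * cos (y$2) * sin (y$3) * h$2
        + sin (y$1) * sin (y$2) * cos (y$3) * h$3])) (at y)"
  (is "(_ has_derivative ?D) _")
proof -
  have nth: "((\<lambda>y::real^3. y $ i) has_derivative (\<lambda>h. h $ i)) (at y)" for i
    by (rule bounded_linear_imp_has_derivative) (rule bounded_linear_vec_nth)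
  have "\<forall>i. ((\<lambda>y. spherical y $ i) has_derivative (\<lambda>h. ?D h $ i)) (at y)"
    unfolding forall_4 spherical_def vector_4
    by (auto intro!: derivative_eq_intros nth simp: algebra_simps)
  then show ?thesis
    by (subst has_derivative_componentwise_within) (auto simp: Basis_vec_def inner_axis)
qed

lemma det_spherical:
  "det (orientation_matrix (spherical y) (\<lambda>\<alpha>. pd spherical \<alpha> y)) = (sin (y$1))\<^sup>2 * sin (y$2)"
proof -
  have pd: "pd spherical \<alpha> y = (\<lambda>h. vector
     [- sin (y$1) * h$1,
      cos (y$1) * cos (y$2) * h$1 - sin (y$1) * sin (y$2) * h$2,
      cos (y$1) * sin (y$2) * cos (y$3) * h$1 + sin (y$1) * cos (y$2) * cos (y$3) * h$2
        - sin (y$1) * sin (y$2) * sin (y$3) * h$3,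
      cos (y$1) * sin (y$2) * sin (y$3) * h$1 + sin (y$1) * cos (y$2) * sin (y$3) * h$2
        + sin (y$1) * sin (y$2) * cos (y$3) * h$3]) (axis \<alpha> 1)" for \<alpha>
    unfolding pd_def frechet_derivative_at[OF spherical_has_derivative, symmetric] ..
  have f: "finite {2::4,3,4}" "1 \<notin> {2::4,3,4}" "finite {3::4,4}" "2 \<notin> {3::4,4}" "finite {4::4}" "3 \<notin> {4::4}"
    by auto
  define a1 b1 a2 b2 a3 b3 where ab: "a1 = sin (y$1)" "b1 = cos (y$1)" "a2 = sin (y$2)"
    "b2 = cos (y$2)" "a3 = sin (y$3)" "b3 = cos (y$3)"
  have sq: "b1^2 = 1 - a1^2" "b2^2 = 1 - a2^2" "b3^2 = 1 - a3^2"
    by (auto simp: ab cos_squared_eq)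
  show ?thesis
    unfolding det_def UNIV_4
    unfolding sum_over_permutations_insert[OF f(1,2)] sum_over_permutations_insert[OF f(3,4)]
      sum_over_permutations_insert[OF f(5,6)] permutes_sing
    apply (simp add: sign_swap_id permutation_swap_id sign_compose permutation_compose sign_id
        orientation_matrix_def vector_4 pd spherical_def axis_def flip: ab)
    using sq apply algebra
    done
qed


section \<open>Riemannian metrics on the 3-sphere\<close>

text \<open>A metric \<open>g x v w\<close> takes tangent vectors as vectors of the ambient space; its values for
  \<open>x\<close> off the sphere or \<open>v\<close>, \<open>w\<close> not tangent at \<open>x\<close> are unconstrained and never used.\<close>

type_synonym metric = "real^4 \<Rightarrow> real^4 \<Rightarrow> real^4 \<Rightarrow> real"

definition metric_comp :: "metric \<Rightarrow> (real^3 \<Rightarrow> real^4) \<Rightarrow> real^3 \<Rightarrow> real^3^3"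
  where "metric_comp g \<phi> y = (\<chi> \<alpha> \<beta>. g (\<phi> y) (pd \<phi> \<alpha> y) (pd \<phi> \<beta> y))"

definition pointwise_metric :: "metric \<Rightarrow> bool"
  where "pointwise_metric g \<longleftrightarrow> (\<forall>x\<in>S3.
    (\<forall>u\<in>tangent_S3 x. \<forall>v\<in>tangent_S3 x. \<forall>w\<in>tangent_S3 x. \<forall>a b.
        g x (a *\<^sub>R u + b *\<^sub>R v) w = a * g x u w + b * g x v w) \<and>
    (\<forall>v\<in>tangent_S3 x. \<forall>w\<in>tangent_S3 x. g x v w = g x w v) \<and>
    (\<forall>v\<in>tangent_S3 x. v \<noteq> 0 \<longrightarrow> g x v v > 0))"

definition riemannian_metric :: "metric \<Rightarrow> bool"
  where "riemannian_metric g \<longleftrightarrow> pointwise_metric g \<and>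
    (\<forall>\<phi> U. pos_coords \<phi> U \<longrightarrow> (\<forall>\<alpha> \<beta>. Cinf_on (\<lambda>y. metric_comp g \<phi> y $ \<alpha> $ \<beta>) U))"

definition smooth_metric_family :: "real \<Rightarrow> (real \<Rightarrow> metric) \<Rightarrow> bool"
  where "smooth_metric_family \<epsilon>0 g \<longleftrightarrow>
    (\<forall>\<epsilon>. \<bar>\<epsilon>\<bar> < \<epsilon>0 \<longrightarrow> riemannian_metric (g \<epsilon>)) \<and>
    (\<forall>\<phi> U. pos_coords \<phi> U \<longrightarrow>
      (\<forall>\<alpha> \<beta>. Cinf_on (\<lambda>(y, \<epsilon>). metric_comp (g \<epsilon>) \<phi> y $ \<alpha> $ \<beta>) (U \<times> {-\<epsilon>0<..<\<epsilon>0})))"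

definition is_standard_metric :: "metric \<Rightarrow> bool"
  where "is_standard_metric g \<longleftrightarrow>
    (\<forall>x\<in>S3. \<forall>v\<in>tangent_S3 x. \<forall>w\<in>tangent_S3 x. g x v w = v \<bullet> w)"

text \<open>Spherical coordinates omit only a null set of the sphere.\<close>

definition riemannian_volume :: "metric \<Rightarrow> real"
  where "riemannian_volume g =
    (LINT y:spherical_domain|lborel. sqrt (det (metric_comp g spherical y)))"

definition christoffel :: "metric \<Rightarrow> (real^3 \<Rightarrow> real^4) \<Rightarrow> real^3 \<Rightarrow> 3 \<Rightarrow> 3 \<Rightarrow> 3 \<Rightarrow> real"
  where "christoffel g \<phi> y \<beta> \<alpha> \<gamma> = (\<Sum>\<delta>\<in>UNIV. matrix_inv (metric_comp g \<phi> y) $ \<beta> $ \<delta> / 2 *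
     (pd (\<lambda>z. metric_comp g \<phi> z $ \<gamma> $ \<delta>) \<alpha> y + pd (\<lambda>z. metric_comp g \<phi> z $ \<alpha> $ \<delta>) \<gamma> y
        - pd (\<lambda>z. metric_comp g \<phi> z $ \<alpha> $ \<gamma>) \<delta> y))"


section \<open>Orthonormal frames\<close>

type_synonym frame = "3 \<Rightarrow> real^4 \<Rightarrow> real^4"

text \<open>The coordinate components \<open>c\<^sup>\<alpha>\<close> of the tangent vector \<open>v = \<Sum>\<alpha>. c\<^sup>\<alpha> \<partial>\<phi>/\<partial>y\<^sup>\<alpha>\<close> at \<open>\<phi> y\<close>.\<close>

definition vec_comp :: "(real^3 \<Rightarrow> real^4) \<Rightarrow> real^3 \<Rightarrow> real^4 \<Rightarrow> real^3"
  where "vec_comp \<phi> y v = (THE c. v = (\<Sum>\<alpha>\<in>UNIV. (c $ \<alpha>) *\<^sub>R pd \<phi> \<alpha> y))"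

definition frame_comp :: "frame \<Rightarrow> (real^3 \<Rightarrow> real^4) \<Rightarrow> real^3 \<Rightarrow> real^3^3"
  where "frame_comp e \<phi> y = (\<chi> j. vec_comp \<phi> y (e j (\<phi> y)))"

definition pos_orthonormal_frame :: "metric \<Rightarrow> frame \<Rightarrow> bool"
  where "pos_orthonormal_frame g e \<longleftrightarrow>
    (\<forall>x\<in>S3. \<forall>j. e j x \<in> tangent_S3 x) \<and>
    (\<forall>x\<in>S3. \<forall>j k. g x (e j x) (e k x) = (if j = k then 1 else 0)) \<and>
    (\<forall>\<phi> U. pos_coords \<phi> U \<longrightarrow>
      (\<forall>j \<alpha>. Cinf_on (\<lambda>y. frame_comp e \<phi> y $ j $ \<alpha>) U) \<and>
      (\<forall>y\<in>U. det (frame_comp e \<phi> y) > 0))"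


section \<open>Sobolev space\<close>

definition loc_L2 :: "(real^3) set \<Rightarrow> (real^3 \<Rightarrow> complex^2) \<Rightarrow> bool"
  where "loc_L2 U w \<longleftrightarrow> w \<in> borel_measurable (lebesgue_on U) \<and>
    (\<forall>K. compact K \<and> K \<subseteq> U \<longrightarrow> integrable (lebesgue_on K) (\<lambda>y. (norm (w y))\<^sup>2))"

definition test_function :: "(real^3) set \<Rightarrow> (real^3 \<Rightarrow> real) \<Rightarrow> bool"
  where "test_function U \<psi> \<longleftrightarrow> Cinf_on \<psi> UNIV \<and>
    (\<exists>K. compact K \<and> K \<subseteq> U \<and> (\<forall>y. y \<notin> K \<longrightarrow> \<psi> y = 0))"

text \<open>\<open>p\<close> is a weak derivative of \<open>w\<close> with respect to \<open>y\<^sup>\<alpha>\<close> in \<open>U\<close> and is locally square integrable.\<close>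

definition weak_pd ::
    "(real^3) set \<Rightarrow> 3 \<Rightarrow> (real^3 \<Rightarrow> complex^2) \<Rightarrow> (real^3 \<Rightarrow> complex^2) \<Rightarrow> bool"
  where "weak_pd U \<alpha> w p \<longleftrightarrow> loc_L2 U p \<and>
    (\<forall>\<psi>. test_function U \<psi> \<longrightarrow>
      (LINT y|lebesgue_on U. pd \<psi> \<alpha> y *\<^sub>R w y) = - (LINT y|lebesgue_on U. \<psi> y *\<^sub>R p y))"

text \<open>The sphere being compact, local square integrability in all coordinates is the same as square
  integrability over the sphere, for any choice of metric. As usual, functions that agree almost
  everywhere are identified.\<close>

definition H1_S3 :: "(real^4 \<Rightarrow> complex^2) \<Rightarrow> bool"
  where "H1_S3 v \<longleftrightarrow> (\<forall>\<phi> U. pos_coords \<phi> U \<longrightarrow>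
    loc_L2 U (v \<circ> \<phi>) \<and> (\<forall>\<alpha>. \<exists>p. weak_pd U \<alpha> (v \<circ> \<phi>) p))"

definition ae_zero_S3 :: "(real^4 \<Rightarrow> complex^2) \<Rightarrow> bool"
  where "ae_zero_S3 v \<longleftrightarrow> (\<forall>\<phi> U. pos_coords \<phi> U \<longrightarrow> (AE y in lebesgue_on U. v (\<phi> y) = 0))"


section \<open>The massless Dirac operator\<close>

definition pauli :: "3 \<Rightarrow> complex^2^2"
  where "pauli j =
    (if j = 1 then vector [vector [0, 1], vector [1, 0]]
     else if j = 2 then vector [vector [0, - \<i>], vector [\<i>, 0]]
     else vector [vector [1, 0], vector [0, - 1]])"

definition sigma_up :: "frame \<Rightarrow> (real^3 \<Rightarrow> real^4) \<Rightarrow> 3 \<Rightarrow> real^3 \<Rightarrow> complex^2^2"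
  where "sigma_up e \<phi> \<alpha> y = (\<Sum>j\<in>UNIV. (frame_comp e \<phi> y $ j $ \<alpha>) *\<^sub>R pauli j)"

definition sigma_down :: "metric \<Rightarrow> frame \<Rightarrow> (real^3 \<Rightarrow> real^4) \<Rightarrow> 3 \<Rightarrow> real^3 \<Rightarrow> complex^2^2"
  where "sigma_down g e \<phi> \<beta> y =
    (\<Sum>\<gamma>\<in>UNIV. (metric_comp g \<phi> y $ \<beta> $ \<gamma>) *\<^sub>R sigma_up e \<phi> \<gamma> y)"

text \<open>The value of the local Dirac expression at \<open>y\<close> for a field with value \<open>w\<close> and partial
  derivatives \<open>p \<alpha>\<close> there.\<close>

definition dirac_expr ::
    "metric \<Rightarrow> frame \<Rightarrow> (real^3 \<Rightarrow> real^4) \<Rightarrow> real^3 \<Rightarrow> complex^2 \<Rightarrow> (3 \<Rightarrow> complex^2) \<Rightarrow> complex^2"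
  where "dirac_expr g e \<phi> y w p = (- \<i>) *s (\<Sum>\<alpha>\<in>UNIV. sigma_up e \<phi> \<alpha> y *v
    (p \<alpha> + (1/4) *\<^sub>R ((\<Sum>\<beta>\<in>UNIV. sigma_down g e \<phi> \<beta> y **
        (pd (sigma_up e \<phi> \<beta>) \<alpha> y +
         (\<Sum>\<gamma>\<in>UNIV. christoffel g \<phi> y \<beta> \<alpha> \<gamma> *\<^sub>R sigma_up e \<phi> \<gamma> y))) *v w)))"

text \<open>\<open>dirac g e v f\<close>: the field \<open>v\<close> lies in the domain \<open>H\<^sup>1\<close> of \<open>W\<close> and \<open>W v = f\<close>.\<close>

definition dirac :: "metric \<Rightarrow> frame \<Rightarrow> (real^4 \<Rightarrow> complex^2) \<Rightarrow> (real^4 \<Rightarrow> complex^2) \<Rightarrow> bool"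
  where "dirac g e v f \<longleftrightarrow> H1_S3 v \<and>
    (\<forall>\<phi> U p. pos_coords \<phi> U \<and> (\<forall>\<alpha>. weak_pd U \<alpha> (v \<circ> \<phi>) (p \<alpha>)) \<longrightarrow>
      (AE y in lebesgue_on U. f (\<phi> y) = dirac_expr g e \<phi> y (v (\<phi> y)) (\<lambda>\<alpha>. p \<alpha> y)))"

definition dirac_eigenvalue :: "metric \<Rightarrow> frame \<Rightarrow> real \<Rightarrow> bool"
  where "dirac_eigenvalue g e lam \<longleftrightarrow> (\<exists>v. \<not> ae_zero_S3 v \<and> dirac g e v (\<lambda>x. lam *\<^sub>R v x))"

definition lowest_pos_eigenvalue :: "metric \<Rightarrow> frame \<Rightarrow> real \<Rightarrow> bool"
  where "lowest_pos_eigenvalue g e lam \<longleftrightarrow> dirac_eigenvalue g e lam \<and> lam > 0 \<and>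
    (\<forall>\<mu>. dirac_eigenvalue g e \<mu> \<and> \<mu> > 0 \<longrightarrow> \<bar>lam\<bar> \<le> \<bar>\<mu>\<bar>)"

definition lowest_neg_eigenvalue :: "metric \<Rightarrow> frame \<Rightarrow> real \<Rightarrow> bool"
  where "lowest_neg_eigenvalue g e lam \<longleftrightarrow> dirac_eigenvalue g e lam \<and> lam < 0 \<and>
    (\<forall>\<mu>. dirac_eigenvalue g e \<mu> \<and> \<mu> < 0 \<longrightarrow> \<bar>lam\<bar> \<le> \<bar>\<mu>\<bar>)"

end

(* Idea. Let tau = 1 or -1 and lam0 = -3 tau / 2. The left- (right-) invariant orthonormal fields of the round sphere
   trivialise its spinor bundle in such a way that W becomes D - 3 tau / 2, where D (D - 2 tau) = - Lap; hence the constant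
   spinors form the eigenspace of lam0. For the metric g(eps) take the frame B E obtained from these invariant fields E by
   Gram-Schmidt, so that B = I + b with b = O(eps); a rotation of the frame lifts to SU(2), so the given frame may be
   replaced by this one. Everything is done with the weak form of the eigenvalue equation. Testing it with
   (D - 2 tau)(psi c), where - Lap psi = f, shows that an eigenspinor u is within O(eps) |u| of its mean in L2. Testing it with
   constant spinors c then gives, since the derivatives of b integrate to zero,
   (lam - lam0) vol(S3) + (tau / 2) \<integral> tr b = O(eps^2), whereas V(eps) = \<integral> 1 / det B = vol(S3) - \<integral> tr b + O(eps^2). *)
theory Submission
  imports Defs
begin

section \<open>Smooth functions\<close>

text \<open>An eigenspinor is only known to lie in H^1. No derivative ever falls on it: it is always
  paired with smooth test rows, so no elliptic regularity and no perturbation theory of the spectrum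
  enters. The estimates hold for any eigenvalue within O(eps) of lam0, and the given expansion
  supplies that closeness. Both signs of \<tau> occur because each invariant frame has constant
  eigenspinors for only one of the two eigenvalues; both frames are positively oriented. The factor
  D - 2 \<tau> absorbs the commutators of the frame: D^2 = 2 \<tau> D - Lap. What remains is a
  scalar Poisson equation, solved by an explicit recursion on powers of linear forms. Density of
  their span and duality turn estimates for the test functions into an L2 bound for u minus its
  mean. All integrals are taken in one stereographic chart. It misses a point, and cutoffs near that
  point disappear in the limit. Eliminating \<integral> tr b between the two first-order relations
  gives (lam - lam0) * 2 pi^2 = (\<tau> / 2) (V - 2 pi^2) + O(eps^2), whence the coefficient \<tau>
  / (4 pi^2), with \<tau> = -1 for the positive eigenvalue.\<close>

lemma Ck_on_cong:
  assumes "open S" "\<And>x. x \<in> S \<Longrightarrow> f x = g x" "Ck_on n f S"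
  shows "Ck_on n g S"
  using assms
proof (induction n arbitrary: f g)
  case 0
  then show ?case by (simp cong: continuous_on_cong)
next
  case (Suc n)
  have d: "(g has_derivative frechet_derivative f (at x)) (at x)" if "x \<in> S" for x
    using Suc.prems that frechet_derivative_works has_derivative_transform_within_open
    by (metis Ck_on.simps(2))
  then have eq: "frechet_derivative f (at x) = frechet_derivative g (at x)" if "x \<in> S" for x
    using that frechet_derivative_at by metis
  have "Ck_on n (\<lambda>x. frechet_derivative g (at x) v) S" for v
  proof (rule Suc.IH[OF \<open>open S\<close>])
    show "Ck_on n (\<lambda>x. frechet_derivative f (at x) v) S"
      using Suc.prems(3) by (simp only: Ck_on.simps)
  qed (simp add: eq)
  then show ?case
    using d unfolding Ck_on.simps differentiable_def by blast
qed

text \<open>The definition speaks of \<open>frechet_derivative\<close>; this rule accepts any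
  explicit formula for the derivative. The closure properties below follow from it by induction on
  the order, because the derivative formula is again built from the same operations.\<close>

lemma Ck_on_SucI:
  assumes "open S" "\<And>x. x \<in> S \<Longrightarrow> (f has_derivative f' x) (at x)"
    and "\<And>v. Ck_on n (\<lambda>x. f' x v) S"
  shows "Ck_on (Suc n) f S"
proof -
  have "frechet_derivative f (at x) = f' x" if "x \<in> S" for x
    using assms(2)[OF that] frechet_derivative_at by metis
  then have "Ck_on n (\<lambda>x. frechet_derivative f (at x) v) S" for v
    by (intro Ck_on_cong[OF assms(1) _ assms(3)[of v]]) simp
  then show ?thesis
    using assms(2) by (auto simp: differentiable_def)
qed

lemma Ck_on_continuous: "Ck_on n f S \<Longrightarrow> continuous_on S f"
proof (cases n)
  case (Suc m)
  assume "Ck_on n f S"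
  then show ?thesis unfolding Suc Ck_on.simps
    by (blast intro: continuous_at_imp_continuous_on differentiable_imp_continuous_within)
qed simp

lemma Ck_on_SucD: "Ck_on (Suc n) f S \<Longrightarrow> Ck_on n f S"
proof (induction n arbitrary: f)
  case 0
  then show ?case unfolding Ck_on.simps(1) by (rule Ck_on_continuous)
next
  case (Suc n)
  then show ?case unfolding Ck_on.simps(2)[of "Suc n" f] Ck_on.simps(2)[of n f] by blast
qed

lemma Ck_on_subset: "Ck_on n f S \<Longrightarrow> T \<subseteq> S \<Longrightarrow> Ck_on n f T"
  by (induction n arbitrary: f) (auto intro: continuous_on_subset)

text \<open>Needed where a smooth formula is available only locally: for the lift of a rotation to
  quaternions, and for the Gram matrix, which is seen through two charts.\<close>

lemma Ck_on_local:
  assumes "\<And>x. x \<in> S \<Longrightarrow> \<exists>T. open T \<and> x \<in> T \<and> Ck_on n f T"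
  shows "Ck_on n f S"
  using assms
proof (induction n arbitrary: f)
  case 0
  then show ?case
    by (auto intro!: continuous_at_imp_continuous_on) (meson continuous_on_eq_continuous_at)
next
  case (Suc n)
  have "f differentiable at x" if "x \<in> S" for x
    using Suc.prems[OF that] Ck_on.simps(2) by blast
  moreover have "Ck_on n (\<lambda>x. frechet_derivative f (at x) v) S" for v
  proof (rule Suc.IH)
    fix x assume "x \<in> S"
    then show "\<exists>T. open T \<and> x \<in> T \<and> Ck_on n (\<lambda>x. frechet_derivative f (at x) v) T"
      using Suc.prems[of x] Ck_on.simps(2) by blast
  qed
  ultimately show ?case by simp
qed

lemma Ck_on_const: "Ck_on n (\<lambda>x. c) S"
  by (induction n arbitrary: c) (auto simp: frechet_derivative_const)

lemma Ck_on_bounded_linear: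
  assumes "open S" "bounded_linear f" shows "Ck_on n f S"
proof (cases n)
  case 0
  then show ?thesis using assms(2) by (simp add: linear_continuous_on)
next
  case (Suc m)
  have "(f has_derivative f) (at x)" for x
    by (rule bounded_linear_imp_has_derivative[OF assms(2)])
  then show ?thesis unfolding Suc
    by (rule Ck_on_SucI[OF assms(1), where f'="\<lambda>x. f", OF _ Ck_on_const])
qed

lemma has_derivative_frechet: "Ck_on (Suc n) f S \<Longrightarrow> x \<in> S \<Longrightarrow> (f has_derivative frechet_derivative f (at x)) (at x)"
  unfolding Ck_on.simps by (rule frechet_derivative_works[THEN iffD1]) blast

lemma Ck_on_add:
  assumes "open S" "Ck_on n f S" "Ck_on n g S"
  shows "Ck_on n (\<lambda>x. f x + g x) S"
  using assms
proof (induction n arbitrary: f g)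
  case 0
  then show ?case by (auto intro: continuous_intros)
next
  case (Suc n)
  show ?case
    by (rule Ck_on_SucI[OF \<open>open S\<close> has_derivative_add[OF has_derivative_frechet[OF Suc.prems(2)] has_derivative_frechet[OF Suc.prems(3)]]])
      (use Suc in auto)
qed

lemma Ck_on_bilinear:
  assumes h: "bounded_bilinear h" and "open S" "Ck_on n f S" "Ck_on n g S"
  shows "Ck_on n (\<lambda>x. h (f x) (g x)) S"
  using assms(2-)
proof (induction n arbitrary: f g)
  case 0
  then show ?case unfolding Ck_on.simps by (intro bounded_bilinear.continuous_on[OF h])
next
  case (Suc n)
  note d = bounded_bilinear.FDERIV[OF h has_derivative_frechet[OF Suc.prems(2)] has_derivative_frechet[OF Suc.prems(3)]]
  show ?case
    by (rule Ck_on_SucI[OF \<open>open S\<close> d])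
      (assumption | rule Ck_on_add Suc.IH \<open>open S\<close> Ck_on_SucD[OF Suc.prems(2)] Ck_on_SucD[OF Suc.prems(3)]
        Suc.prems(2,3)[unfolded Ck_on.simps, THEN conjunct2, rule_format])+
qed

lemma Ck_on_linear_compose:
  assumes h: "bounded_linear h" and "open S" "Ck_on n f S"
  shows "Ck_on n (\<lambda>x. h (f x)) S"
  using assms(2-)
proof (induction n arbitrary: f)
  case 0
  then show ?case unfolding Ck_on.simps by (intro bounded_linear.continuous_on[OF h])
next
  case (Suc n)
  note d = bounded_linear.has_derivative[OF h has_derivative_frechet[OF Suc.prems(2)]]
  show ?case
    by (rule Ck_on_SucI[OF \<open>open S\<close> d])
      (assumption | rule Suc.IH \<open>open S\<close> Suc.prems(2)[unfolded Ck_on.simps, THEN conjunct2, rule_format])+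
qed

lemma Ck_on_sum:
  assumes "open S" "\<And>i. i \<in> I \<Longrightarrow> Ck_on n (f i) S"
  shows "Ck_on n (\<lambda>x. \<Sum>i\<in>I. f i x) S"
proof (cases "finite I")
  case True
  then show ?thesis using assms(2)
    by (induction I) (auto intro: Ck_on_const Ck_on_add[OF assms(1)])
qed (simp add: Ck_on_const)

lemma Ck_on_Pair:
  assumes "open S" "Ck_on n f S" "Ck_on n g S"
  shows "Ck_on n (\<lambda>x. (f x, g x)) S"
proof -
  have "bounded_linear (\<lambda>a. (a, 0))" "bounded_linear (\<lambda>a. (0, a))"
    by (intro bounded_linear_Pair bounded_linear_ident bounded_linear_zero)+
  then have "Ck_on n (\<lambda>x. (f x, 0) + (0, g x)) S"
    by (intro Ck_on_add assms Ck_on_linear_compose[where h="\<lambda>a. (a, 0)"] Ck_on_linear_compose[where h="\<lambda>a. (0, a)"])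
  then show ?thesis by simp
qed

lemma linear_expand_Basis:
  fixes v :: "'a::euclidean_space"
  assumes "linear f" shows "f v = (\<Sum>b\<in>Basis. (v \<bullet> b) *\<^sub>R f b)"
proof -
  have "f v = f (\<Sum>b\<in>Basis. (v \<bullet> b) *\<^sub>R b)" by (simp add: euclidean_representation)
  also have "\<dots> = (\<Sum>b\<in>Basis. (v \<bullet> b) *\<^sub>R f b)"
    using assms by (simp add: linear_sum linear_scale)
  finally show ?thesis .
qed

text \<open>The derivative of \<open>f\<close> is evaluated in the moving direction g'(x) v, whereas
  \<open>Ck_on\<close> controls only fixed directions. Expanding that direction in
  \<open>Basis\<close> reduces to fixed ones; hence the Euclidean codomain of
  \<open>g\<close>.\<close>

lemma Ck_on_compose:
  fixes g :: "'a::real_normed_vector \<Rightarrow> 'b::euclidean_space"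
  assumes "open S" "open T" "Ck_on n f T" "Ck_on n g S" "g ` S \<subseteq> T"
  shows "Ck_on n (\<lambda>x. f (g x)) S"
  using assms(3-)
proof (induction n arbitrary: f g)
  case 0
  then show ?case by (auto intro: continuous_on_compose2)
next
  case (Suc n)
  have df: "(f has_derivative frechet_derivative f (at (g x))) (at (g x))" if "x \<in> S" for x
    using has_derivative_frechet[OF Suc.prems(1)] that Suc.prems(3) by auto
  have d: "((\<lambda>x. f (g x)) has_derivative
     (\<lambda>v. \<Sum>b\<in>Basis. (frechet_derivative g (at x) v \<bullet> b) *\<^sub>R frechet_derivative f (at (g x)) b)) (at x)"
    if "x \<in> S" for x
  proof (rule has_derivative_eq_rhs)
    show "((\<lambda>x. f (g x)) has_derivative (frechet_derivative f (at (g x)) \<circ> frechet_derivative g (at x))) (at x)"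
      using diff_chain_at[OF has_derivative_frechet[OF Suc.prems(2) that] df[OF that]] unfolding o_def .
    show "frechet_derivative f (at (g x)) \<circ> frechet_derivative g (at x) =
      (\<lambda>v. \<Sum>b\<in>Basis. (frechet_derivative g (at x) v \<bullet> b) *\<^sub>R frechet_derivative f (at (g x)) b)"
      unfolding o_def by (rule ext, rule linear_expand_Basis[OF has_derivative_linear[OF df[OF that]]])
  qed
  show ?case
  proof (rule Ck_on_SucI[OF \<open>open S\<close> d])
    show "Ck_on n (\<lambda>x. \<Sum>b\<in>Basis. (frechet_derivative g (at x) v \<bullet> b) *\<^sub>R frechet_derivative f (at (g x)) b) S" for v
    proof (intro Ck_on_sum Ck_on_bilinear[OF bounded_bilinear_scaleR] \<open>open S\<close>)
      show "Ck_on n (\<lambda>x. frechet_derivative g (at x) v \<bullet> b) S" for b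
        using Suc.prems(2) by (intro Ck_on_linear_compose[OF bounded_linear_inner_left] \<open>open S\<close>) auto
      show "Ck_on n (\<lambda>x. frechet_derivative f (at (g x)) b) S" for b
        by (rule Suc.IH) (use Suc.prems Ck_on_SucD[OF Suc.prems(2)] in auto)
    qed
  qed (use \<open>open S\<close> in auto)
qed

lemma Ck_on_inverse: "Ck_on n inverse (- {0::real})"
proof (induction n)
  case 0
  then show ?case by (auto intro!: continuous_intros)
next
  case (Suc n)
  have "Ck_on n (\<lambda>x. - (inverse x * v * inverse x)) (- {0::real})" for v
    by (intro Ck_on_linear_compose[OF bounded_linear_minus[OF bounded_linear_ident]]
        Ck_on_bilinear[OF bounded_bilinear_mult] Suc Ck_on_const) auto
  then show ?case
    by (intro Ck_on_SucI[where f'="\<lambda>x v. - (inverse x * v * inverse x)"])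
      (auto intro!: has_derivative_inverse' )
qed

lemma Ck_on_sqrt: "Ck_on n sqrt {0<..}"
proof (induction n)
  case 0
  then show ?case by (auto intro!: continuous_intros)
next
  case (Suc n)
  have "Ck_on n (\<lambda>x. inverse (sqrt x) * (v / 2)) {0<..}" for v
    by (intro Ck_on_bilinear[OF bounded_bilinear_mult] Ck_on_const Ck_on_compose[OF _ _ Ck_on_inverse Suc]) auto
  moreover have "(sqrt has_derivative (\<lambda>v. inverse (sqrt x) * (v / 2))) (at x)" if "x > 0" for x
    by (rule has_derivative_eq_rhs[OF DERIV_real_sqrt[OF that, unfolded has_field_derivative_def]])
      (simp add: fun_eq_iff)
  ultimately show ?case
    by (intro Ck_on_SucI[where f'="\<lambda>x v. inverse (sqrt x) * (v / 2)"]) auto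
qed

lemma Ck_on_frechet:
  fixes f :: "'a::euclidean_space \<Rightarrow> 'b::real_normed_vector"
  assumes "open S" "Ck_on (Suc n) f S" "Ck_on n w S"
  shows "Ck_on n (\<lambda>x. frechet_derivative f (at x) (w x)) S"
proof -
  have "Ck_on n (\<lambda>x. \<Sum>b\<in>Basis. (w x \<bullet> b) *\<^sub>R frechet_derivative f (at x) b) S"
    using assms by (intro Ck_on_sum Ck_on_bilinear[OF bounded_bilinear_scaleR] Ck_on_linear_compose[OF bounded_linear_inner_left]) auto
  then show ?thesis
    by (rule Ck_on_cong[OF assms(1), rotated])
      (metis linear_expand_Basis has_derivative_linear has_derivative_frechet[OF assms(2)])
qed

lemma Cinf_on_cong: "open S \<Longrightarrow> (\<And>x. x \<in> S \<Longrightarrow> f x = g x) \<Longrightarrow> Cinf_on f S \<Longrightarrow> Cinf_on g S"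
  unfolding Cinf_on_def using Ck_on_cong by blast

lemma Cinf_on_subset: "Cinf_on f S \<Longrightarrow> T \<subseteq> S \<Longrightarrow> Cinf_on f T"
  unfolding Cinf_on_def using Ck_on_subset by blast

lemma Cinf_on_continuous: "Cinf_on f S \<Longrightarrow> continuous_on S f"
  unfolding Cinf_on_def using Ck_on_continuous by blast

lemma Cinf_on_differentiable: "Cinf_on f S \<Longrightarrow> x \<in> S \<Longrightarrow> f differentiable at x"
  unfolding Cinf_on_def using Ck_on.simps(2) by blast

lemma Cinf_on_has_derivative: "Cinf_on f S \<Longrightarrow> x \<in> S \<Longrightarrow> (f has_derivative frechet_derivative f (at x)) (at x)"
  using Cinf_on_differentiable frechet_derivative_works by blast

lemma Cinf_on_local:
  "(\<And>x. x \<in> S \<Longrightarrow> \<exists>T. open T \<and> x \<in> T \<and> Cinf_on f T) \<Longrightarrow> Cinf_on f S"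
  unfolding Cinf_on_def using Ck_on_local by meson

lemma Cinf_on_const [intro]: "Cinf_on (\<lambda>x. c) S"
  unfolding Cinf_on_def using Ck_on_const by blast

lemma Cinf_on_bounded_linear: "open S \<Longrightarrow> bounded_linear f \<Longrightarrow> Cinf_on f S"
  unfolding Cinf_on_def using Ck_on_bounded_linear by blast

lemma Cinf_on_add: "open S \<Longrightarrow> Cinf_on f S \<Longrightarrow> Cinf_on g S \<Longrightarrow> Cinf_on (\<lambda>x. f x + g x) S"
  unfolding Cinf_on_def using Ck_on_add by blast

lemma Cinf_on_linear_compose: "bounded_linear h \<Longrightarrow> open S \<Longrightarrow> Cinf_on f S \<Longrightarrow> Cinf_on (\<lambda>x. h (f x)) S"
  unfolding Cinf_on_def using Ck_on_linear_compose by blast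

lemma Cinf_on_minus: "open S \<Longrightarrow> Cinf_on f S \<Longrightarrow> Cinf_on (\<lambda>x. - f x) S"
  by (rule Cinf_on_linear_compose[OF bounded_linear_minus[OF bounded_linear_ident]])

lemma Cinf_on_diff: "open S \<Longrightarrow> Cinf_on f S \<Longrightarrow> Cinf_on g S \<Longrightarrow> Cinf_on (\<lambda>x. f x - g x) S"
  using Cinf_on_add[OF _ _ Cinf_on_minus] by fastforce

lemma Cinf_on_bilinear:
  "bounded_bilinear h \<Longrightarrow> open S \<Longrightarrow> Cinf_on f S \<Longrightarrow> Cinf_on g S \<Longrightarrow> Cinf_on (\<lambda>x. h (f x) (g x)) S"
  unfolding Cinf_on_def using Ck_on_bilinear by blast

lemmas Cinf_on_scaleR = Cinf_on_bilinear[OF bounded_bilinear_scaleR]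

lemmas Cinf_on_inner = Cinf_on_bilinear[OF bounded_bilinear_inner]

lemma Cinf_on_mult:
  fixes f g :: "_ \<Rightarrow> 'a::real_normed_algebra"
  shows "open S \<Longrightarrow> Cinf_on f S \<Longrightarrow> Cinf_on g S \<Longrightarrow> Cinf_on (\<lambda>x. f x * g x) S"
  by (rule Cinf_on_bilinear[OF bounded_bilinear_mult])

lemma Cinf_on_power:
  fixes f :: "_ \<Rightarrow> 'a::real_normed_algebra_1"
  shows "open S \<Longrightarrow> Cinf_on f S \<Longrightarrow> Cinf_on (\<lambda>x. f x ^ n) S"
  by (induction n) (auto intro: Cinf_on_mult)

lemma Cinf_on_sum: "open S \<Longrightarrow> (\<And>i. i \<in> I \<Longrightarrow> Cinf_on (f i) S) \<Longrightarrow> Cinf_on (\<lambda>x. \<Sum>i\<in>I. f i x) S"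
  unfolding Cinf_on_def by (simp add: Ck_on_sum)

lemma Cinf_on_Pair: "open S \<Longrightarrow> Cinf_on f S \<Longrightarrow> Cinf_on g S \<Longrightarrow> Cinf_on (\<lambda>x. (f x, g x)) S"
  unfolding Cinf_on_def by (simp add: Ck_on_Pair del: Ck_on.simps)

lemma Cinf_on_compose:
  fixes g :: "'a::real_normed_vector \<Rightarrow> 'b::euclidean_space"
  shows "open S \<Longrightarrow> open T \<Longrightarrow> Cinf_on f T \<Longrightarrow> Cinf_on g S \<Longrightarrow> g ` S \<subseteq> T \<Longrightarrow> Cinf_on (\<lambda>x. f (g x)) S"
  unfolding Cinf_on_def by (simp add: Ck_on_compose del: Ck_on.simps)

lemma Cinf_on_inverse:
  fixes f :: "_ \<Rightarrow> real"
  assumes "open S" "Cinf_on f S" "\<And>x. x \<in> S \<Longrightarrow> f x \<noteq> 0" shows "Cinf_on (\<lambda>x. inverse (f x)) S"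
  by (rule Cinf_on_compose[where T="- {0}"]) (use assms in \<open>auto simp: Cinf_on_def intro: Ck_on_inverse\<close>)

lemma Cinf_on_divide:
  fixes f g :: "_ \<Rightarrow> real"
  assumes "open S" "Cinf_on f S" "Cinf_on g S" "\<And>x. x \<in> S \<Longrightarrow> g x \<noteq> 0"
  shows "Cinf_on (\<lambda>x. f x / g x) S"
  unfolding divide_inverse using assms by (intro Cinf_on_mult Cinf_on_inverse)

lemma Cinf_on_sqrt:
  fixes f :: "_ \<Rightarrow> real"
  assumes "open S" "Cinf_on f S" "\<And>x. x \<in> S \<Longrightarrow> f x > 0" shows "Cinf_on (\<lambda>x. sqrt (f x)) S"
  by (rule Cinf_on_compose[where T="{0<..}"]) (use assms in \<open>auto simp: Cinf_on_def intro: Ck_on_sqrt\<close>)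

lemma Cinf_on_frechet:
  fixes f :: "'a::euclidean_space \<Rightarrow> 'b::real_normed_vector"
  shows "open S \<Longrightarrow> Cinf_on f S \<Longrightarrow> Cinf_on w S \<Longrightarrow> Cinf_on (\<lambda>x. frechet_derivative f (at x) (w x)) S"
  unfolding Cinf_on_def by (simp add: Ck_on_frechet del: Ck_on.simps)

lemma Cinf_on_vec_nth: "open S \<Longrightarrow> Cinf_on f S \<Longrightarrow> Cinf_on (\<lambda>x. f x $ i) S"
  by (rule Cinf_on_linear_compose[OF bounded_linear_vec_nth])

lemma Cinf_on_vec:
  fixes f :: "'a::real_normed_vector \<Rightarrow> ('b::real_normed_vector) ^ 'n"
  assumes "open S" "\<And>i. Cinf_on (\<lambda>x. f x $ i) S" shows "Cinf_on f S"
proof -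
  have bl: "bounded_linear (axis i :: 'b \<Rightarrow> 'b^'n)" for i
  proof (rule bounded_linear_intro[where K=1])
    fix x :: 'b
    have "norm (axis i x :: 'b^'n) \<le> (\<Sum>j\<in>UNIV. norm ((axis i x :: 'b^'n) $ j))"
      unfolding norm_vec_def by (intro L2_set_le_sum) auto
    then show "norm (axis i x :: 'b^'n) \<le> norm x * 1"
      by (simp add: axis_def if_distrib cong: if_cong)
  qed (auto simp: axis_def vec_eq_iff)
  have "Cinf_on (\<lambda>x. \<Sum>i\<in>UNIV. axis i (f x $ i)) S"
    by (intro Cinf_on_sum assms(1) Cinf_on_linear_compose[OF bl] assms(2))
  moreover have "(\<Sum>i\<in>UNIV. axis i (f x $ i)) = f x" for x
    by (simp add: vec_eq_iff axis_def if_distrib sum.delta cong: if_cong)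
  ultimately show ?thesis by simp
qed

lemmas Cinf_on_ident = Cinf_on_bounded_linear[OF _ bounded_linear_ident]

section \<open>Matrix products as bounded bilinear maps\<close>

lemma bounded_bilinear_matrix_mult:
  "bounded_bilinear ((**) :: 'a::{euclidean_space,real_normed_algebra_1}^'n^'m \<Rightarrow> 'a^'k^'n \<Rightarrow> 'a^'k^'m)"
proof -
  have "bilinear ((**) :: 'a^'n^'m \<Rightarrow> 'a^'k^'n \<Rightarrow> 'a^'k^'m)"
    unfolding bilinear_def
    by (auto intro!: linearI simp: vec_eq_iff matrix_matrix_mult_def algebra_simps sum.distrib scaleR_sum_right)
  then show ?thesis by (simp add: bilinear_conv_bounded_bilinear)
qed

lemma bounded_bilinear_matrix_vector_mult:
  "bounded_bilinear ((*v) :: 'a::{euclidean_space,real_normed_algebra_1}^'n^'m \<Rightarrow> 'a^'n \<Rightarrow> 'a^'m)"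
proof -
  have "bilinear ((*v) :: 'a^'n^'m \<Rightarrow> 'a^'n \<Rightarrow> 'a^'m)"
    unfolding bilinear_def
    by (auto intro!: linearI simp: vec_eq_iff matrix_vector_mult_def algebra_simps sum.distrib scaleR_sum_right)
  then show ?thesis by (simp add: bilinear_conv_bounded_bilinear)
qed

lemma bounded_bilinear_vector_matrix_mult:
  "bounded_bilinear ((v*) :: 'a::{euclidean_space,real_normed_algebra_1}^'m \<Rightarrow> 'a^'n^'m \<Rightarrow> 'a^'n)"
proof -
  have "bilinear ((v*) :: 'a^'m \<Rightarrow> 'a^'n^'m \<Rightarrow> 'a^'n)"
    unfolding bilinear_def
    by (auto intro!: linearI simp: vec_eq_iff vector_matrix_mult_def algebra_simps sum.distrib scaleR_sum_right)
  then show ?thesis by (simp add: bilinear_conv_bounded_bilinear)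
qed

subsection \<open>A smooth cutoff function on the line\<close>

text \<open>The case k = 0 is the classical flat function. The powers of 1/x make the family closed
  under differentiation up to linear combinations, so smoothness is proved for all \<open>k\<close>
  at once.\<close>

definition flat_exp :: "nat \<Rightarrow> real \<Rightarrow> real"
  where "flat_exp k x = (if x > 0 then (1/x) ^ k * exp (- (1/x)) else 0)"

text \<open>Keep only the term of index k + 2 in the series of exp (1/x). The quadratic bound gives
  differentiability at 0 with derivative 0.\<close>

lemma flat_exp_le: "\<bar>flat_exp k x\<bar> \<le> fact (k + 2) * x\<^sup>2"
proof (cases "x > 0")
  case True
  define t where "t = 1/x"
  define F :: real where "F = fact (k+2)"
  have F: "F > 0" unfolding F_def by (rule fact_gt_zero)
  have t: "t > 0" "x = 1/t" using True by (auto simp: t_def)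
  have "(\<lambda>i. t ^ i /\<^sub>R fact i) sums exp t" by (rule exp_converges)
  then have "t ^ (k+2) /\<^sub>R F \<le> exp t" unfolding F_def
    using t by (intro sums_le[of "\<lambda>i. if i = k+2 then t ^ (k+2) /\<^sub>R fact (k+2) else 0" _ _ "exp t", OF _ sums_single[of "k+2"]]) auto
  then have "t\<^sup>2 * (t ^ k * exp (- t)) \<le> F"
    using F by (simp add: field_simps exp_minus power2_eq_square)
  then have "t ^ k * exp (- t) \<le> F / t\<^sup>2"
    using t by (simp add: field_simps)
  then show ?thesis using True unfolding F_def[symmetric] by (simp add: flat_exp_def t_def power_divide)
qed (simp add: flat_exp_def)

lemma flat_exp_has_derivative:
  "(flat_exp k has_field_derivative (flat_exp (k+2) x - k * flat_exp (k+1) x)) (at x)"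
proof -
  consider "x > 0" | "x = 0" | "x < 0" by linarith
  then show ?thesis
  proof cases
    case 1
    have "((\<lambda>x. (1/x) ^ k * exp (- (1/x))) has_field_derivative (flat_exp (k+2) x - k * flat_exp (k+1) x)) (at x)"
    proof (rule DERIV_cong)
      have r: "((\<lambda>x. 1/x) has_field_derivative - ((1/x) * (1/x))) (at x)"
        using 1 by (auto intro!: derivative_eq_intros simp: power2_eq_square)
      show "((\<lambda>x. (1/x) ^ k * exp (- (1/x))) has_field_derivative
          (of_nat k * (1/x) ^ (k - 1) * - ((1/x) * (1/x))) * exp (- (1/x)) + (1/x) ^ k * (exp (- (1/x)) * ((1/x) * (1/x)))) (at x)"
        by (rule derivative_eq_intros r refl)+ simp
      show "(of_nat k * (1/x) ^ (k - 1) * - ((1/x) * (1/x))) * exp (- (1/x)) + (1/x) ^ k * (exp (- (1/x)) * ((1/x) * (1/x)))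
          = flat_exp (k+2) x - k * flat_exp (k+1) x"
        using 1 unfolding flat_exp_def by (cases k) (simp_all del: power_one_over add: algebra_simps add_divide_distrib)
    qed
    then show ?thesis
      by (rule has_field_derivative_transform_within_open[where S="{0<..}"]) (use 1 in \<open>auto simp: flat_exp_def\<close>)
  next
    case 2
    have "((\<lambda>h. flat_exp k h / h) \<longlongrightarrow> 0) (at 0)"
    proof (rule Lim_null_comparison)
      show "\<forall>\<^sub>F h in at 0. norm (flat_exp k h / h) \<le> fact (k+2) * \<bar>h\<bar>"
      proof (rule eventually_at_topological[THEN iffD2], intro exI[of _ UNIV] conjI ballI impI)
        fix h :: real assume "h \<noteq> 0"
        then show "norm (flat_exp k h / h) \<le> fact (k+2) * \<bar>h\<bar>"
          using flat_exp_le[of k h]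
            by (simp del: fact_Suc add_2_eq_Suc' add: pos_divide_le_eq power2_eq_square mult.assoc)
      qed auto
      show "((\<lambda>h. fact (k+2) * \<bar>h\<bar>) \<longlongrightarrow> 0) (at (0::real))"
        by (auto intro!: tendsto_eq_intros)
    qed
    then show ?thesis using 2 by (simp add: DERIV_def flat_exp_def)
  next
    case 3
    have "((\<lambda>x. 0) has_field_derivative (flat_exp (k+2) x - k * flat_exp (k+1) x)) (at x)"
      using 3 by (auto simp: flat_exp_def)
    then show ?thesis
      by (rule has_field_derivative_transform_within_open[where S="{..<0}"]) (use 3 in \<open>auto simp: flat_exp_def\<close>)
  qed
qed

lemma Cinf_flat_exp: "Cinf_on (flat_exp k) S"
proof -
  have "Ck_on n (flat_exp k) UNIV" for n
  proof (induction n arbitrary: k)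
    case 0
    show ?case using DERIV_isCont[OF flat_exp_has_derivative] by (simp add: continuous_at_imp_continuous_on)
  next
    case (Suc n)
    have "(flat_exp k has_derivative (\<lambda>v. flat_exp (k+2) x * v + flat_exp (k+1) x * (- real k * v))) (at x)" for x
      by (rule has_derivative_eq_rhs[OF flat_exp_has_derivative[of k x, unfolded has_field_derivative_def]])
        (simp add: fun_eq_iff algebra_simps)
    moreover have "Ck_on n (\<lambda>x. flat_exp (k+2) x * v + flat_exp (k+1) x * (- real k * v)) UNIV" for v
      by (rule Ck_on_add[OF open_UNIV Ck_on_bilinear[OF bounded_bilinear_mult] Ck_on_bilinear[OF bounded_bilinear_mult]];
        rule open_UNIV Suc Ck_on_const)
    ultimately show ?case by (rule Ck_on_SucI[OF open_UNIV])
  qed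
  then show ?thesis using Ck_on_subset unfolding Cinf_on_def by blast
qed

definition step :: "real \<Rightarrow> real"
  where "step x = flat_exp 0 (2 - x) / (flat_exp 0 (2 - x) + flat_exp 0 (x - 1))"

lemma flat_exp_nonneg: "flat_exp k x \<ge> 0" and flat_exp_pos: "x > 0 \<Longrightarrow> flat_exp k x > 0"
  by (auto simp: flat_exp_def)

lemma step_denominator: "flat_exp 0 (2 - x) + flat_exp 0 (x - 1) > 0"
  using flat_exp_nonneg[of 0 "2-x"] flat_exp_nonneg[of 0 "x-1"] flat_exp_pos[of "2-x" 0] flat_exp_pos[of "x-1" 0]
  by (cases "x < 2") auto

lemma step_1: "x \<le> 1 \<Longrightarrow> step x = 1" and step_0: "x \<ge> 2 \<Longrightarrow> step x = 0"
  and step_bounds: "0 \<le> step x" "step x \<le> 1"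
  using step_denominator[of x] flat_exp_nonneg[of 0 "2-x"] flat_exp_nonneg[of 0 "x-1"]
  by (auto simp: step_def flat_exp_def)

lemma Cinf_step: "Cinf_on step UNIV"
proof -
  have "Cinf_on (\<lambda>x. flat_exp 0 (2 - x)) UNIV" "Cinf_on (\<lambda>x. flat_exp 0 (x - 1)) UNIV"
    by (rule Cinf_on_compose[where T=UNIV, OF _ _ Cinf_flat_exp]; auto intro!: Cinf_on_diff Cinf_on_ident)+
  then show ?thesis
    unfolding step_def[abs_def]
    by (intro Cinf_on_divide Cinf_on_add) (auto simp: step_denominator less_imp_neq[symmetric] less_imp_neq[OF step_denominator, symmetric])
qed

section \<open>Invariant vector fields on the sphere\<close>

text \<open>Identifying \<open>real^4\<close> with the quaternions, \<open>Ef 1\<close> consists of the left-invariant fields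
  \<open>x i, x j, x k\<close> and \<open>Ef (-1)\<close> of the right-invariant fields \<open>i x, j x, k x\<close>. For
  \<open>\<tau> = 1\<close> the constant spinors in the frame \<open>Ef \<tau>\<close> are eigenfunctions of the round Dirac operator with
  eigenvalue \<open>-3/2\<close>, and for \<open>\<tau> = -1\<close> with eigenvalue \<open>3/2\<close>.\<close>

definition Ef :: "real \<Rightarrow> 3 \<Rightarrow> real^4 \<Rightarrow> real^4"
  where "Ef \<tau> m x =
    (if m = 1 then vector [- (x$2), x$1, \<tau> * x$4, - (\<tau> * x$3)]
     else if m = 2 then vector [- (x$3), - (\<tau> * x$4), x$1, \<tau> * x$2]
     else vector [- (x$4), \<tau> * x$3, - (\<tau> * x$2), x$1])"

text \<open>The Levi-Civita symbol. Up to the factor 2 \<tau> these are the structure constants of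
  the invariant fields.\<close>

definition eps3 :: "3 \<Rightarrow> 3 \<Rightarrow> 3 \<Rightarrow> real"
  where "eps3 j k l =
    (if (j, k, l) = (1, 2, 3) \<or> (j, k, l) = (2, 3, 1) \<or> (j, k, l) = (3, 1, 2) then 1
     else if (j, k, l) = (2, 1, 3) \<or> (j, k, l) = (3, 2, 1) \<or> (j, k, l) = (1, 3, 2) then - 1 else 0)"

lemma vec4_eq_iff: "(x :: 'a^4) = y \<longleftrightarrow> x$1 = y$1 \<and> x$2 = y$2 \<and> x$3 = y$3 \<and> x$4 = y$4"
  by (simp add: vec_eq_iff forall_4)

lemma Ef_linear: "linear (Ef \<tau> m)"
  by (rule linearI) (auto simp: Ef_def vec4_eq_iff vector_4 algebra_simps)

lemma Ef_bounded_linear: "bounded_linear (Ef \<tau> m)"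
  using Ef_linear linear_conv_bounded_linear by blast

lemma Ef_scaleR: "Ef \<tau> m (c *\<^sub>R x) = c *\<^sub>R Ef \<tau> m x" and Ef_uminus: "Ef \<tau> m (- x) = - Ef \<tau> m x"
  using Ef_linear by (auto simp: linear_scale linear_neg)

lemma inner_Ef: "x \<bullet> Ef \<tau> m x = 0"
  by (simp add: Ef_def inner_vec_def sum_4 vector_4)

lemma Ef_inner_Ef:
  assumes "\<tau> = 1 \<or> \<tau> = -1" "norm x = 1"
  shows "Ef \<tau> j x \<bullet> Ef \<tau> k x = (if j = k then 1 else 0)"
proof -
  have "x \<bullet> x = 1" using assms(2) by (simp add: norm_eq_1)
  then show ?thesis
    using exhaust_3[of j] exhaust_3[of k] assms(1)
    by (auto simp: Ef_def inner_vec_def sum_4 vector_4)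
qed

text \<open>The fields are linear, so their Lie bracket is the commutator of the matrices. Left- and
  right-invariant fields differ only in the sign \<tau> of the structure constants, and this sign
  later becomes the sign of the eigenvalue.\<close>

lemma Ef_commutator:
  "Ef \<tau> k (Ef \<tau> j x) - Ef \<tau> j (Ef \<tau> k x) = (\<Sum>l\<in>UNIV. (2 * \<tau> * eps3 j k l) *\<^sub>R Ef \<tau> l x)"
  if "\<tau> = 1 \<or> \<tau> = -1"
  using exhaust_3[of j] exhaust_3[of k] that
  by (elim disjE) (simp_all add: Ef_def sum_3 vec4_eq_iff vector_4 eps3_def)

text \<open>Parseval's identity: \<open>x\<close> and the three fields at \<open>x\<close> are
  mutually orthogonal and all have the length of \<open>x\<close>.\<close>

lemma sum_Ef_squares:
  assumes "\<tau> = 1 \<or> \<tau> = -1"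
  shows "(\<Sum>m\<in>UNIV. (a \<bullet> Ef \<tau> m x)\<^sup>2) = (a \<bullet> a) * (x \<bullet> x) - (a \<bullet> x)\<^sup>2"
  using assms by (elim disjE) (simp_all add: Ef_def inner_vec_def sum_3 sum_4 vector_4 power2_eq_square algebra_simps)

lemma Ef_Ef: "\<tau> = 1 \<or> \<tau> = -1 \<Longrightarrow> Ef \<tau> m (Ef \<tau> m x) = - x"
  using exhaust_3[of m] by (auto simp: Ef_def vec4_eq_iff vector_4)

text \<open>The derivative is taken in the ambient space. Since \<open>Ef\<close> is tangent to the
  sphere, its value there depends only on the restriction of \<open>f\<close> to the sphere, so any
  smooth extension serves.\<close>

definition Ed :: "real \<Rightarrow> 3 \<Rightarrow> (real^4 \<Rightarrow> 'b::real_normed_vector) \<Rightarrow> real^4 \<Rightarrow> 'b"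
  where "Ed \<tau> m f x = frechet_derivative f (at x) (Ef \<tau> m x)"

lemma Ed_eq: "(f has_derivative f') (at x) \<Longrightarrow> Ed \<tau> m f x = f' (Ef \<tau> m x)"
  unfolding Ed_def using frechet_derivative_at by metis

lemma Ed_has_derivative:
  "f differentiable at x \<Longrightarrow> (f has_derivative frechet_derivative f (at x)) (at x)"
  by (rule frechet_derivative_works[THEN iffD1])

lemma Ed_const: "Ed \<tau> m (\<lambda>x. c) x = 0"
  by (rule Ed_eq[of _ "\<lambda>_. 0"]) simp

lemma Ed_add: "f differentiable at x \<Longrightarrow> g differentiable at x \<Longrightarrow>
    Ed \<tau> m (\<lambda>x. f x + g x) x = Ed \<tau> m f x + Ed \<tau> m g x"
  by (subst Ed_eq[OF has_derivative_add[OF Ed_has_derivative Ed_has_derivative]]) (auto simp: Ed_def)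

lemma Ed_diff: "f differentiable at x \<Longrightarrow> g differentiable at x \<Longrightarrow>
    Ed \<tau> m (\<lambda>x. f x - g x) x = Ed \<tau> m f x - Ed \<tau> m g x"
  by (subst Ed_eq[OF has_derivative_diff[OF Ed_has_derivative Ed_has_derivative]]) (auto simp: Ed_def)

lemma Ed_linear: "bounded_linear h \<Longrightarrow> f differentiable at x \<Longrightarrow>
    Ed \<tau> m (\<lambda>x. h (f x)) x = h (Ed \<tau> m f x)"
  by (subst Ed_eq[OF bounded_linear.has_derivative[OF _ Ed_has_derivative]]) (auto simp: Ed_def)

lemma Ed_bilinear: "bounded_bilinear h \<Longrightarrow> f differentiable at x \<Longrightarrow> g differentiable at x \<Longrightarrow>
    Ed \<tau> m (\<lambda>x. h (f x) (g x)) x = h (f x) (Ed \<tau> m g x) + h (Ed \<tau> m f x) (g x)"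
  by (subst Ed_eq[OF bounded_bilinear.FDERIV[OF _ Ed_has_derivative Ed_has_derivative]]) (auto simp: Ed_def)

lemma Ed_mult: 
  fixes f g :: "real^4 \<Rightarrow> 'a::real_normed_algebra"
  shows "f differentiable at x \<Longrightarrow> g differentiable at x \<Longrightarrow>
    Ed \<tau> m (\<lambda>x. f x * g x) x = f x * Ed \<tau> m g x + Ed \<tau> m f x * g x"
  by (rule Ed_bilinear[OF bounded_bilinear_mult])

lemma Ed_sum: "finite I \<Longrightarrow> (\<And>i. i \<in> I \<Longrightarrow> f i differentiable at x) \<Longrightarrow>
    Ed \<tau> m (\<lambda>x. \<Sum>i\<in>I. f i x) x = (\<Sum>i\<in>I. Ed \<tau> m (f i) x)"
proof (induction I rule: finite_induct)
  case (insert i I)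
  then have "(\<lambda>x. \<Sum>i\<in>I. f i x) differentiable at x" by (intro differentiable_sum) auto
  then show ?case using insert by (simp add: Ed_add)
qed (simp add: Ed_const)

lemma Cinf_Ed: "open S \<Longrightarrow> Cinf_on f S \<Longrightarrow> Cinf_on (Ed \<tau> m f) S"
  unfolding Ed_def[abs_def] by (intro Cinf_on_frechet Cinf_on_bounded_linear[OF _ Ef_bounded_linear])

section \<open>Polynomials, the invariant fields and the round Laplacian\<close>

lemma Cinf_poly: "real_polynomial_function p \<Longrightarrow> Cinf_on p UNIV"
  by (induction rule: real_polynomial_function.induct)
    (auto intro: Cinf_on_bounded_linear Cinf_on_add Cinf_on_mult)

lemma poly_differentiable: "real_polynomial_function p \<Longrightarrow> p differentiable at x"
  using Cinf_poly Cinf_on_differentiable by blast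

lemma poly_Ed_simps:
  assumes "real_polynomial_function p" "real_polynomial_function q"
  shows "Ed \<tau> m (\<lambda>x. p x + q x) = (\<lambda>x. Ed \<tau> m p x + Ed \<tau> m q x)"
    and "Ed \<tau> m (\<lambda>x. p x * q x) = (\<lambda>x. p x * Ed \<tau> m q x + Ed \<tau> m p x * q x)"
    and "Ed \<tau> m (\<lambda>x. c * p x) = (\<lambda>x. c * Ed \<tau> m p x)"
  using assms by (auto intro!: ext Ed_add Ed_mult Ed_linear[OF bounded_linear_mult_right] poly_differentiable)

lemma poly_Ed: "real_polynomial_function p \<Longrightarrow> real_polynomial_function (Ed \<tau> m p)"
proof (induction rule: real_polynomial_function.induct)
  case (linear f)
  then have "Ed \<tau> m f = (\<lambda>x. f (Ef \<tau> m x))"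
    by (intro ext Ed_eq bounded_linear_imp_has_derivative)
  then show ?case
    using bounded_linear_compose[OF linear Ef_bounded_linear] by (simp add: real_polynomial_function.intros(1))
next
  case (const c)
  then show ?case by (simp add: Ed_const[abs_def] real_polynomial_function.intros(2))
next
  case (add f g)
  then show ?case
    by (simp add: poly_Ed_simps real_polynomial_function.intros(3))
next
  case (mult f g)
  then show ?case
    by (simp add: poly_Ed_simps real_polynomial_function.intros(3) real_polynomial_function.intros(4))
qed

text \<open>Both sides are derivations in \<open>p\<close>, a commutator of derivations being one.
  It therefore suffices to check linear forms, which is \<open>Ef_commutator\<close>; the induction
  also avoids the symmetry of second derivatives.\<close>

lemma poly_Ed_commutator:
  assumes \<tau>: "\<tau> = 1 \<or> \<tau> = -1" and "real_polynomial_function p"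
  shows "Ed \<tau> j (Ed \<tau> k p) x - Ed \<tau> k (Ed \<tau> j p) x = (\<Sum>l\<in>UNIV. 2 * \<tau> * eps3 j k l * Ed \<tau> l p x)"
  using assms(2)
proof (induction rule: real_polynomial_function.induct)
  case (linear f)
  have 1: "Ed \<tau> m f = (\<lambda>x. f (Ef \<tau> m x))" for m
    using linear by (intro ext Ed_eq bounded_linear_imp_has_derivative)
  have 2: "Ed \<tau> m (\<lambda>x. f (Ef \<tau> n x)) x = f (Ef \<tau> n (Ef \<tau> m x))" for m n
    by (rule Ed_eq) (intro bounded_linear_imp_has_derivative bounded_linear_compose[OF linear] Ef_bounded_linear)
  have "f (Ef \<tau> k (Ef \<tau> j x)) - f (Ef \<tau> j (Ef \<tau> k x)) = f (Ef \<tau> k (Ef \<tau> j x) - Ef \<tau> j (Ef \<tau> k x))"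
    using linear by (simp add: bounded_linear.linear linear_diff)
  also have "\<dots> = (\<Sum>l\<in>UNIV. 2 * \<tau> * eps3 j k l * f (Ef \<tau> l x))"
    unfolding Ef_commutator[OF \<tau>] using linear by (simp add: bounded_linear.linear linear_sum linear_scale)
  finally show ?case unfolding 1 2 .
next
  case (const c)
  then show ?case by (simp add: Ed_const[abs_def])
next
  case (add f g)
  then show ?case
    by (simp add: poly_Ed_simps poly_Ed algebra_simps sum.distrib)
next
  case (mult f g)
  have 1: "Ed \<tau> m (\<lambda>x. f x * g x) = (\<lambda>x. f x * Ed \<tau> m g x + Ed \<tau> m f x * g x)" for m
    using mult by (intro ext Ed_mult poly_differentiable)
  have 2: "Ed \<tau> m (\<lambda>x. f x * Ed \<tau> n g x + Ed \<tau> n f x * g x) x =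
     f x * Ed \<tau> m (Ed \<tau> n g) x + Ed \<tau> m f x * Ed \<tau> n g x + (Ed \<tau> n f x * Ed \<tau> m g x + Ed \<tau> m (Ed \<tau> n f) x * g x)" for m n
    using mult by (simp add: poly_Ed_simps poly_Ed real_polynomial_function.intros(4))
  have "Ed \<tau> j (Ed \<tau> k (\<lambda>x. f x * g x)) x - Ed \<tau> k (Ed \<tau> j (\<lambda>x. f x * g x)) x =
     f x * (Ed \<tau> j (Ed \<tau> k g) x - Ed \<tau> k (Ed \<tau> j g) x) + (Ed \<tau> j (Ed \<tau> k f) x - Ed \<tau> k (Ed \<tau> j f) x) * g x"
    unfolding 1 2 by (simp add: algebra_simps)
  also have "\<dots> = (\<Sum>l\<in>UNIV. 2 * \<tau> * eps3 j k l * Ed \<tau> l (\<lambda>x. f x * g x) x)"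
    unfolding mult.IH 1 by (simp add: algebra_simps sum.distrib sum_distrib_left)
  finally show ?case .
qed

text \<open>On the sphere, for \<tau> = 1 and for \<tau> = -1, this is the Laplace-Beltrami operator
  of the round metric: the fields are orthonormal and divergence-free, so no first-order terms
  arise.\<close>

definition Lap :: "real \<Rightarrow> (real^4 \<Rightarrow> real) \<Rightarrow> real^4 \<Rightarrow> real"
  where "Lap \<tau> f x = (\<Sum>m\<in>UNIV. Ed \<tau> m (Ed \<tau> m f) x)"

lemma poly_Lap: "real_polynomial_function p \<Longrightarrow> real_polynomial_function (Lap \<tau> p)"
  unfolding Lap_def[abs_def] by (intro real_polynomial_function_sum poly_Ed) auto

lemma Lap_add: "real_polynomial_function p \<Longrightarrow> real_polynomial_function q \<Longrightarrow>
    Lap \<tau> (\<lambda>x. p x + q x) x = Lap \<tau> p x + Lap \<tau> q x"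
  unfolding Lap_def by (simp add: poly_Ed_simps poly_Ed sum.distrib)

lemma poly_inner_power: "real_polynomial_function (\<lambda>x::real^4. (a \<bullet> x) ^ n)"
  by (intro real_polynomial_function_power real_polynomial_function.intros(1) bounded_linear_inner_right)

lemma Lap_cmult: "real_polynomial_function p \<Longrightarrow> Lap \<tau> (\<lambda>x. c * p x) x = c * Lap \<tau> p x"
  unfolding Lap_def
  by (simp add: poly_Ed_simps[OF _ poly_inner_power] poly_Ed sum_distrib_left)

lemma Ed_inner_power: "Ed \<tau> m (\<lambda>x. (a \<bullet> x) ^ Suc n) x = real (Suc n) * (a \<bullet> x) ^ n * (a \<bullet> Ef \<tau> m x)"
proof (rule Ed_eq)
  show "((\<lambda>x. (a \<bullet> x) ^ Suc n) has_derivative (\<lambda>h. real (Suc n) * (a \<bullet> x) ^ n * (a \<bullet> h))) (at x)"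
    by (rule has_derivative_eq_rhs, (rule derivative_eq_intros refl)+) (simp add: fun_eq_iff)
qed

text \<open>Two facts enter: applying a field twice gives - x, which contributes three times, and
  the squares of the a . E_m x add up to a . a - (a . x)^2. For n = 0 the truncated exponent n - 1
  is harmless because its coefficient vanishes.\<close>

lemma Lap_inner_power:
  assumes \<tau>: "\<tau> = 1 \<or> \<tau> = -1" and "norm x = 1"
  shows "Lap \<tau> (\<lambda>x. (a \<bullet> x) ^ Suc n) x =
     real (n * Suc n) * (a \<bullet> a) * (a \<bullet> x) ^ (n - 1) - real (Suc n * (n + 3)) * (a \<bullet> x) ^ Suc n"
proof -
  have 1: "Ed \<tau> m (\<lambda>x. (a \<bullet> x) ^ Suc n) = (\<lambda>x. real (Suc n) * (a \<bullet> x) ^ n * (a \<bullet> Ef \<tau> m x))" for m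
    by (intro ext Ed_inner_power)
  have 2: "Ed \<tau> m (\<lambda>x. real (Suc n) * (a \<bullet> x) ^ n * (a \<bullet> Ef \<tau> m x)) x =
     real (Suc n) * (real n * (a \<bullet> x) ^ (n - 1) * (a \<bullet> Ef \<tau> m x)\<^sup>2 - (a \<bullet> x) ^ Suc n)" for m
  proof (rule Ed_eq[THEN trans])
    show "((\<lambda>x. real (Suc n) * (a \<bullet> x) ^ n * (a \<bullet> Ef \<tau> m x)) has_derivative
       (\<lambda>h. real (Suc n) * ((a \<bullet> x) ^ n * (a \<bullet> Ef \<tau> m h) + real n * (a \<bullet> h) * (a \<bullet> x) ^ (n - 1) * (a \<bullet> Ef \<tau> m x)))) (at x)"
      by (auto intro!: derivative_eq_intros bounded_linear.has_derivative[OF Ef_bounded_linear] simp: algebra_simps)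
  qed (simp add: Ef_Ef[OF \<tau>] algebra_simps power2_eq_square)
  have "x \<bullet> x = 1" using assms(2) by (simp add: norm_eq_1)
  then have s: "(\<Sum>m\<in>UNIV. (a \<bullet> Ef \<tau> m x)\<^sup>2) = (a \<bullet> a) - (a \<bullet> x)\<^sup>2"
    using sum_Ef_squares[OF \<tau>] by simp
  have "Lap \<tau> (\<lambda>x. (a \<bullet> x) ^ Suc n) x =
     real (Suc n) * (real n * (a \<bullet> x) ^ (n - 1) * (\<Sum>m\<in>UNIV. (a \<bullet> Ef \<tau> m x)\<^sup>2) - 3 * (a \<bullet> x) ^ Suc n)"
    unfolding Lap_def 1 2 by (simp add: sum_distrib_left sum_subtractf algebra_simps)
  also have "\<dots> = real (n * Suc n) * (a \<bullet> a) * (a \<bullet> x) ^ (n - 1) - real (Suc n * (n + 3)) * (a \<bullet> x) ^ Suc n"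
    unfolding s by (cases n) (auto simp: algebra_simps power2_eq_square)
  finally show ?thesis .
qed

text \<open>Finite sums of powers of linear forms: a uniformly dense class on which the Poisson equation is
  solvable by a two-step recursion.\<close>

inductive ridge :: "(real^4 \<Rightarrow> real) \<Rightarrow> bool" where
  power: "ridge (\<lambda>x. (a \<bullet> x) ^ n)"
| add: "ridge f \<Longrightarrow> ridge g \<Longrightarrow> ridge (\<lambda>x. f x + g x)"
| cmult: "ridge f \<Longrightarrow> ridge (\<lambda>x. c * f x)"

lemma ridge_poly: "ridge f \<Longrightarrow> real_polynomial_function f"
  by (induction rule: ridge.induct)
    (auto intro: poly_inner_power real_polynomial_function.intros(3) real_polynomial_function.intros(4) real_polynomial_function.intros(2))

lemma ridge_const: "ridge (\<lambda>x. c)"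
  using ridge.cmult[OF ridge.power[of 0 0], of c] by simp

lemma ridge_sum: "finite I \<Longrightarrow> (\<And>i. i \<in> I \<Longrightarrow> ridge (f i)) \<Longrightarrow> ridge (\<lambda>x. \<Sum>i\<in>I. f i x)"
  by (induction I rule: finite_induct) (auto intro: ridge_const ridge.add)

text \<open>Solving \<open>Lap_inner_power\<close> for its last term expresses a power of a linear
  form, modulo Laplacians, by the power two degrees lower. The recursion ends in a constant, which
  cannot be a Laplacian; this is the \<open>c\<close> of the statement.\<close>

lemma ridge_poisson:
  assumes \<tau>: "\<tau> = 1 \<or> \<tau> = -1" and "ridge f"
  shows "\<exists>\<psi> c. ridge \<psi> \<and> (\<forall>x. norm x = 1 \<longrightarrow> f x = c - Lap \<tau> \<psi> x)"
  using assms(2)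
proof (induction rule: ridge.induct)
  case (power a n)
  show ?case
  proof (induction n rule: less_induct)
    case (less n)
    show ?case
    proof (cases n)
      case 0
      then show ?thesis
        by (intro exI[of _ "\<lambda>x. 0"] exI[of _ 1]) (auto simp: ridge_const Lap_def Ed_const[abs_def])
    next
      case (Suc m)
      \<comment> \<open>With n = m + 1 this is n (n + 2), the eigenvalue of minus the Laplacian on
        spherical harmonics of degree n. It is positive, so the division is legitimate.\<close>
      define K where "K = real (Suc m * (m + 3))"
      have K: "K > 0" unfolding K_def of_nat_0_less_iff by simp
      have L: "(a \<bullet> x) ^ n = real (m * Suc m) * (a \<bullet> a) / K * (a \<bullet> x) ^ (m - 1) - (1 / K) * Lap \<tau> (\<lambda>x. (a \<bullet> x) ^ n) x"
        if "norm x = 1" for x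
      proof -
        have aux: "\<And>L u v P. L = u * v - K * P \<Longrightarrow> P = u / K * v - (1 / K) * L" using K by (simp add: field_simps)
        show ?thesis by (rule aux) (use Lap_inner_power[OF \<tau> that, of a m] in \<open>simp only: Suc K_def\<close>)
      qed
      have "m - 1 < n" using Suc by simp
      from less[OF this] obtain \<psi> c where \<psi>: "ridge \<psi>"
        and c: "\<And>x. norm x = 1 \<Longrightarrow> (a \<bullet> x) ^ (m - 1) = c - Lap \<tau> \<psi> x" by blast
      define C where "C = real (m * Suc m) * (a \<bullet> a) / K"
      have p: "real_polynomial_function (\<lambda>x. C * \<psi> x)" "real_polynomial_function (\<lambda>x. (1/K) * (a \<bullet> x) ^ n)"
        by (intro ridge_poly ridge.cmult \<psi> ridge.power)+
      have "(a \<bullet> x) ^ n = C * c - Lap \<tau> (\<lambda>x. C * \<psi> x + (1/K) * (a \<bullet> x) ^ n) x" if "norm x = 1" for x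
        unfolding Lap_add[OF p] Lap_cmult[OF ridge_poly[OF \<psi>]] Lap_cmult[OF poly_inner_power]
        using L[OF that, unfolded c[OF that]] unfolding C_def[symmetric] by (simp add: algebra_simps)
      moreover have "ridge (\<lambda>x. C * \<psi> x + (1/K) * (a \<bullet> x) ^ n)"
        by (rule ridge.add[OF ridge.cmult[OF \<psi>] ridge.cmult[OF ridge.power]])
      ultimately show ?thesis by blast
    qed
  qed
next
  case (add f g)
  then obtain \<psi> \<psi>' c c' where "ridge \<psi>" "ridge \<psi>'" "\<And>x. norm x = 1 \<Longrightarrow> f x = c - Lap \<tau> \<psi> x" "\<And>x. norm x = 1 \<Longrightarrow> g x = c' - Lap \<tau> \<psi>' x"
    by blast
  then show ?case
    by (intro exI[of _ "\<lambda>x. \<psi> x + \<psi>' x"] exI[of _ "c + c'"]) (auto intro: ridge.add simp: Lap_add ridge_poly)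
next
  case (cmult f c)
  then obtain \<psi> c' where "ridge \<psi>" "\<And>x. norm x = 1 \<Longrightarrow> f x = c' - Lap \<tau> \<psi> x"
    by blast
  then show ?case
    by (intro exI[of _ "\<lambda>x. c * \<psi> x"] exI[of _ "c * c'"]) (auto intro: ridge.cmult simp: Lap_cmult ridge_poly right_diff_distrib)
qed

section \<open>Stereographic coordinates\<close>

lemma sum_insert_UNIV_4: "det (A::real^4^4) = 
    A$1$1 * (A$2$2 * (A$3$3 * A$4$4 - A$3$4 * A$4$3) - A$2$3 * (A$3$2 * A$4$4 - A$3$4 * A$4$2) + A$2$4 * (A$3$2 * A$4$3 - A$3$3 * A$4$2))
  - A$1$2 * (A$2$1 * (A$3$3 * A$4$4 - A$3$4 * A$4$3) - A$2$3 * (A$3$1 * A$4$4 - A$3$4 * A$4$1) + A$2$4 * (A$3$1 * A$4$3 - A$3$3 * A$4$1))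
  + A$1$3 * (A$2$1 * (A$3$2 * A$4$4 - A$3$4 * A$4$2) - A$2$2 * (A$3$1 * A$4$4 - A$3$4 * A$4$1) + A$2$4 * (A$3$1 * A$4$2 - A$3$2 * A$4$1))
  - A$1$4 * (A$2$1 * (A$3$2 * A$4$3 - A$3$3 * A$4$2) - A$2$2 * (A$3$1 * A$4$3 - A$3$3 * A$4$1) + A$2$3 * (A$3$1 * A$4$2 - A$3$2 * A$4$1))"
proof -
  have f: "finite {2::4,3,4}" "1 \<notin> {2::4,3,4}" "finite {3::4,4}" "2 \<notin> {3::4,4}" "finite {4::4}" "3 \<notin> {4::4}"
    by auto
  show ?thesis
    unfolding det_def UNIV_4
    unfolding sum_over_permutations_insert[OF f(1,2)] sum_over_permutations_insert[OF f(3,4)]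
      sum_over_permutations_insert[OF f(5,6)] permutes_sing
    by (simp add: sign_swap_id permutation_swap_id sign_compose permutation_compose sign_id algebra_simps)
qed

section \<open>Rules for partial derivatives\<close>

lemma pd_eq: "(f has_derivative f') (at y) \<Longrightarrow> pd f \<alpha> y = f' (axis \<alpha> 1)"
  unfolding pd_def using frechet_derivative_at by metis

lemma differentiable_has_derivative:
  "f differentiable at x \<Longrightarrow> (f has_derivative frechet_derivative f (at x)) (at x)"
  by (rule frechet_derivative_works[THEN iffD1])

lemma pd_const [simp]: "pd (\<lambda>y. c) \<alpha> y = 0"
  by (rule pd_eq[of _ "\<lambda>_. 0"]) simp

lemma pd_add: "f differentiable at y \<Longrightarrow> g differentiable at y \<Longrightarrow>
    pd (\<lambda>x. f x + g x) \<alpha> y = pd f \<alpha> y + pd g \<alpha> y"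
  by (subst pd_eq[OF has_derivative_add[OF differentiable_has_derivative differentiable_has_derivative]]) (auto simp: pd_def)

lemma pd_linear: "bounded_linear h \<Longrightarrow> f differentiable at y \<Longrightarrow>
    pd (\<lambda>x. h (f x)) \<alpha> y = h (pd f \<alpha> y)"
  by (subst pd_eq[OF bounded_linear.has_derivative[OF _ differentiable_has_derivative]]) (auto simp: pd_def)

lemma pd_bilinear: "bounded_bilinear h \<Longrightarrow> f differentiable at y \<Longrightarrow> g differentiable at y \<Longrightarrow>
    pd (\<lambda>x. h (f x) (g x)) \<alpha> y = h (f y) (pd g \<alpha> y) + h (pd f \<alpha> y) (g y)"
  by (subst pd_eq[OF bounded_bilinear.FDERIV[OF _ differentiable_has_derivative differentiable_has_derivative]]) (auto simp: pd_def)

lemma pd_sum: "finite I \<Longrightarrow> (\<And>i. i \<in> I \<Longrightarrow> f i differentiable at y) \<Longrightarrow>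
    pd (\<lambda>x. \<Sum>i\<in>I. f i x) \<alpha> y = (\<Sum>i\<in>I. pd (f i) \<alpha> y)"
proof (induction I rule: finite_induct)
  case (insert i I)
  then have "(\<lambda>x. \<Sum>i\<in>I. f i x) differentiable at y" by (intro differentiable_sum) auto
  then show ?case using insert by (simp add: pd_add)
qed simp

text \<open>Functions that agree near \<open>y\<close> have the same derivatives there, so the
  choice operator in \<open>frechet_derivative\<close> picks the same value for both.
  Differentiability is not assumed.\<close>

lemma pd_cong:
  assumes "open S" "y \<in> S" "\<And>x. x \<in> S \<Longrightarrow> f x = g x"
  shows "pd f \<alpha> y = pd g \<alpha> y"
proof -
  have "(f has_derivative D) (at y) \<longleftrightarrow> (g has_derivative D) (at y)" for D
    using has_derivative_transform_within_open[OF _ assms(1,2)] assms(3) by metis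
  then show ?thesis unfolding pd_def frechet_derivative_def by simp
qed

lemma Cinf_pd: "open S \<Longrightarrow> Cinf_on f S \<Longrightarrow> Cinf_on (pd f \<alpha>) S"
  unfolding pd_def[abs_def] by (intro Cinf_on_frechet Cinf_on_const)

lemma frechet_pd:
  assumes "f differentiable at y"
  shows "frechet_derivative f (at y) h = (\<Sum>\<alpha>\<in>UNIV. (h $ \<alpha>) *\<^sub>R pd f \<alpha> y)"
proof -
  have l: "linear (frechet_derivative f (at y))"
    using differentiable_has_derivative[OF assms] has_derivative_linear by blast
  have h: "h = (\<Sum>\<alpha>\<in>UNIV. (h $ \<alpha>) *\<^sub>R axis \<alpha> 1)"
    by (simp add: vec_eq_iff axis_def if_distrib cong: if_cong)
  show ?thesis
    by (subst h) (simp add: linear_sum[OF l] linear_scale[OF l] pd_def)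
qed

lemma pd_chain:
  assumes "g differentiable at y" "f differentiable at (g y)"
  shows "pd (\<lambda>y. f (g y)) \<alpha> y = frechet_derivative f (at (g y)) (pd g \<alpha> y)"
  by (subst pd_eq[OF diff_chain_at[OF differentiable_has_derivative[OF assms(1)]
     differentiable_has_derivative[OF assms(2)], unfolded o_def]]) (simp add: pd_def)

text \<open>The inverse of stereographic projection from \<open>- pole\<close>. The antipodal chart
  \<open>- stereo\<close> omits \<open>pole\<close> instead, so the two cover the sphere.\<close>

definition stereo :: "real^3 \<Rightarrow> real^4"
  where "stereo y = (1 / (1 + y \<bullet> y)) *\<^sub>R vector [1 - y \<bullet> y, 2 * y$1, 2 * y$2, 2 * y$3]"

definition unstereo :: "real^4 \<Rightarrow> real^3"
  where "unstereo x = (1 / (1 + x$1)) *\<^sub>R vector [x$2, x$3, x$4]"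

text \<open>The cube of the conformal factor 2 / (1 + |y|^2), that is, the density of the round
  volume.\<close>

definition Jac :: "real^3 \<Rightarrow> real"
  where "Jac y = 8 / (1 + y \<bullet> y) ^ 3"

abbreviation pole :: "real^4" where "pole \<equiv> axis 1 1"

lemma one_plus_inner: "1 + y \<bullet> y > (0::real)"
  by (smt (verit) inner_ge_zero)

lemma Jac_pos: "Jac y > 0"
  using one_plus_inner by (simp add: Jac_def)

lemma inner_3: "(x::real^3) \<bullet> y = x$1 * y$1 + x$2 * y$2 + x$3 * y$3"
  and inner_4: "(u::real^4) \<bullet> v = u$1 * v$1 + u$2 * v$2 + u$3 * v$3 + u$4 * v$4"
  by (simp_all add: inner_vec_def sum_3 sum_4)

lemma vec4_eqI: "x$1 = y$1 \<Longrightarrow> x$2 = y$2 \<Longrightarrow> x$3 = y$3 \<Longrightarrow> x$4 = y$4 \<Longrightarrow> (x :: 'a^4) = y"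
  by (simp add: vec_eq_iff forall_4)

lemma vec3_eqI: "x$1 = y$1 \<Longrightarrow> x$2 = y$2 \<Longrightarrow> x$3 = y$3 \<Longrightarrow> (x :: 'a^3) = y"
  by (simp add: vec_eq_iff forall_3)

lemma stereo_nth: "stereo y $ 1 = 2 / (1 + y \<bullet> y) - 1" "stereo y $ 2 = 2 * y$1 / (1 + y \<bullet> y)"
  "stereo y $ 3 = 2 * y$2 / (1 + y \<bullet> y)" "stereo y $ 4 = 2 * y$3 / (1 + y \<bullet> y)"
  using one_plus_inner[of y] by (simp_all add: stereo_def vector_4 field_simps)

lemma norm_stereo: "norm (stereo y) = 1"
proof -
  define a where "a = 1 / (1 + y \<bullet> y)"
  have "a * (1 + (y$1 * y$1 + y$2 * y$2 + y$3 * y$3)) = 1"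
    using one_plus_inner[of y] by (simp add: a_def inner_3)
  moreover have "stereo y $ 1 = 2 * a - 1" "stereo y $ 2 = 2 * a * y$1" "stereo y $ 3 = 2 * a * y$2" "stereo y $ 4 = 2 * a * y$3"
    unfolding stereo_nth a_def by simp_all
  ultimately have "stereo y \<bullet> stereo y = 1"
    unfolding inner_4 by algebra
  then show ?thesis by (simp add: norm_eq_1)
qed

lemma stereo_S3: "stereo y \<in> S3" and minus_stereo_S3: "- stereo y \<in> S3"
  by (simp_all add: S3_def norm_stereo)

lemma unstereo_stereo: "unstereo (stereo y) = y"
  using one_plus_inner[of y]
  by (intro vec3_eqI) (simp_all add: unstereo_def stereo_nth vector_3)

lemma stereo_ne: "stereo y \<noteq> - pole"
  using one_plus_inner[of y] by (auto simp: vec_eq_iff forall_4 stereo_nth axis_def)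

lemma S3_nth_1:
  assumes "x \<in> S3" "x \<noteq> - pole" shows "1 + x$1 > 0"
proof -
  have "x$1 * x$1 + x$2 * x$2 + x$3 * x$3 + x$4 * x$4 = 1"
    using assms(1) by (simp add: S3_def norm_eq_1 inner_4)
  moreover have "\<bar>x $ 1\<bar> \<le> 1" using component_le_norm_cart[of x 1] assms(1) by (simp add: S3_def)
  moreover have "x$1 \<noteq> -1"
  proof
    assume "x$1 = -1"
    then have "x$2 * x$2 + x$3 * x$3 + x$4 * x$4 = 0" using calculation(1) by simp
    then have "x$2 = 0 \<and> x$3 = 0 \<and> x$4 = 0"
      by (smt (verit) mult_eq_0_iff zero_le_square)
    then show False using assms(2) \<open>x$1 = -1\<close> by (auto simp: vec_eq_iff forall_4 axis_def)
  qed
  ultimately show ?thesis by linarith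
qed

lemma stereo_unstereo:
  assumes "x \<in> S3" "x \<noteq> - pole" shows "stereo (unstereo x) = x"
proof -
  have s: "x$1 * x$1 + x$2 * x$2 + x$3 * x$3 + x$4 * x$4 = 1"
    using assms(1) by (simp add: S3_def norm_eq_1 inner_4)
  have p: "1 + x$1 > 0" by (rule S3_nth_1[OF assms])
  have u: "unstereo x $ 1 = x$2 / (1 + x$1)" "unstereo x $ 2 = x$3 / (1 + x$1)" "unstereo x $ 3 = x$4 / (1 + x$1)"
    by (simp_all add: unstereo_def vector_3)
  have "1 + unstereo x \<bullet> unstereo x = 2 / (1 + x$1)"
  proof -
    have "unstereo x \<bullet> unstereo x = (x$2 * x$2 + x$3 * x$3 + x$4 * x$4) / ((1 + x$1) * (1 + x$1))"
      unfolding inner_3 u by (simp add: add_divide_distrib)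
    also have "x$2 * x$2 + x$3 * x$3 + x$4 * x$4 = (1 + x$1) * (1 - x$1)"
      using s by (simp add: algebra_simps)
    also have "(1 + x$1) * (1 - x$1) / ((1 + x$1) * (1 + x$1)) = (1 - x$1) / (1 + x$1)"
      using p by simp
    finally show ?thesis using p by (simp add: field_simps)
  qed
  then show ?thesis using p by (intro vec4_eqI) (simp_all add: stereo_nth u add_divide_distrib)
qed

lemma range_stereo: "range stereo = S3 - {- pole}"
  using stereo_S3 stereo_ne stereo_unstereo by (auto simp: image_iff) metis

lemma range_minus_stereo: "range (\<lambda>y. - stereo y) = S3 - {pole}"
proof -
  have "x \<in> S3 - {pole} \<longleftrightarrow> - x \<in> range stereo" for x
    unfolding range_stereo by (auto simp: S3_def)
  then show ?thesis by (auto simp: image_iff) (metis minus_equation_iff)+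
qed

lemma stereo_component: "stereo y $ 1 = - 1 + (1 / (1 + y \<bullet> y)) * 2"
  "stereo y $ 2 = (1 / (1 + y \<bullet> y)) * (2 * y$1)"
  "stereo y $ 3 = (1 / (1 + y \<bullet> y)) * (2 * y$2)" "stereo y $ 4 = (1 / (1 + y \<bullet> y)) * (2 * y$3)"
  unfolding stereo_nth by simp_all

lemma Cinf_one_plus_inner: "Cinf_on (\<lambda>y::real^3. 1 + y \<bullet> y) UNIV"
  by (intro Cinf_on_add Cinf_on_inner Cinf_on_ident Cinf_on_const) auto

lemma Cinf_nth: "open S \<Longrightarrow> Cinf_on (\<lambda>y::real^'n. y $ i) S"
  by (intro Cinf_on_bounded_linear bounded_linear_vec_nth)

lemma Cinf_stereo: "Cinf_on stereo UNIV"
proof (rule Cinf_on_vec)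
  have i: "Cinf_on (\<lambda>y::real^3. 1 / (1 + y \<bullet> y)) UNIV"
    by (intro Cinf_on_divide Cinf_one_plus_inner Cinf_on_const) (simp_all add: one_plus_inner less_imp_neq[symmetric] less_imp_neq[OF one_plus_inner, symmetric])
  show "Cinf_on (\<lambda>x. stereo x $ j) UNIV" for j
    using exhaust_4[of j]
    by (elim disjE; simp only: stereo_component; intro Cinf_on_add Cinf_on_mult i Cinf_on_const Cinf_nth open_UNIV)
qed simp

lemma Cinf_Jac: "Cinf_on Jac UNIV"
  unfolding Jac_def[abs_def]
  by (intro Cinf_on_divide Cinf_on_power Cinf_one_plus_inner Cinf_on_const) 
    (simp_all add: less_imp_neq[OF one_plus_inner, symmetric])

lemma Cinf_unstereo: "Cinf_on unstereo {x. 1 + x$1 > 0}"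
proof (rule Cinf_on_vec)
  show o: "open {x::real^4. 1 + x$1 > 0}"
    by (intro open_Collect_less continuous_intros)
  have i: "Cinf_on (\<lambda>x::real^4. 1 / (1 + x$1)) {x. 1 + x$1 > 0}"
    by (intro Cinf_on_divide Cinf_on_add Cinf_nth Cinf_on_const o) auto
  have u: "unstereo x $ 1 = 1 / (1 + x$1) * x$2" "unstereo x $ 2 = 1 / (1 + x$1) * x$3" "unstereo x $ 3 = 1 / (1 + x$1) * x$4" for x
    by (simp_all add: unstereo_def vector_3)
  show "Cinf_on (\<lambda>x. unstereo x $ j) {x. 1 + x$1 > 0}" for j
    using exhaust_3[of j]
    by (elim disjE; simp only: u; intro Cinf_on_mult i Cinf_nth o)
qed

lemma stereo_has_derivative:
  "(stereo has_derivative (\<lambda>h. vector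
     [- 4 * (y \<bullet> h) / (1 + y \<bullet> y)^2,
      2 * h$1 / (1 + y \<bullet> y) - 4 * (y \<bullet> h) * y$1 / (1 + y \<bullet> y)^2,
      2 * h$2 / (1 + y \<bullet> y) - 4 * (y \<bullet> h) * y$2 / (1 + y \<bullet> y)^2,
      2 * h$3 / (1 + y \<bullet> y) - 4 * (y \<bullet> h) * y$3 / (1 + y \<bullet> y)^2])) (at y)"
  (is "(_ has_derivative ?D) _")
proof -
  have nth: "((\<lambda>y::real^3. y $ i) has_derivative (\<lambda>h. h $ i)) (at y)" for i
    by (rule bounded_linear_imp_has_derivative) (rule bounded_linear_vec_nth)
  have i: "((\<lambda>y::real^3. 1 / (1 + y \<bullet> y)) has_derivative (\<lambda>h. - (2 * (y \<bullet> h) * (1 / (1 + y \<bullet> y))\<^sup>2))) (at y)"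
    using one_plus_inner[of y]
    by (auto intro!: derivative_eq_intros simp: power2_eq_square inner_commute divide_inverse)
  have c: "((\<lambda>y::real^3. 1 / (1 + y \<bullet> y) * (2 * y $ k)) has_derivative
      (\<lambda>h. 2 * h$k / (1 + y \<bullet> y) - 4 * (y \<bullet> h) * y$k / (1 + y \<bullet> y)^2)) (at y)" for k
    by (rule has_derivative_eq_rhs[OF has_derivative_mult[OF i has_derivative_mult_right[OF nth]]])
      (simp add: fun_eq_iff power_divide algebra_simps)
  have d: "((\<lambda>y::real^3. - 1 + 1 / (1 + y \<bullet> y) * 2) has_derivative (\<lambda>h. - 4 * (y \<bullet> h) / (1 + y \<bullet> y)^2)) (at y)"
    by (rule has_derivative_eq_rhs[OF has_derivative_add[OF has_derivative_const has_derivative_mult_left[OF i]]])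
      (simp add: fun_eq_iff power_divide algebra_simps)
  have "\<forall>i. ((\<lambda>y. stereo y $ i) has_derivative (\<lambda>h. ?D h $ i)) (at y)"
    unfolding forall_4 stereo_component vector_4
    by (intro conjI c d)
  then show ?thesis
    by (subst has_derivative_componentwise_within) (auto simp: Basis_vec_def inner_axis)
qed

lemma pd_stereo: "pd stereo \<alpha> y = vector
     [- 4 * y$\<alpha> / (1 + y \<bullet> y)^2,
      2 * axis \<alpha> 1 $ 1 / (1 + y \<bullet> y) - 4 * y$\<alpha> * y$1 / (1 + y \<bullet> y)^2,
      2 * axis \<alpha> 1 $ 2 / (1 + y \<bullet> y) - 4 * y$\<alpha> * y$2 / (1 + y \<bullet> y)^2,
      2 * axis \<alpha> 1 $ 3 / (1 + y \<bullet> y) - 4 * y$\<alpha> * y$3 / (1 + y \<bullet> y)^2]"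
  by (subst pd_eq[OF stereo_has_derivative]) (simp add: inner_axis)

lemma det_stereo: "det (orientation_matrix (stereo y) (\<lambda>\<alpha>. pd stereo \<alpha> y)) = Jac y"
proof -
  \<comment> \<open>In \<open>c\<close> and \<open>z\<close> all entries are polynomials, and the
    only relation between these variables is \<open>r\<close>, the equation (c - 1)^2 + |z|^2 = 1 of
    the sphere.\<close>
  define c where "c = 2 / (1 + y \<bullet> y)"
  define z where "z \<alpha> = c * y$\<alpha>" for \<alpha>
  have s: "stereo y $ 1 = c - 1" "stereo y $ 2 = z 1" "stereo y $ 3 = z 2" "stereo y $ 4 = z 3"
    unfolding stereo_nth c_def z_def by simp_all
  have p: "pd stereo \<alpha> y = vector [- (c * z \<alpha>), c * axis \<alpha> 1 $ 1 - z \<alpha> * z 1,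
     c * axis \<alpha> 1 $ 2 - z \<alpha> * z 2, c * axis \<alpha> 1 $ 3 - z \<alpha> * z 3]" for \<alpha>
    unfolding pd_stereo c_def z_def
    by (rule arg_cong[where f=vector]) (simp add: power2_eq_square)
  have "c * (1 + y \<bullet> y) = 2" using one_plus_inner[of y] by (simp add: c_def field_simps)
  then have "c * (c * (1 + y \<bullet> y)) = 2 * c" by simp
  then have r: "c\<^sup>2 + z 1 * z 1 + z 2 * z 2 + z 3 * z 3 = 2 * c"
    unfolding z_def inner_3 by (simp add: algebra_simps power2_eq_square)
  have "det (orientation_matrix (stereo y) (\<lambda>\<alpha>. pd stereo \<alpha> y)) = c\<^sup>2 * (c\<^sup>2 - c + z 1 * z 1 + z 2 * z 2 + z 3 * z 3)"
    unfolding sum_insert_UNIV_4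
    unfolding orientation_matrix_def vector_4 p s
    by (simp add: axis_def) algebra
  also have "\<dots> = c\<^sup>2 * c" using r by (simp add: algebra_simps)
  also have "\<dots> = Jac y" by (simp add: Jac_def c_def power2_eq_square power3_eq_cube)
  finally show ?thesis .
qed

lemma stereo_differentiable: "stereo differentiable at y"
  using Cinf_on_differentiable[OF Cinf_stereo] by simp

lemma inj_stereo_derivative: "inj (frechet_derivative stereo (at y))"
proof -
  have l: "linear (frechet_derivative stereo (at y))"
    using differentiable_has_derivative[OF stereo_differentiable] by (rule has_derivative_linear)
  have "h = 0" if "frechet_derivative stereo (at y) h = 0" for h
  proof -
    have z: "vector
     [- 4 * (y \<bullet> h) / (1 + y \<bullet> y)^2,
      2 * h$1 / (1 + y \<bullet> y) - 4 * (y \<bullet> h) * y$1 / (1 + y \<bullet> y)^2,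
      2 * h$2 / (1 + y \<bullet> y) - 4 * (y \<bullet> h) * y$2 / (1 + y \<bullet> y)^2,
      2 * h$3 / (1 + y \<bullet> y) - 4 * (y \<bullet> h) * y$3 / (1 + y \<bullet> y)^2] = (0::real^4)"
      using that unfolding frechet_derivative_at[OF stereo_has_derivative[of y], symmetric] .
    have "y \<bullet> h = 0"
      using arg_cong[OF z, of "\<lambda>v. v $ 1"] one_plus_inner[of y] by (simp add: vector_4)
    then show "h = 0"
      using arg_cong[OF z, of "\<lambda>v. v $ 2"] arg_cong[OF z, of "\<lambda>v. v $ 3"] arg_cong[OF z, of "\<lambda>v. v $ 4"] one_plus_inner[of y]
      by (intro vec3_eqI) (simp_all add: vector_4)
  qed
  then show ?thesis using l by (simp add: linear_injective_0)
qed

lemma continuous_stereo: "continuous_on S stereo"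
  using Cinf_on_continuous[OF Cinf_stereo] continuous_on_subset by blast

lemma pos_coords_stereo: "pos_coords stereo UNIV"
  unfolding pos_coords_def local_coords_def
proof (intro conjI ballI)
  show "openin (top_of_set S3) (range stereo)"
    unfolding range_stereo by (intro openin_diff) (auto simp: S3_def norm_axis_1)
  have "homeomorphism UNIV (range stereo) stereo unstereo"
  proof (rule homeomorphismI)
    show "continuous_on (range stereo) unstereo"
      by (rule continuous_on_subset[OF Cinf_on_continuous[OF Cinf_unstereo]]) (auto simp: range_stereo S3_nth_1)
  qed (auto simp: continuous_stereo unstereo_stereo)
  then show "\<exists>\<psi>. homeomorphism UNIV (range stereo) stereo \<psi>" by blast
qed (auto simp: Cinf_stereo inj_stereo_derivative det_stereo Jac_pos)

lemma pd_minus_stereo: "pd (\<lambda>y. - stereo y) \<alpha> y = - pd stereo \<alpha> y"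
  by (rule pd_linear[OF bounded_linear_minus[OF bounded_linear_ident] stereo_differentiable])

text \<open>The map x to - x has determinant 1 in dimension four, so the antipodal chart is again
  positively oriented and no reflection of the coordinates is required.\<close>

lemma det_minus_stereo: "det (orientation_matrix (- stereo y) (\<lambda>\<alpha>. pd (\<lambda>y. - stereo y) \<alpha> y)) = Jac y"
  unfolding det_stereo[symmetric] sum_insert_UNIV_4
  unfolding orientation_matrix_def vector_4 pd_minus_stereo vector_uminus_component by algebra

lemma pos_coords_minus_stereo: "pos_coords (\<lambda>y. - stereo y) UNIV"
  unfolding pos_coords_def local_coords_def
proof (intro conjI ballI)
  show "openin (top_of_set S3) (range (\<lambda>y. - stereo y))"
    unfolding range_minus_stereo by (intro openin_diff) (auto simp: S3_def norm_axis_1)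
  have m: "x \<in> range (\<lambda>y. - stereo y) \<Longrightarrow> - x \<in> range stereo" for x by auto
  have "homeomorphism UNIV (range (\<lambda>y. - stereo y)) (\<lambda>y. - stereo y) (\<lambda>x. unstereo (- x))"
  proof (rule homeomorphismI)
    show "continuous_on (range (\<lambda>y. - stereo y)) (\<lambda>x. unstereo (- x))"
      by (rule continuous_on_compose2[OF Cinf_on_continuous[OF Cinf_unstereo]])
        (use m in \<open>auto intro!: continuous_intros S3_nth_1[of "stereo _", simplified] stereo_S3 stereo_ne\<close>)
  qed (auto simp: continuous_stereo unstereo_stereo intro!: continuous_intros)
  then show "\<exists>\<psi>. homeomorphism UNIV (range (\<lambda>y. - stereo y)) (\<lambda>y. - stereo y) \<psi>" by blast
  have "frechet_derivative (\<lambda>y. - stereo y) (at y) = (\<lambda>h. - frechet_derivative stereo (at y) h)" for y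
    by (rule frechet_derivative_at[OF has_derivative_minus[OF differentiable_has_derivative[OF stereo_differentiable]], symmetric])
  then show "inj (frechet_derivative (\<lambda>y. - stereo y) (at y))" for y
    using inj_stereo_derivative by (simp add: inj_def)
qed (auto simp: Cinf_stereo Cinf_on_minus det_minus_stereo Jac_pos)

text \<open>The components of \<open>Ef \<tau> m\<close> in stereographic coordinates.\<close>

definition Eh :: "real \<Rightarrow> real^3 \<Rightarrow> real^3^3"
  where "Eh \<tau> y = (\<chi> m \<alpha>. (1 - y \<bullet> y) * (if m = \<alpha> then 1/2 else 0) + y$m * y$\<alpha>
    + \<tau> * (\<Sum>\<gamma>\<in>UNIV. eps3 \<alpha> \<gamma> m * y$\<gamma>))"

lemma Cinf_Eh: "Cinf_on (\<lambda>y. Eh \<tau> y $ m $ \<alpha>) UNIV"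
  unfolding Eh_def vec_lambda_beta
  by (intro Cinf_on_add Cinf_on_mult Cinf_on_sum Cinf_on_diff Cinf_on_inner Cinf_on_ident Cinf_on_const Cinf_nth open_UNIV)

lemma pd_Eh: "pd (\<lambda>y. Eh \<tau> y $ m $ \<beta>) \<alpha> y =
   - y$\<alpha> * (if m = \<beta> then 1 else 0) + (if \<alpha> = m then y$\<beta> else 0) + (if \<alpha> = \<beta> then y$m else 0) + \<tau> * eps3 \<beta> \<alpha> m"
proof -
  have nth: "((\<lambda>y::real^3. y $ i) has_derivative (\<lambda>h. h $ i)) (at y)" for i
    by (rule bounded_linear_imp_has_derivative) (rule bounded_linear_vec_nth)
  have "((\<lambda>y. Eh \<tau> y $ m $ \<beta>) has_derivative (\<lambda>h. - (y \<bullet> h) * (if m = \<beta> then 1 else 0) + (y$m * h$\<beta> + h$m * y$\<beta>)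
    + \<tau> * (\<Sum>\<gamma>\<in>UNIV. eps3 \<beta> \<gamma> m * h$\<gamma>))) (at y)"
    unfolding Eh_def vec_lambda_beta
    by (rule has_derivative_eq_rhs, (rule nth has_derivative_add has_derivative_mult has_derivative_sum
        has_derivative_diff has_derivative_inner has_derivative_const has_derivative_ident)+)
      (auto simp: fun_eq_iff inner_commute)
  from pd_eq[OF this] show ?thesis
    by (simp add: inner_axis) (auto simp: axis_def if_distrib cong: if_cong)
qed

lemma Eh_bracket:
  assumes "\<tau> = 1 \<or> \<tau> = -1"
  shows "(\<Sum>\<alpha>\<in>UNIV. Eh \<tau> y$m$\<alpha> * pd (\<lambda>y. Eh \<tau> y$n$\<beta>) \<alpha> y - Eh \<tau> y$n$\<alpha> * pd (\<lambda>y. Eh \<tau> y$m$\<beta>) \<alpha> y)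
    = (\<Sum>p\<in>UNIV. 2 * \<tau> * eps3 m n p * Eh \<tau> y$p$\<beta>)"
  unfolding pd_Eh
  using assms exhaust_3[of m] exhaust_3[of n] exhaust_3[of \<beta>]
  by (elim disjE; simp add: Eh_def sum_3 eps3_def inner_3; simp add: field_simps)

lemma pd_Jac: "pd Jac \<alpha> y = - (6 * y$\<alpha> / (1 + y \<bullet> y)) * Jac y"
proof -
  have 1: "((\<lambda>s. 8 / s ^ 3) has_field_derivative (- (3 / s) * (8 / s ^ 3))) (at s)" if "s > 0" for s :: real
    using that by (auto intro!: derivative_eq_intros simp: field_simps eval_nat_numeral)
  have 2: "((\<lambda>y::real^3. 1 + y \<bullet> y) has_derivative (\<lambda>h. 2 * (y \<bullet> h))) (at y)"
    by (auto intro!: derivative_eq_intros simp: inner_commute)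
  have "(Jac has_derivative (\<lambda>h. 2 * (y \<bullet> h) * (- (3 / (1 + y \<bullet> y)) * Jac y))) (at y)"
    unfolding Jac_def[abs_def] by (rule DERIV_compose_FDERIV[OF 1[OF one_plus_inner] 2])
  from pd_eq[OF this] show ?thesis by (simp add: inner_axis)
qed

text \<open>The radial part of a field: the rotational term drops out by antisymmetry of
  \<open>eps3\<close>. It enters the divergence of the fields and their action on radial
  cutoffs.\<close>

lemma sum_y_Eh: "(\<Sum>\<alpha>\<in>UNIV. y$\<alpha> * Eh \<tau> y$m$\<alpha>) = y$m * (1 + y \<bullet> y) / 2"
  using exhaust_3[of m] by (elim disjE; simp add: Eh_def sum_3 eps3_def inner_3; simp add: field_simps)

text \<open>The invariant fields are Killing fields, hence divergence-free. Integration by parts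
  along them therefore produces no term of order zero.\<close>

lemma div_Eh: "(\<Sum>\<alpha>\<in>UNIV. pd (\<lambda>y. Jac y * Eh \<tau> y$m$\<alpha>) \<alpha> y) = 0"
proof -
  have d: "Jac differentiable at y" "(\<lambda>y. Eh \<tau> y$m$\<alpha>) differentiable at y" for \<alpha>
    using Cinf_on_differentiable[OF Cinf_Jac] Cinf_on_differentiable[OF Cinf_Eh] by auto
  have 1: "(\<Sum>\<alpha>\<in>UNIV. 6 * y$\<alpha> / (1 + y \<bullet> y) * Eh \<tau> y$m$\<alpha>) = 3 * y$m"
    using one_plus_inner[of y] sum_y_Eh[of y \<tau> m] by (simp add: sum_divide_distrib[symmetric] sum_distrib_left[symmetric] mult.assoc divide_simps)
  have 2: "(\<Sum>\<alpha>\<in>UNIV. pd (\<lambda>y. Eh \<tau> y$m$\<alpha>) \<alpha> y) = 3 * y$m"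
    unfolding pd_Eh using exhaust_3[of m] by (elim disjE; simp add: sum_3 eps3_def)
  have "(\<Sum>\<alpha>\<in>UNIV. pd (\<lambda>y. Jac y * Eh \<tau> y$m$\<alpha>) \<alpha> y)
    = Jac y * ((\<Sum>\<alpha>\<in>UNIV. pd (\<lambda>y. Eh \<tau> y$m$\<alpha>) \<alpha> y) - (\<Sum>\<alpha>\<in>UNIV. 6 * y$\<alpha> / (1 + y \<bullet> y) * Eh \<tau> y$m$\<alpha>))"
    unfolding pd_bilinear[OF bounded_bilinear_mult d] pd_Jac
    by (simp add: sum_distrib_left sum.distrib sum_subtractf algebra_simps sum_negf)
  then show ?thesis unfolding 1 2 by simp
qed

lemma Ef_stereo: "Ef \<tau> m (stereo y) = (\<Sum>\<alpha>\<in>UNIV. Eh \<tau> y $ m $ \<alpha> *\<^sub>R pd stereo \<alpha> y)"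
proof -
  define c where "c = 2 / (1 + y \<bullet> y)"
  have c: "c * (1 + y \<bullet> y) = 2" using one_plus_inner[of y] by (simp add: c_def field_simps)
  have s: "stereo y $ 1 = c - 1" "stereo y $ 2 = c * y$1" "stereo y $ 3 = c * y$2" "stereo y $ 4 = c * y$3"
    unfolding stereo_nth c_def by simp_all
  have p: "pd stereo \<alpha> y = vector [- (c * c * y$\<alpha>), c * axis \<alpha> 1 $ 1 - c * c * y$\<alpha> * y$1,
     c * axis \<alpha> 1 $ 2 - c * c * y$\<alpha> * y$2, c * axis \<alpha> 1 $ 3 - c * c * y$\<alpha> * y$3]" for \<alpha>
    unfolding pd_stereo c_def
    by (rule arg_cong[where f=vector]) (simp add: power2_eq_square)
  have "c * c * (\<Sum>\<alpha>\<in>UNIV. y$\<alpha> * Eh \<tau> y$m$\<alpha>) = c * y$m * (c * (1 + y \<bullet> y)) / 2"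
    unfolding sum_y_Eh by simp
  then have S: "c * c * (y$1 * Eh \<tau> y$m$1 + y$2 * Eh \<tau> y$m$2 + y$3 * Eh \<tau> y$m$3) = c * y$m"
    unfolding c by (simp add: sum_3)
  have e: "c * Eh \<tau> y$m$\<beta> = (c - 1) * (if m = \<beta> then 1 else 0) + c * y$m * y$\<beta> + c * \<tau> * (\<Sum>\<gamma>\<in>UNIV. eps3 \<beta> \<gamma> m * y$\<gamma>)" for \<beta>
    using c by (simp add: Eh_def algebra_simps)
  define R where "R = (\<Sum>\<alpha>\<in>UNIV. Eh \<tau> y $ m $ \<alpha> *\<^sub>R pd stereo \<alpha> y)"
  have "R $ 1 = - (c * c * (y$1 * Eh \<tau> y$m$1 + y$2 * Eh \<tau> y$m$2 + y$3 * Eh \<tau> y$m$3))"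
    unfolding R_def by (simp add: p sum_3 vector_4 axis_def algebra_simps)
  moreover have "R $ 2 = c * Eh \<tau> y$m$1 - c * c * (y$1 * Eh \<tau> y$m$1 + y$2 * Eh \<tau> y$m$2 + y$3 * Eh \<tau> y$m$3) * y$1"
    "R $ 3 = c * Eh \<tau> y$m$2 - c * c * (y$1 * Eh \<tau> y$m$1 + y$2 * Eh \<tau> y$m$2 + y$3 * Eh \<tau> y$m$3) * y$2"
    "R $ 4 = c * Eh \<tau> y$m$3 - c * c * (y$1 * Eh \<tau> y$m$1 + y$2 * Eh \<tau> y$m$2 + y$3 * Eh \<tau> y$m$3) * y$3"
    unfolding R_def by (simp_all add: p sum_3 vector_4 axis_def algebra_simps)
  ultimately have "Ef \<tau> m (stereo y) = R"
    unfolding S e using exhaust_3[of m]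
    by (intro vec4_eqI; elim disjE; simp add: Ef_def vector_4 s sum_3 eps3_def algebra_simps)
  then show ?thesis unfolding R_def .
qed

lemma Ed_stereo:
  assumes "f differentiable at (stereo y)"
  shows "Ed \<tau> m f (stereo y) = (\<Sum>\<alpha>\<in>UNIV. Eh \<tau> y $ m $ \<alpha> *\<^sub>R pd (\<lambda>y. f (stereo y)) \<alpha> y)"
proof -
  have l: "linear (frechet_derivative f (at (stereo y)))"
    using differentiable_has_derivative[OF assms] by (rule has_derivative_linear)
  show ?thesis
    unfolding Ed_def Ef_stereo pd_chain[OF stereo_differentiable assms]
    by (simp add: linear_sum[OF l] linear_scale[OF l])
qed

text \<open>The value is 1 / \<open>Jac\<close>, as it must be for an orthonormal frame. It is
  positive for both signs of \<tau>: left- and right-invariant frames have the same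
  orientation.\<close>

lemma det_Eh: "det (Eh \<tau> y) = ((1 + y \<bullet> y) / 2) ^ 3"
  if "\<tau> = 1 \<or> \<tau> = -1"
  using that unfolding det_3
  by (elim disjE; simp add: Eh_def sum_3 eps3_def inner_3; simp add: field_simps power3_eq_cube)

section \<open>Spin algebra\<close>

definition cmul :: "complex \<Rightarrow> complex^2^2 \<Rightarrow> complex^2^2"
  where "cmul c A = (\<chi> i j. c * A$i$j)"

lemma mat2_eqI: "A$1$1 = B$1$1 \<Longrightarrow> A$1$2 = B$1$2 \<Longrightarrow> A$2$1 = B$2$1 \<Longrightarrow> A$2$2 = B$2$2 \<Longrightarrow> A = (B :: 'a^2^2)"
  by (simp add: vec_eq_iff forall_2)

lemma pauli_nth:
  "pauli 1 $ 1 $ 1 = 0" "pauli 1 $ 1 $ 2 = 1" "pauli 1 $ 2 $ 1 = 1" "pauli 1 $ 2 $ 2 = 0"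
  "pauli 2 $ 1 $ 1 = 0" "pauli 2 $ 1 $ 2 = - \<i>" "pauli 2 $ 2 $ 1 = \<i>" "pauli 2 $ 2 $ 2 = 0"
  "pauli 3 $ 1 $ 1 = 1" "pauli 3 $ 1 $ 2 = 0" "pauli 3 $ 2 $ 1 = 0" "pauli 3 $ 2 $ 2 = - 1"
  by (simp_all add: pauli_def vector_2)

lemma mm2_nth: "((A :: complex^2^2) ** B) $ i $ j = A$i$1 * B$1$j + A$i$2 * B$2$j"
  by (simp add: matrix_matrix_mult_def sum_2)

text \<open>The spin representation of the rotation algebra: it turns the connection matrix of an
  orthonormal frame into the spin connection.\<close>

definition spin :: "real^3^3 \<Rightarrow> complex^2^2"
  where "spin G = (1/4) *\<^sub>R (\<Sum>l\<in>UNIV. \<Sum>k\<in>UNIV. G$l$k *\<^sub>R (pauli l ** pauli k))"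

text \<open>The matrix q_1 - i (q_2 s^1 + q_3 s^2 + q_4 s^3), which identifies unit quaternions with
  SU(2).\<close>

definition Rm :: "real^4 \<Rightarrow> complex^2^2"
  where "Rm q = vector [vector [Complex (q$1) (- (q$4)), Complex (- (q$3)) (- (q$2))],
     vector [Complex (q$3) (- (q$2)), Complex (q$1) (q$4)]]"

definition qconj :: "real^4 \<Rightarrow> real^4"
  where "qconj q = vector [q$1, - (q$2), - (q$3), - (q$4)]"

text \<open>The double cover of SO(3) by unit quaternions, with conventions fixed by
  \<open>Rm_pauli\<close>. Its entries are quadratic forms in \<open>q\<close>.\<close>

definition Rot :: "real^4 \<Rightarrow> real^3^3"
  where "Rot q = vector [
    vector [q$1*q$1 + q$2*q$2 - q$3*q$3 - q$4*q$4, 2 * (q$2*q$3 - q$1*q$4), 2 * (q$2*q$4 + q$1*q$3)],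
    vector [2 * (q$2*q$3 + q$1*q$4), q$1*q$1 - q$2*q$2 + q$3*q$3 - q$4*q$4, 2 * (q$3*q$4 - q$1*q$2)],
    vector [2 * (q$2*q$4 - q$1*q$3), 2 * (q$3*q$4 + q$1*q$2), q$1*q$1 - q$2*q$2 - q$3*q$3 + q$4*q$4]]"

text \<open>The polarization of \<open>Rot\<close>, which gives its derivative.\<close>

definition dRot :: "real^4 \<Rightarrow> real^4 \<Rightarrow> real^3^3"
  where "dRot q r = Rot (q + r) - Rot q - Rot r"

lemma Rm_linear: "linear Rm"
  by (rule linearI) (auto intro!: mat2_eqI simp: Rm_def vector_2 complex_eq_iff algebra_simps)

lemma qconj_nth: "qconj q $ 1 = q$1" "qconj q $ 2 = - (q$2)" "qconj q $ 3 = - (q$3)" "qconj q $ 4 = - (q$4)"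
  by (simp_all add: qconj_def vector_4)

lemma Rm_nth: "Rm q $ 1 $ 1 = Complex (q$1) (- (q$4))" "Rm q $ 1 $ 2 = Complex (- (q$3)) (- (q$2))"
  "Rm q $ 2 $ 1 = Complex (q$3) (- (q$2))" "Rm q $ 2 $ 2 = Complex (q$1) (q$4)"
  by (simp_all add: Rm_def vector_2)

lemma Rm_qconj: "norm q = 1 \<Longrightarrow> Rm (qconj q) ** Rm q = mat 1" "norm q = 1 \<Longrightarrow> Rm q ** Rm (qconj q) = mat 1"
  by (intro mat2_eqI; simp add: mm2_nth Rm_nth qconj_nth mat_def complex_eq_iff norm_eq_1 inner_4)+

lemma Rot_nth: "Rot q $ 1 $ 1 = q$1*q$1 + q$2*q$2 - q$3*q$3 - q$4*q$4"
  "Rot q $ 1 $ 2 = 2 * (q$2*q$3 - q$1*q$4)" "Rot q $ 1 $ 3 = 2 * (q$2*q$4 + q$1*q$3)"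
  "Rot q $ 2 $ 1 = 2 * (q$2*q$3 + q$1*q$4)" "Rot q $ 2 $ 2 = q$1*q$1 - q$2*q$2 + q$3*q$3 - q$4*q$4"
  "Rot q $ 2 $ 3 = 2 * (q$3*q$4 - q$1*q$2)" "Rot q $ 3 $ 1 = 2 * (q$2*q$4 - q$1*q$3)"
  "Rot q $ 3 $ 2 = 2 * (q$3*q$4 + q$1*q$2)" "Rot q $ 3 $ 3 = q$1*q$1 - q$2*q$2 - q$3*q$3 + q$4*q$4"
  by (simp_all add: Rot_def vector_3)

lemma Rm_pauli: "Rm (qconj q) ** pauli j ** Rm q = (\<Sum>k\<in>UNIV. Rot q $ j $ k *\<^sub>R pauli k)"
  using exhaust_3[of j]
  by (elim disjE; intro mat2_eqI; simp add: mm2_nth Rm_nth qconj_nth pauli_nth sum_3 Rot_nth complex_eq_iff; algebra?)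

lemma mat3_eqI: "(\<And>i j. A$i$j = B$i$j) \<Longrightarrow> A = (B :: 'a^3^3)"
  by (simp add: vec_eq_iff)

lemma mm3_nth: "((A :: real^3^3) ** B) $ i $ j = A$i$1 * B$1$j + A$i$2 * B$2$j + A$i$3 * B$3$j"
  by (simp add: matrix_matrix_mult_def sum_3)

lemma sum_pauli_mult:
  "(\<Sum>l\<in>UNIV. a l *\<^sub>R pauli l) ** (\<Sum>k\<in>UNIV. b k *\<^sub>R pauli k) = (\<Sum>l\<in>UNIV. \<Sum>k\<in>UNIV. (a l * b k) *\<^sub>R (pauli l ** pauli k))"
  unfolding sum_3
  by (intro mat2_eqI; simp add: mm2_nth algebra_simps)

text \<open>Conjugation by \<open>Rm q\<close> rotates each Pauli matrix (\<open>Rm_pauli\<close>);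
  inserting Rm q ** Rm (qconj q) = 1 between the two factors extends this to products.\<close>

lemma spin_conj:
  assumes "norm q = 1"
  shows "spin (transpose (Rot q) ** G ** Rot q) = Rm (qconj q) ** spin G ** Rm q"
proof -
  have id: "A ** (Rm q ** (Rm (qconj q) ** B)) = A ** B" for A B :: "complex^2^2"
    by (simp add: Rm_qconj(2)[OF assms] matrix_mul_assoc)
  have "Rm (qconj q) ** (pauli l ** pauli k) ** Rm q
      = (Rm (qconj q) ** pauli l ** Rm q) ** (Rm (qconj q) ** pauli k ** Rm q)" for l k
    by (simp add: matrix_mul_assoc[symmetric] id)
  then have c: "Rm (qconj q) ** (pauli l ** pauli k) ** Rm q
      = (\<Sum>m\<in>UNIV. \<Sum>n\<in>UNIV. (Rot q $ l $ m * Rot q $ k $ n) *\<^sub>R (pauli m ** pauli n))" for l k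
    unfolding Rm_pauli sum_pauli_mult .
  have lin: "linear (\<lambda>B. Rm (qconj q) ** B ** Rm q)"
    by (rule linearI; intro mat2_eqI; simp add: mm2_nth algebra_simps)
  have "Rm (qconj q) ** spin G ** Rm q = (1/4) *\<^sub>R (\<Sum>l\<in>UNIV. \<Sum>k\<in>UNIV. G$l$k *\<^sub>R 
     (\<Sum>m\<in>UNIV. \<Sum>n\<in>UNIV. (Rot q $ l $ m * Rot q $ k $ n) *\<^sub>R (pauli m ** pauli n)))"
    unfolding spin_def linear_scale[OF lin] linear_sum[OF lin] c by simp
  also have "\<dots> = (1/4) *\<^sub>R (\<Sum>m\<in>UNIV. \<Sum>n\<in>UNIV. (transpose (Rot q) ** G ** Rot q)$m$n *\<^sub>R (pauli m ** pauli n))"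
    by (simp only: sum_3 mm3_nth transpose_def vec_lambda_beta scaleR_add_right scaleR_add_left scaleR_scaleR)
       (simp add: algebra_simps)
  finally show ?thesis unfolding spin_def by simp
qed

lemma spin_add: "spin (G + H) = spin G + spin H"
  unfolding spin_def by (simp add: scaleR_add_left scaleR_add_right sum.distrib)

text \<open>Here \<open>r\<close> is a velocity of the curve of unit quaternions, hence orthogonal
  to \<open>q\<close>. The formula computes the inhomogeneous term of the gauge transformation on
  the level of SU(2).\<close>

lemma spin_dRot:
  assumes "norm q = 1" "q \<bullet> r = 0"
  shows "spin (transpose (dRot q r) ** Rot q) = - (Rm (qconj q) ** Rm r)"
proof -
  \<comment> \<open>The imaginary part of the quaternion product of \<open>qconj q\<close> and
    \<open>r\<close>; the orthogonality of \<open>q\<close> and \<open>r\<close> says that its real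
    part vanishes.\<close>
  define u where "u = (\<lambda>l::3. if l = 1 then q$1*r$2 - q$2*r$1 - q$3*r$4 + q$4*r$3
     else if l = 2 then q$1*r$3 - q$3*r$1 + q$2*r$4 - q$4*r$2 else q$1*r$4 - q$4*r$1 - q$2*r$3 + q$3*r$2)"
  have q: "q$1*q$1 + q$2*q$2 + q$3*q$3 + q$4*q$4 = 1" using assms(1) by (simp add: norm_eq_1 inner_4)
  have r: "q$1*r$1 + q$2*r$2 + q$3*r$3 + q$4*r$4 = 0" using assms(2) by (simp add: inner_4)
  have "(transpose (dRot q r) ** Rot q) $ m $ n = 2 * (q$1*q$1 + q$2*q$2 + q$3*q$3 + q$4*q$4) * (\<Sum>l\<in>UNIV. eps3 m n l * u l)
     + (if m = n then 2 * (q$1*q$1 + q$2*q$2 + q$3*q$3 + q$4*q$4) * (q$1*r$1 + q$2*r$2 + q$3*r$3 + q$4*r$4) else 0)" for m n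
    using exhaust_3[of m] exhaust_3[of n]
    by (elim disjE; simp add: mm3_nth transpose_def dRot_def Rot_nth sum_3 eps3_def u_def; simp add: algebra_simps)
  then have "(transpose (dRot q r) ** Rot q) $ m $ n = 2 * (\<Sum>l\<in>UNIV. eps3 m n l * u l)" for m n
    unfolding q r by simp
  then show ?thesis
    using r by (intro mat2_eqI; simp add: spin_def sum_3 eps3_def mm2_nth pauli_nth Rm_nth qconj_nth complex_eq_iff u_def; simp add: algebra_simps)
qed

section \<open>The Dirac operator in a frame\<close>

definition sig :: "(real^3 \<Rightarrow> real^3^3) \<Rightarrow> 3 \<Rightarrow> real^3 \<Rightarrow> complex^2^2"
  where "sig X \<alpha> y = (\<Sum>j\<in>UNIV. X y $ j $ \<alpha> *\<^sub>R pauli j)"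

definition chrm :: "metric \<Rightarrow> (real^3 \<Rightarrow> real^4) \<Rightarrow> 3 \<Rightarrow> real^3 \<Rightarrow> real^3^3"
  where "chrm g \<phi> \<alpha> y = (\<chi> \<gamma> \<beta>. christoffel g \<phi> y \<beta> \<alpha> \<gamma>)"

text \<open>The rows of \<open>X\<close> are the frame vectors, so the entry (l, k) is g(X_l,
  nabla_\<alpha> X_k), the connection matrix of the frame. The index order in \<open>chrm\<close> is
  chosen so that rows can be multiplied from the left.\<close>

definition Gam :: "metric \<Rightarrow> (real^3 \<Rightarrow> real^4) \<Rightarrow> (real^3 \<Rightarrow> real^3^3) \<Rightarrow> 3 \<Rightarrow> real^3 \<Rightarrow> real^3^3"
  where "Gam g \<phi> X \<alpha> y = X y ** metric_comp g \<phi> y ** transpose (pd X \<alpha> y + X y ** chrm g \<phi> \<alpha> y)"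

lemma bounded_linear_matrix_nth: "bounded_linear (\<lambda>A::real^3^3. A $ i $ j)"
  by (rule bounded_linear_compose[OF bounded_linear_vec_nth bounded_linear_vec_nth])

lemma pd_matrix_nth: "X differentiable at y \<Longrightarrow> pd (\<lambda>z. X z $ k $ \<beta>) \<alpha> y = pd X \<alpha> y $ k $ \<beta>" 
  for X :: "real^3 \<Rightarrow> real^3^3"
  by (rule pd_linear[OF bounded_linear_matrix_nth])

lemma pd_sig: "X differentiable at y \<Longrightarrow> pd (sig X \<beta>) \<alpha> y = (\<Sum>k\<in>UNIV. pd X \<alpha> y $ k $ \<beta> *\<^sub>R pauli k)"
proof -
  have bl: "bounded_linear (\<lambda>A::real^3^3. \<Sum>k\<in>UNIV. A $ k $ \<beta> *\<^sub>R pauli k)"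
    by (intro bounded_linear_sum bounded_linear_scaleR_left[THEN bounded_linear_compose] bounded_linear_matrix_nth)
  show "X differentiable at y \<Longrightarrow> ?thesis"
    unfolding sig_def[abs_def] by (rule pd_linear[OF bl])
qed

lemma mv2_nth: "((A :: complex^2^2) *v w) $ i = A$i$1 * w$1 + A$i$2 * w$2"
  by (simp add: matrix_vector_mult_def sum_2)

lemma dirac_expr_spin:
  assumes X: "frame_comp e \<phi> differentiable at y"
    and sym: "transpose (metric_comp g \<phi> y) = metric_comp g \<phi> y"
  shows "dirac_expr g e \<phi> y w p = (- \<i>) *s (\<Sum>\<alpha>\<in>UNIV. sig (frame_comp e \<phi>) \<alpha> y *v
    (p \<alpha> + spin (Gam g \<phi> (frame_comp e \<phi>) \<alpha> y) *v w))"
proof -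
  define F where "F = frame_comp e \<phi>"
  define G where "G = metric_comp g \<phi> y"
  have su: "sigma_up e \<phi> \<alpha> = sig F \<alpha>" for \<alpha>
    unfolding sig_def sigma_up_def F_def by (rule ext) (rule refl)
  have sym': "G $ \<beta> $ \<gamma> = G $ \<gamma> $ \<beta>" for \<beta> \<gamma>
    using arg_cong[OF sym, of "\<lambda>A. A $ \<beta> $ \<gamma>"] by (simp add: transpose_def G_def)
  have sd: "sigma_down g e \<phi> \<beta> y = (\<Sum>l\<in>UNIV. (F y ** G) $ l $ \<beta> *\<^sub>R pauli l)" for \<beta>
    unfolding sigma_down_def su sig_def G_def[symmetric]
    by (simp add: sum_3 mm3_nth sym'[of \<beta>] algebra_simps scaleR_add_left)
  define H where "H \<alpha> = pd F \<alpha> y + F y ** chrm g \<phi> \<alpha> y" for \<alpha>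
  have in1: "pd (sig F \<beta>) \<alpha> y + (\<Sum>\<gamma>\<in>UNIV. christoffel g \<phi> y \<beta> \<alpha> \<gamma> *\<^sub>R sig F \<gamma> y)
      = (\<Sum>k\<in>UNIV. H \<alpha> $ k $ \<beta> *\<^sub>R pauli k)" for \<alpha> \<beta>
    unfolding pd_sig[OF X[folded F_def]] H_def sig_def
    by (simp add: sum_3 mm3_nth chrm_def algebra_simps scaleR_add_left)
  have "(\<Sum>\<beta>\<in>UNIV. sigma_down g e \<phi> \<beta> y ** (pd (sig F \<beta>) \<alpha> y + (\<Sum>\<gamma>\<in>UNIV. christoffel g \<phi> y \<beta> \<alpha> \<gamma> *\<^sub>R sig F \<gamma> y)))
     = (\<Sum>\<beta>\<in>UNIV. \<Sum>l\<in>UNIV. \<Sum>k\<in>UNIV. ((F y ** G) $ l $ \<beta> * H \<alpha> $ k $ \<beta>) *\<^sub>R (pauli l ** pauli k))" for \<alpha>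
    unfolding in1 sd sum_pauli_mult ..
  also have "(\<Sum>\<beta>\<in>UNIV. \<Sum>l\<in>UNIV. \<Sum>k\<in>UNIV. ((F y ** G) $ l $ \<beta> * H \<alpha> $ k $ \<beta>) *\<^sub>R (pauli l ** pauli k)) = (\<Sum>l\<in>UNIV. \<Sum>k\<in>UNIV. Gam g \<phi> F \<alpha> y $ l $ k *\<^sub>R (pauli l ** pauli k))" for \<alpha>
  proof -
    have "Gam g \<phi> F \<alpha> y $ l $ k = (\<Sum>\<beta>\<in>UNIV. (F y ** G) $ l $ \<beta> * H \<alpha> $ k $ \<beta>)" for l k
      unfolding Gam_def G_def[symmetric] H_def[symmetric] by (simp add: matrix_matrix_mult_def[of "F y ** G"] transpose_def)
    then show ?thesis
      by (simp only: scaleR_sum_left) (rule trans[OF sum.swap], rule sum.cong[OF refl], rule sum.swap)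
  qed
  finally have "(1/4) *\<^sub>R ((\<Sum>\<beta>\<in>UNIV. sigma_down g e \<phi> \<beta> y ** (pd (sig F \<beta>) \<alpha> y + (\<Sum>\<gamma>\<in>UNIV. christoffel g \<phi> y \<beta> \<alpha> \<gamma> *\<^sub>R sig F \<gamma> y))) *v w)
     = spin (Gam g \<phi> F \<alpha> y) *v w" for \<alpha>
    unfolding spin_def by (simp add: vec_eq_iff forall_2 mv2_nth algebra_simps)
  then show ?thesis unfolding dirac_expr_def su F_def[symmetric] by simp
qed

section \<open>The Levi-Civita connection in an orthonormal frame\<close>

lemma christoffel_lower:
  assumes inv: "invertible (metric_comp g \<phi> y)"
    and sym: "\<And>z. transpose (metric_comp g \<phi> z) = metric_comp g \<phi> z"
  shows "(chrm g \<phi> \<alpha> y ** metric_comp g \<phi> y) $ \<gamma> $ \<delta> =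
    (pd (\<lambda>z. metric_comp g \<phi> z $ \<gamma> $ \<delta>) \<alpha> y + pd (\<lambda>z. metric_comp g \<phi> z $ \<alpha> $ \<delta>) \<gamma> y
        - pd (\<lambda>z. metric_comp g \<phi> z $ \<alpha> $ \<gamma>) \<delta> y) / 2"
proof -
  define K where "K \<delta> = (pd (\<lambda>z. metric_comp g \<phi> z $ \<gamma> $ \<delta>) \<alpha> y + pd (\<lambda>z. metric_comp g \<phi> z $ \<alpha> $ \<delta>) \<gamma> y
        - pd (\<lambda>z. metric_comp g \<phi> z $ \<alpha> $ \<gamma>) \<delta> y) / 2" for \<delta>
  define G where "G = metric_comp g \<phi> y"
  have G: "G ** matrix_inv G = mat 1" using inv unfolding G_def invertible_def matrix_inv_def by (rule someI2_ex) simp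
  have sy: "G $ \<beta> $ \<delta> = G $ \<delta> $ \<beta>" for \<beta> \<delta>
    using arg_cong[OF sym[of y], of "\<lambda>A. A $ \<beta> $ \<delta>"] by (simp add: transpose_def G_def)
  have "(chrm g \<phi> \<alpha> y ** G) $ \<gamma> $ \<delta> = (\<Sum>\<beta>\<in>UNIV. \<Sum>\<epsilon>\<in>UNIV. matrix_inv G $ \<beta> $ \<epsilon> * K \<epsilon> * G $ \<beta> $ \<delta>)"
    unfolding matrix_matrix_mult_def chrm_def christoffel_def G_def[symmetric] K_def
    by (simp add: sum_distrib_right)
  also have "\<dots> = (\<Sum>\<epsilon>\<in>UNIV. (G ** matrix_inv G) $ \<delta> $ \<epsilon> * K \<epsilon>)"
    by (subst sum.swap) (simp add: matrix_matrix_mult_def sum_distrib_right sum_distrib_left sy[of _ \<delta>] mult_ac)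
  also have "\<dots> = K \<delta>" unfolding G by (simp add: mat_def if_distrib[of "\<lambda>x. x * _"] cong: if_cong)
  finally show ?thesis unfolding G_def K_def .
qed

lemma christoffel_metric:
  assumes inv: "invertible (metric_comp g \<phi> y)"
    and sym: "\<And>z. transpose (metric_comp g \<phi> z) = metric_comp g \<phi> z"
    and diff: "metric_comp g \<phi> differentiable at y"
  shows "pd (metric_comp g \<phi>) \<alpha> y = chrm g \<phi> \<alpha> y ** metric_comp g \<phi> y + transpose (chrm g \<phi> \<alpha> y ** metric_comp g \<phi> y)"
proof -
  have sy: "metric_comp g \<phi> z $ \<beta> $ \<delta> = metric_comp g \<phi> z $ \<delta> $ \<beta>" for \<beta> \<delta> z
    using arg_cong[OF sym[of z], of "\<lambda>A. A $ \<beta> $ \<delta>"] by (simp add: transpose_def)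
  have "pd (metric_comp g \<phi>) \<alpha> y $ \<gamma> $ \<delta> = (chrm g \<phi> \<alpha> y ** metric_comp g \<phi> y) $ \<gamma> $ \<delta> + (chrm g \<phi> \<alpha> y ** metric_comp g \<phi> y) $ \<delta> $ \<gamma>" for \<gamma> \<delta>
    unfolding christoffel_lower[OF inv sym] pd_matrix_nth[OF diff, symmetric] sy[of _ \<delta> \<gamma>] by (simp only: add_divide_distrib[symmetric]) simp
  then show ?thesis by (simp add: vec_eq_iff transpose_def)
qed

lemma christoffel_sym: 
  assumes sym: "\<And>z. transpose (metric_comp g \<phi> z) = metric_comp g \<phi> z"
  shows "christoffel g \<phi> y \<beta> \<alpha> \<gamma> = christoffel g \<phi> y \<beta> \<gamma> \<alpha>"
proof -
  have sy: "metric_comp g \<phi> z $ \<beta> $ \<delta> = metric_comp g \<phi> z $ \<delta> $ \<beta>" for \<beta> \<delta> z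
    using arg_cong[OF sym[of z], of "\<lambda>A. A $ \<beta> $ \<delta>"] by (simp add: transpose_def)
  show ?thesis unfolding christoffel_def sy[of _ \<alpha> \<gamma>] by (simp add: add.commute)
qed

lemma transpose_add: "transpose (A + B) = transpose A + transpose (B :: real^3^3)"
  by (simp add: vec_eq_iff transpose_def)

lemma bounded_linear_transpose: "bounded_linear (transpose :: real^3^3 \<Rightarrow> real^3^3)"
  unfolding linear_conv_bounded_linear[symmetric]
  by (rule linearI) (simp_all add: vec_eq_iff transpose_def)

lemma matrix_ring: 
  fixes A B C :: "real^3^3"
  shows "(A + B) ** C = A ** C + B ** C" "A ** (B + C) = A ** B + A ** C"
  by (simp_all add: mat3_eqI mm3_nth algebra_simps vec_eq_iff)

lemma differentiable_linear_compose:
  "bounded_linear h \<Longrightarrow> f differentiable at x \<Longrightarrow> (\<lambda>x. h (f x)) differentiable at x"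
  using bounded_linear.has_derivative unfolding differentiable_def by blast

lemma differentiable_bilinear:
  "bounded_bilinear h \<Longrightarrow> f differentiable at x \<Longrightarrow> g differentiable at x \<Longrightarrow> (\<lambda>x. h (f x) (g x)) differentiable at x"
  using bounded_bilinear.FDERIV unfolding differentiable_def by blast

text \<open>Metric compatibility: differentiate the orthonormality relation \<open>orth\<close> and
  replace the derivative of the metric by Christoffel symbols.\<close>

lemma Gam_antisym:
  assumes inv: "invertible (metric_comp g \<phi> y)"
    and sym: "\<And>z. transpose (metric_comp g \<phi> z) = metric_comp g \<phi> z"
    and diff: "metric_comp g \<phi> differentiable at y" "X differentiable at y"
    and orth: "\<And>z. X z ** metric_comp g \<phi> z ** transpose (X z) = mat 1"
  shows "transpose (Gam g \<phi> X \<alpha> y) = - Gam g \<phi> X \<alpha> y"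
proof -
  define G where "G = metric_comp g \<phi>"
  have dX: "(\<lambda>z. transpose (X z)) differentiable at y"
    using differentiable_linear_compose[OF bounded_linear_transpose diff(2)] .
  have dXG: "(\<lambda>z. X z ** G z) differentiable at y"
    using differentiable_bilinear[OF bounded_bilinear_matrix_mult diff(2,1)] unfolding G_def .
  have "pd (\<lambda>z. X z ** G z ** transpose (X z)) \<alpha> y = 0"
    unfolding G_def orth by simp
  then have z: "X y ** G y ** transpose (pd X \<alpha> y) + (X y ** pd G \<alpha> y + pd X \<alpha> y ** G y) ** transpose (X y) = 0"
    unfolding pd_bilinear[OF bounded_bilinear_matrix_mult dXG dX]
      pd_bilinear[OF bounded_bilinear_matrix_mult diff(2) diff(1)[folded G_def]]
      pd_linear[OF bounded_linear_transpose diff(2)] .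
  have "Gam g \<phi> X \<alpha> y + transpose (Gam g \<phi> X \<alpha> y) = 0"
    using z unfolding christoffel_metric[OF inv sym diff(1), of \<alpha>, folded G_def] Gam_def G_def[symmetric]
      matrix_transpose_mul transpose_add transpose_transpose sym[folded G_def]
    by (simp add: matrix_ring matrix_mul_assoc add_ac)
  then show ?thesis by (simp add: add_eq_0_iff)
qed

text \<open>The \<open>l\<close>-component of the bracket of the \<open>j\<close>-th and \<open>k\<close>-th fields of the frame \<open>X\<close>, when \<open>X\<close> is
  orthonormal.\<close>

definition brk :: "metric \<Rightarrow> (real^3 \<Rightarrow> real^4) \<Rightarrow> (real^3 \<Rightarrow> real^3^3) \<Rightarrow> real^3 \<Rightarrow> 3 \<Rightarrow> 3 \<Rightarrow> 3 \<Rightarrow> real"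
  where "brk g \<phi> X y l j k = (\<Sum>\<beta>\<in>UNIV. (X y ** metric_comp g \<phi> y) $ l $ \<beta> *
    (\<Sum>\<alpha>\<in>UNIV. X y $ j $ \<alpha> * pd X \<alpha> y $ k $ \<beta> - X y $ k $ \<alpha> * pd X \<alpha> y $ j $ \<beta>))"

text \<open>Absence of torsion: the Christoffel symbols are symmetric in their lower indices, so
  antisymmetrisation leaves only the Lie bracket of the frame vectors.\<close>

lemma Gam_torsion:
  assumes sym: "\<And>z. transpose (metric_comp g \<phi> z) = metric_comp g \<phi> z"
  shows "(\<Sum>\<alpha>\<in>UNIV. X y $ j $ \<alpha> * Gam g \<phi> X \<alpha> y $ l $ k) - (\<Sum>\<alpha>\<in>UNIV. X y $ k $ \<alpha> * Gam g \<phi> X \<alpha> y $ l $ j) = brk g \<phi> X y l j k"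
proof -
  define P where "P = X y ** metric_comp g \<phi> y"
  have G: "Gam g \<phi> X \<alpha> y $ l $ k = (\<Sum>\<beta>\<in>UNIV. P $ l $ \<beta> * (pd X \<alpha> y $ k $ \<beta> + (X y ** chrm g \<phi> \<alpha> y) $ k $ \<beta>))" for \<alpha> k
    unfolding Gam_def P_def[symmetric] by (simp add: matrix_matrix_mult_def[of P] transpose_def)
  have s: "(\<Sum>\<alpha>\<in>UNIV. X y $ j $ \<alpha> * (X y ** chrm g \<phi> \<alpha> y) $ k $ \<beta>) = (\<Sum>\<alpha>\<in>UNIV. X y $ k $ \<alpha> * (X y ** chrm g \<phi> \<alpha> y) $ j $ \<beta>)" for \<beta>
  proof -
    have "(\<Sum>\<alpha>\<in>UNIV. X y $ j $ \<alpha> * (X y ** chrm g \<phi> \<alpha> y) $ k $ \<beta>) = (\<Sum>\<alpha>\<in>UNIV. \<Sum>\<gamma>\<in>UNIV. X y $ j $ \<alpha> * (X y $ k $ \<gamma> * christoffel g \<phi> y \<beta> \<alpha> \<gamma>))" for j k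
      by (simp add: matrix_matrix_mult_def chrm_def sum_distrib_left)
    note e = this
    show ?thesis unfolding e
      by (subst sum.swap, subst christoffel_sym[OF sym]) (simp add: mult_ac)
  qed
  have "(\<Sum>\<alpha>\<in>UNIV. X y $ j $ \<alpha> * Gam g \<phi> X \<alpha> y $ l $ k) = (\<Sum>\<beta>\<in>UNIV. P $ l $ \<beta> *
     ((\<Sum>\<alpha>\<in>UNIV. X y $ j $ \<alpha> * pd X \<alpha> y $ k $ \<beta>) + (\<Sum>\<alpha>\<in>UNIV. X y $ j $ \<alpha> * (X y ** chrm g \<phi> \<alpha> y) $ k $ \<beta>)))" for j k
    unfolding G sum_distrib_left sum.distrib[symmetric]
    by (subst sum.swap) (simp add: algebra_simps)
  note e = this
  show ?thesis unfolding e brk_def P_def[symmetric] s[of _]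
    by (simp add: sum_subtractf sum.distrib algebra_simps)
qed

text \<open>The term of order zero of the Dirac operator, written in the structure functions
  \<open>c l j k\<close> of an orthonormal frame. The traces of \<open>c\<close> give a vector part,
  its totally antisymmetric part gives a scalar.\<close>

definition Qc :: "(3 \<Rightarrow> 3 \<Rightarrow> 3 \<Rightarrow> real) \<Rightarrow> complex^2^2"
  where "Qc c = (\<Sum>k\<in>UNIV. (\<Sum>j\<in>UNIV. c j j k) *\<^sub>R cmul (- \<i> / 2) (pauli k))
    + (1/8) *\<^sub>R (\<Sum>j\<in>UNIV. \<Sum>l\<in>UNIV. \<Sum>k\<in>UNIV. eps3 j l k * c l j k) *\<^sub>R mat 1"

text \<open>By Koszul's formula an antisymmetric connection is determined by its torsion-free
  relation to the brackets. The Pauli algebra then retains only the trace and the totally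
  antisymmetric part. This removes the Christoffel symbols from the operator: only brackets of frame
  vectors are left to expand.\<close>

lemma spin_Koszul:
  fixes L :: "3 \<Rightarrow> real^3^3"
  assumes anti: "\<And>j. transpose (L j) = - L j"
    and c: "\<And>l j k. L j $ l $ k - L k $ l $ j = c l j k"
  shows "cmul (- \<i>) (\<Sum>j\<in>UNIV. pauli j ** spin (L j)) = Qc c"
proof -
  have a: "L j $ l $ k = - (L j $ k $ l)" for j l k
    using arg_cong[OF anti[of j], of "\<lambda>A. A $ k $ l"] by (simp add: transpose_def)
  have d: "L j $ 1 $ 1 = 0" "L j $ 2 $ 2 = 0" "L j $ 3 $ 3 = 0" "L j $ 2 $ 1 = - (L j $ 1 $ 2)"
    "L j $ 3 $ 1 = - (L j $ 1 $ 3)" "L j $ 3 $ 2 = - (L j $ 2 $ 3)" for j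
    using a[of j 1 1] a[of j 2 2] a[of j 3 3] a[of j 2 1] a[of j 3 1] a[of j 3 2] by simp_all
  have s: "spin (L j) = (1/2) *\<^sub>R (L j $ 1 $ 2 *\<^sub>R (pauli 1 ** pauli 2) + L j $ 1 $ 3 *\<^sub>R (pauli 1 ** pauli 3) + L j $ 2 $ 3 *\<^sub>R (pauli 2 ** pauli 3))" for j
    unfolding spin_def
    by (intro mat2_eqI; simp add: sum_3 d mm2_nth pauli_nth complex_eq_iff)
  show ?thesis
    unfolding Qc_def c[symmetric] s
    by (intro mat2_eqI; simp add: sum_3 eps3_def d mm2_nth pauli_nth cmul_def mat_def complex_eq_iff; simp add: field_simps)
qed

definition Qmat :: "metric \<Rightarrow> (real^3 \<Rightarrow> real^4) \<Rightarrow> (real^3 \<Rightarrow> real^3^3) \<Rightarrow> real^3 \<Rightarrow> complex^2^2"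
  where "Qmat g \<phi> X y = cmul (- \<i>) (\<Sum>\<alpha>\<in>UNIV. sig X \<alpha> y ** spin (Gam g \<phi> X \<alpha> y))"

lemma spin_linear: "linear spin"
  by (rule linearI) (rule spin_add, simp add: spin_def scaleR_sum_right mult.commute)

lemma Qmat_eq_Qc:
  assumes inv: "invertible (metric_comp g \<phi> y)"
    and sym: "\<And>z. transpose (metric_comp g \<phi> z) = metric_comp g \<phi> z"
    and diff: "metric_comp g \<phi> differentiable at y" "X differentiable at y"
    and orth: "\<And>z. X z ** metric_comp g \<phi> z ** transpose (X z) = mat 1"
  shows "Qmat g \<phi> X y = Qc (brk g \<phi> X y)"
proof -
  \<comment> \<open>Contracting the coordinate index with the frame makes both the direction and the
    matrix indices refer to the frame, as Koszul's formula requires.\<close>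
  define L where "L j = (\<Sum>\<alpha>\<in>UNIV. X y $ j $ \<alpha> *\<^sub>R Gam g \<phi> X \<alpha> y)" for j
  have "transpose (L j) = - L j" for j
    unfolding L_def linear_sum[OF bounded_linear.linear[OF bounded_linear_transpose]]
      linear_scale[OF bounded_linear.linear[OF bounded_linear_transpose]] Gam_antisym[OF inv sym diff orth]
    by (simp add: sum_negf)
  moreover have "L j $ l $ k - L k $ l $ j = brk g \<phi> X y l j k" for l j k
    unfolding L_def Gam_torsion[OF sym, symmetric] by simp
  ultimately have "cmul (- \<i>) (\<Sum>j\<in>UNIV. pauli j ** spin (L j)) = Qc (brk g \<phi> X y)"
    by (rule spin_Koszul)
  moreover have "(\<Sum>j\<in>UNIV. pauli j ** spin (L j)) = (\<Sum>\<alpha>\<in>UNIV. sig X \<alpha> y ** spin (Gam g \<phi> X \<alpha> y))"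
    unfolding L_def linear_sum[OF spin_linear] linear_scale[OF spin_linear]
    unfolding sig_def sum_3
    by (intro mat2_eqI; simp add: mm2_nth algebra_simps)
  ultimately show ?thesis unfolding Qmat_def by simp
qed

lemma Rot_orth:
  assumes "norm q = 1" shows "Rot q ** transpose (Rot q) = mat 1" "transpose (Rot q) ** Rot q = mat 1"
proof -
  have q: "q$1*q$1 + q$2*q$2 + q$3*q$3 + q$4*q$4 = 1" using assms(1) by (simp add: norm_eq_1 inner_4)
  have "(Rot q ** transpose (Rot q)) $ i $ j = (if i = j then (q$1*q$1 + q$2*q$2 + q$3*q$3 + q$4*q$4)\<^sup>2 else 0)" for i j
    using exhaust_3[of i] exhaust_3[of j]
    by (elim disjE; simp add: mm3_nth transpose_def Rot_nth; simp add: algebra_simps power2_eq_square)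
  then show 1: "Rot q ** transpose (Rot q) = mat 1"
    unfolding q by (simp add: vec_eq_iff mat_def)
  then show "transpose (Rot q) ** Rot q = mat 1" by (simp add: matrix_left_right_inverse)
qed

lemma bounded_bilinear_dRot: "bounded_bilinear dRot"
proof -
  have 1: "linear (dRot q)" for q
  proof (rule linearI; rule mat3_eqI)
    show "dRot q (r + s) $ i $ j = (dRot q r + dRot q s) $ i $ j" "dRot q (c *\<^sub>R r) $ i $ j = (c *\<^sub>R dRot q r) $ i $ j" for r s i j c
      using exhaust_3[of i] exhaust_3[of j] by (elim disjE; simp add: dRot_def Rot_nth algebra_simps)+
  qed
  moreover have "(\<lambda>q. dRot q r) = dRot r" for r by (rule ext) (simp add: dRot_def add.commute)
  ultimately have "bilinear dRot" unfolding bilinear_def by simp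
  then show ?thesis by (simp add: bilinear_conv_bounded_bilinear)
qed

lemma Rot_has_derivative: "(Rot has_derivative dRot q) (at q)"
proof -
  have sym: "dRot q r = dRot r q" for q r by (simp add: dRot_def add.commute)
  have "Rot q = (1/2) *\<^sub>R dRot q q" for q
  proof (rule mat3_eqI)
    show "Rot q $ i $ j = ((1/2) *\<^sub>R dRot q q) $ i $ j" for i j
      using exhaust_3[of i] exhaust_3[of j] by (elim disjE; simp add: dRot_def Rot_nth algebra_simps)
  qed
  then have "Rot = (\<lambda>q. (1/2) *\<^sub>R dRot q q)" by (rule ext)
  moreover have "((\<lambda>q. (1/2) *\<^sub>R dRot q q) has_derivative (\<lambda>h. (1/2) *\<^sub>R (dRot q h + dRot h q))) (at q)"
    by (intro has_derivative_scaleR_right bounded_bilinear.FDERIV[OF bounded_bilinear_dRot] has_derivative_ident)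
  moreover have "(\<lambda>h. (1/2) *\<^sub>R (dRot q h + dRot h q)) = dRot q"
  proof
    show "(1/2) *\<^sub>R (dRot q h + dRot h q) = dRot q h" for h
      unfolding sym[of h q] by (simp flip: scaleR_2)
  qed
  ultimately show ?thesis by simp
qed

text \<open>Change of spin frame. The covariant derivatives in the frames \<open>X\<close> and
  \<open>X'\<close> are conjugate by \<open>Rm (q y)\<close>: differentiating the rotation adds an
  inhomogeneous term to the connection matrix, and by \<open>spin_dRot\<close> it is exactly
  cancelled by the derivative of \<open>Rm\<close>. The second claim is the conjugation of the
  symbols.\<close>

lemma
  assumes q: "\<And>z. norm (q z) = 1" and dq: "q differentiable at y" and X: "X differentiable at y"
    and orth: "\<And>z. X z ** metric_comp g \<phi> z ** transpose (X z) = mat 1"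
    and X': "\<And>z. X' z = Rot (q z) ** X z"
  shows gauge_spin: "spin (Gam g \<phi> X' \<alpha> y) ** Rm (q y) + pd (\<lambda>z. Rm (q z)) \<alpha> y = Rm (q y) ** spin (Gam g \<phi> X \<alpha> y)"
    and gauge_sig: "Rm (q y) ** sig X \<alpha> y = sig X' \<alpha> y ** Rm (q y)"
proof -
  define r where "r = pd q \<alpha> y"
  define A where "A = Rot (q y)"
  have hq: "(q has_derivative frechet_derivative q (at y)) (at y)"
    by (rule differentiable_has_derivative[OF dq])
  have qr: "q y \<bullet> r = 0"
  proof -
    have "((\<lambda>z. q z \<bullet> q z) has_derivative (\<lambda>h. q y \<bullet> frechet_derivative q (at y) h + frechet_derivative q (at y) h \<bullet> q y)) (at y)"
      by (rule has_derivative_inner[OF hq hq])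
    from pd_eq[OF this, of \<alpha>] have "pd (\<lambda>z. 1::real) \<alpha> y = 2 * (q y \<bullet> r)"
      using q by (simp add: r_def pd_def inner_commute norm_eq_1)
    then show ?thesis by simp
  qed
  have dA: "((\<lambda>z. Rot (q z)) has_derivative (\<lambda>h. dRot (q y) (frechet_derivative q (at y) h))) (at y)"
    using diff_chain_at[OF hq Rot_has_derivative] by (simp add: o_def)
  have pdA: "pd (\<lambda>z. Rot (q z)) \<alpha> y = dRot (q y) r"
    using pd_eq[OF dA, of \<alpha>] unfolding r_def pd_def[of q] .
  have pdX': "pd X' \<alpha> y = A ** pd X \<alpha> y + dRot (q y) r ** X y"
    unfolding X'[abs_def] pdA[symmetric] A_def
    by (rule pd_bilinear[OF bounded_bilinear_matrix_mult _ X]) (use dA in \<open>auto simp: differentiable_def\<close>)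
  define G where "G = metric_comp g \<phi> y"
  have o: "M ** (X y ** (G ** (transpose (X y) ** N))) = M ** N" for M N :: "real^3^3"
    using orth[of y] unfolding G_def by (simp add: matrix_mul_assoc)
  have "Gam g \<phi> X' \<alpha> y = A ** transpose (dRot (q y) r) + A ** Gam g \<phi> X \<alpha> y ** transpose A"
    unfolding Gam_def pdX' X' A_def[symmetric] G_def[symmetric]
    by (simp add: matrix_ring transpose_add matrix_transpose_mul matrix_mul_assoc[symmetric] o)
  then have "transpose A ** Gam g \<phi> X' \<alpha> y ** A = transpose (dRot (q y) r) ** A + Gam g \<phi> X \<alpha> y"
    using Rot_orth[OF q, of y, folded A_def]
    by (simp add: matrix_ring matrix_mul_assoc) (simp add: matrix_mul_assoc[symmetric])
  then have s: "Rm (qconj (q y)) ** spin (Gam g \<phi> X' \<alpha> y) ** Rm (q y) = - (Rm (qconj (q y)) ** Rm r) + spin (Gam g \<phi> X \<alpha> y)"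
    unfolding spin_conj[OF q, symmetric] A_def by (simp add: spin_add spin_dRot[OF q qr])
  have "Rm (q y) ** (Rm (qconj (q y)) ** M) = M" for M
    by (simp add: matrix_mul_assoc Rm_qconj[OF q])
  note c = this
  have "Rm (q y) ** (Rm (qconj (q y)) ** spin (Gam g \<phi> X' \<alpha> y) ** Rm (q y)) =
     Rm (q y) ** (spin (Gam g \<phi> X \<alpha> y) - (Rm (qconj (q y)) ** Rm r))"
    unfolding s by simp
  then have f: "spin (Gam g \<phi> X' \<alpha> y) ** Rm (q y) = Rm (q y) ** spin (Gam g \<phi> X \<alpha> y) - Rm r"
    by (simp add: matrix_mul_assoc[symmetric] c bounded_bilinear.diff_right[OF bounded_bilinear_matrix_mult])
  have "pd (\<lambda>z. Rm (q z)) \<alpha> y = Rm r"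
    unfolding r_def by (rule pd_linear[OF linear_conv_bounded_linear[THEN iffD1, OF Rm_linear] dq])
  then show "spin (Gam g \<phi> X' \<alpha> y) ** Rm (q y) + pd (\<lambda>z. Rm (q z)) \<alpha> y = Rm (q y) ** spin (Gam g \<phi> X \<alpha> y)"
    using f by simp
  have pR: "pauli j ** Rm (q y) = Rm (q y) ** (\<Sum>k\<in>UNIV. A $ j $ k *\<^sub>R pauli k)" for j
    unfolding A_def Rm_pauli[symmetric] by (simp add: matrix_mul_assoc[symmetric] c)
  have "sig X' \<alpha> y ** Rm (q y) = (\<Sum>j\<in>UNIV. X' y $ j $ \<alpha> *\<^sub>R (pauli j ** Rm (q y)))"
    unfolding sig_def sum_3 by (intro mat2_eqI; simp add: mm2_nth algebra_simps)
  also have "\<dots> = Rm (q y) ** (\<Sum>k\<in>UNIV. (transpose A ** X' y) $ k $ \<alpha> *\<^sub>R pauli k)"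
    unfolding pR sum_3 mm3_nth transpose_def vec_lambda_beta
    by (intro mat2_eqI; simp add: mm2_nth algebra_simps)
  also have "transpose A ** X' y = X y"
    unfolding X' A_def by (simp add: matrix_mul_assoc Rot_orth[OF q])
  finally show "Rm (q y) ** sig X \<alpha> y = sig X' \<alpha> y ** Rm (q y)" unfolding sig_def ..
qed

subsection \<open>Lifting rotations to unit quaternions\<close>

text \<open>It identifies exactly \<open>q\<close> and \<open>- q\<close>, so the image of the unit
  sphere is a copy of SO(3) on which the double cover and its local inverses are explicit.\<close>

definition outer :: "real^4 \<Rightarrow> real^4^4"
  where "outer q = (\<chi> i j. q$i * q$j)"

text \<open>On \<open>Rot q\<close> with \<open>q\<close> a unit quaternion this returns \<open>outer q\<close>.\<close>

definition outer_of_rot :: "real^3^3 \<Rightarrow> real^4^4"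
  where "outer_of_rot A = (1/4) *\<^sub>R vector [
    vector [1 + A$1$1 + A$2$2 + A$3$3, A$3$2 - A$2$3, A$1$3 - A$3$1, A$2$1 - A$1$2],
    vector [A$3$2 - A$2$3, 1 + A$1$1 - A$2$2 - A$3$3, A$1$2 + A$2$1, A$1$3 + A$3$1],
    vector [A$1$3 - A$3$1, A$1$2 + A$2$1, 1 - A$1$1 + A$2$2 - A$3$3, A$2$3 + A$3$2],
    vector [A$2$1 - A$1$2, A$1$3 + A$3$1, A$2$3 + A$3$2, 1 - A$1$1 - A$2$2 + A$3$3]]"

text \<open>The squared distance from c to the cross product of a and b is |c|^2 + |a x b|^2 - 2 det
  = 1 + 1 - 2, where Lagrange's identity gives |a x b| = 1.\<close>

lemma orthonormal_rows_cross:
  fixes a1 a2 a3 b1 b2 b3 c1 c2 c3 :: real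
  assumes "a1*a1 + a2*a2 + a3*a3 = 1" "b1*b1 + b2*b2 + b3*b3 = 1" "c1*c1 + c2*c2 + c3*c3 = 1"
    "a1*b1 + a2*b2 + a3*b3 = 0"
    "c1 * (a2*b3 - a3*b2) + c2 * (a3*b1 - a1*b3) + c3 * (a1*b2 - a2*b1) = 1"
  shows "c1 = a2*b3 - a3*b2" "c2 = a3*b1 - a1*b3" "c3 = a1*b2 - a2*b1"
proof -
  define u2 v2 w2 where uvw: "u2 = a2*b3 - a3*b2" "v2 = a3*b1 - a1*b3" "w2 = a1*b2 - a2*b1"
  have 1: "u2 * u2 + v2 * v2 + w2 * w2 = (a1*a1 + a2*a2 + a3*a3) * (b1*b1 + b2*b2 + b3*b3) - (a1*b1 + a2*b2 + a3*b3) * (a1*b1 + a2*b2 + a3*b3)"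
    unfolding uvw by (simp add: algebra_simps)
  have 2: "c1 * u2 + c2 * v2 + c3 * w2 = 1" using assms(5) unfolding uvw .
  have "(c1 - u2) * (c1 - u2) + (c2 - v2) * (c2 - v2) + (c3 - w2) * (c3 - w2) =
     (c1*c1 + c2*c2 + c3*c3) + (u2 * u2 + v2 * v2 + w2 * w2) - 2 * (c1 * u2 + c2 * v2 + c3 * w2)"
    by (simp add: algebra_simps)
  also have "\<dots> = 0" unfolding 1 2 assms(1-4) by simp
  finally have "(c1 - u2) * (c1 - u2) = 0" "(c2 - v2) * (c2 - v2) = 0" "(c3 - w2) * (c3 - w2) = 0"
    using zero_le_square[of "c1 - u2"] zero_le_square[of "c2 - v2"] zero_le_square[of "c3 - w2"] by linarith+
  then show "c1 = a2*b3 - a3*b2" "c2 = a3*b1 - a1*b3" "c3 = a1*b2 - a2*b1" unfolding uvw by simp_all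
qed

text \<open>These relations say that the matrix has rank one, so that it can be of the form
  \<open>outer q\<close>. They follow from orthonormality of rows and columns together with the fact
  that a rotation equals its cofactor matrix.\<close>

lemma outer_of_rot_rank_one:
  assumes o: "A ** transpose A = mat 1" and d: "det A = 1"
  shows "outer_of_rot A $ i $ j * outer_of_rot A $ i $ k = outer_of_rot A $ i $ i * outer_of_rot A $ j $ k"
proof -
  define a1 a2 a3 b1 b2 b3 c1 c2 c3 where e: "a1 = A$1$1" "a2 = A$1$2" "a3 = A$1$3" "b1 = A$2$1" "b2 = A$2$2" "b3 = A$2$3"
    "c1 = A$3$1" "c2 = A$3$2" "c3 = A$3$3"
  have o': "transpose A ** A = mat 1" using o by (simp add: matrix_left_right_inverse)
  have r: "a1*a1 + a2*a2 + a3*a3 = 1" "b1*b1 + b2*b2 + b3*b3 = 1" "c1*c1 + c2*c2 + c3*c3 = 1"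
    "a1*b1 + a2*b2 + a3*b3 = 0" "a1*c1 + a2*c2 + a3*c3 = 0" "b1*c1 + b2*c2 + b3*c3 = 0"
    using arg_cong[OF o, of "\<lambda>M. M$1$1"] arg_cong[OF o, of "\<lambda>M. M$2$2"] arg_cong[OF o, of "\<lambda>M. M$3$3"]
      arg_cong[OF o, of "\<lambda>M. M$1$2"] arg_cong[OF o, of "\<lambda>M. M$1$3"] arg_cong[OF o, of "\<lambda>M. M$2$3"]
    by (simp_all add: mm3_nth transpose_def mat_def e)
  have c: "a1*a1 + b1*b1 + c1*c1 = 1" "a2*a2 + b2*b2 + c2*c2 = 1" "a3*a3 + b3*b3 + c3*c3 = 1"
    "a1*a2 + b1*b2 + c1*c2 = 0" "a1*a3 + b1*b3 + c1*c3 = 0" "a2*a3 + b2*b3 + c2*c3 = 0"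
    using arg_cong[OF o', of "\<lambda>M. M$1$1"] arg_cong[OF o', of "\<lambda>M. M$2$2"] arg_cong[OF o', of "\<lambda>M. M$3$3"]
      arg_cong[OF o', of "\<lambda>M. M$1$2"] arg_cong[OF o', of "\<lambda>M. M$1$3"] arg_cong[OF o', of "\<lambda>M. M$2$3"]
    by (simp_all add: mm3_nth transpose_def mat_def e)
  have D: "a1 * b2 * c3 + a2 * b3 * c1 + a3 * b1 * c2 - a1 * b3 * c2 - a2 * b1 * c3 - a3 * b2 * c1 = 1"
    using d unfolding det_3 e .
  have x: "c1 = a2*b3 - a3*b2" "c2 = a3*b1 - a1*b3" "c3 = a1*b2 - a2*b1"
    using r D by (intro orthonormal_rows_cross[of a1 a2 a3 b1 b2 b3 c1 c2 c3]; simp add: algebra_simps)+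
  have y: "a1 = b2*c3 - b3*c2" "a2 = b3*c1 - b1*c3" "a3 = b1*c2 - b2*c1"
    using r D by (intro orthonormal_rows_cross[of b1 b2 b3 c1 c2 c3 a1 a2 a3]; simp add: algebra_simps)+
  have z: "b1 = c2*a3 - c3*a2" "b2 = c3*a1 - c1*a3" "b3 = c1*a2 - c2*a1"
    using r D by (intro orthonormal_rows_cross[of c1 c2 c3 a1 a2 a3 b1 b2 b3]; simp add: algebra_simps)+
  define N where "N i j = 4 * outer_of_rot A $ i $ j" for i j
  have N: "N 1 1 = 1 + a1 + b2 + c3" "N 2 2 = 1 + a1 - b2 - c3" "N 3 3 = 1 - a1 + b2 - c3" "N 4 4 = 1 - a1 - b2 + c3"
    "N 1 2 = c2 - b3" "N 1 3 = a3 - c1" "N 1 4 = b1 - a2" "N 2 1 = c2 - b3" "N 3 1 = a3 - c1" "N 4 1 = b1 - a2"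
    "N 2 3 = a2 + b1" "N 2 4 = a3 + c1" "N 3 4 = b3 + c2" "N 3 2 = a2 + b1" "N 4 2 = a3 + c1" "N 4 3 = b3 + c2"
    unfolding N_def by (simp_all add: outer_of_rot_def vector_4 e)
  have z': "b1 = a3*c2 - a2*c3" "b2 = a1*c3 - a3*c1" "b3 = a2*c1 - a1*c2"
    unfolding z by (simp_all add: algebra_simps)
  have "N i j * N i k = N i i * N j k"
  proof (cases "j = i \<or> k = i")
    case True
    have "N i j = N j i" using exhaust_4[of i] exhaust_4[of j] by (elim disjE; simp add: N)
    then show ?thesis using True by auto
  next
    case False
    \<comment> \<open>After expansion each case is linear in the products of two entries of
      \<open>A\<close>, so linear arithmetic over the listed quadratic relations decides it.\<close>
    show ?thesis
      using False exhaust_4[of i] exhaust_4[of j] exhaust_4[of k]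
      by (elim disjE; simp only: N simp_thms; (simp; fail)?; simp only: algebra_simps mult_1 mult_1_right; (insert r c x y z')[1]; linarith)
  qed
  then show ?thesis unfolding N_def by simp
qed

lemma outer_of_rot_trace: "(\<Sum>i\<in>UNIV. outer_of_rot A $ i $ i) = 1"
  by (simp add: outer_of_rot_def vector_4 sum_4 field_simps)

lemma Rot_eqI:
  assumes "outer q = outer_of_rot A" shows "Rot q = A"
proof -
  have m: "q$i * q$j = outer_of_rot A $ i $ j" for i j
    using arg_cong[OF assms, of "\<lambda>M. M $ i $ j"] by (simp add: outer_def)
  show ?thesis
  proof (rule mat3_eqI)
    show "Rot q $ i $ j = A $ i $ j" for i j
      using exhaust_3[of i] exhaust_3[of j]
      by (elim disjE; simp add: Rot_nth m outer_of_rot_def vector_4; simp add: field_simps)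
  qed
qed

text \<open>The trace is 1, so some diagonal entry is positive; by the rank-one relations the
  corresponding row, divided by the square root of that entry, is the required quaternion.\<close>

lemma outer_of_rot_image:
  assumes o: "A ** transpose A = mat 1" and d: "det A = 1"
  shows "outer_of_rot A \<in> outer ` sphere 0 1"
proof -
  define M where "M = outer_of_rot A"
  have tr: "M$1$1 + M$2$2 + M$3$3 + M$4$4 = 1"
    using outer_of_rot_trace[of A] by (simp add: M_def sum_4)
  then obtain i where i: "M$i$i > 0" by (metis add_nonpos_nonpos not_less zero_less_one)
  define q where "q = (\<chi> j. M$i$j / sqrt (M$i$i))"
  have q: "q$j * q$k = M$j$k" for j k
    using outer_of_rot_rank_one[OF o d, of i j k] i by (simp add: q_def M_def)
  then have "outer q = M" by (simp add: outer_def vec_eq_iff)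
  moreover have "q \<bullet> q = 1" unfolding inner_4 q by (rule tr)
  ultimately show ?thesis unfolding M_def[symmetric] by (auto simp: norm_eq_1 image_iff intro!: bexI[of _ q])
qed

lemma outer_mult: "outer q *v v = (q \<bullet> v) *\<^sub>R q"
  by (simp add: outer_def matrix_vector_mult_def vec_eq_iff inner_vec_def sum_distrib_left mult_ac)

lemma continuous_outer: "continuous_on S outer"
  unfolding outer_def[abs_def] by (intro continuous_intros)

lemma covering_outer: "covering_space (sphere 0 1) outer (outer ` sphere 0 1)"
  unfolding covering_space_def
proof (intro conjI ballI refl)
  let ?c = "sphere 0 1 :: (real^4) set"
  show "continuous_on ?c outer" by (rule continuous_outer)
  fix x assume "x \<in> outer ` ?c"
  then obtain p where p: "norm p = 1" "x = outer p" by auto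
  define h where "h N = p \<bullet> (N *v p)" for N :: "real^4^4"
  have hq: "h (outer q) = (q \<bullet> p)\<^sup>2" for q
    by (simp add: h_def outer_mult power2_eq_square inner_commute)
  have ch: "continuous_on S h" for S
    unfolding h_def[abs_def] matrix_vector_mult_def by (intro continuous_intros)
  \<comment> \<open>The evenly covered neighbourhood consists of the classes of unit quaternions not
    orthogonal to \<open>p\<close>. Its two sheets are the open half spheres given by the sign of q
    . p, and N p = (q . p) q recovers \<open>q\<close> from N = outer q.\<close>
  define T where "T = {N \<in> outer ` ?c. h N > 0}"
  define u where "u s = {q \<in> ?c. s * (q \<bullet> p) > 0}" for s :: real
  have hom: "\<exists>q. homeomorphism (u s) T outer q" if s: "s = 1 \<or> s = -1" for s
  proof (intro exI)
    define k where "k N = (s / sqrt (h N)) *\<^sub>R (N *v p)" for N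
    have kq: "k (outer q) = q" if "q \<in> u s" for q
    proof -
      have "s * (q \<bullet> p) = \<bar>q \<bullet> p\<bar>" "s * s = 1" "q \<bullet> p \<noteq> 0" using that s by (auto simp: u_def)
      then have "s * (q \<bullet> p) / \<bar>q \<bullet> p\<bar> = 1" by simp
      moreover have "k (outer q) = (s * (q \<bullet> p) / \<bar>q \<bullet> p\<bar>) *\<^sub>R q" by (simp add: k_def hq outer_mult)
      ultimately show ?thesis by (metis scaleR_one)
    qed
    have Tk: "k N \<in> u s \<and> outer (k N) = N" if "N \<in> T" for N
    proof -
      have "N \<in> outer ` ?c" using that by (simp add: T_def)
      then obtain q where "q \<in> ?c" and q2: "N = outer q" by (rule imageE)
      then have q: "norm q = 1" "N = outer q" by simp_all
      have qp: "q \<bullet> p \<noteq> 0" using that unfolding q(2) T_def by (auto simp: hq)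
      define t where "t = s * sgn (q \<bullet> p)"
      have t: "t = 1 \<or> t = -1" using qp s by (auto simp: t_def sgn_if)
      have tq: "t *\<^sub>R q \<in> u s" using q qp s by (auto simp: u_def t_def sgn_if)
      have "outer (t *\<^sub>R q) = N" using t q(2) by (auto simp: outer_def)
      then show ?thesis using kq[OF tq] tq by simp
    qed
    show "homeomorphism (u s) T outer k"
    proof (rule homeomorphismI)
      show "continuous_on T k" unfolding k_def matrix_vector_mult_def
        by (intro continuous_intros ch) (auto simp: T_def)
      show "outer ` u s \<subseteq> T" by (auto simp: T_def u_def hq zero_less_mult_iff)
      show "k ` T \<subseteq> u s" using Tk by auto
    qed (use kq Tk continuous_outer in auto)
  qed
  show "\<exists>T. x \<in> T \<and> openin (top_of_set (outer ` ?c)) T \<and>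
     (\<exists>v. \<Union> v = ?c \<inter> outer -` T \<and> (\<forall>u\<in>v. openin (top_of_set ?c) u) \<and> pairwise disjnt v \<and>
       (\<forall>u\<in>v. \<exists>q. homeomorphism u T outer q))"
  proof (intro exI conjI)
    show "x \<in> T" using p by (auto simp: T_def hq norm_eq_1)
    have "T = outer ` ?c \<inter> h -` {0<..}" by (auto simp: T_def)
    then show "openin (top_of_set (outer ` ?c)) T"
      using continuous_openin_preimage_gen[OF ch open_greaterThan, of "outer ` ?c" 0] by simp
    show "\<Union> {u 1, u (-1)} = ?c \<inter> outer -` T" by (auto simp: u_def T_def hq)
    have "u s = ?c \<inter> (\<lambda>q. s * (q \<bullet> p)) -` {0<..}" for s by (auto simp: u_def)
    moreover have "continuous_on ?c (\<lambda>q. s * (q \<bullet> p))" for s by (intro continuous_intros)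
    ultimately have "openin (top_of_set ?c) (u s)" for s
      using continuous_openin_preimage_gen[OF _ open_greaterThan, of ?c "\<lambda>q. s * (q \<bullet> p)" 0] by simp
    then show "\<forall>u\<in>{u 1, u (-1)}. openin (top_of_set ?c) u" by auto
    show "pairwise disjnt {u 1, u (-1)}" by (auto simp: pairwise_def disjnt_def u_def)
    show "\<forall>u\<in>{u 1, u (-1)}. \<exists>q. homeomorphism u T outer q" using hom by auto
  qed
qed

text \<open>All of real^3 is simply connected, so the map to SO(3) lifts continuously through the
  double cover. Smoothness is recovered afterwards, because near each point the lift is an algebraic
  expression in the entries of \<open>M\<close>.\<close>

lemma rotation_lift:
  fixes A :: "real^3 \<Rightarrow> real^3^3"
  assumes smooth: "\<And>i j. Cinf_on (\<lambda>y. A y $ i $ j) UNIV"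
    and o: "\<And>y. A y ** transpose (A y) = mat 1" and d: "\<And>y. det (A y) = 1"
  obtains q where "Cinf_on q UNIV" "\<And>y. norm (q y) = 1" "\<And>y. Rot (q y) = A y"
proof -
  define M where "M y = outer_of_rot (A y)" for y
  have sM: "Cinf_on (\<lambda>y. M y $ i $ j) UNIV" for i j
  proof -
    have "\<exists>a c. \<forall>A. outer_of_rot A $ i $ j = c + (\<Sum>k\<in>UNIV. \<Sum>l\<in>UNIV. a k l * A $ k $ l)"
    proof -
      \<comment> \<open>The entries are affine in those of \<open>A\<close>; the coefficients are
        read off at 0 and at the elementary matrices.\<close>
      define c where "c = outer_of_rot 0 $ i $ j"
      define a where "a k l = outer_of_rot (\<chi> m n. if m = k \<and> n = l then 1 else 0) $ i $ j - c" for k l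
      have "\<forall>A. outer_of_rot A $ i $ j = c + (\<Sum>k\<in>UNIV. \<Sum>l\<in>UNIV. a k l * A $ k $ l)"
        unfolding a_def c_def
        using exhaust_4[of i] exhaust_4[of j] by (elim disjE; simp add: outer_of_rot_def vector_4 sum_3)
      then show ?thesis by blast
    qed
    then obtain a c where "\<And>A. outer_of_rot A $ i $ j = c + (\<Sum>k\<in>UNIV. \<Sum>l\<in>UNIV. a k l * A $ k $ l)" by blast
    then show ?thesis unfolding M_def
      by simp (intro Cinf_on_add Cinf_on_sum Cinf_on_mult smooth Cinf_on_const open_UNIV)
  qed
  have cM: "continuous_on UNIV M"
    by (intro Cinf_on_continuous Cinf_on_vec sM open_UNIV)
  have MS: "M \<in> UNIV \<rightarrow> outer ` sphere 0 1"
    using outer_of_rot_image[OF o d] by (auto simp: M_def)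
  obtain q where cq: "continuous_on UNIV q" and q1: "q \<in> UNIV \<rightarrow> sphere 0 1" and qM: "\<And>y. outer (q y) = M y"
    by (rule covering_space_lift[OF covering_outer _ _ cM MS])
      (auto simp: convex_imp_simply_connected convex_imp_locally_path_connected)
  have qq: "q y $ i * q y $ j = M y $ i $ j" for y i j
    using arg_cong[OF qM[of y], of "\<lambda>N. N $ i $ j"] by (simp add: outer_def)
  have "Cinf_on q UNIV"
  proof (rule Cinf_on_local)
    fix y0
    have "norm (q y0) = 1" using q1 by (auto simp: Pi_iff)
    then have "q y0 \<noteq> 0" by auto
    then obtain i where i: "q y0 $ i \<noteq> 0" by (auto simp: vec_eq_iff)
    \<comment> \<open>Near \<open>y0\<close> the component \<open>i\<close> of the lift keeps its
      sign \<open>s\<close>, and there q_j = s M_ij / sqrt M_ii.\<close>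
    define s where "s = sgn (q y0 $ i)"
    define T where "T = {y. s * q y $ i > 0}"
    have oT: "open T" unfolding T_def
      by (intro open_Collect_less continuous_intros cq)
    have y0: "y0 \<in> T" using i by (auto simp: T_def s_def sgn_if)
    have s: "s = 1 \<or> s = -1" using i by (auto simp: s_def sgn_if)
    have eq: "q y $ j = s * M y $ i $ j / sqrt (M y $ i $ i)" and pos: "M y $ i $ i > 0" if "y \<in> T" for y j
    proof -
      have "q y $ i \<noteq> 0" using that by (auto simp: T_def)
      then show "M y $ i $ i > 0" unfolding qq[symmetric] by (simp add: zero_less_mult_iff) linarith
      have "sqrt (q y $ i * q y $ i) = s * q y $ i"
        using that s by (auto simp: T_def)
      then show "q y $ j = s * M y $ i $ j / sqrt (M y $ i $ i)"
        unfolding qq[symmetric] using that s by (auto simp: T_def)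
    qed
    have "Cinf_on q T"
    proof (rule Cinf_on_vec[OF oT], rule Cinf_on_cong[OF oT])
      show "s * M y $ i $ j / sqrt (M y $ i $ i) = q y $ j" if "y \<in> T" for y j using eq[OF that] by simp
      show "Cinf_on (\<lambda>y. s * M y $ i $ j / sqrt (M y $ i $ i)) T" for j
        by (intro Cinf_on_divide Cinf_on_mult Cinf_on_sqrt oT Cinf_on_subset[OF sM] Cinf_on_const) (use pos in force)+
    qed
    then show "\<exists>T. open T \<and> y0 \<in> T \<and> Cinf_on q T" using oT y0 by blast
  qed
  moreover have "norm (q y) = 1" for y using q1 by (auto simp: Pi_iff)
  moreover have "Rot (q y) = A y" for y using qM[of y] by (intro Rot_eqI) (simp add: M_def)
  ultimately show ?thesis using that by blast
qed

section \<open>Integration over the sphere\<close>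

text \<open>The first row of the orientation matrix is the point itself, which does not depend on
  the chart. A change of coordinates therefore acts by a block matrix with blocks 1 and the Jacobian
  matrix of \<open>T\<close>.\<close>

lemma det_orientation_compose:
  assumes "open S" "y \<in> S" "T differentiable at y" "\<psi> differentiable at (T y)" "\<And>z. z \<in> S \<Longrightarrow> \<phi> z = \<psi> (T z)"
  shows "det (orientation_matrix (\<phi> y) (\<lambda>\<alpha>. pd \<phi> \<alpha> y)) =
    det (matrix (frechet_derivative T (at y))) * det (orientation_matrix (\<psi> (T y)) (\<lambda>\<alpha>. pd \<psi> \<alpha> (T y)))"
proof -
  define t where "t \<alpha> \<beta> = pd T \<alpha> y $ \<beta>" for \<alpha> \<beta>
  have l: "linear (frechet_derivative \<psi> (at (T y)))"
    using differentiable_has_derivative[OF assms(4)] by (rule has_derivative_linear)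
  have "pd \<phi> \<alpha> y = pd (\<lambda>z. \<psi> (T z)) \<alpha> y" for \<alpha>
    by (rule pd_cong[OF assms(1,2,5)])
  then have p: "pd \<phi> \<alpha> y = (\<Sum>\<beta>\<in>UNIV. t \<alpha> \<beta> *\<^sub>R pd \<psi> \<beta> (T y))" for \<alpha>
    unfolding pd_chain[OF assms(3,4)] frechet_pd[OF assms(4)] t_def by simp
  define P :: "real^4^4" where "P = vector [vector [1, 0, 0, 0], vector [0, t 1 1, t 1 2, t 1 3], vector [0, t 2 1, t 2 2, t 2 3], vector [0, t 3 1, t 3 2, t 3 3]]"
  have "orientation_matrix (\<phi> y) (\<lambda>\<alpha>. pd \<phi> \<alpha> y) = P ** orientation_matrix (\<psi> (T y)) (\<lambda>\<alpha>. pd \<psi> \<alpha> (T y))"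
    unfolding orientation_matrix_def p assms(5)[OF assms(2)]
    by (intro vec4_eqI; simp add: vector_4 matrix_matrix_mult_def P_def sum_4 sum_3)
  moreover have "det P = det (matrix (frechet_derivative T (at y)))"
    unfolding det_3 sum_insert_UNIV_4 P_def
    by (simp add: vector_4 matrix_def t_def pd_def algebra_simps)
  ultimately show ?thesis by (simp add: det_mul)
qed

lemma change_of_variables_real:
  fixes f :: "real^3 \<Rightarrow> real" and g :: "real^3 \<Rightarrow> real^3"
  assumes S: "S \<in> sets lebesgue"
    and der_g: "\<And>x. x \<in> S \<Longrightarrow> (g has_derivative g' x) (at x within S)"
    and inj: "inj_on g S"
  shows "(\<lambda>x. \<bar>det (matrix (g' x))\<bar> * f (g x)) absolutely_integrable_on S \<and>
           integral S (\<lambda>x. \<bar>det (matrix (g' x))\<bar> * f (g x)) = b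
     \<longleftrightarrow> f absolutely_integrable_on (g ` S) \<and> integral (g ` S) f = b"
  using has_absolute_integral_change_of_variables[OF S der_g inj, of "\<lambda>x. vec (f x) :: real^1" "vec b"]
  unfolding absolutely_integrable_on_1_iff integral_on_1_eq by simp

text \<open>Both charts are positive, so the Jacobian determinant of \<open>T\<close> is positive
  and the absolute value in the transformation formula disappears. Stating it as an equivalence with
  a value \<open>b\<close> transports integrability and value together, in either direction.\<close>

lemma sphere_change_of_variables:
  fixes f :: "real^4 \<Rightarrow> real"
  assumes S: "open S" and T: "\<And>y. y \<in> S \<Longrightarrow> T differentiable at y" and inj: "inj_on T S"
    and \<psi>: "\<And>y. y \<in> S \<Longrightarrow> \<psi> differentiable at (T y)" and eq: "\<And>y. y \<in> S \<Longrightarrow> \<phi> y = \<psi> (T y)"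
    and J1: "\<And>y. y \<in> S \<Longrightarrow> det (orientation_matrix (\<phi> y) (\<lambda>\<alpha>. pd \<phi> \<alpha> y)) = J1 y" "\<And>y. y \<in> S \<Longrightarrow> J1 y > 0"
    and J2: "\<And>y. y \<in> S \<Longrightarrow> det (orientation_matrix (\<psi> (T y)) (\<lambda>\<alpha>. pd \<psi> \<alpha> (T y))) = J2 (T y)" "\<And>y. y \<in> S \<Longrightarrow> J2 (T y) > 0"
  shows "(\<lambda>y. J1 y * f (\<phi> y)) absolutely_integrable_on S \<and> integral S (\<lambda>y. J1 y * f (\<phi> y)) = b
     \<longleftrightarrow> (\<lambda>z. J2 z * f (\<psi> z)) absolutely_integrable_on (T ` S) \<and> integral (T ` S) (\<lambda>z. J2 z * f (\<psi> z)) = b"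
proof -
  have d: "J1 y = det (matrix (frechet_derivative T (at y))) * J2 (T y)" if "y \<in> S" for y
    using det_orientation_compose[OF S that T[OF that] \<psi>[OF that] eq] J1(1)[OF that] J2(1)[OF that] by simp
  have e: "\<bar>det (matrix (frechet_derivative T (at y)))\<bar> * (J2 (T y) * f (\<psi> (T y))) = J1 y * f (\<phi> y)" if "y \<in> S" for y
  proof -
    have "det (matrix (frechet_derivative T (at y))) > 0"
      using d[OF that] J1(2)[OF that] J2(2)[OF that] by (simp add: zero_less_mult_iff)
    then show ?thesis using d[OF that] eq[OF that] by simp
  qed
  have "(\<lambda>y. J1 y * f (\<phi> y)) absolutely_integrable_on S \<longleftrightarrow>
    (\<lambda>y. \<bar>det (matrix (frechet_derivative T (at y)))\<bar> * (J2 (T y) * f (\<psi> (T y)))) absolutely_integrable_on S"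
    by (intro set_integrable_cong) (use e in auto)
  moreover have "integral S (\<lambda>y. J1 y * f (\<phi> y)) = integral S (\<lambda>y. \<bar>det (matrix (frechet_derivative T (at y)))\<bar> * (J2 (T y) * f (\<psi> (T y))))"
    by (intro integral_cong) (use e in auto)
  moreover have "S \<in> sets lebesgue" using S by simp
  moreover have "(T has_derivative frechet_derivative T (at y)) (at y within S)" if "y \<in> S" for y
    using differentiable_has_derivative[OF T[OF that]] has_derivative_at_withinI by blast
  ultimately show ?thesis
    using change_of_variables_real[of S T "\<lambda>y. frechet_derivative T (at y)" "\<lambda>z. J2 z * f (\<psi> z)" b] inj by simp
qed

text \<open>\<open>spherical_domain\<close> without the face y_3 = 0: an open set, as the change of
  variables requires, that differs only by a null set.\<close>

definition spherical_box :: "(real^3) set"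
  where "spherical_box = {y. 0 < y$1 \<and> y$1 < pi \<and> 0 < y$2 \<and> y$2 < pi \<and> 0 < y$3 \<and> y$3 < 2 * pi}"

definition Jsph :: "real^3 \<Rightarrow> real" where "Jsph y = (sin (y$1))\<^sup>2 * sin (y$2)"

lemma open_spherical_box: "open spherical_box"
  unfolding spherical_box_def by (intro open_Collect_conj open_Collect_less continuous_intros)

lemma Jsph_pos: "y \<in> spherical_box \<Longrightarrow> Jsph y > 0"
  using sin_gt_zero[of "y$1"] sin_gt_zero[of "y$2"] by (simp add: spherical_box_def Jsph_def)

lemma norm_spherical: "norm (spherical y) = 1"
proof -
  have "spherical y \<bullet> spherical y = (cos (y$1))\<^sup>2 + (sin (y$1))\<^sup>2 * ((cos (y$2))\<^sup>2 + (sin (y$2))\<^sup>2 * ((cos (y$3))\<^sup>2 + (sin (y$3))\<^sup>2))"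
    by (simp only: inner_4 spherical_def vector_4) (simp only: power2_eq_square algebra_simps)
  then show ?thesis by (simp add: norm_eq_1)
qed

lemma spherical_ne_pole:
  assumes "y \<in> spherical_box" shows "1 + spherical y $ 1 > 0"
proof -
  have "cos pi < cos (y$1)" using assms by (intro cos_monotone_0_pi) (auto simp: spherical_box_def)
  then show ?thesis by (simp add: spherical_def vector_4)
qed

lemma inj_on_spherical: "inj_on spherical spherical_box"
proof (rule inj_onI)
  fix y z assume y: "y \<in> spherical_box" and z: "z \<in> spherical_box" and e: "spherical y = spherical z"
  have e': "cos (y$1) = cos (z$1)" "sin (y$1) * cos (y$2) = sin (z$1) * cos (z$2)"
    "sin (y$1) * sin (y$2) * cos (y$3) = sin (z$1) * sin (z$2) * cos (z$3)"
    "sin (y$1) * sin (y$2) * sin (y$3) = sin (z$1) * sin (z$2) * sin (z$3)"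
    using arg_cong[OF e, of "\<lambda>x. x$1"] arg_cong[OF e, of "\<lambda>x. x$2"] arg_cong[OF e, of "\<lambda>x. x$3"] arg_cong[OF e, of "\<lambda>x. x$4"]
    by (simp_all add: spherical_def vector_4)
  have 1: "y$1 = z$1" by (intro cos_inj_pi[OF _ _ _ _ e'(1)]) (use y z in \<open>auto simp: spherical_box_def\<close>)
  have s1: "sin (z$1) > 0" "sin (z$2) > 0" using z by (auto simp: spherical_box_def intro!: sin_gt_zero)
  then have c2: "cos (y$2) = cos (z$2)" using e'(2) 1 by simp
  have 2: "y$2 = z$2" by (intro cos_inj_pi[OF _ _ _ _ c2]) (use y z in \<open>auto simp: spherical_box_def\<close>)
  have "sin (y$3) = sin (z$3) \<and> cos (y$3) = cos (z$3)" using e'(3,4) 1 2 s1 by simp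
  then obtain n :: int where n: "y$3 = z$3 + 2 * pi * n" using sin_cos_eq_iff by blast
  have "\<bar>y$3 - z$3\<bar> < 2 * pi" using y z by (auto simp: spherical_box_def)
  then have "\<bar>real_of_int n\<bar> < 1" unfolding n by (simp add: abs_mult)
  then have "n = 0" by linarith
  then show "y = z" using 1 2 n by (intro vec3_eqI) auto
qed

lemma sphere_subset_spherical:
  assumes "norm x = 1" "x$4 \<noteq> 0" shows "x \<in> spherical ` spherical_box"
proof -
  have n: "(x$1)\<^sup>2 + (x$2)\<^sup>2 + (x$3)\<^sup>2 + (x$4)\<^sup>2 = 1" using assms(1) by (simp add: norm_eq_1 inner_4 power2_eq_square)
  have x4: "(x$4)\<^sup>2 > 0" using assms(2) by simp
  define s where "s = sqrt (1 - (x$1)\<^sup>2)"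
  have s2: "s\<^sup>2 = (x$2)\<^sup>2 + (x$3)\<^sup>2 + (x$4)\<^sup>2" and s: "s > 0"
  proof -
    have r: "1 - (x$1)\<^sup>2 = (x$2)\<^sup>2 + (x$3)\<^sup>2 + (x$4)\<^sup>2" using n by linarith
    have "(x$2)\<^sup>2 + (x$3)\<^sup>2 + (x$4)\<^sup>2 > 0"
      using x4 zero_le_power2[of "x$2"] zero_le_power2[of "x$3"] by linarith
    then show "s\<^sup>2 = (x$2)\<^sup>2 + (x$3)\<^sup>2 + (x$4)\<^sup>2" "s > 0" unfolding s_def r by simp_all
  qed
  have x1: "-1 < x$1" "x$1 < 1"
  proof -
    have "(x$1)\<^sup>2 < 1" using n x4 zero_le_power2[of "x$2"] zero_le_power2[of "x$3"] by linarith
    then show "-1 < x$1" "x$1 < 1" by (auto simp: abs_square_less_1 abs_less_iff)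
  qed
  define a where "a = arccos (x$1)"
  have a: "0 < a" "a < pi" "cos a = x$1" "sin a = s"
    using x1 by (auto simp: a_def s_def sin_arccos arccos_lt_bounded cos_arccos)
  define t where "t = sqrt (s\<^sup>2 - (x$2)\<^sup>2)"
  have t2: "t\<^sup>2 = (x$3)\<^sup>2 + (x$4)\<^sup>2" and t: "t > 0"
  proof -
    have r: "s\<^sup>2 - (x$2)\<^sup>2 = (x$3)\<^sup>2 + (x$4)\<^sup>2" unfolding s2 by simp
    have "(x$3)\<^sup>2 + (x$4)\<^sup>2 > 0" using x4 zero_le_power2[of "x$3"] by linarith
    then show "t\<^sup>2 = (x$3)\<^sup>2 + (x$4)\<^sup>2" "t > 0" unfolding t_def r by simp_all
  qed
  have x2: "-1 < x$2 / s" "x$2 / s < 1"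
  proof -
    have "(x$2)\<^sup>2 < s\<^sup>2" unfolding s2 using x4 zero_le_power2[of "x$3"] by linarith
    then have "(x$2 / s)\<^sup>2 < 1" using s by (simp add: power_divide)
    then have "\<bar>x$2 / s\<bar> < 1" using abs_square_less_1 by blast
    then show "-1 < x$2 / s" "x$2 / s < 1" by linarith+
  qed
  define b where "b = arccos (x$2 / s)"
  have b: "0 < b" "b < pi" "cos b = x$2 / s" "sin b = t / s"
  proof -
    have "1 - (x$2 / s)\<^sup>2 = (s\<^sup>2 - (x$2)\<^sup>2) / s\<^sup>2" using s by (simp add: field_simps)
    then have "sqrt (1 - (x$2 / s)\<^sup>2) = t / s" unfolding t_def using s by (simp add: real_sqrt_divide)
    then show "sin b = t / s" using x2 by (simp add: b_def sin_arccos)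
  qed (use x2 in \<open>auto simp: b_def arccos_lt_bounded cos_arccos\<close>)
  have "(x$3 / t)\<^sup>2 + (x$4 / t)\<^sup>2 = ((x$3)\<^sup>2 + (x$4)\<^sup>2) / t\<^sup>2" by (simp add: power_divide add_divide_distrib)
  also have "\<dots> = 1" unfolding t2[symmetric] using t by simp
  finally have "(x$3 / t)\<^sup>2 + (x$4 / t)\<^sup>2 = 1" .
  then obtain c where c: "0 \<le> c" "c < 2 * pi" "x$3 / t = cos c" "x$4 / t = sin c"
    using sincos_total_2pi by metis
  have "c \<noteq> 0" using c(4) assms(2) t by auto
  then have "(vector [a, b, c] :: real^3) \<in> spherical_box" using a b c by (simp add: spherical_box_def vector_3)
  moreover have "spherical (vector [a, b, c]) = x"
    using a b c s t by (intro vec4_eqI) (simp_all add: spherical_def vector_3 vector_4 field_simps)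
  ultimately show ?thesis by (metis imageI)
qed

section \<open>Comparison of spherical with stereographic coordinates\<close>

definition sph_to_stereo :: "real^3 \<Rightarrow> real^3" where "sph_to_stereo y = unstereo (spherical y)"

lemma stereo_sph:
  assumes "y \<in> spherical_box" shows "stereo (sph_to_stereo y) = spherical y"
  unfolding sph_to_stereo_def
  using spherical_ne_pole[OF assms] norm_spherical[of y] by (intro stereo_unstereo) (auto simp: S3_def axis_def)

lemma sph_to_stereo_image: "negligible (UNIV - sph_to_stereo ` spherical_box)"
proof (rule negligible_subset)
  show "negligible {z::real^3. axis 3 1 \<bullet> z = 0}" by (rule negligible_hyperplane) (auto simp: axis_eq_0_iff)
  have "z \<in> sph_to_stereo ` spherical_box" if "z$3 \<noteq> 0" for z
  proof -
    have "stereo z $ 4 \<noteq> 0" using that one_plus_inner[of z] by (simp add: stereo_nth)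
    then obtain y where "y \<in> spherical_box" "stereo z = spherical y"
      using sphere_subset_spherical[OF norm_stereo] by blast
    then have "z = sph_to_stereo y" unfolding sph_to_stereo_def by (metis unstereo_stereo)
    then show ?thesis using \<open>y \<in> spherical_box\<close> by blast
  qed
  then show "UNIV - sph_to_stereo ` spherical_box \<subseteq> {z. axis 3 1 \<bullet> z = 0}" by (auto simp: inner_axis')
qed

lemma sph_to_stereo_differentiable: "y \<in> spherical_box \<Longrightarrow> sph_to_stereo differentiable at y"
  unfolding sph_to_stereo_def[abs_def]
  by (rule differentiable_chain_at[unfolded o_def])
    (use spherical_has_derivative Cinf_on_differentiable[OF Cinf_unstereo] spherical_ne_pole in \<open>auto simp: differentiable_def[of spherical]\<close>)

lemma spherical_stereo_integral:
  fixes f :: "real^4 \<Rightarrow> real"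
  shows "(\<lambda>y. Jsph y * f (spherical y)) absolutely_integrable_on spherical_box \<and> integral spherical_box (\<lambda>y. Jsph y * f (spherical y)) = b
     \<longleftrightarrow> (\<lambda>z. Jac z * f (stereo z)) absolutely_integrable_on UNIV \<and> integral UNIV (\<lambda>z. Jac z * f (stereo z)) = b"
proof -
  let ?F = "\<lambda>z. Jac z * f (stereo z)"
  have inj: "inj_on sph_to_stereo spherical_box"
    by (rule inj_onI) (metis inj_onD[OF inj_on_spherical] stereo_sph)
  have J: "det (orientation_matrix (spherical y) (\<lambda>\<alpha>. pd stereo \<alpha> (sph_to_stereo y))) = Jac (sph_to_stereo y)"
    if "y \<in> spherical_box" for y
    using det_stereo[of "sph_to_stereo y"] stereo_sph[OF that] by simp
  have "(\<lambda>y. Jsph y * f (spherical y)) absolutely_integrable_on spherical_box \<and> integral spherical_box (\<lambda>y. Jsph y * f (spherical y)) = b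
     \<longleftrightarrow> ?F absolutely_integrable_on (sph_to_stereo ` spherical_box) \<and> integral (sph_to_stereo ` spherical_box) ?F = b"
    by (rule sphere_change_of_variables[OF open_spherical_box sph_to_stereo_differentiable inj])
      (auto simp: stereo_differentiable stereo_sph J det_spherical Jsph_pos Jac_pos simp flip: Jsph_def)
  moreover have "?F absolutely_integrable_on (sph_to_stereo ` spherical_box) \<longleftrightarrow> ?F absolutely_integrable_on UNIV"
    "integral (sph_to_stereo ` spherical_box) ?F = integral UNIV ?F"
  proof -
    have n: "negligible {x \<in> sph_to_stereo ` spherical_box - UNIV. G x \<noteq> 0}" "negligible {x \<in> UNIV - sph_to_stereo ` spherical_box. G x \<noteq> 0}" for G :: "real^3 \<Rightarrow> real"
      by (auto intro: negligible_subset[OF sph_to_stereo_image])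
    show "?F absolutely_integrable_on (sph_to_stereo ` spherical_box) \<longleftrightarrow> ?F absolutely_integrable_on UNIV"
      by (rule absolutely_integrable_spike_set_eq[OF n])
    show "integral (sph_to_stereo ` spherical_box) ?F = integral UNIV ?F"
      by (rule integral_spike_set[OF n])
  qed
  ultimately show ?thesis by simp
qed

text \<open>The round measure of the sphere, transported to the stereographic chart; the omitted
  point carries no mass. All later integrals over the sphere are integrals against
  \<open>Mst\<close>.\<close>

definition Mst :: "(real^3) measure"
  where "Mst = density lebesgue (\<lambda>y. ennreal (Jac y))"

lemma sets_Mst [measurable_cong, simp]: "sets Mst = sets lebesgue" and space_Mst [simp]: "space Mst = UNIV"
  by (simp_all add: Mst_def)

lemma continuous_borel_lebesgue: "continuous_on UNIV f \<Longrightarrow> f \<in> borel_measurable lebesgue"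
  by (intro measurable_completion) (simp add: borel_measurable_continuous_onI)

lemma Jac_measurable [measurable]: "Jac \<in> borel_measurable lebesgue"
  by (intro continuous_borel_lebesgue Cinf_on_continuous[OF Cinf_Jac])

lemma measurable_Mst_iff [simp]: "f \<in> borel_measurable Mst \<longleftrightarrow> f \<in> borel_measurable lebesgue"
  by (simp add: measurable_def)

lemma integrable_Mst:
  fixes f :: "real^3 \<Rightarrow> 'b::{banach, second_countable_topology}"
  assumes "f \<in> borel_measurable lebesgue"
  shows "integrable Mst f \<longleftrightarrow> integrable lebesgue (\<lambda>y. Jac y *\<^sub>R f y)"
  unfolding Mst_def by (rule integrable_density) (use assms Jac_pos in \<open>auto intro: less_imp_le\<close>)

lemma integral_Mst:
  fixes f :: "real^3 \<Rightarrow> 'b::{banach, second_countable_topology}"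
  assumes "f \<in> borel_measurable lebesgue"
  shows "(LINT y|Mst. f y) = (LINT y|lebesgue. Jac y *\<^sub>R f y)"
  unfolding Mst_def by (rule integral_density) (use assms Jac_pos in \<open>auto intro: less_imp_le\<close>)

lemma AE_Mst: "(AE y in Mst. P y) \<longleftrightarrow> (AE y in lebesgue. P y)"
  unfolding Mst_def by (subst AE_density) (auto simp: Jac_pos)

lemma stereo_measurable_comp: "continuous_on S3 f \<Longrightarrow> (\<lambda>y. f (stereo y)) \<in> borel_measurable lebesgue"
  by (intro continuous_borel_lebesgue continuous_on_compose2[OF _ continuous_stereo]) (auto simp: stereo_S3)

lemma continuous_on_spherical: "continuous_on S spherical"
  by (intro continuous_at_imp_continuous_on ballI has_derivative_continuous[OF spherical_has_derivative])

lemma spherical_S3: "spherical y \<in> S3" by (simp add: S3_def norm_spherical)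

lemma spherical_box_cbox: "spherical_box \<subseteq> cbox 0 (vector [pi, pi, 2 * pi])"
  by (auto simp: spherical_box_def mem_box_cart forall_3 vector_3)

lemma absolutely_integrable_continuous_spherical_box:
  fixes h :: "real^3 \<Rightarrow> real"
  assumes "continuous_on UNIV h" shows "h absolutely_integrable_on spherical_box"
proof (rule set_integrable_subset)
  show "h absolutely_integrable_on cbox 0 (vector [pi, pi, 2 * pi])"
    using assms by (intro absolutely_integrable_continuous) (auto intro: continuous_on_subset)
  show "spherical_box \<in> sets lebesgue" using open_spherical_box by simp
qed (rule spherical_box_cbox)

text \<open>On the sphere 1 + |y|^2 is 2 / (1 + x_1), which is singular only at the omitted pole. In
  spherical coordinates the density sin^2 y_1 = (1 - cos y_1)(1 + cos y_1) cancels the singularity.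
  This integrability is what makes cutoffs near the pole negligible.\<close>

lemma Mst_one_plus_inner: "integrable Mst (\<lambda>y. 1 + y \<bullet> y)"
proof -
  let ?f = "\<lambda>x::real^4. 2 / (1 + x$1)"
  have s: "sin y * sin y * (2 / (1 + cos y)) = 2 * (1 - cos y)" if "1 + cos y > 0" for y :: real
  proof -
    have "sin y * sin y = (1 - cos y) * (1 + cos y)"
      using sin_cos_squared_add[of y] by (simp add: power2_eq_square algebra_simps)
    then show ?thesis using that by simp
  qed
  have "(\<lambda>y. Jsph y * ?f (spherical y)) absolutely_integrable_on spherical_box \<longleftrightarrow>
     (\<lambda>y. 2 * (1 - cos (y$1)) * sin (y$2)) absolutely_integrable_on spherical_box"
  proof (rule set_integrable_cong[OF refl refl])
    fix y assume "y \<in> spherical_box"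
    from spherical_ne_pole[OF this] have "1 + cos (y$1) > 0" by (simp add: spherical_def vector_4)
    note s = s[OF this]
    have "Jsph y * ?f (spherical y) = (sin (y$1) * sin (y$1) * (2 / (1 + cos (y$1)))) * sin (y$2)"
      by (simp add: Jsph_def spherical_def vector_4 power2_eq_square mult_ac)
    then show "Jsph y * ?f (spherical y) = 2 * (1 - cos (y$1)) * sin (y$2)" unfolding s .
  qed
  moreover have "(\<lambda>y::real^3. 2 * (1 - cos (y$1)) * sin (y$2)) absolutely_integrable_on spherical_box"
    by (intro absolutely_integrable_continuous_spherical_box continuous_intros)
  ultimately have "(\<lambda>z. Jac z * ?f (stereo z)) absolutely_integrable_on UNIV"
    using spherical_stereo_integral[of ?f] by blast
  moreover have "?f (stereo z) = 1 + z \<bullet> z" for z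
    using one_plus_inner[of z] by (simp add: stereo_nth)
  ultimately have "integrable lebesgue (\<lambda>z. Jac z *\<^sub>R (1 + z \<bullet> z))"
    by (simp add: set_integrable_def)
  then show ?thesis
    by (subst integrable_Mst) (auto intro!: continuous_borel_lebesgue continuous_intros)
qed

lemma finite_measure_Mst: "finite_measure Mst"
proof -
  have "integrable Mst (\<lambda>y. 1::real)"
    by (rule Bochner_Integration.integrable_bound[OF Mst_one_plus_inner]) (auto intro!: AE_I2 simp: inner_ge_zero)
  then have "(\<integral>\<^sup>+ y. ennreal (norm (1::real)) \<partial>Mst) < \<infinity>" unfolding integrable_iff_bounded by blast
  then show ?thesis by (intro finite_measureI) auto
qed

interpretation Mst: finite_measure Mst by (rule finite_measure_Mst)

lemma set_lebesgue_integral_lborel_lebesgue: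
  fixes f :: "'a::euclidean_space \<Rightarrow> real"
  assumes "S \<in> sets borel" "f \<in> borel_measurable borel"
  shows "(LINT y:S|lborel. f y) = (LINT y:S|lebesgue. f y)"
  unfolding set_lebesgue_integral_def
  by (rule integral_completion[symmetric]) (use assms in measurable)

lemma sets_spherical_domain: "spherical_domain \<in> sets borel"
proof -
  have e: "spherical_domain = {y. 0 < y$1 \<and> y$1 < pi \<and> 0 < y$2 \<and> y$2 < pi} \<inter> {y. 0 \<le> y$3} \<inter> {y. y$3 < 2 * pi}"
    by (auto simp: spherical_domain_def)
  have o: "open {y::real^3. 0 < y$1 \<and> y$1 < pi \<and> 0 < y$2 \<and> y$2 < pi}" "closed {y::real^3. 0 \<le> y$3}" "open {y::real^3. y$3 < 2 * pi}"
    by (intro open_Collect_conj open_Collect_less closed_Collect_le continuous_intros)+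
  show ?thesis unfolding e by (intro sets.Int borel_open borel_closed o)
qed

lemma spherical_integral_Mst:
  assumes f: "continuous_on S3 f"
  shows "(LINT y:spherical_domain|lborel. Jsph y * f (spherical y)) = (LINT y|Mst. f (stereo y) :: real)"
proof -
  let ?h = "\<lambda>y. Jsph y * f (spherical y)"
  have ch: "continuous_on UNIV ?h"
    unfolding Jsph_def by (intro continuous_intros continuous_on_compose2[OF f continuous_on_spherical]) (auto simp: spherical_S3)
  have i: "(\<lambda>z. Jac z * f (stereo z)) absolutely_integrable_on UNIV"
    using spherical_stereo_integral[of f] absolutely_integrable_continuous_spherical_box[OF ch] by metis
  have "(LINT y:spherical_domain|lborel. ?h y) = (LINT y:spherical_domain|lebesgue. ?h y)"
    by (rule set_lebesgue_integral_lborel_lebesgue) (auto simp: sets_spherical_domain ch borel_measurable_continuous_onI)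
  also have "\<dots> = (LINT y:spherical_box|lebesgue. ?h y)"
    unfolding set_lebesgue_integral_def
  proof (rule integral_cong_AE)
    have "negligible {y::real^3. axis 3 1 \<bullet> y = 0}" by (rule negligible_hyperplane) (auto simp: axis_eq_0_iff)
    then have "AE y in lebesgue. y \<notin> {y::real^3. axis 3 1 \<bullet> y = 0}"
      by (intro AE_not_in) (simp add: negligible_iff_null_sets)
    then show "AE y in lebesgue. indicat_real spherical_domain y *\<^sub>R ?h y = indicat_real spherical_box y *\<^sub>R ?h y"
    proof eventually_elim
      case (elim y)
      then have "y$3 \<noteq> 0" by (simp add: inner_axis')
      then have "y \<in> spherical_domain \<longleftrightarrow> y \<in> spherical_box" by (auto simp: spherical_domain_def spherical_box_def)
      then show ?case by (simp add: indicator_def)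
    qed
    have "spherical_domain \<in> sets lebesgue" "spherical_box \<in> sets lebesgue"
      using sets_spherical_domain open_spherical_box by auto
    then show "(\<lambda>y. indicat_real spherical_domain y *\<^sub>R ?h y) \<in> borel_measurable lebesgue"
       "(\<lambda>y. indicat_real spherical_box y *\<^sub>R ?h y) \<in> borel_measurable lebesgue"
      using continuous_borel_lebesgue[OF ch] by auto
  qed
  also have "\<dots> = integral spherical_box ?h"
    by (rule set_lebesgue_integral_eq_integral(2)[OF absolutely_integrable_continuous_spherical_box[OF ch]])
  also have "\<dots> = integral UNIV (\<lambda>z. Jac z * f (stereo z))"
    using spherical_stereo_integral[of f] absolutely_integrable_continuous_spherical_box[OF ch] by metis
  also have "integral UNIV (\<lambda>z. Jac z * f (stereo z)) = (LINT z:UNIV|lebesgue. Jac z * f (stereo z))"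
    by (rule set_lebesgue_integral_eq_integral(2)[OF i, symmetric])
  also have "\<dots> = (LINT y|Mst. f (stereo y))"
    unfolding integral_Mst[OF stereo_measurable_comp[OF f]] by (simp add: set_lebesgue_integral_def)
  finally show ?thesis .
qed

lemma lborel_integral_prod_cart:
  fixes h :: "'n::finite \<Rightarrow> real \<Rightarrow> real"
  assumes "\<And>i. integrable lborel (h i)"
  shows "(LINT y|lborel. (\<Prod>i\<in>UNIV. h i (y$i))) = (\<Prod>i\<in>UNIV. LINT t|lborel. h i t)"
proof -
  have m [measurable]: "h i \<in> borel_measurable borel" for i using assms[of i] by auto
  interpret product_sigma_finite "\<lambda>_::real^'n. lborel :: real measure" by standard
  let ?e = "\<lambda>i. axis i 1 :: real^'n"
  have B: "Basis = range ?e" by (auto simp: Basis_vec_def)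
  have inj: "inj ?e" by (auto simp: inj_def axis_eq_axis)
  have meas: "(\<lambda>f. \<Sum>b\<in>Basis. f b *\<^sub>R b) \<in> measurable (\<Pi>\<^sub>M b\<in>Basis. lborel) (borel :: (real^'n) measure)"
    by measurable
  have nth: "(\<Sum>b\<in>Basis. f b *\<^sub>R b) $ i = f (?e i)" for f :: "real^'n \<Rightarrow> real" and i
    unfolding B by (subst sum.reindex[OF inj]) (simp add: axis_def if_distrib cong: if_cong)
  have pe: "(\<Prod>i\<in>UNIV. h i (f (?e i))) = (\<Prod>b\<in>Basis. h (inv ?e b) (f b))" for f :: "real^'n \<Rightarrow> real"
    unfolding B by (subst prod.reindex[OF inj]) (simp add: inv_f_f[OF inj])
  have "(LINT y|lborel. (\<Prod>i\<in>UNIV. h i (y$i))) =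
     (LINT f|(\<Pi>\<^sub>M b\<in>Basis. lborel). (\<Prod>i\<in>UNIV. h i ((\<Sum>b\<in>Basis. f b *\<^sub>R b) $ i)))"
    by (subst lborel_eq, rule integral_distr[OF meas]) measurable
  also have "\<dots> = (LINT f|(\<Pi>\<^sub>M b\<in>Basis. lborel). (\<Prod>b\<in>Basis. h (inv ?e b) (f b)))"
    by (simp only: nth pe)
  also have "\<dots> = (\<Prod>b\<in>Basis. LINT t|lborel. h (inv ?e b) t)"
    by (rule product_integral_prod) (auto simp: assms)
  also have "\<dots> = (\<Prod>i\<in>UNIV. LINT t|lborel. h i t)"
    unfolding B by (subst prod.reindex[OF inj]) (simp add: inv_f_f[OF inj])
  finally show ?thesis .
qed

lemma measure_Mst: "measure Mst UNIV = 2 * pi\<^sup>2"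
proof -
  \<comment> \<open>The volume factorises as (pi / 2) * 2 * (2 pi). Closed intervals may be used for
    the first two angles because the density vanishes at their end points.\<close>
  define h where "h i = (if i = (1::3) then (\<lambda>t. (sin t)\<^sup>2 * indicat_real {0..pi} t)
    else if i = 2 then (\<lambda>t. sin t * indicat_real {0..pi} t) else (\<lambda>t. indicat_real {0..<2 * pi} t))" for i
  have i1: "has_bochner_integral lborel (h 1) (pi / 2)"
  proof -
    have "has_bochner_integral lborel (\<lambda>t. (sin t)\<^sup>2 * indicat_real {0..pi} t) ((pi / 2 - sin (2 * pi) / 4) - (0 / 2 - sin (2 * 0) / 4))"
    proof (rule has_bochner_integral_FTC_Icc_real)
      show "((\<lambda>t. t / 2 - sin (2 * t) / 4) has_real_derivative (sin x)\<^sup>2) (at x)" for x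
        by (auto intro!: derivative_eq_intros simp: cos_double_sin) (simp add: field_simps)
    qed (auto intro!: continuous_intros)
    then show ?thesis by (simp add: h_def)
  qed
  have i2: "has_bochner_integral lborel (h 2) 2"
  proof -
    have "has_bochner_integral lborel (\<lambda>t. sin t * indicat_real {0..pi} t) (- cos pi - - cos 0)"
      by (rule has_bochner_integral_FTC_Icc_real) (auto intro!: derivative_eq_intros continuous_intros)
    then show ?thesis by (simp add: h_def)
  qed
  have i3: "integrable lborel (h 3)" "(LINT t|lborel. h 3 t) = 2 * pi" by (simp_all add: h_def)
  have "measure Mst UNIV = (LINT y|Mst. (\<lambda>_. 1) (stereo y))" by simp
  also have "\<dots> = (LINT y:spherical_domain|lborel. Jsph y)"
    using spherical_integral_Mst[of "\<lambda>_. 1"] by simp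
  also have "\<dots> = (LINT y|lborel. (\<Prod>i\<in>UNIV. h i (y$i)))"
    unfolding set_lebesgue_integral_def
  proof (rule arg_cong[where f="integral\<^sup>L lborel"], rule ext)
    fix y :: "real^3"
    have p: "(\<Prod>i\<in>UNIV. h i (y$i)) = h 1 (y$1) * h 2 (y$2) * h 3 (y$3)"
      unfolding UNIV_3 by (simp add: mult.assoc)
    show "indicat_real spherical_domain y *\<^sub>R Jsph y = (\<Prod>i\<in>UNIV. h i (y$i))"
    proof (cases "y$1 = 0 \<or> y$1 = pi \<or> y$2 = 0 \<or> y$2 = pi")
      case True
      then have "Jsph y = 0" "h 1 (y$1) * h 2 (y$2) * h 3 (y$3) = 0" by (auto simp: Jsph_def h_def)
      then show ?thesis unfolding p by simp
    next
      case False
      then have "y \<in> spherical_domain \<longleftrightarrow> y$1 \<in> {0..pi} \<and> y$2 \<in> {0..pi} \<and> y$3 \<in> {0..<2 * pi}"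
        by (auto simp: spherical_domain_def)
      then show ?thesis unfolding p by (simp add: h_def indicator_def Jsph_def)
    qed
  qed
  also have "\<dots> = (\<Prod>i\<in>UNIV. LINT t|lborel. h i t)"
  proof (rule lborel_integral_prod_cart)
    show "integrable lborel (h i)" for i
      using exhaust_3[of i] i1 i2 i3 by (auto intro: integrable.intros)
  qed
  also have "\<dots> = 2 * pi\<^sup>2"
    unfolding UNIV_3 using has_bochner_integral_integral_eq[OF i1] has_bochner_integral_integral_eq[OF i2] i3
    by (simp add: power2_eq_square)
  finally show ?thesis .
qed

text \<open>\<open>ae_zero_S3\<close> quantifies over all charts, whereas the analysis is done in
  one. The transition map back from the stereographic chart is differentiable, hence preserves null
  sets, and the preimage of the omitted point is at most one point.\<close>

lemma ae_zero_S3_from_stereo: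
  assumes ae: "AE y in lebesgue. v (stereo y) = 0"
  shows "ae_zero_S3 v"
  unfolding ae_zero_S3_def
proof (intro allI impI)
  fix \<phi> U assume "pos_coords \<phi> U"
  then have U: "open U" and c\<phi>: "Cinf_on \<phi> U" and inj\<phi>: "\<And>y. y \<in> U \<Longrightarrow> inj (frechet_derivative \<phi> (at y))"
    and sub: "\<phi> ` U \<subseteq> S3" and "\<exists>\<psi>. homeomorphism U (\<phi> ` U) \<phi> \<psi>"
    unfolding pos_coords_def local_coords_def by (auto dest: openin_imp_subset)
  then obtain \<psi> where hom: "homeomorphism U (\<phi> ` U) \<phi> \<psi>" by blast
  define N where "N = {z. v (stereo z) \<noteq> 0}"
  obtain N' where "N' \<in> null_sets lebesgue" "N \<subseteq> N'"
    using ae unfolding eventually_ae_filter N_def by auto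
  then have N: "negligible N" using negligible_iff_null_sets negligible_subset by blast
  define U' where "U' = {y \<in> U. 1 + \<phi> y $ 1 > 0}"
  have "continuous_on U (\<lambda>y. 1 + \<phi> y $ 1)" using Cinf_on_continuous[OF c\<phi>] by (intro continuous_intros)
  moreover have "U' = U \<inter> (\<lambda>y. 1 + \<phi> y $ 1) -` {0<..}" by (auto simp: U'_def)
  ultimately have U': "open U'"
    using continuous_open_preimage[OF _ U open_greaterThan, of "\<lambda>y. 1 + \<phi> y $ 1" 0] by simp
  define T where "T y = unstereo (\<phi> y)" for y
  define S where "S z = \<psi> (stereo z)" for z
  have sT: "stereo (T y) = \<phi> y" if "y \<in> U'" for y
    unfolding T_def using that sub by (intro stereo_unstereo) (auto simp: U'_def axis_def)
  have ST: "S (T y) = y" if "y \<in> U'" for y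
    using homeomorphism_apply1[OF hom, of y] that unfolding S_def sT[OF that] by (auto simp: U'_def)
  have "Cinf_on T U'"
    unfolding T_def using Cinf_on_subset[OF c\<phi>, of U']
    by (intro Cinf_on_compose[OF U' _ Cinf_unstereo]) (auto simp: U'_def intro!: open_Collect_less continuous_intros)
  then have dT: "(T has_derivative frechet_derivative T (at y)) (at y)" if "y \<in> U'" for y
    using Cinf_on_has_derivative that by blast
  have "S differentiable at (T y)" if y: "y \<in> U'" for y
  proof -
    have l: "linear (frechet_derivative T (at y))" using dT[OF y] by (rule has_derivative_linear)
    have "(\<phi> has_derivative (frechet_derivative stereo (at (T y)) \<circ> frechet_derivative T (at y))) (at y)"
      using diff_chain_at[OF dT[OF y] differentiable_has_derivative[OF stereo_differentiable]]
      by (rule has_derivative_transform_within_open[OF _ U' y]) (simp add: sT)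
    then have "frechet_derivative \<phi> (at y) = frechet_derivative stereo (at (T y)) \<circ> frechet_derivative T (at y)"
      using frechet_derivative_at by metis
    then have "inj (frechet_derivative T (at y))"
      using inj\<phi>[of y] y inj_on_imageI2[of "frechet_derivative stereo (at (T y))" "frechet_derivative T (at y)" UNIV] by (simp add: U'_def)
    then obtain g' where g': "linear g'" "g' \<circ> frechet_derivative T (at y) = id"
      using linear_injective_left_inverse[OF l] by blast
    have f: "frechet_derivative T (at y) \<circ> g' = id"
      using left_inverse_linear l g'(1) g'(2) left_right_inverse_eq linear_inverse_left by metis
    have "(S has_derivative g') (at (T y))"
      by (rule has_derivative_inverse_strong[OF U' y _ _ dT[OF y] f])
        (use \<open>Cinf_on T U'\<close> Cinf_on_continuous ST in auto)
    then show ?thesis by (auto simp: differentiable_def)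
  qed
  then have "S differentiable_on (N \<inter> T ` U')"
    unfolding differentiable_on_def by (auto intro: differentiable_at_withinI)
  then have "negligible (S ` (N \<inter> T ` U'))"
    by (intro negligible_differentiable_image_negligible negligible_subset[OF N]) auto
  moreover have "negligible {y \<in> U. \<phi> y = - pole}"
  proof (cases "\<exists>y0\<in>U. \<phi> y0 = - pole")
    case True
    then obtain y0 where "y0 \<in> U" "\<phi> y0 = - pole" by blast
    then have "{y \<in> U. \<phi> y = - pole} \<subseteq> {y0}"
      using homeomorphism_apply1[OF hom] by (auto) metis
    then show ?thesis using negligible_subset negligible_sing by blast
  next
    case False
    then show ?thesis by (metis (mono_tags, lifting) Collect_empty_eq negligible_empty)
  qed
  ultimately have n: "negligible (S ` (N \<inter> T ` U') \<union> {y \<in> U. \<phi> y = - pole})" by (rule negligible_Un)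
  have "v (\<phi> y) = 0" if "y \<in> U" "y \<notin> S ` (N \<inter> T ` U') \<union> {y \<in> U. \<phi> y = - pole}" for y
  proof (rule ccontr)
    assume nz: "v (\<phi> y) \<noteq> 0"
    have "\<phi> y \<in> S3" "\<phi> y \<noteq> - pole" using that sub by auto
    then have y: "y \<in> U'" using that(1) S3_nth_1 by (auto simp: U'_def)
    then have "T y \<in> N" using nz sT[OF y] by (simp add: N_def)
    then have "y \<in> S ` (N \<inter> T ` U')" using y ST[OF y] by (metis IntI imageI)
    then show False using that by blast
  qed
  then have "AE y in lebesgue. y \<in> U \<longrightarrow> v (\<phi> y) = 0"
    by (intro AE_I'[of "S ` (N \<inter> T ` U') \<union> {y \<in> U. \<phi> y = - pole}"]) (use n in \<open>auto simp: negligible_iff_null_sets\<close>)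
  then show "AE y in lebesgue_on U. v (\<phi> y) = 0"
    using U by (subst AE_restrict_space_iff) auto
qed

lemma stereo_inversion:
  assumes "y \<noteq> 0" shows "stereo y = - stereo (- ((1 / (y \<bullet> y)) *\<^sub>R y))"
proof -
  have p: "y \<bullet> y > 0" using assms by simp
  have i: "- ((1 / (y \<bullet> y)) *\<^sub>R y) \<bullet> - ((1 / (y \<bullet> y)) *\<^sub>R y) = 1 / (y \<bullet> y)" using p by simp
  show ?thesis
    unfolding vec_eq_iff forall_4 vector_uminus_component stereo_nth i using p one_plus_inner[of y]
    by (simp add: field_simps)
qed

text \<open>Local square integrability says nothing near the omitted pole. The unit ball is compact
  in the stereographic chart; its complement is carried by inversion into the unit ball of the
  antipodal chart, where local integrability applies again.\<close>

lemma L2_sphere: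
  assumes H: "H1_S3 v"
  shows "(\<lambda>y. v (stereo y)) \<in> borel_measurable lebesgue" "integrable Mst (\<lambda>y. (norm (v (stereo y)))\<^sup>2)"
proof -
  have L1: "loc_L2 UNIV (v \<circ> stereo)" and L2: "loc_L2 UNIV (v \<circ> (\<lambda>y. - stereo y))"
    using H pos_coords_stereo pos_coords_minus_stereo unfolding H1_S3_def by blast+
  show m: "(\<lambda>y. v (stereo y)) \<in> borel_measurable lebesgue"
    using L1 by (simp add: loc_L2_def o_def lebesgue_on_UNIV_eq)
  define f where "f x = (norm (v x))\<^sup>2" for x
  have bJ: "bounded (Jac ` cball 0 1)"
    by (intro compact_imp_bounded compact_continuous_image Cinf_on_continuous[OF Cinf_on_subset[OF Cinf_Jac]]) auto
  have ball: "(\<lambda>z. Jac z * f (w z)) absolutely_integrable_on cball 0 1"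
    if "loc_L2 UNIV (v \<circ> w)" for w
  proof -
    have "integrable (lebesgue_on (cball 0 1)) (\<lambda>y. f (w y))"
      using that unfolding loc_L2_def f_def o_def by (meson compact_cball subset_UNIV)
    then have "(\<lambda>z. f (w z)) absolutely_integrable_on cball 0 1"
      by (simp add: set_integrable_def integrable_restrict_space)
    then show ?thesis
      using bJ Jac_measurable
      by (intro absolutely_integrable_bounded_measurable_product[where h="(*)"] bilinear_times)
        (auto simp: measurable_restrict_space1)
  qed
  define D where "D = - cball (0::real^3) 1"
  define T where "T y = - ((1 / (y \<bullet> y)) *\<^sub>R y)" for y :: "real^3"
  have nz: "y \<noteq> 0" if "y \<in> D" for y using that by (auto simp: D_def)
  have TT: "T (T y) = y" if "y \<noteq> 0" for y using that by (simp add: T_def)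
  have TD: "T ` D \<subseteq> cball 0 1"
    by (auto simp: T_def D_def divide_le_eq dot_square_norm power2_eq_square)
  have sub: "set_integrable lebesgue (T ` D) (\<lambda>z. Jac z * f (- stereo z))"
  proof (rule set_integrable_subset[OF ball[OF L2] _ TD])
    have "T ` D = ball 0 1 - {0}"
    proof (intro set_eqI iffI)
      fix z assume "z \<in> T ` D"
      then show "z \<in> ball 0 1 - {0}"
        by (auto simp: T_def D_def divide_less_eq dot_square_norm power2_eq_square)
    next
      fix z :: "real^3" assume z: "z \<in> ball 0 1 - {0}"
      then have "norm (T z) = 1 / norm z"
        by (simp add: T_def dot_square_norm power2_eq_square)
      then have "T z \<in> D" using z by (simp add: D_def)
      then show "z \<in> T ` D" using TT[of z] z by (metis DiffD2 imageI singletonI)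
    qed
    then show "T ` D \<in> sets lebesgue" by simp
  qed
  have "(\<lambda>y. Jac y * f (stereo y)) absolutely_integrable_on D \<and> integral D (\<lambda>y. Jac y * f (stereo y)) = integral (T ` D) (\<lambda>z. Jac z * f (- stereo z))"
  proof (subst sphere_change_of_variables[where T=T and \<psi>="\<lambda>z. - stereo z" and ?J2.0=Jac])
    show "T differentiable at y" if "y \<in> D" for y
    proof -
      have "(\<lambda>y::real^3. (1 / (y \<bullet> y)) *\<^sub>R y) differentiable at y"
        using nz[OF that] by (intro derivative_intros) auto
      then show ?thesis unfolding T_def[abs_def] by (rule differentiable_minus)
    qed
    show "inj_on T D" by (rule inj_onI) (metis TT nz)
    show "stereo y = - stereo (T y)" if "y \<in> D" for y
      using stereo_inversion[OF nz[OF that]] by (simp add: T_def)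
  qed (use sub in \<open>auto simp: D_def det_stereo det_minus_stereo Jac_pos stereo_differentiable\<close>)
  then have "(\<lambda>y. Jac y * f (stereo y)) absolutely_integrable_on (cball 0 1 \<union> D)"
    using ball[OF L1] by (intro set_integrable_Un) (auto simp: D_def)
  then have "integrable lebesgue (\<lambda>y. Jac y *\<^sub>R f (stereo y))"
    by (simp add: D_def set_integrable_def)
  then show "integrable Mst (\<lambda>y. (norm (v (stereo y)))\<^sup>2)"
    using m unfolding f_def by (subst integrable_Mst) auto
qed

section \<open>Integration by parts on the sphere, with cutoffs at the pole\<close>

lemma lborel_integral_shift:
  fixes f :: "'a::euclidean_space \<Rightarrow> real"
  assumes "f \<in> borel_measurable borel"
  shows "(LINT y|lborel. f (y + c)) = (LINT y|lborel. f y)"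
proof -
  have "(LINT y|lborel. f y) = (LINT y|distr lborel borel ((+) c). f y)"
    by (simp add: lborel_distr_plus)
  also have "\<dots> = (LINT y|lborel. f (c + y))"
    by (rule integral_distr) (use assms in auto)
  finally show ?thesis by (simp add: add.commute)
qed

text \<open>Difference quotients integrate to zero by translation invariance. The mean value theorem
  bounds them by a constant, and steps of length at most 1 keep them supported in radius R + 1, so
  dominated convergence gives the claim.\<close>

lemma integral_pd_zero:
  fixes \<psi> :: "real^3 \<Rightarrow> real"
  assumes smooth: "Cinf_on \<psi> UNIV" and K: "bounded K" "\<And>y. y \<notin> K \<Longrightarrow> \<psi> y = 0"
  shows "(LINT y|lebesgue. pd \<psi> \<alpha> y) = 0"
proof -
  let ?e = "axis \<alpha> 1 :: real^3"
  have c: "continuous_on UNIV \<psi>" "continuous_on UNIV (pd \<psi> \<alpha>)"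
    by (intro Cinf_on_continuous Cinf_pd smooth open_UNIV)+
  have m: "\<psi> \<in> borel_measurable borel" "pd \<psi> \<alpha> \<in> borel_measurable borel"
    using c by (auto intro: borel_measurable_continuous_onI)
  obtain R where "R > 0" "\<forall>x\<in>K. norm x \<le> R" using K(1) by (auto simp: bounded_pos)
  then have R: "K \<subseteq> cball 0 R" "R > 0" by auto
  have zR: "\<psi> x = 0" if "x \<notin> cball 0 R" for x using K(2) R(1) that by blast
  have pz: "pd \<psi> \<alpha> y = 0" if "y \<notin> cball 0 R" for y
  proof -
    have "pd \<psi> \<alpha> y = pd (\<lambda>_. 0) \<alpha> y"
      by (rule pd_cong[of "- cball 0 R"]) (use that zR in auto)
    then show ?thesis by simp
  qed
  have "bounded (pd \<psi> \<alpha> ` cball 0 R)"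
    by (intro compact_imp_bounded compact_continuous_image continuous_on_subset[OF c(2)]) auto
  then obtain C0 where C0: "\<forall>y\<in>cball 0 R. \<bar>pd \<psi> \<alpha> y\<bar> \<le> C0" by (auto simp: bounded_iff)
  define C where "C = max C0 0"
  have C: "\<bar>pd \<psi> \<alpha> y\<bar> \<le> C" for y using C0 pz[of y] by (cases "y \<in> cball 0 R") (force simp: C_def)+
  have der: "((\<lambda>s. \<psi> (y + s *\<^sub>R ?e)) has_field_derivative pd \<psi> \<alpha> (y + s *\<^sub>R ?e)) (at s)" for y s
  proof -
    have g: "((\<lambda>s. y + s *\<^sub>R ?e) has_derivative (\<lambda>h. h *\<^sub>R ?e)) (at s)" by (auto intro!: derivative_eq_intros)
    have l: "linear (frechet_derivative \<psi> (at (y + s *\<^sub>R ?e)))"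
      using Cinf_on_has_derivative[OF smooth] has_derivative_linear by blast
    show ?thesis
      using diff_chain_at[OF g Cinf_on_has_derivative[OF smooth UNIV_I]]
      by (simp add: has_field_derivative_def o_def linear_scale[OF l] pd_def mult.commute[of _ "frechet_derivative \<psi> _ _"])
  qed
  define D where "D n y = (\<psi> (y + (1 / real (Suc n)) *\<^sub>R ?e) - \<psi> y) * real (Suc n)" for n y
  have bound: "norm (D n y) \<le> C * indicat_real (cball 0 (R + 1)) y" for n y
  proof (cases "y \<in> cball 0 (R + 1)")
    case True
    obtain z where "0 < z" "\<psi> (y + (1 / real (Suc n)) *\<^sub>R ?e) - \<psi> (y + 0 *\<^sub>R ?e) = (1 / real (Suc n) - 0) * pd \<psi> \<alpha> (y + z *\<^sub>R ?e)"
      using MVT2[of 0 "1 / real (Suc n)" "\<lambda>s. \<psi> (y + s *\<^sub>R ?e)" "\<lambda>s. pd \<psi> \<alpha> (y + s *\<^sub>R ?e)"] der by auto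
    then have "D n y = pd \<psi> \<alpha> (y + z *\<^sub>R ?e)" by (simp add: D_def)
    then show ?thesis using C True by simp
  next
    case False
    define w where "w = (1 / real (Suc n)) *\<^sub>R ?e"
    have "norm w \<le> 1" by (simp add: w_def norm_axis_1)
    then have "norm (y + w) > R"
      using False norm_triangle_ineq4[of "y + w" w] by simp
    then have "norm (y + (1 / real (Suc n)) *\<^sub>R ?e) > R" unfolding w_def .
    then have "y + (1 / real (Suc n)) *\<^sub>R ?e \<notin> K" "y \<notin> K" using R False by auto
    then show ?thesis using K(2) False by (simp add: D_def)
  qed
  have lim: "(\<lambda>n. D n y) \<longlonglongrightarrow> pd \<psi> \<alpha> y" for y
  proof -
    have "((\<lambda>h. (\<psi> (y + h *\<^sub>R ?e) - \<psi> y) / h) \<longlongrightarrow> pd \<psi> \<alpha> y) (at 0)"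
      using der[of y 0] by (simp add: DERIV_def)
    moreover have "filterlim (\<lambda>n. 1 / real (Suc n)) (at 0) sequentially"
      using LIMSEQ_inverse_real_of_nat by (auto simp: filterlim_at divide_inverse)
    ultimately have "(\<lambda>n. (\<psi> (y + (1 / real (Suc n)) *\<^sub>R ?e) - \<psi> y) / (1 / real (Suc n))) \<longlonglongrightarrow> pd \<psi> \<alpha> y"
      by (rule filterlim_compose)
    then show ?thesis by (simp add: D_def[abs_def])
  qed
  have mD: "D n \<in> borel_measurable borel" for n
    unfolding D_def by (intro borel_measurable_continuous_onI continuous_intros continuous_on_compose2[OF c(1)]) auto
  have i\<psi>: "integrable lborel \<psi>"
  proof -
    have "integrable lborel (\<lambda>y. indicator (cball 0 R) y *\<^sub>R \<psi> y)"
      by (rule borel_integrable_compact) (auto intro: continuous_on_subset[OF c(1)])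
    moreover have "indicator (cball 0 R) y *\<^sub>R \<psi> y = \<psi> y" for y
      using zR[of y] by (auto simp: indicator_def)
    ultimately show ?thesis by (simp only:)
  qed
  have i\<psi>': "integrable lborel (\<lambda>y. \<psi> (y + d))" for d
  proof -
    have "integrable lborel (\<lambda>y. \<psi> (d + y))"
      using i\<psi> integrable_distr_eq[of "(+) d" lborel borel \<psi>] m by (simp add: lborel_distr_plus)
    then show ?thesis by (simp add: add.commute)
  qed
  have "(LINT y|lborel. D n y) = 0" for n
    unfolding D_def using i\<psi> i\<psi>' lborel_integral_shift[OF m(1)] by simp
  moreover have "(\<lambda>n. LINT y|lborel. D n y) \<longlonglongrightarrow> (LINT y|lborel. pd \<psi> \<alpha> y)"
  proof (rule integral_dominated_convergence)
    show "integrable lborel (\<lambda>y. C * indicat_real (cball 0 (R + 1)) y)"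
      by (rule integrable_mult_right, rule integrable_real_indicator) (simp, rule emeasure_bounded_finite[OF bounded_cball])
  qed (use lim bound mD m in auto)
  ultimately have "(LINT y|lborel. pd \<psi> \<alpha> y) = 0" by (simp add: LIMSEQ_const_iff)
  then show ?thesis using integral_completion[of "pd \<psi> \<alpha>" lborel] m by simp
qed

text \<open>It is 1 for |y|^2 up to N + 1 and 0 from 2 (N + 1) on, so on the sphere it cuts out a
  shrinking neighbourhood of the omitted pole. Using y . y instead of the norm keeps it smooth at
  0.\<close>

definition chi :: "nat \<Rightarrow> real^3 \<Rightarrow> real"
  where "chi N y = step ((y \<bullet> y) / real (Suc N))"

definition dchi :: "real \<Rightarrow> nat \<Rightarrow> 3 \<Rightarrow> real^3 \<Rightarrow> real"
  where "dchi \<tau> N m y = (\<Sum>\<alpha>\<in>UNIV. Eh \<tau> y $ m $ \<alpha> * pd (chi N) \<alpha> y)"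

lemma Cinf_chi: "Cinf_on (chi N) UNIV"
  unfolding chi_def[abs_def]
  by (rule Cinf_on_compose[where T=UNIV, OF _ _ Cinf_step])
    (auto intro!: Cinf_on_divide Cinf_on_inner Cinf_on_ident)

lemma chi_bounds: "0 \<le> chi N y" "chi N y \<le> 1"
  by (simp_all add: chi_def step_bounds)

lemma chi_support: "y \<notin> cball 0 (sqrt (2 * real (Suc N))) \<Longrightarrow> chi N y = 0"
proof -
  assume "y \<notin> cball 0 (sqrt (2 * real (Suc N)))"
  then have "sqrt (2 * real (Suc N)) < norm y" by simp
  then have "2 * real (Suc N) < (norm y)\<^sup>2"
    by (metis real_less_rsqrt real_sqrt_less_iff real_sqrt_abs abs_norm_cancel)
  then have "2 \<le> (y \<bullet> y) / real (Suc N)"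
    by (simp add: dot_square_norm pos_le_divide_eq del: of_nat_Suc)
  then show ?thesis by (simp add: chi_def step_0)
qed

lemma step_differentiable: "(step has_field_derivative deriv step x) (at x)"
proof -
  have "step differentiable (at x)" using Cinf_on_differentiable[OF Cinf_step] by simp
  then show ?thesis by (simp add: DERIV_deriv_iff_real_differentiable)
qed

lemma deriv_step_eq_0: "x < 1 \<or> x > 2 \<Longrightarrow> deriv step x = 0"
proof (elim disjE)
  assume "x < 1"
  have "(step has_field_derivative 0) (at x)"
    by (rule has_field_derivative_transform_within_open[of "\<lambda>_. 1" 0 x "{..<1}"]) (use \<open>x < 1\<close> in \<open>auto simp: step_1\<close>)
  then show ?thesis by (rule DERIV_imp_deriv)
next
  assume "x > 2"
  have "(step has_field_derivative 0) (at x)"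
    by (rule has_field_derivative_transform_within_open[of "\<lambda>_. 0" 0 x "{2<..}"]) (use \<open>x > 2\<close> in \<open>auto simp: step_0\<close>)
  then show ?thesis by (rule DERIV_imp_deriv)
qed

lemma deriv_step_bounded: obtains K where "K \<ge> 0" "\<And>x. \<bar>deriv step x\<bar> \<le> K"
proof -
  have "deriv step x = frechet_derivative step (at x) 1" for x
    using frechet_derivative_at[OF step_differentiable[of x, unfolded has_field_derivative_def]] by (metis mult.right_neutral)
  then have "continuous_on {1..2} (deriv step)"
    using continuous_on_subset[OF Cinf_on_continuous[OF Cinf_on_frechet[OF open_UNIV Cinf_step Cinf_on_const, of 1]] subset_UNIV]
    by simp
  then have "bounded (deriv step ` {1..2})" by (intro compact_imp_bounded compact_continuous_image) auto
  then obtain K where "\<forall>x\<in>{1..2}. \<bar>deriv step x\<bar> \<le> K" by (auto simp: bounded_iff)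
  then have "\<bar>deriv step x\<bar> \<le> max K 0" for x
    using deriv_step_eq_0[of x] by (cases "x \<in> {1..2}") force+
  then show ?thesis using that by (metis max.cobounded2)
qed

lemma dchi_eq: "dchi \<tau> N m y = deriv step ((y \<bullet> y) / real (Suc N)) * (y$m * (1 + y \<bullet> y) / real (Suc N))"
proof -
  have h: "((\<lambda>y::real^3. (y \<bullet> y) / real (Suc N)) has_derivative (\<lambda>h. 2 * (y \<bullet> h) / real (Suc N))) (at y)"
    by (auto intro!: derivative_eq_intros simp: inner_commute)
  have "pd (chi N) \<alpha> y = 2 * y$\<alpha> / real (Suc N) * deriv step ((y \<bullet> y) / real (Suc N))" for \<alpha>
    using pd_eq[OF DERIV_compose_FDERIV[OF step_differentiable h], of \<alpha>]
    unfolding chi_def[abs_def] by (simp add: inner_axis)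
  then have "dchi \<tau> N m y = deriv step ((y \<bullet> y) / real (Suc N)) * (2 / real (Suc N) * (\<Sum>\<alpha>\<in>UNIV. y$\<alpha> * Eh \<tau> y $ m $ \<alpha>))"
    unfolding dchi_def by (simp add: sum_distrib_left mult_ac)
  then show ?thesis unfolding sum_y_Eh by (simp del: of_nat_Suc)
qed

text \<open>The derivative of the cutoff lives where |y|^2 lies between N + 1 and 2 (N + 1). There
  (1 + |y|^2) / (N + 1) is at most 3, so by \<open>dchi_eq\<close> only a factor of the size of |y|
  remains, uniformly in \<open>N\<close>.\<close>

lemma dchi_bound: obtains K where "K \<ge> 0" "\<And>N m y. \<bar>dchi \<tau> N m y\<bar> \<le> K * sqrt (1 + y \<bullet> y)"
proof -
  obtain K where K: "K \<ge> 0" "\<And>x. \<bar>deriv step x\<bar> \<le> K" by (rule deriv_step_bounded) blast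
  have "\<bar>dchi \<tau> N m y\<bar> \<le> 4 * K * sqrt (1 + y \<bullet> y)" for N m and y :: "real^3"
  proof (cases "1 \<le> (y \<bullet> y) / real (Suc N) \<and> (y \<bullet> y) / real (Suc N) \<le> 2")
    case False
    then have "dchi \<tau> N m y = 0" unfolding dchi_eq using deriv_step_eq_0[of "(y \<bullet> y) / real (Suc N)"] by auto
    then show ?thesis using K(1) one_plus_inner[of y] by simp
  next
    case True
    have n: "real (Suc N) \<ge> 1" by simp
    then have 1: "real (Suc N) \<le> y \<bullet> y" "y \<bullet> y \<le> 2 * real (Suc N)" using True by (auto simp: field_simps)
    have "(1 + y \<bullet> y) / real (Suc N) \<le> 4"
      using 1 n by (simp add: divide_le_eq del: of_nat_Suc)
    moreover have "\<bar>y$m\<bar> \<le> sqrt (1 + y \<bullet> y)"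
    proof -
      have "\<bar>y$m\<bar> \<le> norm y" by (rule component_le_norm_cart)
      also have "norm y \<le> sqrt (1 + y \<bullet> y)" by (simp add: norm_eq_sqrt_inner)
      finally show ?thesis .
    qed
    ultimately have "\<bar>y$m\<bar> * ((1 + y \<bullet> y) / real (Suc N)) \<le> sqrt (1 + y \<bullet> y) * 4"
      using one_plus_inner[of y] by (intro mult_mono) auto
    then have "\<bar>deriv step ((y \<bullet> y) / real (Suc N))\<bar> * (\<bar>y$m\<bar> * ((1 + y \<bullet> y) / real (Suc N))) \<le> K * (sqrt (1 + y \<bullet> y) * 4)"
      by (rule mult_mono[OF K(2)]) (use K(1) one_plus_inner[of y] in \<open>auto simp del: of_nat_Suc\<close>)
    then show ?thesis unfolding dchi_eq using one_plus_inner[of y] by (simp add: abs_mult mult_ac del: of_nat_Suc)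
  qed
  then show ?thesis using that[of "4 * K"] K(1) by simp
qed

lemma chi_eventually: "\<forall>\<^sub>F N in sequentially. chi N y = 1 \<and> (\<forall>m. dchi \<tau> N m y = 0)"
proof -
  have "\<forall>\<^sub>F N in sequentially. y \<bullet> y < real N"
    by (metis filterlim_real_sequentially filterlim_at_top_dense)
  then show ?thesis
  proof eventually_elim
    case (elim N)
    then have "(y \<bullet> y) / real (Suc N) < 1" by simp
    then show ?case by (simp add: chi_def step_1 dchi_eq deriv_step_eq_0 del: of_nat_Suc)
  qed
qed

lemma continuous_chi: "continuous_on UNIV (chi N)" and continuous_dchi: "continuous_on UNIV (dchi \<tau> N m)"
proof -
  show "continuous_on UNIV (chi N)" by (rule Cinf_on_continuous[OF Cinf_chi])
  have "Cinf_on (dchi \<tau> N m) UNIV" unfolding dchi_def[abs_def]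
    by (intro Cinf_on_sum Cinf_on_mult Cinf_Eh Cinf_pd Cinf_chi open_UNIV)
  then show "continuous_on UNIV (dchi \<tau> N m)" by (rule Cinf_on_continuous)
qed

text \<open>A point has zero capacity in dimension three, so the cutoff near the pole disappears in the limit.\<close>

lemma cutoff_limit:
  fixes h :: "real^3 \<Rightarrow> 'b::{banach, second_countable_topology}" and k :: "3 \<Rightarrow> real^3 \<Rightarrow> 'b"
  assumes h: "integrable Mst h" and km: "\<And>m. k m \<in> borel_measurable lebesgue"
    and k: "\<And>m. integrable Mst (\<lambda>y. (norm (k m y))\<^sup>2)"
  shows "(\<lambda>N. LINT y|Mst. chi N y *\<^sub>R h y + (\<Sum>m\<in>UNIV. dchi \<tau> N m y *\<^sub>R k m y)) \<longlonglongrightarrow> (LINT y|Mst. h y)"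
proof -
  obtain K where K: "K \<ge> 0" "\<And>N m y. \<bar>dchi \<tau> N m y\<bar> \<le> K * sqrt (1 + y \<bullet> y)" by (rule dchi_bound) blast
  have [measurable]: "chi N \<in> borel_measurable lebesgue" "dchi \<tau> N m \<in> borel_measurable lebesgue" for N m
    by (intro continuous_borel_lebesgue continuous_chi continuous_dchi)+
  have [measurable]: "h \<in> borel_measurable lebesgue" "k m \<in> borel_measurable lebesgue" for m
    using borel_measurable_integrable[OF h] km by auto
  show ?thesis
  proof (rule integral_dominated_convergence)
    \<comment> \<open>The dominating function: the product of sqrt (1 + y . y) with the norm of
      \<open>k m y\<close> is bounded by the sum of their squares, and each square is
      integrable.\<close>
    show "integrable Mst (\<lambda>y. norm (h y) + (\<Sum>m\<in>UNIV. K * ((1 + y \<bullet> y) + (norm (k m y))\<^sup>2)))"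
      by (intro Bochner_Integration.integrable_add integrable_norm h Bochner_Integration.integrable_sum integrable_mult_right Mst_one_plus_inner k)
    show "AE y in Mst. (\<lambda>N. chi N y *\<^sub>R h y + (\<Sum>m\<in>UNIV. dchi \<tau> N m y *\<^sub>R k m y)) \<longlonglongrightarrow> h y"
    proof (rule AE_I2)
      fix y
      have "\<forall>\<^sub>F N in sequentially. chi N y *\<^sub>R h y + (\<Sum>m\<in>UNIV. dchi \<tau> N m y *\<^sub>R k m y) = h y"
        using chi_eventually[of y \<tau>] by eventually_elim simp
      then show "(\<lambda>N. chi N y *\<^sub>R h y + (\<Sum>m\<in>UNIV. dchi \<tau> N m y *\<^sub>R k m y)) \<longlonglongrightarrow> h y"
        by (rule tendsto_eventually)
    qed
    show "AE y in Mst. norm (chi N y *\<^sub>R h y + (\<Sum>m\<in>UNIV. dchi \<tau> N m y *\<^sub>R k m y))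
       \<le> norm (h y) + (\<Sum>m\<in>UNIV. K * ((1 + y \<bullet> y) + (norm (k m y))\<^sup>2))" for N
    proof (rule AE_I2)
      fix y
      have 1: "norm (chi N y *\<^sub>R h y) \<le> norm (h y)"
        using chi_bounds[of N y] by (simp add: mult_left_le_one_le)
      have "norm (dchi \<tau> N m y *\<^sub>R k m y) \<le> K * ((1 + y \<bullet> y) + (norm (k m y))\<^sup>2)" for m
      proof -
        have "norm (dchi \<tau> N m y *\<^sub>R k m y) \<le> K * sqrt (1 + y \<bullet> y) * norm (k m y)"
          using K(2)[of N m y] by (simp add: mult_right_mono)
        moreover have "sqrt (1 + y \<bullet> y) * norm (k m y) \<le> (1 + y \<bullet> y) + (norm (k m y))\<^sup>2"
        proof -
          have "0 \<le> (sqrt (1 + y \<bullet> y) - norm (k m y))\<^sup>2" by simp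
          then have "2 * (sqrt (1 + y \<bullet> y) * norm (k m y)) \<le> (1 + y \<bullet> y) + (norm (k m y))\<^sup>2"
            using one_plus_inner[of y] by (simp add: power2_diff)
          moreover have "0 \<le> sqrt (1 + y \<bullet> y) * norm (k m y)" using one_plus_inner[of y] by simp
          ultimately show ?thesis by linarith
        qed
        ultimately show ?thesis
          using mult_left_mono[OF _ K(1), of "sqrt (1 + y \<bullet> y) * norm (k m y)" "(1 + y \<bullet> y) + (norm (k m y))\<^sup>2"] by (simp add: mult.assoc)
      qed
      then have "norm (\<Sum>m\<in>UNIV. dchi \<tau> N m y *\<^sub>R k m y) \<le> (\<Sum>m\<in>UNIV. K * ((1 + y \<bullet> y) + (norm (k m y))\<^sup>2))"
        by (intro sum_norm_le) auto
      then show "norm (chi N y *\<^sub>R h y + (\<Sum>m\<in>UNIV. dchi \<tau> N m y *\<^sub>R k m y))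
       \<le> norm (h y) + (\<Sum>m\<in>UNIV. K * ((1 + y \<bullet> y) + (norm (k m y))\<^sup>2))"
        using 1 norm_triangle_mono by blast
    qed
  qed measurable
qed

lemma compact_S3: "compact S3" by (simp add: S3_def)

lemma S3_nonzero: "S3 \<subseteq> - {0}" by (auto simp: S3_def)

lemma stereo_bounded:
  assumes "continuous_on S3 f" obtains C where "C \<ge> 0" "\<And>y. norm (f (stereo y)) \<le> C"
proof -
  have "bounded (f ` S3)" by (intro compact_imp_bounded compact_continuous_image assms compact_S3)
  then obtain C where "\<And>x. x \<in> S3 \<Longrightarrow> norm (f x) \<le> C" by (auto simp: bounded_iff)
  then show ?thesis using that[of "max C 0"] stereo_S3 by (simp add: max.coboundedI1)
qed

lemma stereo_integrable:
  fixes f :: "real^4 \<Rightarrow> 'b::euclidean_space"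
  assumes "continuous_on S3 f" shows "integrable Mst (\<lambda>y. f (stereo y))"
proof -
  obtain C where "C \<ge> 0" "\<And>y. norm (f (stereo y)) \<le> C" using stereo_bounded[OF assms] by blast
  then show ?thesis
    by (intro Mst.integrable_const_bound[of _ C]) (auto intro: stereo_measurable_comp assms)
qed

text \<open>The divergence theorem on the closed sphere. After multiplication by
  \<open>chi N\<close> the integrand is a divergence of compactly supported functions on the chart,
  since the field itself is divergence-free; \<open>cutoff_limit\<close> then removes the
  cutoff.\<close>

lemma integral_Ed_zero:
  fixes f :: "real^4 \<Rightarrow> real"
  assumes f: "Cinf_on f (- {0})"
  shows "(LINT y|Mst. Ed \<tau> m f (stereo y)) = 0"
proof -
  define F where "F y = f (stereo y)" for y
  have nz: "stereo y \<noteq> 0" for y using norm_stereo[of y] by auto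
  have F: "Cinf_on F UNIV" unfolding F_def
    by (rule Cinf_on_compose[OF _ _ f Cinf_stereo]) (use nz in auto)
  have cF: "continuous_on S3 f" "continuous_on S3 (Ed \<tau> m f)"
    by (rule continuous_on_subset[OF Cinf_on_continuous S3_nonzero], intro f Cinf_Ed open_Compl finite_imp_closed, simp)+
  have d: "F differentiable at y" "chi N differentiable at y" "(\<lambda>y. Jac y * Eh \<tau> y $ m $ \<alpha>) differentiable at y"
     "(\<lambda>y. chi N y * F y) differentiable at y" for y N \<alpha>
    by (rule Cinf_on_differentiable[where S=UNIV]; intro F Cinf_chi Cinf_on_mult Cinf_Jac Cinf_Eh open_UNIV UNIV_I)+
  \<comment> \<open>\<open>cutoff_limit\<close> sums the cutoff terms of all three fields; here only
    the field \<open>m\<close> contributes one.\<close>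
  define k where "k j y = (if j = m then F y else 0)" for j y
  have ck: "continuous_on UNIV (k j)" for j
    by (cases "j = m") (simp_all add: k_def Cinf_on_continuous[OF F])
  have meas: "(\<lambda>y. chi N y *\<^sub>R Ed \<tau> m f (stereo y) + (\<Sum>j\<in>UNIV. dchi \<tau> N j y *\<^sub>R k j y)) \<in> borel_measurable lebesgue" for N
    by (intro continuous_borel_lebesgue continuous_intros continuous_chi continuous_dchi ck continuous_on_compose2[OF cF(2) continuous_stereo])
      (auto simp: stereo_S3)
  have z: "(LINT y|Mst. chi N y *\<^sub>R Ed \<tau> m f (stereo y) + (\<Sum>j\<in>UNIV. dchi \<tau> N j y *\<^sub>R k j y)) = 0" for N
  proof -
    let ?G = "\<lambda>\<alpha> y. Jac y * Eh \<tau> y $ m $ \<alpha> * (chi N y * F y)"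
    have s: "Cinf_on (?G \<alpha>) UNIV" for \<alpha>
      by (intro F Cinf_chi Cinf_on_mult Cinf_Jac Cinf_Eh open_UNIV)
    have supp: "?G \<alpha> y = 0" if "y \<notin> cball 0 (sqrt (2 * real (Suc N)))" for \<alpha> y
      using chi_support[OF that] by simp
    have i: "integrable lebesgue (pd (?G \<alpha>) \<alpha>)" for \<alpha>
    proof -
      have c: "continuous_on UNIV (pd (?G \<alpha>) \<alpha>)" by (intro Cinf_on_continuous Cinf_pd s open_UNIV)
      have pz: "pd (?G \<alpha>) \<alpha> y = 0" if "y \<notin> cball 0 (sqrt (2 * real (Suc N)))" for y
      proof -
        have "pd (?G \<alpha>) \<alpha> y = pd (\<lambda>_. 0) \<alpha> y"
          by (rule pd_cong[of "- cball 0 (sqrt (2 * real (Suc N)))"]) (use that supp in auto)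
        then show ?thesis by simp
      qed
      have e: "indicator (cball 0 (sqrt (2 * real (Suc N)))) y *\<^sub>R pd (?G \<alpha>) \<alpha> y = pd (?G \<alpha>) \<alpha> y" for y
        using pz[of y] by (cases "y \<in> cball 0 (sqrt (2 * real (Suc N)))") (simp_all only: indicator_simps scaleR_one scaleR_zero_left not_False_eq_True)
      have "integrable lborel (\<lambda>y. indicator (cball 0 (sqrt (2 * real (Suc N)))) y *\<^sub>R pd (?G \<alpha>) \<alpha> y)"
        by (rule borel_integrable_compact) (auto intro: continuous_on_subset[OF c])
      then show ?thesis unfolding e by (rule integrable_completion[THEN iffD2, rotated]) (use c in \<open>auto intro: borel_measurable_continuous_onI\<close>)
    qed
    have eq: "(\<Sum>\<alpha>\<in>UNIV. pd (?G \<alpha>) \<alpha> y) = Jac y *\<^sub>R (chi N y *\<^sub>R Ed \<tau> m f (stereo y) + (\<Sum>j\<in>UNIV. dchi \<tau> N j y *\<^sub>R k j y))" for y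
    proof -
      have "pd (?G \<alpha>) \<alpha> y = Jac y * Eh \<tau> y $ m $ \<alpha> * (chi N y * pd F \<alpha> y + pd (chi N) \<alpha> y * F y)
         + pd (\<lambda>y. Jac y * Eh \<tau> y $ m $ \<alpha>) \<alpha> y * (chi N y * F y)" for \<alpha>
        unfolding pd_bilinear[OF bounded_bilinear_mult d(3,4)] pd_bilinear[OF bounded_bilinear_mult d(2,1)] by simp
      then have "(\<Sum>\<alpha>\<in>UNIV. pd (?G \<alpha>) \<alpha> y) = Jac y * (chi N y * (\<Sum>\<alpha>\<in>UNIV. Eh \<tau> y $ m $ \<alpha> * pd F \<alpha> y) + dchi \<tau> N m y * F y)
         + (\<Sum>\<alpha>\<in>UNIV. pd (\<lambda>y. Jac y * Eh \<tau> y $ m $ \<alpha>) \<alpha> y) * (chi N y * F y)"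
        by (simp add: dchi_def sum_3 algebra_simps)
      moreover have "Ed \<tau> m f (stereo y) = (\<Sum>\<alpha>\<in>UNIV. Eh \<tau> y $ m $ \<alpha> * pd F \<alpha> y)"
        using Ed_stereo[OF Cinf_on_differentiable[OF f], of y \<tau> m] nz unfolding F_def by simp
      moreover have "(\<Sum>j\<in>UNIV. dchi \<tau> N j y *\<^sub>R k j y) = dchi \<tau> N m y * F y"
        by (simp add: k_def if_distrib cong: if_cong)
      ultimately show ?thesis unfolding div_Eh by simp
    qed
    have "(LINT y|lebesgue. (\<Sum>\<alpha>\<in>UNIV. pd (?G \<alpha>) \<alpha> y)) = (\<Sum>\<alpha>\<in>UNIV. LINT y|lebesgue. pd (?G \<alpha>) \<alpha> y)"
      by (rule Bochner_Integration.integral_sum) (rule i)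
    also have "\<dots> = 0"
      by (rule sum.neutral) (use integral_pd_zero[OF s bounded_cball supp] in blast)
    finally show ?thesis
      unfolding eq
      unfolding integral_Mst[OF meas] .
  qed
  have "(\<lambda>N. LINT y|Mst. chi N y *\<^sub>R Ed \<tau> m f (stereo y) + (\<Sum>j\<in>UNIV. dchi \<tau> N j y *\<^sub>R k j y)) \<longlonglongrightarrow> (LINT y|Mst. Ed \<tau> m f (stereo y))"
  proof (rule cutoff_limit)
    show "integrable Mst (\<lambda>y. Ed \<tau> m f (stereo y))" by (rule stereo_integrable[OF cF(2)])
    show "k j \<in> borel_measurable lebesgue" for j
      by (rule continuous_borel_lebesgue[OF ck])
    have "integrable Mst (\<lambda>y. (norm (f (stereo y)))\<^sup>2)"
      by (rule stereo_integrable) (intro continuous_intros cF)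
    then show "integrable Mst (\<lambda>y. (norm (k j y))\<^sup>2)" for j
      by (cases "j = m") (auto simp: k_def F_def)
  qed
  then show ?thesis unfolding z by (simp add: LIMSEQ_const_iff)
qed

section \<open>The Poisson equation with estimates\<close>

definition pint :: "(real^4 \<Rightarrow> real) \<Rightarrow> real"
  where "pint f = (LINT y|Mst. f (stereo y))"

lemma poly_continuous: "real_polynomial_function p \<Longrightarrow> continuous_on S p"
  using Cinf_on_continuous[OF Cinf_poly] continuous_on_subset by blast

lemma poly_integrable: "real_polynomial_function p \<Longrightarrow> integrable Mst (\<lambda>y. p (stereo y))"
  by (intro stereo_integrable poly_continuous)

lemma pint_add: "real_polynomial_function p \<Longrightarrow> real_polynomial_function q \<Longrightarrow> pint (\<lambda>x. p x + q x) = pint p + pint q"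
  unfolding pint_def by (intro Bochner_Integration.integral_add poly_integrable)

lemma pint_cmult: "pint (\<lambda>x. c * p x) = c * pint p"
  unfolding pint_def by simp

lemma pint_sum: "(\<And>i. i \<in> I \<Longrightarrow> real_polynomial_function (p i)) \<Longrightarrow> pint (\<lambda>x. \<Sum>i\<in>I. p i x) = (\<Sum>i\<in>I. pint (p i))"
  unfolding pint_def by (intro Bochner_Integration.integral_sum poly_integrable)

lemma pint_cong: "(\<And>x. norm x = 1 \<Longrightarrow> p x = q x) \<Longrightarrow> pint p = pint q"
  unfolding pint_def by (simp add: norm_stereo)

lemma pint_mono:
  assumes "real_polynomial_function p" "real_polynomial_function q" "\<And>x. norm x = 1 \<Longrightarrow> p x \<le> q x"
  shows "pint p \<le> pint q"
  unfolding pint_def by (intro integral_mono poly_integrable assms) (simp add: norm_stereo)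

lemma pint_nonneg: "(\<And>x. norm x = 1 \<Longrightarrow> p x \<ge> 0) \<Longrightarrow> pint p \<ge> 0"
  unfolding pint_def by (intro integral_nonneg_AE) (auto simp: norm_stereo)

lemmas rpf_mult = real_polynomial_function.intros(4) and rpf_add = real_polynomial_function.intros(3)
  and rpf_const = real_polynomial_function.intros(2)

lemma pint_Ed: "real_polynomial_function p \<Longrightarrow> pint (Ed \<tau> m p) = 0"
  unfolding pint_def by (intro integral_Ed_zero Cinf_on_subset[OF Cinf_poly]) auto

lemma pint_by_parts:
  assumes p: "real_polynomial_function p" and q: "real_polynomial_function q"
  shows "pint (\<lambda>x. p x * Ed \<tau> m q x) = - pint (\<lambda>x. Ed \<tau> m p x * q x)"
proof -
  have "0 = pint (\<lambda>x. p x * Ed \<tau> m q x + Ed \<tau> m p x * q x)"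
    using pint_Ed[OF rpf_mult[OF p q], of \<tau> m] by (simp add: poly_Ed_simps[OF p q])
  also have "\<dots> = pint (\<lambda>x. p x * Ed \<tau> m q x) + pint (\<lambda>x. Ed \<tau> m p x * q x)"
    by (intro pint_add rpf_mult poly_Ed p q)
  finally show ?thesis by simp
qed

lemma poly_Ed_sum3: "real_polynomial_function p \<Longrightarrow> real_polynomial_function q \<Longrightarrow> real_polynomial_function r \<Longrightarrow>
   Ed \<tau> m (\<lambda>x. a * p x + b * q x + c * r x) = (\<lambda>x. a * Ed \<tau> m p x + b * Ed \<tau> m q x + c * Ed \<tau> m r x)"
  by (simp add: poly_Ed_simps rpf_add rpf_mult rpf_const Ed_const)

lemma poly_Ed_swap:
  assumes \<tau>: "\<tau> = 1 \<or> \<tau> = -1" and p: "real_polynomial_function p"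
  shows "Ed \<tau> j (Ed \<tau> k p) = (\<lambda>x. Ed \<tau> k (Ed \<tau> j p) x + (\<Sum>l\<in>UNIV. 2 * \<tau> * eps3 j k l * Ed \<tau> l p x))"
  using poly_Ed_commutator[OF \<tau> p, of j k] by (auto simp: algebra_simps)

text \<open>The Laplacian is the Casimir element of the Lie algebra of the fields. Commuting
  \<open>Ed \<tau> j\<close> past it leaves products of fields symmetrised in i and l, multiplied by
  coefficients antisymmetric in i and l; their sum is zero.\<close>

lemma Ed_Lap:
  assumes \<tau>: "\<tau> = 1 \<or> \<tau> = -1" and p: "real_polynomial_function p"
  shows "Ed \<tau> j (Lap \<tau> p) x = Lap \<tau> (Ed \<tau> j p) x"
proof -
  have "Lap \<tau> p = (\<lambda>x. 1 * Ed \<tau> 1 (Ed \<tau> 1 p) x + 1 * Ed \<tau> 2 (Ed \<tau> 2 p) x + 1 * Ed \<tau> 3 (Ed \<tau> 3 p) x)"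
    by (simp add: Lap_def[abs_def] sum_3)
  then have L: "Ed \<tau> j (Lap \<tau> p) x = Ed \<tau> j (Ed \<tau> 1 (Ed \<tau> 1 p)) x + Ed \<tau> j (Ed \<tau> 2 (Ed \<tau> 2 p)) x + Ed \<tau> j (Ed \<tau> 3 (Ed \<tau> 3 p)) x"
    using poly_Ed_sum3[of "Ed \<tau> 1 (Ed \<tau> 1 p)" "Ed \<tau> 2 (Ed \<tau> 2 p)" "Ed \<tau> 3 (Ed \<tau> 3 p)" \<tau> j 1 1 1] p
    by (simp add: poly_Ed)
  define c where "c i = (\<lambda>l. 2 * \<tau> * eps3 j i l)" for i
  have s: "Ed \<tau> j (Ed \<tau> i q) = (\<lambda>x. Ed \<tau> i (Ed \<tau> j q) x + (c i 1 * Ed \<tau> 1 q x + c i 2 * Ed \<tau> 2 q x + c i 3 * Ed \<tau> 3 q x))"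
    if "real_polynomial_function q" for q i
    using poly_Ed_swap[OF \<tau> that, of j i] unfolding sum_3 c_def .
  have 1: "Ed \<tau> j (Ed \<tau> i (Ed \<tau> i p)) x = Ed \<tau> i (Ed \<tau> i (Ed \<tau> j p)) x
     + (c i 1 * Ed \<tau> i (Ed \<tau> 1 p) x + c i 2 * Ed \<tau> i (Ed \<tau> 2 p) x + c i 3 * Ed \<tau> i (Ed \<tau> 3 p) x)
     + (c i 1 * Ed \<tau> 1 (Ed \<tau> i p) x + c i 2 * Ed \<tau> 2 (Ed \<tau> i p) x + c i 3 * Ed \<tau> 3 (Ed \<tau> i p) x)" for i
  proof -
    have "Ed \<tau> i (Ed \<tau> j (Ed \<tau> i p)) = Ed \<tau> i (\<lambda>x. Ed \<tau> i (Ed \<tau> j p) x + (c i 1 * Ed \<tau> 1 p x + c i 2 * Ed \<tau> 2 p x + c i 3 * Ed \<tau> 3 p x))"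
      by (rule arg_cong[OF s[OF p]])
    also have "\<dots> = (\<lambda>x. Ed \<tau> i (Ed \<tau> i (Ed \<tau> j p)) x + Ed \<tau> i (\<lambda>x. c i 1 * Ed \<tau> 1 p x + c i 2 * Ed \<tau> 2 p x + c i 3 * Ed \<tau> 3 p x) x)"
      by (rule poly_Ed_simps(1)) (intro rpf_add rpf_mult rpf_const poly_Ed p)+
    also have "Ed \<tau> i (\<lambda>x. c i 1 * Ed \<tau> 1 p x + c i 2 * Ed \<tau> 2 p x + c i 3 * Ed \<tau> 3 p x)
       = (\<lambda>x. c i 1 * Ed \<tau> i (Ed \<tau> 1 p) x + c i 2 * Ed \<tau> i (Ed \<tau> 2 p) x + c i 3 * Ed \<tau> i (Ed \<tau> 3 p) x)"
      by (rule poly_Ed_sum3) (intro poly_Ed p)+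
    finally show ?thesis using fun_cong[OF s[OF poly_Ed[OF p, of \<tau> i], of i], of x] by simp
  qed
  show ?thesis
    unfolding L 1 Lap_def sum_3 c_def
    using exhaust_3[of j] by (elim disjE; simp add: eps3_def)
qed

text \<open>Integrate by parts once to move a field off the second Laplacian, commute it past the
  first one by \<open>Ed_Lap\<close>, and integrate by parts again. No curvature term appears,
  because the derivatives are taken along invariant fields.\<close>

lemma pint_Lap_square:
  assumes \<tau>: "\<tau> = 1 \<or> \<tau> = -1" and p: "real_polynomial_function p"
  shows "pint (\<lambda>x. (Lap \<tau> p x)\<^sup>2) = (\<Sum>j\<in>UNIV. \<Sum>i\<in>UNIV. pint (\<lambda>x. (Ed \<tau> i (Ed \<tau> j p) x)\<^sup>2))"
proof -
  have "pint (\<lambda>x. (Lap \<tau> p x)\<^sup>2) = pint (\<lambda>x. \<Sum>j\<in>UNIV. Lap \<tau> p x * Ed \<tau> j (Ed \<tau> j p) x)"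
    by (rule pint_cong) (simp add: power2_eq_square Lap_def[of \<tau> p] sum_distrib_left)
  also have "\<dots> = (\<Sum>j\<in>UNIV. pint (\<lambda>x. Lap \<tau> p x * Ed \<tau> j (Ed \<tau> j p) x))"
    by (intro pint_sum rpf_mult poly_Lap poly_Ed p)
  also have "\<dots> = (\<Sum>j\<in>UNIV. - pint (\<lambda>x. Lap \<tau> (Ed \<tau> j p) x * Ed \<tau> j p x))"
    by (simp add: pint_by_parts poly_Lap poly_Ed p Ed_Lap[OF \<tau> p])
  also have "\<dots> = (\<Sum>j\<in>UNIV. \<Sum>i\<in>UNIV. pint (\<lambda>x. (Ed \<tau> i (Ed \<tau> j p) x)\<^sup>2))"
  proof (rule sum.cong[OF refl])
    fix j :: 3
    have "pint (\<lambda>x. Lap \<tau> (Ed \<tau> j p) x * Ed \<tau> j p x) = pint (\<lambda>x. \<Sum>i\<in>UNIV. Ed \<tau> j p x * Ed \<tau> i (Ed \<tau> i (Ed \<tau> j p)) x)"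
      by (rule pint_cong) (simp add: Lap_def sum_distrib_left mult.commute)
    also have "\<dots> = (\<Sum>i\<in>UNIV. pint (\<lambda>x. Ed \<tau> j p x * Ed \<tau> i (Ed \<tau> i (Ed \<tau> j p)) x))"
      by (intro pint_sum rpf_mult poly_Ed p)
    also have "\<dots> = - (\<Sum>i\<in>UNIV. pint (\<lambda>x. (Ed \<tau> i (Ed \<tau> j p) x)\<^sup>2))"
      by (simp add: pint_by_parts poly_Ed p power2_eq_square sum_negf)
    finally show "- pint (\<lambda>x. Lap \<tau> (Ed \<tau> j p) x * Ed \<tau> j p x) = (\<Sum>i\<in>UNIV. pint (\<lambda>x. (Ed \<tau> i (Ed \<tau> j p) x)\<^sup>2))" by simp
  qed
  finally show ?thesis .
qed

definition grad2 :: "real \<Rightarrow> (real^4 \<Rightarrow> real) \<Rightarrow> real"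
  where "grad2 \<tau> p = (\<Sum>l\<in>UNIV. pint (\<lambda>x. (Ed \<tau> l p x)\<^sup>2))"

lemma poly_square: "real_polynomial_function p \<Longrightarrow> real_polynomial_function (\<lambda>x. (p x)\<^sup>2)"
  by (rule real_polynomial_function_power)

text \<open>A first derivative is, up to the factor 2 \<tau>, the difference of two mixed second
  derivatives. The noncommuting fields thus control the gradient by second derivatives, which takes
  the place of a spectral gap.\<close>

lemma grad2_le_Lap:
  assumes \<tau>: "\<tau> = 1 \<or> \<tau> = -1" and p: "real_polynomial_function p"
  shows "2 * grad2 \<tau> p \<le> pint (\<lambda>x. (Lap \<tau> p x)\<^sup>2)"
proof -
  let ?d = "\<lambda>i j x. Ed \<tau> i (Ed \<tau> j p) x"
  have t2: "\<tau>\<^sup>2 = 1" using \<tau> by auto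
  have pw: "2 * (\<Sum>l\<in>UNIV. (Ed \<tau> l p x)\<^sup>2) \<le> (\<Sum>j\<in>UNIV. \<Sum>i\<in>UNIV. (?d i j x)\<^sup>2)" for x
  proof -
    have q: "2 * u\<^sup>2 \<le> a\<^sup>2 + b\<^sup>2" if "a - b = 2 * \<tau> * u" for a b u :: real
    proof -
      have "4 * u\<^sup>2 = (a - b)\<^sup>2" unfolding that by (simp add: power_mult_distrib t2)
      also have "\<dots> \<le> 2 * (a\<^sup>2 + b\<^sup>2)" using zero_le_power2[of "a + b"] by (simp add: power2_eq_square algebra_simps)
      finally show ?thesis by simp
    qed
    have "2 * (Ed \<tau> 3 p x)\<^sup>2 \<le> (?d 1 2 x)\<^sup>2 + (?d 2 1 x)\<^sup>2" "2 * (Ed \<tau> 1 p x)\<^sup>2 \<le> (?d 2 3 x)\<^sup>2 + (?d 3 2 x)\<^sup>2"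
      "2 * (Ed \<tau> 2 p x)\<^sup>2 \<le> (?d 3 1 x)\<^sup>2 + (?d 1 3 x)\<^sup>2"
      by (rule q, simp add: poly_Ed_commutator[OF \<tau> p] sum_3 eps3_def)+
    note le = this
    have lin: "2 * (u1 + u2 + u3) \<le> a11 + a21 + a31 + (a12 + a22 + a32) + (a13 + a23 + a33)"
      if "2 * u3 \<le> a12 + a21" "2 * u1 \<le> a23 + a32" "2 * u2 \<le> a31 + a13" "0 \<le> a11" "0 \<le> a22" "0 \<le> a33"
      for u1 u2 u3 a11 a12 a13 a21 a22 a23 a31 a32 a33 :: real
    proof -
      have "2 * u3 + 2 * u1 + 2 * u2 + (0 + 0 + 0) \<le> (a12 + a21) + (a23 + a32) + (a31 + a13) + (a11 + a22 + a33)"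
        by (intro add_mono that)
      also have "\<dots> = a11 + a21 + a31 + (a12 + a22 + a32) + (a13 + a23 + a33)" by simp
      finally show ?thesis by (simp add: algebra_simps)
    qed
    show ?thesis unfolding sum_3 by (rule lin[OF le]) (rule zero_le_power2)+
  qed
  have "2 * grad2 \<tau> p = pint (\<lambda>x. 2 * (\<Sum>l\<in>UNIV. (Ed \<tau> l p x)\<^sup>2))"
    unfolding grad2_def pint_cmult by (simp add: pint_sum poly_square poly_Ed p)
  also have "\<dots> \<le> pint (\<lambda>x. \<Sum>j\<in>UNIV. \<Sum>i\<in>UNIV. (?d i j x)\<^sup>2)"
    by (intro pint_mono pw rpf_mult rpf_const real_polynomial_function_sum poly_square poly_Ed p) auto
  also have "\<dots> = (\<Sum>j\<in>UNIV. \<Sum>i\<in>UNIV. pint (\<lambda>x. (?d i j x)\<^sup>2))"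
    by (simp add: pint_sum real_polynomial_function_sum poly_square poly_Ed p)
  also have "\<dots> = pint (\<lambda>x. (Lap \<tau> p x)\<^sup>2)" by (rule pint_Lap_square[OF \<tau> p, symmetric])
  finally show ?thesis .
qed

text \<open>A Poincare inequality by duality. Write p - c as minus the Laplacian of \<psi> and
  integrate its square A by parts once. Then A is at most half the sum of the gradient terms of
  \<open>p\<close> and \<psi>; that of \<psi> is at most A / 2 by \<open>grad2_le_Lap\<close> and is
  absorbed.\<close>

lemma ridge_poincare:
  assumes \<tau>: "\<tau> = 1 \<or> \<tau> = -1" and p: "ridge p"
  obtains c where "pint (\<lambda>x. (p x - c)\<^sup>2) \<le> grad2 \<tau> p"
proof -
  obtain \<psi> c where \<psi>: "ridge \<psi>" and c: "\<And>x. norm x = 1 \<Longrightarrow> p x = c - Lap \<tau> \<psi> x"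
    using ridge_poisson[OF \<tau> p] by blast
  note P = ridge_poly[OF p] and R = ridge_poly[OF \<psi>]
  define A where "A = pint (\<lambda>x. (Lap \<tau> \<psi> x)\<^sup>2)"
  have A: "pint (\<lambda>x. (p x - c)\<^sup>2) = A" unfolding A_def by (rule pint_cong) (simp add: c)
  have "A = pint (\<lambda>x. \<Sum>j\<in>UNIV. (c - p x) * Ed \<tau> j (Ed \<tau> j \<psi>) x)"
  proof -
    have "(Lap \<tau> \<psi> x)\<^sup>2 = (c - p x) * Lap \<tau> \<psi> x" if "norm x = 1" for x
      using c[OF that] by (simp add: power2_eq_square)
    then show ?thesis unfolding A_def by (intro pint_cong) (simp add: Lap_def sum_distrib_left)
  qed
  also have "\<dots> = (\<Sum>j\<in>UNIV. pint (\<lambda>x. (c - p x) * Ed \<tau> j (Ed \<tau> j \<psi>) x))"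
    by (intro pint_sum rpf_mult poly_Ed R real_polynomial_function_diff rpf_const P)
  also have "\<dots> = (\<Sum>j\<in>UNIV. pint (\<lambda>x. Ed \<tau> j p x * Ed \<tau> j \<psi> x))"
  proof (rule sum.cong[OF refl])
    fix j :: 3
    have 1: "real_polynomial_function (\<lambda>x. c - p x)" by (intro real_polynomial_function_diff rpf_const P)
    have "Ed \<tau> j (\<lambda>x. c - p x) x = - Ed \<tau> j p x" for x
      by (subst Ed_diff) (auto simp: Ed_const poly_differentiable P)
    then show "pint (\<lambda>x. (c - p x) * Ed \<tau> j (Ed \<tau> j \<psi>) x) = pint (\<lambda>x. Ed \<tau> j p x * Ed \<tau> j \<psi> x)"
      using pint_by_parts[OF 1 poly_Ed[OF R, of \<tau> j], of \<tau> j] pint_cmult[of "-1" "\<lambda>x. Ed \<tau> j p x * Ed \<tau> j \<psi> x"] by simp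
  qed
  also have "\<dots> \<le> (\<Sum>j\<in>UNIV. pint (\<lambda>x. (1/2) * ((Ed \<tau> j p x)\<^sup>2 + (Ed \<tau> j \<psi> x)\<^sup>2)))"
  proof (intro sum_mono pint_mono rpf_mult rpf_const rpf_add poly_square poly_Ed P R)
    show "Ed \<tau> j p x * Ed \<tau> j \<psi> x \<le> (1/2) * ((Ed \<tau> j p x)\<^sup>2 + (Ed \<tau> j \<psi> x)\<^sup>2)" for j x
      using zero_le_power2[of "Ed \<tau> j p x - Ed \<tau> j \<psi> x"] by (simp add: power2_diff)
  qed
  also have "\<dots> = (1/2) * (grad2 \<tau> p + grad2 \<tau> \<psi>)"
    unfolding pint_cmult grad2_def sum_distrib_left[symmetric] by (simp add: pint_add poly_square poly_Ed P R sum.distrib)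
  also have "grad2 \<tau> \<psi> \<le> A / 2" using grad2_le_Lap[OF \<tau> R] unfolding A_def by simp
  finally have "A \<le> (1/2) * (grad2 \<tau> p + A / 2)" by simp
  moreover have "grad2 \<tau> p \<ge> 0" unfolding grad2_def by (intro sum_nonneg pint_nonneg) simp
  ultimately have "A \<le> grad2 \<tau> p" by simp
  then show ?thesis using that[of c] A by simp
qed

lemma pint_const: "pint (\<lambda>x. c) = c * (2 * pi\<^sup>2)"
  using measure_Mst by (simp add: pint_def mult.commute)

text \<open>The constant left over by \<open>ridge_poisson\<close> vanishes because Laplacians have
  mean zero. Shifting \<psi> by the constant of \<open>ridge_poincare\<close> affects no derivative
  and makes \<psi> itself small.\<close>

lemma ridge_poisson_estimate:
  assumes \<tau>: "\<tau> = 1 \<or> \<tau> = -1" and f: "ridge f" and mean: "pint f = 0"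
  obtains \<psi> where "real_polynomial_function \<psi>" "\<And>x. norm x = 1 \<Longrightarrow> f x = - Lap \<tau> \<psi> x"
    "pint (\<lambda>x. (\<psi> x)\<^sup>2) \<le> pint (\<lambda>x. (f x)\<^sup>2)"
    "\<And>i. pint (\<lambda>x. (Ed \<tau> i \<psi> x)\<^sup>2) \<le> pint (\<lambda>x. (f x)\<^sup>2)"
    "\<And>i j. pint (\<lambda>x. (Ed \<tau> i (Ed \<tau> j \<psi>) x)\<^sup>2) \<le> pint (\<lambda>x. (f x)\<^sup>2)"
proof -
  obtain p c where p: "ridge p" and c: "\<And>x. norm x = 1 \<Longrightarrow> f x = c - Lap \<tau> p x"
    using ridge_poisson[OF \<tau> f] by blast
  note P = ridge_poly[OF p]
  have L0: "pint (Lap \<tau> p) = 0"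
    unfolding Lap_def[abs_def] by (subst pint_sum) (auto simp: pint_Ed poly_Ed P)
  have "pint f = pint (\<lambda>x. c + (-1) * Lap \<tau> p x)" by (rule pint_cong) (simp add: c)
  also have "\<dots> = c * (2 * pi\<^sup>2)"
  proof -
    have "pint (\<lambda>x. c + (-1) * Lap \<tau> p x) = pint (\<lambda>x. c) + pint (\<lambda>x. (-1) * Lap \<tau> p x)"
      by (intro pint_add rpf_const rpf_mult poly_Lap P)
    then show ?thesis unfolding pint_cmult L0 pint_const by simp
  qed
  finally have c0: "c = 0" using mean by simp
  obtain d where d: "pint (\<lambda>x. (p x - d)\<^sup>2) \<le> grad2 \<tau> p" by (rule ridge_poincare[OF \<tau> p])
  define \<psi> where "\<psi> x = p x - d" for x
  have R: "real_polynomial_function \<psi>" unfolding \<psi>_def by (intro real_polynomial_function_diff rpf_const P)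
  have E: "Ed \<tau> i \<psi> = Ed \<tau> i p" for i
    unfolding \<psi>_def[abs_def] by (rule ext, subst Ed_diff) (auto simp: Ed_const poly_differentiable P)
  have fp: "f x = - Lap \<tau> \<psi> x" if "norm x = 1" for x
    using c[OF that] by (simp add: Lap_def E c0)
  have F: "pint (\<lambda>x. (f x)\<^sup>2) = pint (\<lambda>x. (Lap \<tau> \<psi> x)\<^sup>2)"
    by (rule pint_cong) (simp add: fp)
  have g: "2 * grad2 \<tau> \<psi> \<le> pint (\<lambda>x. (f x)\<^sup>2)" using grad2_le_Lap[OF \<tau> R] F by simp
  have nn: "pint (\<lambda>x. (h x)\<^sup>2) \<ge> 0" for h by (intro pint_nonneg) simp
  have le: "pint (\<lambda>x. (Ed \<tau> i \<psi> x)\<^sup>2) \<le> grad2 \<tau> \<psi>" for i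
    unfolding grad2_def by (rule member_le_sum[where f="\<lambda>l. pint (\<lambda>x. (Ed \<tau> l \<psi> x)\<^sup>2)"]) (auto intro: nn)
  have g0: "grad2 \<tau> \<psi> \<ge> 0" unfolding grad2_def by (intro sum_nonneg nn)
  show ?thesis
  proof (rule that[OF R fp])
    show "pint (\<lambda>x. (\<psi> x)\<^sup>2) \<le> pint (\<lambda>x. (f x)\<^sup>2)"
      using d g g0 unfolding \<psi>_def[symmetric] grad2_def E[symmetric] by linarith
    show "pint (\<lambda>x. (Ed \<tau> i \<psi> x)\<^sup>2) \<le> pint (\<lambda>x. (f x)\<^sup>2)" for i
      using le[of i] g g0 by linarith
    show "pint (\<lambda>x. (Ed \<tau> i (Ed \<tau> j \<psi>) x)\<^sup>2) \<le> pint (\<lambda>x. (f x)\<^sup>2)" for i j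
    proof -
      have "pint (\<lambda>x. (Ed \<tau> i (Ed \<tau> j \<psi>) x)\<^sup>2) \<le> (\<Sum>i\<in>UNIV. pint (\<lambda>x. (Ed \<tau> i (Ed \<tau> j \<psi>) x)\<^sup>2))"
        by (rule member_le_sum[where f="\<lambda>i. pint (\<lambda>x. (Ed \<tau> i (Ed \<tau> j \<psi>) x)\<^sup>2)"]) (auto intro: nn)
      also have "\<dots> \<le> (\<Sum>j\<in>UNIV. \<Sum>i\<in>UNIV. pint (\<lambda>x. (Ed \<tau> i (Ed \<tau> j \<psi>) x)\<^sup>2))"
        by (rule member_le_sum[where f="\<lambda>j. \<Sum>i\<in>UNIV. pint (\<lambda>x. (Ed \<tau> i (Ed \<tau> j \<psi>) x)\<^sup>2)"]) (auto intro: nn sum_nonneg)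
      finally show ?thesis unfolding F pint_Lap_square[OF \<tau> R] .
    qed
  qed
qed

section \<open>Density of ridge sums\<close>

text \<open>Exponentials of linear forms are visibly closed under products, so Stone-Weierstrass
  applies to their span. Each exponential is then approximated by a polynomial in one linear form,
  which is a ridge sum.\<close>

inductive expsum :: "(real^4 \<Rightarrow> real) \<Rightarrow> bool" where
  exp: "expsum (\<lambda>x. exp (a \<bullet> x))"
| add: "expsum f \<Longrightarrow> expsum g \<Longrightarrow> expsum (\<lambda>x. f x + g x)"
| cmult: "expsum f \<Longrightarrow> expsum (\<lambda>x. c * f x)"

lemma expsum_continuous: "expsum f \<Longrightarrow> continuous_on S f"
  by (induction rule: expsum.induct) (auto intro!: continuous_intros)

lemma expsum_mult: 
  assumes "expsum f" "expsum g" shows "expsum (\<lambda>x. f x * g x)"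
  using assms(1)
proof (induction rule: expsum.induct)
  case (exp a)
  from assms(2) show ?case
  proof (induction rule: expsum.induct)
    case (exp b)
    show ?case using expsum.exp[of "a + b"] by (simp add: inner_add_left exp_add)
  next
    case (add f g)
    then show ?case using expsum.add[OF add.IH] by (simp add: algebra_simps)
  next
    case (cmult f c)
    then show ?case using expsum.cmult[OF cmult.IH, of c] by (simp add: algebra_simps)
  qed
next
  case (add f h)
  then show ?case using expsum.add[OF add.IH] by (simp add: algebra_simps)
next
  case (cmult f c)
  then show ?case using expsum.cmult[OF cmult.IH, of c] by (simp add: algebra_simps)
qed

lemma expsum_ridge:
  assumes "expsum f" "e > 0" shows "\<exists>r. ridge r \<and> (\<forall>x\<in>S3. \<bar>f x - r x\<bar> < e)"
  using assms
proof (induction arbitrary: e rule: expsum.induct)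
  case (exp a)
  obtain g :: "real \<Rightarrow> real" where g: "real_polynomial_function g" "\<And>t. t \<in> {- norm a..norm a} \<Longrightarrow> \<bar>exp t - g t\<bar> < e"
  proof -
    have "continuous_on {- norm a..norm a} (exp :: real \<Rightarrow> real)" by (intro continuous_intros)
    from Stone_Weierstrass_real_polynomial_function[OF compact_Icc this \<open>e > 0\<close>] show thesis using that by blast
  qed
  obtain c n where c: "g = (\<lambda>t. \<Sum>i\<le>n. c i * t ^ i)"
    using g(1) real_polynomial_function_iff_sum by blast
  have "ridge (\<lambda>x. g (a \<bullet> x))" unfolding c by (intro ridge_sum ridge.cmult ridge.power) auto
  moreover have "\<bar>exp (a \<bullet> x) - g (a \<bullet> x)\<bar> < e" if "x \<in> S3" for x
    using Cauchy_Schwarz_ineq2[of a x] that by (intro g(2)) (auto simp: S3_def abs_le_iff)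
  ultimately show ?case by blast
next
  case (add f g)
  obtain r s where "ridge r" "ridge s" and r: "\<And>x. x \<in> S3 \<Longrightarrow> \<bar>f x - r x\<bar> < e / 2" and s: "\<And>x. x \<in> S3 \<Longrightarrow> \<bar>g x - s x\<bar> < e / 2"
    using add.IH[of "e / 2"] add.prems by (metis half_gt_zero)
  moreover have "\<bar>f x + g x - (r x + s x)\<bar> < e" if "x \<in> S3" for x using r[OF that] s[OF that] by linarith
  ultimately show ?case by (intro exI[of _ "\<lambda>x. r x + s x"]) (simp add: ridge.add)
next
  case (cmult f c)
  have "e / (\<bar>c\<bar> + 1) > 0" using cmult.prems by simp
  from cmult.IH[OF this] obtain r where "ridge r" and r: "\<And>x. x \<in> S3 \<Longrightarrow> \<bar>f x - r x\<bar> < e / (\<bar>c\<bar> + 1)" by blast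
  moreover have "\<bar>c * f x - c * r x\<bar> < e" if "x \<in> S3" for x
  proof -
    have "\<bar>c * f x - c * r x\<bar> = \<bar>c\<bar> * \<bar>f x - r x\<bar>" by (simp add: abs_mult[symmetric] algebra_simps)
    also have "\<dots> \<le> \<bar>c\<bar> * (e / (\<bar>c\<bar> + 1))" using r[OF that] by (intro mult_left_mono) auto
    also have "\<dots> < e" using cmult.prems by (simp add: field_simps)
    finally show ?thesis .
  qed
  ultimately show ?case by (intro exI[of _ "\<lambda>x. c * r x"]) (simp add: ridge.cmult)
qed

lemma ridge_dense:
  assumes "continuous_on S3 f" "e > 0" shows "\<exists>r. ridge r \<and> (\<forall>x\<in>S3. \<bar>f x - r x\<bar> < e)"
proof -
  interpret function_ring_on "Collect expsum" S3
  proof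
    show "(\<lambda>_. c) \<in> Collect expsum" for c
      using expsum.cmult[OF expsum.exp[of 0], of c] by simp
    show "\<exists>f\<in>Collect expsum. f x \<noteq> f y" if "x \<noteq> y" for x y
    proof (intro bexI)
      have "(x - y) \<bullet> (x - y) \<noteq> 0" using that by simp
      then show "exp ((x - y) \<bullet> x) \<noteq> exp ((x - y) \<bullet> y)" by (simp add: inner_diff_right)
    qed (simp add: expsum.exp)
  qed (auto simp: compact_S3 expsum_continuous intro: expsum.add expsum_mult)
  obtain g where "expsum g" and g: "\<And>x. x \<in> S3 \<Longrightarrow> \<bar>f x - g x\<bar> < e / 2"
    using Stone_Weierstrass_basic[OF assms(1), of "e / 2"] assms(2) by auto
  moreover obtain r where "ridge r" and r: "\<And>x. x \<in> S3 \<Longrightarrow> \<bar>g x - r x\<bar> < e / 2"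
    using expsum_ridge[OF \<open>expsum g\<close>, of "e / 2"] assms(2) by auto
  moreover have "\<bar>f x - r x\<bar> < e" if "x \<in> S3" for x using g[OF that] r[OF that] by linarith
  ultimately show ?thesis by blast
qed

section \<open>An L2 bound by duality with ridge sums\<close>

lemma square_integrable_imp_integrable:
  fixes u :: "real^3 \<Rightarrow> real"
  assumes "u \<in> borel_measurable lebesgue" "integrable Mst (\<lambda>y. (u y)\<^sup>2)" shows "integrable Mst u"
proof (rule Bochner_Integration.integrable_bound)
  show "integrable Mst (\<lambda>y. 1 + (u y)\<^sup>2)" using assms(2) by simp
  show "u \<in> borel_measurable Mst" using assms(1) by simp
  show "AE y in Mst. norm (u y) \<le> norm (1 + (u y)\<^sup>2)"
  proof (rule AE_I2)
    fix y
    have "0 \<le> (\<bar>u y\<bar> - 1)\<^sup>2" by simp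
    then have "2 * \<bar>u y\<bar> \<le> 1 + (u y)\<^sup>2" by (simp add: power2_diff)
    then show "norm (u y) \<le> norm (1 + (u y)\<^sup>2)" by simp
  qed
qed

context
  fixes u :: "real^3 \<Rightarrow> real" and K :: real
  assumes mu: "u \<in> borel_measurable lebesgue" and iu: "integrable Mst (\<lambda>y. (u y)\<^sup>2)"
begin

text \<open>The limit step for extending a bound on the functional w to \<integral> w u. It is
  applied in stages, from ridge sums to continuous functions on the sphere and from compactly
  supported continuous functions to bounded measurable ones. Bounded pointwise convergence suffices
  because \<open>u\<close> is integrable and \<open>Mst\<close> is finite.\<close>

lemma dual_bound_limit:
  fixes w :: "nat \<Rightarrow> real^3 \<Rightarrow> real"
  assumes mw: "\<And>n. w n \<in> borel_measurable lebesgue" and mW: "W \<in> borel_measurable lebesgue"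
    and lim: "AE y in lebesgue. (\<lambda>n. w n y) \<longlonglongrightarrow> W y" and bd: "\<And>n y. \<bar>w n y\<bar> \<le> C"
    and le: "\<And>n. \<bar>LINT y|Mst. w n y * u y\<bar> \<le> K * sqrt (LINT y|Mst. (w n y)\<^sup>2)"
  shows "\<bar>LINT y|Mst. W y * u y\<bar> \<le> K * sqrt (LINT y|Mst. (W y)\<^sup>2)"
proof -
  have lim': "AE y in Mst. (\<lambda>n. w n y) \<longlonglongrightarrow> W y" using lim by (simp add: AE_Mst)
  note [measurable] = mw mW mu
  have "(\<lambda>n. LINT y|Mst. w n y * u y) \<longlonglongrightarrow> (LINT y|Mst. W y * u y)"
  proof (rule integral_dominated_convergence)
    show "integrable Mst (\<lambda>y. C * \<bar>u y\<bar>)"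
      using square_integrable_imp_integrable[OF mu iu] by auto
    show "AE y in Mst. (\<lambda>n. w n y * u y) \<longlonglongrightarrow> W y * u y"
      using lim' by eventually_elim (intro tendsto_intros)
    show "AE y in Mst. norm (w n y * u y) \<le> C * \<bar>u y\<bar>" for n
      using bd by (intro AE_I2) (simp add: abs_mult mult_right_mono)
  qed (simp_all add: mw mW mu borel_measurable_times borel_measurable_power)
  then have 1: "(\<lambda>n. \<bar>LINT y|Mst. w n y * u y\<bar>) \<longlonglongrightarrow> \<bar>LINT y|Mst. W y * u y\<bar>" by (rule tendsto_rabs)
  have "(\<lambda>n. LINT y|Mst. (w n y)\<^sup>2) \<longlonglongrightarrow> (LINT y|Mst. (W y)\<^sup>2)"
  proof (rule integral_dominated_convergence)
    show "integrable Mst (\<lambda>y. C\<^sup>2)" by simp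
    show "AE y in Mst. (\<lambda>n. (w n y)\<^sup>2) \<longlonglongrightarrow> (W y)\<^sup>2"
      using lim' by eventually_elim (intro tendsto_intros)
    show "AE y in Mst. norm ((w n y)\<^sup>2) \<le> C\<^sup>2" for n
      using bd[of n] by (intro AE_I2) (metis abs_le_square_iff abs_power2 order_trans abs_ge_self real_norm_def)
  qed (simp_all add: mw mW mu borel_measurable_times borel_measurable_power)
  then have "(\<lambda>n. K * sqrt (LINT y|Mst. (w n y)\<^sup>2)) \<longlonglongrightarrow> K * sqrt (LINT y|Mst. (W y)\<^sup>2)"
    by (intro tendsto_intros)
  from LIMSEQ_le[OF 1 this] show ?thesis using le by blast
qed

context
  assumes ridge_le: "\<And>f. ridge f \<Longrightarrow> \<bar>LINT y|Mst. f (stereo y) * u y\<bar> \<le> K * sqrt (pint (\<lambda>x. (f x)\<^sup>2))"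
begin

lemma dual_bound_continuous:
  assumes f: "continuous_on S3 f"
  shows "\<bar>LINT y|Mst. f (stereo y) * u y\<bar> \<le> K * sqrt (LINT y|Mst. (f (stereo y))\<^sup>2)"
proof -
  have "\<forall>n. \<exists>r. ridge r \<and> (\<forall>x\<in>S3. \<bar>f x - r x\<bar> < 1 / real (Suc n))"
    using ridge_dense[OF f] by simp
  then obtain r where r: "\<And>n. ridge (r n)" "\<And>n x. x \<in> S3 \<Longrightarrow> \<bar>f x - r n x\<bar> < 1 / real (Suc n)" by metis
  obtain C where C: "\<And>y. norm (f (stereo y)) \<le> C" using stereo_bounded[OF f] by blast
  show ?thesis
  proof (rule dual_bound_limit[where w="\<lambda>n y. r n (stereo y)" and C="C + 1"])
    show "(\<lambda>y. r n (stereo y)) \<in> borel_measurable lebesgue" for n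
      by (intro stereo_measurable_comp poly_continuous ridge_poly r)
    show "(\<lambda>y. f (stereo y)) \<in> borel_measurable lebesgue" by (rule stereo_measurable_comp[OF f])
    show "AE y in lebesgue. (\<lambda>n. r n (stereo y)) \<longlonglongrightarrow> f (stereo y)"
    proof (rule AE_I2)
      fix y
      have "(\<lambda>n. f (stereo y) - r n (stereo y)) \<longlonglongrightarrow> 0"
        by (rule Lim_null_comparison[OF _ LIMSEQ_Suc[OF lim_1_over_n]])
          (use less_imp_le[OF r(2)[OF stereo_S3]] in \<open>auto simp del: of_nat_Suc\<close>)
      then have "(\<lambda>n. f (stereo y) - (f (stereo y) - r n (stereo y))) \<longlonglongrightarrow> f (stereo y) - 0" by (intro tendsto_intros)
      then show "(\<lambda>n. r n (stereo y)) \<longlonglongrightarrow> f (stereo y)" by simp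
    qed
    show "\<bar>r n (stereo y)\<bar> \<le> C + 1" for n y
    proof -
      have "1 / real (Suc n) \<le> 1" by simp
      then show ?thesis using r(2)[OF stereo_S3, of y n] C[of y] unfolding real_norm_def by linarith
    qed
    show "\<bar>LINT y|Mst. r n (stereo y) * u y\<bar> \<le> K * sqrt (LINT y|Mst. (r n (stereo y))\<^sup>2)" for n
      using ridge_le[OF r(1)] by (simp add: pint_def)
  qed
qed

text \<open>A compactly supported function on the chart extends by zero over the omitted pole to a
  continuous function on the sphere, to which \<open>dual_bound_continuous\<close> applies.\<close>

lemma dual_bound_compact_support:
  assumes G: "continuous_on UNIV G" and z: "\<And>y. y \<notin> cball 0 R \<Longrightarrow> G y = 0" and R: "R > 0"
  shows "\<bar>LINT y|Mst. G y * u y\<bar> \<le> K * sqrt (LINT y|Mst. (G y)\<^sup>2)"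
proof -
  \<comment> \<open>The height 1 + x_1 of the circle of latitude |y| = R + 1. Below it
    \<open>G\<close> vanishes; the cut at d / 2 leaves a band in which both formulas for
    \<open>F\<close> hold, so that they glue.\<close>
  define d where "d = 2 / (1 + (R + 1)\<^sup>2)"
  have d: "d > 0" unfolding d_def by (simp add: add_pos_nonneg)
  define F where "F x = (if 1 + x$1 > d / 2 then G (unstereo x) else 0)" for x :: "real^4"
  have F0: "G (unstereo x) = 0" if "x \<in> S3" "0 < 1 + x$1" "1 + x$1 < d" for x
  proof -
    have "x \<noteq> - pole" using that(2) by (auto simp: axis_def)
    then have s: "stereo (unstereo x) = x" by (rule stereo_unstereo[OF that(1)])
    have "2 / (1 + unstereo x \<bullet> unstereo x) < 2 / (1 + (R + 1)\<^sup>2)"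
      using that(3) stereo_nth(1)[of "unstereo x"] unfolding s d_def by simp
    then have "(R + 1)\<^sup>2 < unstereo x \<bullet> unstereo x"
    proof (rule contrapos_pp)
      assume "\<not> (R + 1)\<^sup>2 < unstereo x \<bullet> unstereo x"
      then show "\<not> 2 / (1 + unstereo x \<bullet> unstereo x) < 2 / (1 + (R + 1)\<^sup>2)"
        using one_plus_inner[of "unstereo x"] by (simp add: not_less frac_le)
    qed
    then have "R + 1 < norm (unstereo x)"
      by (simp add: dot_square_norm power_less_imp_less_base)
    then show ?thesis by (intro z) simp
  qed
  have "continuous_on S3 F"
  proof -
    define A where "A = S3 \<inter> {x. 1 + x$1 > d / 2}"
    define B where "B = S3 \<inter> {x. 1 + x$1 < d}"
    have AB: "A \<union> B = S3" using d by (auto simp: A_def B_def)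
    have "continuous_on (A \<union> B) F"
    proof (rule continuous_on_Un_local_open)
      show "openin (top_of_set (A \<union> B)) A" "openin (top_of_set (A \<union> B)) B"
        unfolding AB unfolding A_def B_def
        by (auto intro!: openin_open_Int open_Collect_less continuous_intros)
      have "continuous_on A (\<lambda>x. G (unstereo x))"
        by (intro continuous_on_compose2[OF G] continuous_on_subset[OF Cinf_on_continuous[OF Cinf_unstereo]])
          (use d in \<open>auto simp: A_def\<close>)
      then show "continuous_on A F" by (rule continuous_on_eq) (auto simp: F_def A_def)
      have "F x = 0" if "x \<in> B" for x using F0[of x] that d by (auto simp: F_def B_def)
      then show "continuous_on B F" by (simp cong: continuous_on_cong)
    qed
    then show ?thesis unfolding AB .
  qed
  moreover have "F (stereo y) = G y" for y
  proof (cases "1 + stereo y $ 1 > d / 2")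
    case True
    then show ?thesis by (simp add: F_def unstereo_stereo)
  next
    case False
    then have "G y = 0"
      using F0[OF stereo_S3, of y] S3_nth_1[OF stereo_S3 stereo_ne, of y] d by (simp add: unstereo_stereo)
    then show ?thesis using False by (simp add: F_def)
  qed
  ultimately show ?thesis using dual_bound_continuous[of F] by simp
qed

text \<open>Lebesgue measurability provides continuous functions converging almost everywhere.
  Clipping at \<open>?C\<close> bounds them and the factor \<open>chi n\<close> gives them compact
  support; neither changes the limit, since \<open>chi n\<close> is 1 wherever \<open>W\<close> may
  be nonzero.\<close>

lemma dual_bound_measurable:
  assumes mW: "W \<in> borel_measurable lebesgue" and W: "\<And>y. \<bar>W y\<bar> \<le> real (Suc n)" "\<And>y. y \<bullet> y > real (Suc n) \<Longrightarrow> W y = 0"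
  shows "\<bar>LINT y|Mst. W y * u y\<bar> \<le> K * sqrt (LINT y|Mst. (W y)\<^sup>2)"
proof -
  have "W measurable_on UNIV" using mW by (rule lebesgue_measurable_imp_measurable_on) simp
  then obtain N g where N: "negligible N" and g: "\<And>k. continuous_on UNIV (g k)" "\<And>y. y \<notin> N \<Longrightarrow> (\<lambda>k. g k y) \<longlonglongrightarrow> W y"
    unfolding measurable_on_def by auto
  let ?C = "real (Suc n)"
  define w where "w k y = max (- ?C) (min ?C (g k y)) * chi n y" for k y
  have cw: "continuous_on UNIV (w k)" for k
    unfolding w_def by (intro continuous_intros g continuous_chi)
  show ?thesis
  proof (rule dual_bound_limit[where w=w and C="?C", OF _ mW])
    show "w k \<in> borel_measurable lebesgue" for k by (rule continuous_borel_lebesgue[OF cw])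
    show "AE y in lebesgue. (\<lambda>k. w k y) \<longlonglongrightarrow> W y"
    proof (rule AE_I'[of N])
      have "(\<lambda>k. w k y) \<longlonglongrightarrow> max (- ?C) (min ?C (W y)) * chi n y" if "y \<notin> N" for y
        unfolding w_def by (intro tendsto_intros g that)
      moreover have "max (- ?C) (min ?C (W y)) * chi n y = W y" for y
      proof (cases "y \<bullet> y > ?C")
        case True
        then show ?thesis using W(2) by simp
      next
        case False
        then have "chi n y = 1" by (auto simp: chi_def intro!: step_1)
        then show ?thesis using W(1)[of y] by (simp add: abs_le_iff max_def min_def)
      qed
      ultimately show "{y \<in> space lebesgue. \<not> (\<lambda>k. w k y) \<longlonglongrightarrow> W y} \<subseteq> N" by auto
    qed (use N in \<open>simp add: negligible_iff_null_sets\<close>)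
    show "\<bar>w k y\<bar> \<le> ?C" for k y
    proof -
      have "\<bar>max (- ?C) (min ?C (g k y))\<bar> \<le> ?C" by (simp add: abs_le_iff max_def min_def)
      then have "\<bar>max (- ?C) (min ?C (g k y))\<bar> * chi n y \<le> ?C * 1"
        using chi_bounds[of n y] by (intro mult_mono) auto
      then show ?thesis using chi_bounds[of n y] by (simp add: w_def abs_mult)
    qed
    show "\<bar>LINT y|Mst. w k y * u y\<bar> \<le> K * sqrt (LINT y|Mst. (w k y)\<^sup>2)" for k
      by (rule dual_bound_compact_support[OF cw, of "sqrt (2 * ?C)"]) (use chi_support[of _ n] in \<open>auto simp: w_def simp del: of_nat_Suc mem_cball\<close>)
  qed
qed

text \<open>Test with truncations of \<open>u\<close> itself: then the square integral A of the
  truncation satisfies A <= K sqrt A. Truncating both in size and in space makes the test function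
  admissible, and dominated convergence removes the truncation.\<close>

lemma ridge_dual_bound:
  assumes K: "K \<ge> 0" shows "(LINT y|Mst. (u y)\<^sup>2) \<le> K\<^sup>2"
proof -
  define W where "W n y = (if \<bar>u y\<bar> \<le> real (Suc n) \<and> y \<bullet> y \<le> real (Suc n) then u y else 0)" for n y
  have [measurable]: "(\<lambda>y::real^3. y \<bullet> y) \<in> borel_measurable lebesgue"
    by (intro continuous_borel_lebesgue continuous_intros)
  note [measurable] = mu
  have mW [measurable]: "W n \<in> borel_measurable lebesgue" for n unfolding W_def by measurable
  have le: "(LINT y|Mst. (W n y)\<^sup>2) \<le> K\<^sup>2" for n
  proof -
    define A where "A = (LINT y|Mst. (W n y)\<^sup>2)"
    have A0: "A \<ge> 0" unfolding A_def by simp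
    have "W n y * u y = (W n y)\<^sup>2" for y by (simp add: W_def power2_eq_square)
    then have "\<bar>A\<bar> \<le> K * sqrt A"
      using dual_bound_measurable[OF mW, of n n] unfolding A_def by (simp add: W_def)
    then have "sqrt A * sqrt A \<le> K * sqrt A" using A0 by simp
    then have "sqrt A \<le> K"
    proof (cases "A = 0")
      case False
      then have "sqrt A > 0" using A0 by simp
      with \<open>sqrt A * sqrt A \<le> K * sqrt A\<close> show ?thesis by (rule mult_right_le_imp_le)
    qed (use K in simp)
    then show ?thesis unfolding A_def[symmetric] using A0 K by (metis real_sqrt_le_iff real_sqrt_abs abs_of_nonneg)
  qed
  have "(\<lambda>n. LINT y|Mst. (W n y)\<^sup>2) \<longlonglongrightarrow> (LINT y|Mst. (u y)\<^sup>2)"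
  proof (rule integral_dominated_convergence[OF _ _ iu])
    show "AE y in Mst. (\<lambda>n. (W n y)\<^sup>2) \<longlonglongrightarrow> (u y)\<^sup>2"
    proof (rule AE_I2)
      fix y
      have "\<forall>\<^sub>F n in sequentially. max \<bar>u y\<bar> (y \<bullet> y) < real n"
        by (metis filterlim_real_sequentially filterlim_at_top_dense)
      then have "\<forall>\<^sub>F n in sequentially. (W n y)\<^sup>2 = (u y)\<^sup>2"
        by eventually_elim (auto simp: W_def)
      then show "(\<lambda>n. (W n y)\<^sup>2) \<longlonglongrightarrow> (u y)\<^sup>2" by (rule tendsto_eventually)
    qed
    show "AE y in Mst. norm ((W n y)\<^sup>2) \<le> (u y)\<^sup>2" for n
      by (intro AE_I2) (auto simp: W_def)
  qed (simp_all add: mW mu borel_measurable_times borel_measurable_power)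
  then show ?thesis by (rule LIMSEQ_le_const2) (use le in blast)
qed

end

end

section \<open>Frames of the perturbed metric\<close>

lemma tangent_expand:
  assumes \<tau>: "\<tau> = 1 \<or> \<tau> = -1" and x: "norm x = 1" and w: "w \<in> tangent_S3 x"
  shows "w = (\<Sum>m\<in>UNIV. (w \<bullet> Ef \<tau> m x) *\<^sub>R Ef \<tau> m x)"
proof -
  define a where "a = w - (\<Sum>m\<in>UNIV. (w \<bullet> Ef \<tau> m x) *\<^sub>R Ef \<tau> m x)"
  have o: "Ef \<tau> j x \<bullet> Ef \<tau> k x = (if j = k then 1 else 0)" for j k by (rule Ef_inner_Ef[OF \<tau> x])
  have "a \<bullet> Ef \<tau> k x = 0" for k
    unfolding a_def by (simp add: inner_diff_left inner_sum_left o if_distrib cong: if_cong)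
  moreover have "a \<bullet> x = 0"
    unfolding a_def using w by (simp add: inner_diff_left inner_sum_left inner_diff_right inner_sum_right inner_Ef inner_commute[of _ x] tangent_S3_def)
  ultimately have "(a \<bullet> a) * (x \<bullet> x) = 0" using sum_Ef_squares[OF \<tau>, of a x] by simp
  then show ?thesis using x unfolding a_def by (auto simp: norm_eq_1)
qed

lemma pd_stereo_tangent: "pd stereo \<alpha> y \<in> tangent_S3 (stereo y)"
proof -
  have "pd (\<lambda>y. stereo y \<bullet> stereo y) \<alpha> y = stereo y \<bullet> pd stereo \<alpha> y + pd stereo \<alpha> y \<bullet> stereo y"
    by (rule pd_bilinear[OF bounded_bilinear_inner stereo_differentiable stereo_differentiable])
  moreover have "stereo z \<bullet> stereo z = 1" for z using norm_stereo by (simp add: norm_eq_1)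
  ultimately show ?thesis by (simp add: tangent_S3_def inner_commute)
qed

lemma Ef_tangent: "Ef \<tau> m x \<in> tangent_S3 x"
  by (simp add: tangent_S3_def inner_Ef)

text \<open>\<open>vec_comp\<close> is a definite description. The components exist because the
  invariant frame spans the tangent space, and are unique because the chart is an immersion.\<close>

lemma vec_comp_stereo:
  assumes w: "w \<in> tangent_S3 (stereo y)"
  shows "w = (\<Sum>\<alpha>\<in>UNIV. vec_comp stereo y w $ \<alpha> *\<^sub>R pd stereo \<alpha> y)"
proof -
  have "w = (\<Sum>m\<in>UNIV. (w \<bullet> Ef 1 m (stereo y)) *\<^sub>R (\<Sum>\<alpha>\<in>UNIV. Eh 1 y $ m $ \<alpha> *\<^sub>R pd stereo \<alpha> y))"
    using tangent_expand[OF _ norm_stereo w, of 1] unfolding Ef_stereo[of _ _ y, symmetric] by simp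
  also have "\<dots> = (\<Sum>\<alpha>\<in>UNIV. (\<chi> \<alpha>. \<Sum>m\<in>UNIV. (w \<bullet> Ef 1 m (stereo y)) * Eh 1 y $ m $ \<alpha>) $ \<alpha> *\<^sub>R pd stereo \<alpha> y)"
    unfolding sum_3 by (simp add: scaleR_add_left scaleR_add_right)
  finally have ex: "w = (\<Sum>\<alpha>\<in>UNIV. (\<chi> \<alpha>. \<Sum>m\<in>UNIV. (w \<bullet> Ef 1 m (stereo y)) * Eh 1 y $ m $ \<alpha>) $ \<alpha> *\<^sub>R pd stereo \<alpha> y)" .
  have "c = d" if "w = (\<Sum>\<alpha>\<in>UNIV. c $ \<alpha> *\<^sub>R pd stereo \<alpha> y)" "w = (\<Sum>\<alpha>\<in>UNIV. d $ \<alpha> *\<^sub>R pd stereo \<alpha> y)" for c d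
    using that unfolding frechet_pd[OF stereo_differentiable, symmetric] using inj_stereo_derivative[of y] by (metis injD)
  then have "\<exists>!c. w = (\<Sum>\<alpha>\<in>UNIV. c $ \<alpha> *\<^sub>R pd stereo \<alpha> y)" using ex by blast
  then show ?thesis unfolding vec_comp_def by (rule theI')
qed

lemma tangent_combination: "t1 \<in> tangent_S3 x \<Longrightarrow> t2 \<in> tangent_S3 x \<Longrightarrow> a *\<^sub>R t1 + b *\<^sub>R t2 \<in> tangent_S3 x"
  by (simp add: tangent_S3_def inner_add_right)

text \<open>A \<open>metric\<close> is constrained only on tangent vectors, so linearity is usable
  only while every partial sum stays tangent.\<close>

lemma metric_linear:
  assumes g: "pointwise_metric g" and x: "x \<in> S3" and t: "\<And>\<alpha>::3. t \<alpha> \<in> tangent_S3 x" and w: "w \<in> tangent_S3 x"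
  shows "g x (\<Sum>\<alpha>\<in>UNIV. a \<alpha> *\<^sub>R t \<alpha>) w = (\<Sum>\<alpha>\<in>UNIV. a \<alpha> * g x (t \<alpha>) w)"
proof -
  have l: "g x (a *\<^sub>R u + b *\<^sub>R v) w = a * g x u w + b * g x v w" if "u \<in> tangent_S3 x" "v \<in> tangent_S3 x" for u v a b
    using g x that w unfolding pointwise_metric_def by blast
  have "g x (\<Sum>\<alpha>\<in>UNIV. a \<alpha> *\<^sub>R t \<alpha>) w = g x (1 *\<^sub>R (a 1 *\<^sub>R t 1 + a 2 *\<^sub>R t 2) + a 3 *\<^sub>R t 3) w" by (simp add: sum_3)
  also have "\<dots> = 1 * (a 1 * g x (t 1) w + a 2 * g x (t 2) w) + a 3 * g x (t 3) w"
    by (simp only: l t tangent_combination)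
  finally show ?thesis by (simp add: sum_3)
qed

lemma metric_symmetric: "pointwise_metric g \<Longrightarrow> x \<in> S3 \<Longrightarrow> v \<in> tangent_S3 x \<Longrightarrow> w \<in> tangent_S3 x \<Longrightarrow> g x v w = g x w v"
  unfolding pointwise_metric_def by blast

lemma metric_comp_stereo_sym: "pointwise_metric g \<Longrightarrow> transpose (metric_comp g stereo y) = metric_comp g stereo y"
  by (auto simp: vec_eq_iff transpose_def metric_comp_def intro!: metric_symmetric stereo_S3 pd_stereo_tangent)

lemma tangent_sum3: "(\<And>\<alpha>::3. t \<alpha> \<in> tangent_S3 x) \<Longrightarrow> (\<Sum>\<alpha>\<in>UNIV. a \<alpha> *\<^sub>R t \<alpha>) \<in> tangent_S3 x"
  by (simp add: tangent_S3_def inner_sum_right)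

lemma frame_gram:
  fixes X :: "real^3^3"
  assumes g: "pointwise_metric g" and w: "\<And>j. w j = (\<Sum>\<alpha>\<in>UNIV. X $ j $ \<alpha> *\<^sub>R pd stereo \<alpha> y)"
  shows "g (stereo y) (w j) (w k) = (X ** metric_comp g stereo y ** transpose X) $ j $ k"
proof -
  have t: "(\<Sum>\<alpha>\<in>UNIV. a \<alpha> *\<^sub>R pd stereo \<alpha> y) \<in> tangent_S3 (stereo y)" for a
    by (intro tangent_sum3 pd_stereo_tangent)
  have "g (stereo y) (w j) (w k) = (\<Sum>\<alpha>\<in>UNIV. X $ j $ \<alpha> * g (stereo y) (pd stereo \<alpha> y) (w k))"
    unfolding w by (intro metric_linear g stereo_S3 pd_stereo_tangent t)
  also have "\<dots> = (\<Sum>\<alpha>\<in>UNIV. X $ j $ \<alpha> * g (stereo y) (w k) (pd stereo \<alpha> y))"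
    by (subst metric_symmetric[OF g stereo_S3 pd_stereo_tangent]) (simp_all add: w t)
  also have "\<dots> = (\<Sum>\<alpha>\<in>UNIV. X $ j $ \<alpha> * (\<Sum>\<beta>\<in>UNIV. X $ k $ \<beta> * g (stereo y) (pd stereo \<beta> y) (pd stereo \<alpha> y)))"
    unfolding w by (intro sum.cong refl arg_cong2[where f="(*)"] metric_linear g stereo_S3 pd_stereo_tangent)
  also have "\<dots> = (X ** metric_comp g stereo y ** transpose X) $ j $ k"
    by (simp add: mm3_nth sum_3 transpose_def metric_comp_def metric_symmetric[OF g stereo_S3 pd_stereo_tangent pd_stereo_tangent] algebra_simps)
  finally show ?thesis .
qed

definition gram :: "metric \<Rightarrow> real \<Rightarrow> real^4 \<Rightarrow> real^3^3"
  where "gram g \<tau> x = (\<chi> j k. g x (Ef \<tau> j x) (Ef \<tau> k x))"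

lemma gram_stereo: "pointwise_metric g \<Longrightarrow> Eh \<tau> y ** metric_comp g stereo y ** transpose (Eh \<tau> y) = gram g \<tau> (stereo y)"
proof -
  assume g: "pointwise_metric g"
  have "g (stereo y) (Ef \<tau> j (stereo y)) (Ef \<tau> k (stereo y)) = (Eh \<tau> y ** metric_comp g stereo y ** transpose (Eh \<tau> y)) $ j $ k" for j k
    by (rule frame_gram[OF g Ef_stereo])
  then show ?thesis by (simp add: gram_def vec_eq_iff)
qed

lemma frame_comp_orthonormal:
  assumes g: "pointwise_metric g" and e: "pos_orthonormal_frame g e"
  shows "frame_comp e stereo y ** metric_comp g stereo y ** transpose (frame_comp e stereo y) = mat 1"
proof -
  have "e j (stereo y) = (\<Sum>\<alpha>\<in>UNIV. frame_comp e stereo y $ j $ \<alpha> *\<^sub>R pd stereo \<alpha> y)" for j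
    using vec_comp_stereo[of "e j (stereo y)" y] e stereo_S3 by (simp add: frame_comp_def pos_orthonormal_frame_def)
  from frame_gram[OF g this] show ?thesis
    using e stereo_S3 by (simp add: pos_orthonormal_frame_def vec_eq_iff mat_def)
qed

text \<open>The structure functions of the frame \<open>\<Sum>m. B j m Ef m\<close>.\<close>

definition Nc :: "real \<Rightarrow> (real^4 \<Rightarrow> real^3^3) \<Rightarrow> 3 \<Rightarrow> 3 \<Rightarrow> 3 \<Rightarrow> real^4 \<Rightarrow> real"
  where "Nc \<tau> B j k n x = (\<Sum>m\<in>UNIV. B x $ j $ m * Ed \<tau> m (\<lambda>x. B x $ k $ n) x - B x $ k $ m * Ed \<tau> m (\<lambda>x. B x $ j $ n) x)
    + (\<Sum>a\<in>UNIV. \<Sum>b\<in>UNIV. B x $ j $ a * B x $ k $ b * (2 * \<tau> * eps3 a b n))"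

text \<open>\<open>Nc\<close> gives the components of the bracket in the invariant fields. For an
  orthonormal frame B ** G is the inverse transpose of B, so contracting with its row
  \<open>l\<close> converts them to components in the frame itself.\<close>

definition cst :: "real \<Rightarrow> (real^4 \<Rightarrow> real^3^3) \<Rightarrow> (real^4 \<Rightarrow> real^3^3) \<Rightarrow> real^4 \<Rightarrow> 3 \<Rightarrow> 3 \<Rightarrow> 3 \<Rightarrow> real"
  where "cst \<tau> B G x l j k = (\<Sum>n\<in>UNIV. (B x ** G x) $ l $ n * Nc \<tau> B j k n x)"

text \<open>Brackets do not depend on coordinates, so the structure functions depend on
  \<open>y\<close> only through the point of the sphere. After this step the term of order zero is a
  function on the sphere, without Christoffel symbols.\<close>

lemma brk_eq_cst:
  assumes \<tau>: "\<tau> = 1 \<or> \<tau> = -1" and g: "pointwise_metric g"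
    and B: "\<And>i j. Cinf_on (\<lambda>x. B x $ i $ j) (- {0})"
    and X: "\<And>y. X y = B (stereo y) ** Eh \<tau> y"
  shows "brk g stereo X y l j k = cst \<tau> B (gram g \<tau>) (stereo y) l j k"
proof -
  have nz: "stereo y \<noteq> 0" for y using norm_stereo[of y] by auto
  let ?b = "\<lambda>i j. B (stereo y) $ i $ j"
  define D where "D m k n = Ed \<tau> m (\<lambda>x. B x $ k $ n) (stereo y)" for m k n
  define H where "H m n \<beta> = (\<Sum>\<alpha>\<in>UNIV. Eh \<tau> y $ m $ \<alpha> * pd (\<lambda>y. Eh \<tau> y $ n $ \<beta>) \<alpha> y)" for m n \<beta>
  have sB: "Cinf_on (\<lambda>y. B (stereo y) $ i $ j) UNIV" for i j
    by (rule Cinf_on_compose[OF _ _ B Cinf_stereo]) (use nz in auto)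
  have dB: "(\<lambda>y. B (stereo y) $ i $ j) differentiable at y" for i j
    using Cinf_on_differentiable[OF sB] by simp
  have dE: "(\<lambda>y. Eh \<tau> y $ i $ j) differentiable at y" for i j
    using Cinf_on_differentiable[OF Cinf_Eh] by simp
  have Xn: "X z $ k $ \<beta> = (\<Sum>n\<in>UNIV. B (stereo z) $ k $ n * Eh \<tau> z $ n $ \<beta>)" for z k \<beta>
    unfolding X by (simp add: matrix_matrix_mult_def)
  have sX: "Cinf_on X UNIV"
    by (intro Cinf_on_vec open_UNIV, simp only: Xn) (intro Cinf_on_sum Cinf_on_mult sB Cinf_Eh open_UNIV)
  have pX: "pd X \<alpha> y $ k $ \<beta> = (\<Sum>n\<in>UNIV. ?b k n * pd (\<lambda>y. Eh \<tau> y $ n $ \<beta>) \<alpha> y + pd (\<lambda>y. B (stereo y) $ k $ n) \<alpha> y * Eh \<tau> y $ n $ \<beta>)" for \<alpha> k \<beta>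
  proof -
    have "pd X \<alpha> y $ k $ \<beta> = pd (\<lambda>z. X z $ k $ \<beta>) \<alpha> y"
      by (rule pd_matrix_nth[symmetric]) (rule Cinf_on_differentiable[OF sX UNIV_I])
    also have "\<dots> = (\<Sum>n\<in>UNIV. pd (\<lambda>z. B (stereo z) $ k $ n * Eh \<tau> z $ n $ \<beta>) \<alpha> y)"
      unfolding Xn by (rule pd_sum) (auto intro: differentiable_bilinear[OF bounded_bilinear_mult] dB dE)
    finally show ?thesis by (simp add: pd_bilinear[OF bounded_bilinear_mult dB dE])
  qed
  have Dn: "D m k n = (\<Sum>\<alpha>\<in>UNIV. Eh \<tau> y $ m $ \<alpha> * pd (\<lambda>y. B (stereo y) $ k $ n) \<alpha> y)" for m k n
    unfolding D_def using Ed_stereo[OF Cinf_on_differentiable[OF B], of y \<tau> m] nz by simp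
  have in1: "(\<Sum>\<alpha>\<in>UNIV. Eh \<tau> y $ m $ \<alpha> * pd X \<alpha> y $ k $ \<beta>) = (\<Sum>n\<in>UNIV. ?b k n * H m n \<beta> + D m k n * Eh \<tau> y $ n $ \<beta>)" for m k \<beta>
    unfolding pX Dn H_def sum_3 by (simp add: algebra_simps)
  have T: "(\<Sum>\<alpha>\<in>UNIV. X y $ j $ \<alpha> * pd X \<alpha> y $ k $ \<beta>) = (\<Sum>m\<in>UNIV. \<Sum>n\<in>UNIV. ?b j m * (?b k n * H m n \<beta> + D m k n * Eh \<tau> y $ n $ \<beta>))" for j k \<beta>
  proof -
    have "(\<Sum>\<alpha>\<in>UNIV. X y $ j $ \<alpha> * pd X \<alpha> y $ k $ \<beta>) = (\<Sum>\<alpha>\<in>UNIV. \<Sum>m\<in>UNIV. ?b j m * Eh \<tau> y $ m $ \<alpha> * pd X \<alpha> y $ k $ \<beta>)"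
      unfolding Xn by (simp add: sum_distrib_right)
    also have "\<dots> = (\<Sum>m\<in>UNIV. ?b j m * (\<Sum>\<alpha>\<in>UNIV. Eh \<tau> y $ m $ \<alpha> * pd X \<alpha> y $ k $ \<beta>))"
      by (subst sum.swap) (simp add: sum_distrib_left mult.assoc)
    also have "\<dots> = (\<Sum>m\<in>UNIV. ?b j m * (\<Sum>n\<in>UNIV. ?b k n * H m n \<beta> + D m k n * Eh \<tau> y $ n $ \<beta>))"
      unfolding in1 ..
    finally show ?thesis by (simp add: sum_distrib_left)
  qed
  have HH: "H m n \<beta> - H n m \<beta> = (\<Sum>p\<in>UNIV. 2 * \<tau> * eps3 m n p * Eh \<tau> y $ p $ \<beta>)" for m n \<beta>
    using Eh_bracket[OF \<tau>, of y m n \<beta>] unfolding H_def by (simp add: sum_subtractf)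
  have inner: "(\<Sum>\<alpha>\<in>UNIV. X y $ j $ \<alpha> * pd X \<alpha> y $ k $ \<beta> - X y $ k $ \<alpha> * pd X \<alpha> y $ j $ \<beta>) = (\<Sum>n\<in>UNIV. Nc \<tau> B j k n (stereo y) * Eh \<tau> y $ n $ \<beta>)" for \<beta>
  proof -
    have s: "(\<Sum>m\<in>UNIV. \<Sum>n\<in>UNIV. ?b k m * (?b j n * H m n \<beta>)) = (\<Sum>m\<in>UNIV. \<Sum>n\<in>UNIV. ?b j m * (?b k n * H n m \<beta>))"
      by (subst sum.swap) (simp add: mult_ac)
    have "(\<Sum>\<alpha>\<in>UNIV. X y $ j $ \<alpha> * pd X \<alpha> y $ k $ \<beta> - X y $ k $ \<alpha> * pd X \<alpha> y $ j $ \<beta>) =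
       (\<Sum>m\<in>UNIV. \<Sum>n\<in>UNIV. ?b j m * (?b k n * H m n \<beta>)) - (\<Sum>m\<in>UNIV. \<Sum>n\<in>UNIV. ?b k m * (?b j n * H m n \<beta>))
        + (\<Sum>m\<in>UNIV. \<Sum>n\<in>UNIV. (?b j m * D m k n - ?b k m * D m j n) * Eh \<tau> y $ n $ \<beta>)"
      unfolding sum_subtractf T sum_3 by (simp add: algebra_simps)
    also have "\<dots> = (\<Sum>m\<in>UNIV. \<Sum>n\<in>UNIV. ?b j m * ?b k n * (H m n \<beta> - H n m \<beta>))
        + (\<Sum>n\<in>UNIV. (\<Sum>m\<in>UNIV. ?b j m * D m k n - ?b k m * D m j n) * Eh \<tau> y $ n $ \<beta>)"
      unfolding s sum_3 by (simp add: algebra_simps)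
    also have "(\<Sum>m\<in>UNIV. \<Sum>n\<in>UNIV. ?b j m * ?b k n * (H m n \<beta> - H n m \<beta>)) =
        (\<Sum>p\<in>UNIV. (\<Sum>m\<in>UNIV. \<Sum>n\<in>UNIV. ?b j m * ?b k n * (2 * \<tau> * eps3 m n p)) * Eh \<tau> y $ p $ \<beta>)"
      unfolding HH sum_3 by (simp add: algebra_simps)
    finally show ?thesis unfolding Nc_def D_def[symmetric] by (simp add: sum.distrib distrib_right)
  qed
  have "brk g stereo X y l j k = (\<Sum>n\<in>UNIV. (X y ** metric_comp g stereo y ** transpose (Eh \<tau> y)) $ l $ n * Nc \<tau> B j k n (stereo y))"
    unfolding brk_def inner
    by (simp only: matrix_matrix_mult_def[of "X y ** metric_comp g stereo y"] transpose_def vec_lambda_beta sum_distrib_left sum_distrib_right)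
      (subst sum.swap, simp add: mult_ac)
  also have "X y ** metric_comp g stereo y ** transpose (Eh \<tau> y) = B (stereo y) ** gram g \<tau> (stereo y)"
    unfolding gram_stereo[OF g, symmetric] X by (simp add: matrix_mul_assoc)
  finally show ?thesis unfolding cst_def .
qed

section \<open>The weak eigenvalue equation\<close>

text \<open>Complex bilinear, not sesquilinear: test objects are rows and operators act on them by
  right multiplication, so no complex conjugates occur.\<close>

definition pair :: "complex^2 \<Rightarrow> complex^2 \<Rightarrow> complex"
  where "pair \<theta> w = (\<Sum>k\<in>UNIV. \<theta>$k * w$k)"

lemma bounded_bilinear_pair: "bounded_bilinear pair"
proof -
  have "bilinear pair" unfolding bilinear_def pair_def
    by (auto intro!: linearI simp: sum_2 algebra_simps)
  then show ?thesis by (simp add: bilinear_conv_bounded_bilinear)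
qed

interpretation pair: bounded_bilinear pair by (rule bounded_bilinear_pair)

lemma pair_row: "pair (\<theta> v* A) w = pair \<theta> (A *v w)"
  by (simp add: pair_def sum_2 vector_matrix_mult_def matrix_vector_mult_def algebra_simps)

lemma pair_smult: "pair (c *s \<theta>) w = c * pair \<theta> w" "pair \<theta> (c *s w) = c * pair \<theta> w"
  by (simp_all add: pair_def sum_2 algebra_simps)

lemma bounded_linear_smult: "bounded_linear (\<lambda>v::complex^2. c *s v)"
proof -
  have "linear (\<lambda>v::complex^2. c *s v)" by (rule linearI) (auto simp: vec_eq_iff algebra_simps)
  then show ?thesis by (simp add: linear_conv_bounded_linear)
qed

lemma borel_measurable_bilinear:
  fixes h :: "'a::euclidean_space \<Rightarrow> 'b::euclidean_space \<Rightarrow> 'c::euclidean_space"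
  assumes "bounded_bilinear h" "f \<in> borel_measurable M" "g \<in> borel_measurable M"
  shows "(\<lambda>y. h (f y) (g y)) \<in> borel_measurable M"
  using assms(2,3)
  by (rule borel_measurable_continuous_Pair)
    (intro bounded_bilinear.continuous_on[OF assms(1)] continuous_intros)

lemma loc_L2_integrable:
  assumes w: "loc_L2 UNIV w" and K: "compact K"
  shows "integrable lebesgue (\<lambda>y. indicat_real K y *\<^sub>R w y)"
proof -
  have mw: "w \<in> borel_measurable lebesgue" using w by (simp add: loc_L2_def lebesgue_on_UNIV_eq)
  have sK: "K \<in> sets lebesgue" using K by (simp add: compact_imp_closed)
  have "integrable (lebesgue_on K) (\<lambda>y. (norm (w y))\<^sup>2)" using w K by (auto simp: loc_L2_def)
  then have 1: "integrable lebesgue (\<lambda>y. indicat_real K y *\<^sub>R (norm (w y))\<^sup>2)"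
    using sK by (simp add: integrable_restrict_space)
  have "integrable lebesgue (\<lambda>y. indicat_real K y + indicat_real K y *\<^sub>R (norm (w y))\<^sup>2)"
  proof (intro Bochner_Integration.integrable_add 1 integrable_real_indicator sK)
    show "emeasure lebesgue K < \<infinity>" using fmeasurableD2[OF lmeasurable_compact[OF K]] by (simp add: less_top del: emeasure_completion)
  qed
  then show ?thesis
  proof (rule Bochner_Integration.integrable_bound)
    show "(\<lambda>y. indicat_real K y *\<^sub>R w y) \<in> borel_measurable lebesgue"
      using mw sK by (intro borel_measurable_scaleR borel_measurable_indicator)
    show "AE y in lebesgue. norm (indicat_real K y *\<^sub>R w y) \<le> norm (indicat_real K y + indicat_real K y *\<^sub>R (norm (w y))\<^sup>2)"
    proof (rule AE_I2)
      fix y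
      have "0 \<le> (norm (w y) - 1)\<^sup>2" by simp
      then have "2 * norm (w y) \<le> 1 + (norm (w y))\<^sup>2" by (simp add: power2_diff)
      then have "norm (w y) \<le> 1 + (norm (w y))\<^sup>2" using norm_ge_zero[of "w y"] by linarith
      then show "norm (indicat_real K y *\<^sub>R w y) \<le> norm (indicat_real K y + indicat_real K y *\<^sub>R (norm (w y))\<^sup>2)"
        by (simp add: indicator_def)
    qed
  qed
qed

lemma loc_L2_integrable_bilinear:
  fixes h :: "'a::euclidean_space \<Rightarrow> complex^2 \<Rightarrow> 'c::euclidean_space"
  assumes h: "bounded_bilinear h" and w: "loc_L2 UNIV w" and K: "compact K"
    and f: "continuous_on UNIV f" "\<And>y. y \<notin> K \<Longrightarrow> f y = 0"
  shows "integrable lebesgue (\<lambda>y. h (f y) (w y))"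
proof -
  have mw: "w \<in> borel_measurable lebesgue" using w by (simp add: loc_L2_def lebesgue_on_UNIV_eq)
  obtain B where B: "B > 0" "\<And>a b. norm (h a b) \<le> norm a * norm b * B" using bounded_bilinear.pos_bounded[OF h] by blast
  have "bounded (f ` K)" by (intro compact_imp_bounded compact_continuous_image continuous_on_subset[OF f(1)] K) auto
  then obtain C where C: "\<forall>y\<in>K. norm (f y) \<le> C" by (auto simp: bounded_iff)
  show ?thesis
  proof (rule Bochner_Integration.integrable_bound)
    show "integrable lebesgue (\<lambda>y. (max C 0 * B) *\<^sub>R (indicat_real K y *\<^sub>R w y))"
      by (intro integrable_scaleR_right loc_L2_integrable w K)
    show "(\<lambda>y. h (f y) (w y)) \<in> borel_measurable lebesgue"
      by (rule borel_measurable_bilinear[OF h continuous_borel_lebesgue[OF f(1)] mw])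
    show "AE y in lebesgue. norm (h (f y) (w y)) \<le> norm ((max C 0 * B) *\<^sub>R (indicat_real K y *\<^sub>R w y))"
    proof (rule AE_I2)
      fix y
      show "norm (h (f y) (w y)) \<le> norm ((max C 0 * B) *\<^sub>R (indicat_real K y *\<^sub>R w y))"
      proof (cases "y \<in> K")
        case True
        have "norm (h (f y) (w y)) \<le> norm (f y) * norm (w y) * B" by (rule B)
        also have "\<dots> \<le> max C 0 * norm (w y) * B" using C True B(1) by (intro mult_right_mono) (auto simp: le_max_iff_disj)
        finally show ?thesis using True B(1) by (simp add: abs_mult mult_ac)
      next
        case False
        then show ?thesis using f(2) by (simp add: bounded_bilinear.zero_left[OF h])
      qed
    qed
  qed
qed

lemma pd_support:
  assumes "compact K" "\<And>y. y \<notin> K \<Longrightarrow> f y = 0" "y \<notin> K" shows "pd f \<alpha> y = 0"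
proof -
  have "pd f \<alpha> y = pd (\<lambda>_. 0) \<alpha> y"
    by (rule pd_cong[of "- K"]) (use assms compact_imp_closed in auto)
  then show ?thesis by simp
qed

lemma integral_sum_i:
  fixes A C :: "2 \<Rightarrow> _ \<Rightarrow> complex"
  assumes "\<And>k. integrable M (A k)" "\<And>k. integrable M (C k)"
  shows "(LINT y|M. (\<Sum>k\<in>UNIV. A k y + \<i> * C k y)) = (\<Sum>k\<in>UNIV. (LINT y|M. A k y) + \<i> * (LINT y|M. C k y))"
proof -
  have i: "integrable M (\<lambda>y. A k y + \<i> * C k y)" for k
    by (rule Bochner_Integration.integrable_add[OF assms(1) integrable_mult_right[OF assms(2)]])
  have "(LINT y|M. A k y + \<i> * C k y) = (LINT y|M. A k y) + \<i> * (LINT y|M. C k y)" for k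
    by (simp add: Bochner_Integration.integral_add[OF assms(1) integrable_mult_right[OF assms(2)]])
  then show ?thesis by (simp add: Bochner_Integration.integral_sum[OF i])
qed

text \<open>The test functions in \<open>weak_pd\<close> are real and scalar. A complex row is split
  into components and these into real and imaginary parts.\<close>

lemma weak_pd_row:
  fixes \<Theta> :: "real^3 \<Rightarrow> complex^2"
  assumes w: "loc_L2 UNIV w" and wp: "weak_pd UNIV \<alpha> w p" and \<Theta>: "Cinf_on \<Theta> UNIV" and K: "compact K" "\<And>y. y \<notin> K \<Longrightarrow> \<Theta> y = 0"
  shows "integrable lebesgue (\<lambda>y. pair (pd \<Theta> \<alpha> y) (w y))" "integrable lebesgue (\<lambda>y. pair (\<Theta> y) (p y))"
    and "(LINT y|lebesgue. pair (pd \<Theta> \<alpha> y) (w y)) = - (LINT y|lebesgue. pair (\<Theta> y) (p y))"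
proof -
  have p: "loc_L2 UNIV p" using wp by (simp add: weak_pd_def)
  have c\<Theta>: "continuous_on UNIV \<Theta>" "continuous_on UNIV (pd \<Theta> \<alpha>)" by (intro Cinf_on_continuous \<Theta> Cinf_pd open_UNIV)+
  have pz: "pd \<Theta> \<alpha> y = 0" if "y \<notin> K" for y
    by (rule pd_support[of K \<Theta> y \<alpha>]) (use K that in auto)
  show "integrable lebesgue (\<lambda>y. pair (pd \<Theta> \<alpha> y) (w y))" "integrable lebesgue (\<lambda>y. pair (\<Theta> y) (p y))"
    by (rule loc_L2_integrable_bilinear[OF bounded_bilinear_pair w K(1) c\<Theta>(2)], simp add: pz)
      (rule loc_L2_integrable_bilinear[OF bounded_bilinear_pair p K(1) c\<Theta>(1) K(2)])
  have test: "(LINT y|lebesgue. pd \<psi> \<alpha> y *\<^sub>R w y $ k) = - (LINT y|lebesgue. \<psi> y *\<^sub>R p y $ k)"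
    "integrable lebesgue (\<lambda>y. pd \<psi> \<alpha> y *\<^sub>R w y $ k)" "integrable lebesgue (\<lambda>y. \<psi> y *\<^sub>R p y $ k)"
    if \<psi>: "Cinf_on \<psi> UNIV" "\<And>y. y \<notin> K \<Longrightarrow> \<psi> y = 0" for \<psi> :: "real^3 \<Rightarrow> real" and k
  proof -
    have c: "continuous_on UNIV \<psi>" "continuous_on UNIV (pd \<psi> \<alpha>)" by (intro Cinf_on_continuous \<psi> Cinf_pd open_UNIV)+
    have "test_function UNIV \<psi>" using \<psi> K(1) by (auto simp: test_function_def)
    then have "(LINT y|lebesgue. pd \<psi> \<alpha> y *\<^sub>R w y) = - (LINT y|lebesgue. \<psi> y *\<^sub>R p y)"
      using wp by (simp add: weak_pd_def lebesgue_on_UNIV_eq)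
    then have e: "(LINT y|lebesgue. pd \<psi> \<alpha> y *\<^sub>R w y) $ k = - (LINT y|lebesgue. \<psi> y *\<^sub>R p y) $ k" by simp
    have pz: "pd \<psi> \<alpha> y = 0" if "y \<notin> K" for y
      by (rule pd_support[of K \<psi> y \<alpha>]) (use K(1) \<psi>(2) that in auto)
    have i1: "integrable lebesgue (\<lambda>y. pd \<psi> \<alpha> y *\<^sub>R w y)"
      by (rule loc_L2_integrable_bilinear[OF bounded_bilinear_scaleR w K(1) c(2) pz])
    have i2: "integrable lebesgue (\<lambda>y. \<psi> y *\<^sub>R p y)"
      by (rule loc_L2_integrable_bilinear[OF bounded_bilinear_scaleR p K(1) c(1) \<psi>(2)])
    have bl: "bounded_linear (\<lambda>v::complex^2. v $ k)" by (rule bounded_linear_vec_nth)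
    show "(LINT y|lebesgue. pd \<psi> \<alpha> y *\<^sub>R w y $ k) = - (LINT y|lebesgue. \<psi> y *\<^sub>R p y $ k)"
      using integral_bounded_linear[OF bl i1] integral_bounded_linear[OF bl i2] e by simp
    show "integrable lebesgue (\<lambda>y. pd \<psi> \<alpha> y *\<^sub>R w y $ k)" "integrable lebesgue (\<lambda>y. \<psi> y *\<^sub>R p y $ k)"
      using integrable_bounded_linear[OF bl i1] integrable_bounded_linear[OF bl i2] by simp_all
  qed
  have bR: "bounded_linear (\<lambda>v::complex^2. Re (v $ k))" "bounded_linear (\<lambda>v::complex^2. Im (v $ k))" for k
    by (rule bounded_linear_compose[OF bounded_linear_Re bounded_linear_vec_nth] bounded_linear_compose[OF bounded_linear_Im bounded_linear_vec_nth])+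
  define a b where "a k y = Re (\<Theta> y $ k)" and "b k y = Im (\<Theta> y $ k)" for k y
  have sa: "Cinf_on (a k) UNIV" "Cinf_on (b k) UNIV" "\<And>y. y \<notin> K \<Longrightarrow> a k y = 0" "\<And>y. y \<notin> K \<Longrightarrow> b k y = 0" for k
    unfolding a_def b_def using Cinf_on_linear_compose[OF bR(1) open_UNIV \<Theta>] Cinf_on_linear_compose[OF bR(2) open_UNIV \<Theta>] K(2) by auto
  have d: "\<Theta> differentiable at y" for y using Cinf_on_differentiable[OF \<Theta>] by simp
  have pa: "pd (a k) \<alpha> y = Re (pd \<Theta> \<alpha> y $ k)" "pd (b k) \<alpha> y = Im (pd \<Theta> \<alpha> y $ k)" for k y
    unfolding a_def[abs_def] b_def[abs_def] by (rule pd_linear[OF bR(1) d], rule pd_linear[OF bR(2) d])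
  have ex: "pair \<theta> v = (\<Sum>k\<in>UNIV. Re (\<theta> $ k) *\<^sub>R v $ k + \<i> * (Im (\<theta> $ k) *\<^sub>R v $ k))" for \<theta> v
    unfolding pair_def sum_2 by (simp add: complex_eq_iff)
  have t1: "(LINT y|lebesgue. pd (a k) \<alpha> y *\<^sub>R w y $ k) = - (LINT y|lebesgue. a k y *\<^sub>R p y $ k)"
    "(LINT y|lebesgue. pd (b k) \<alpha> y *\<^sub>R w y $ k) = - (LINT y|lebesgue. b k y *\<^sub>R p y $ k)" for k
    by (rule test(1)[OF sa(1,3)] test(1)[OF sa(2,4)]; assumption)+
  have "(LINT y|lebesgue. pair (pd \<Theta> \<alpha> y) (w y)) = (LINT y|lebesgue. (\<Sum>k\<in>UNIV. pd (a k) \<alpha> y *\<^sub>R w y $ k + \<i> * (pd (b k) \<alpha> y *\<^sub>R w y $ k)))"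
    unfolding ex pa ..
  also have "\<dots> = (\<Sum>k\<in>UNIV. (LINT y|lebesgue. pd (a k) \<alpha> y *\<^sub>R w y $ k) + \<i> * (LINT y|lebesgue. pd (b k) \<alpha> y *\<^sub>R w y $ k))"
    by (rule integral_sum_i[OF test(2)[OF sa(1,3)] test(2)[OF sa(2,4)]])
  also have "\<dots> = - (\<Sum>k\<in>UNIV. (LINT y|lebesgue. a k y *\<^sub>R p y $ k) + \<i> * (LINT y|lebesgue. b k y *\<^sub>R p y $ k))"
    unfolding t1 by (simp add: sum_2 algebra_simps)
  also have "(\<Sum>k\<in>UNIV. (LINT y|lebesgue. a k y *\<^sub>R p y $ k) + \<i> * (LINT y|lebesgue. b k y *\<^sub>R p y $ k))
     = (LINT y|lebesgue. (\<Sum>k\<in>UNIV. a k y *\<^sub>R p y $ k + \<i> * (b k y *\<^sub>R p y $ k)))"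
    by (rule integral_sum_i[OF test(3)[OF sa(1,3)] test(3)[OF sa(2,4)], symmetric])
  also have "\<dots> = (LINT y|lebesgue. pair (\<Theta> y) (p y))" unfolding ex a_def b_def ..
  finally show "(LINT y|lebesgue. pair (pd \<Theta> \<alpha> y) (w y)) = - (LINT y|lebesgue. pair (\<Theta> y) (p y))" .
qed

lemma norm_Rm: "norm q = 1 \<Longrightarrow> norm (Rm q *v w) = norm w"
proof -
  assume q: "norm q = 1"
  have n: "(norm v)\<^sup>2 = (Re (v$1))\<^sup>2 + (Im (v$1))\<^sup>2 + ((Re (v$2))\<^sup>2 + (Im (v$2))\<^sup>2)" for v :: "complex^2"
    unfolding norm_vec_def L2_set_def by (simp add: sum_2 cmod_power2 sum_nonneg)
  have "(norm (Rm q *v w))\<^sup>2 = (q$1*q$1 + q$2*q$2 + q$3*q$3 + q$4*q$4) * (norm w)\<^sup>2"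
    unfolding n mv2_nth Rm_nth by (simp add: power2_eq_square algebra_simps)
  also have "q$1*q$1 + q$2*q$2 + q$3*q$3 + q$4*q$4 = 1" using q by (simp add: norm_eq_1 inner_4)
  finally show ?thesis by simp
qed

definition Sm :: "(real^4 \<Rightarrow> real^3^3) \<Rightarrow> 3 \<Rightarrow> real^4 \<Rightarrow> complex^2^2"
  where "Sm B m x = (\<Sum>j\<in>UNIV. B x $ j $ m *\<^sub>R pauli j)"

text \<open>The formal transpose of \<open>W - lam\<close> in the frame \<open>\<Sum>m. B j m Ef m\<close>, acting on rows.\<close>

definition Wt :: "real \<Rightarrow> (real^4 \<Rightarrow> real^3^3) \<Rightarrow> (real^4 \<Rightarrow> real^3^3) \<Rightarrow> real \<Rightarrow> (real^4 \<Rightarrow> complex^2) \<Rightarrow> real^4 \<Rightarrow> complex^2"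
  where "Wt \<tau> B G lam \<eta> x = \<i> *s (\<Sum>m\<in>UNIV. Ed \<tau> m (\<lambda>x. \<eta> x v* Sm B m x) x) + \<eta> x v* Qc (cst \<tau> B G x) - lam *\<^sub>R \<eta> x"

lemma sig_Eh: "sig (\<lambda>y. B (stereo y) ** Eh \<tau> y) \<alpha> y = (\<Sum>m\<in>UNIV. Eh \<tau> y $ m $ \<alpha> *\<^sub>R Sm B m (stereo y))"
  unfolding sig_def Sm_def by (simp add: sum_3 mm3_nth algebra_simps scaleR_add_left scaleR_add_right)

lemma Cinf_Sm: "(\<And>i j. Cinf_on (\<lambda>x. B x $ i $ j) S) \<Longrightarrow> open S \<Longrightarrow> Cinf_on (Sm B m) S"
  unfolding Sm_def[abs_def] by (intro Cinf_on_sum Cinf_on_scaleR Cinf_on_const)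

lemma Cinf_Qc:
  fixes c :: "real^4 \<Rightarrow> 3 \<Rightarrow> 3 \<Rightarrow> 3 \<Rightarrow> real"
  assumes "open S" "\<And>l j k. Cinf_on (\<lambda>x. c x l j k) S" shows "Cinf_on (\<lambda>x. Qc (c x)) S"
  unfolding Qc_def by (intro Cinf_on_add Cinf_on_sum Cinf_on_scaleR Cinf_on_mult Cinf_on_const assms)

lemma Cinf_cst:
  assumes "open S" "\<And>i j. Cinf_on (\<lambda>x. B x $ i $ j) S" "\<And>i j. Cinf_on (\<lambda>x. G x $ i $ j) S"
  shows "Cinf_on (\<lambda>x. cst \<tau> B G x l j k) S"
  unfolding cst_def Nc_def mm3_nth
  by (intro Cinf_on_add Cinf_on_diff Cinf_on_sum Cinf_on_mult Cinf_on_const Cinf_Ed assms)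

lemma Cinf_Wt:
  assumes "open S" "\<And>i j. Cinf_on (\<lambda>x. B x $ i $ j) S" "\<And>i j. Cinf_on (\<lambda>x. G x $ i $ j) S" "Cinf_on \<eta> S"
  shows "Cinf_on (Wt \<tau> B G lam \<eta>) S"
  unfolding Wt_def[abs_def]
  by (intro Cinf_on_diff Cinf_on_add Cinf_on_linear_compose[OF bounded_linear_smult] Cinf_on_sum
     Cinf_on_bilinear[OF bounded_bilinear_vector_matrix_mult] Cinf_on_scaleR Cinf_on_const Cinf_Qc Cinf_cst Cinf_Ed Cinf_Sm assms)

lemma vm2_nth: "(\<theta> v* (A :: complex^2^2)) $ i = \<theta>$1 * A$1$i + \<theta>$2 * A$2$i"
  by (simp add: vector_matrix_mult_def sum_2)

lemma vec2_eqI: "x$1 = y$1 \<Longrightarrow> x$2 = y$2 \<Longrightarrow> (x :: 'a^2) = y"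
  by (simp add: vec_eq_iff forall_2)

lemma row_smult: "(c *s \<theta>) v* (A::complex^2^2) = c *s (\<theta> v* A)"
  by (intro vec2_eqI; simp add: vm2_nth algebra_simps)

lemma row_mult: "(\<theta> v* (A::complex^2^2)) v* (B::complex^2^2) = \<theta> v* (A ** B)"
  by (intro vec2_eqI; simp add: vm2_nth mm2_nth algebra_simps)

lemma row_Qmat_sum:
  fixes S Z :: "3 \<Rightarrow> complex^2^2"
  shows
  "- (\<Sum>\<alpha>\<in>UNIV. ((\<i> *s \<theta>) v* S \<alpha>) v* Z \<alpha>) = \<theta> v* cmul (- \<i>) (\<Sum>\<alpha>\<in>(UNIV::3 set). S \<alpha> ** Z \<alpha>)"
  unfolding sum_3 by (intro vec2_eqI; simp add: vm2_nth mm2_nth cmul_def algebra_simps)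

lemma pair_dirac:
  "pair \<theta> ((- \<i>) *s (\<Sum>\<alpha>\<in>(UNIV::3 set). S \<alpha> *v x \<alpha>)) = - (\<Sum>\<alpha>\<in>UNIV. pair ((\<i> *s \<theta>) v* S \<alpha>) (x \<alpha>))"
  unfolding sum_3 pair_row pair_smult pair.add_right by (simp add: algebra_simps)

lemmas bb_vm = bounded_bilinear_vector_matrix_mult

interpretation vm: bounded_bilinear "(v*) :: complex^2 \<Rightarrow> complex^2^2 \<Rightarrow> complex^2"
  by (rule bounded_bilinear_vector_matrix_mult)

lemma smult_scaleR: "c *s (r *\<^sub>R (v::complex^2)) = r *\<^sub>R (c *s v)"
  by (simp add: vec_eq_iff)

text \<open>Since the fields weighted with \<open>Jac\<close> are divergence-free, only the
  derivatives of the coefficients \<Phi> survive.\<close>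

lemma div_combination:
  fixes a :: "3 \<Rightarrow> real^3 \<Rightarrow> complex^2"
  assumes \<Phi>: "\<And>m. \<Phi> m differentiable at y"
    and a: "\<And>\<alpha> y. a \<alpha> y = (\<Sum>m\<in>UNIV. (Jac y * Eh \<tau> y $ m $ \<alpha>) *\<^sub>R \<Phi> m y)"
  shows "(\<Sum>\<alpha>\<in>UNIV. pd (a \<alpha>) \<alpha> y) = Jac y *\<^sub>R (\<Sum>m\<in>UNIV. \<Sum>\<alpha>\<in>UNIV. Eh \<tau> y $ m $ \<alpha> *\<^sub>R pd (\<Phi> m) \<alpha> y)"
proof -
  have d: "(\<lambda>y. Jac y * Eh \<tau> y $ m $ \<alpha>) differentiable at y" for m \<alpha>
    by (rule Cinf_on_differentiable[where S=UNIV]) (intro Cinf_on_mult Cinf_Jac Cinf_Eh open_UNIV, simp)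
  have "pd (a \<alpha>) \<alpha> y = (\<Sum>m\<in>UNIV. pd (\<lambda>y. (Jac y * Eh \<tau> y $ m $ \<alpha>) *\<^sub>R \<Phi> m y) \<alpha> y)" for \<alpha>
    unfolding a[abs_def] by (rule pd_sum) (auto intro: differentiable_bilinear[OF bounded_bilinear_scaleR] d \<Phi>)
  also have "\<dots> \<alpha> = (\<Sum>m\<in>UNIV. (Jac y * Eh \<tau> y $ m $ \<alpha>) *\<^sub>R pd (\<Phi> m) \<alpha> y + pd (\<lambda>y. Jac y * Eh \<tau> y $ m $ \<alpha>) \<alpha> y *\<^sub>R \<Phi> m y)" for \<alpha>
    by (intro sum.cong refl pd_bilinear[OF bounded_bilinear_scaleR d \<Phi>])
  finally have "(\<Sum>\<alpha>\<in>UNIV. pd (a \<alpha>) \<alpha> y) = (\<Sum>\<alpha>\<in>UNIV. \<Sum>m\<in>UNIV. (Jac y * Eh \<tau> y $ m $ \<alpha>) *\<^sub>R pd (\<Phi> m) \<alpha> y)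
     + (\<Sum>\<alpha>\<in>UNIV. \<Sum>m\<in>UNIV. pd (\<lambda>y. Jac y * Eh \<tau> y $ m $ \<alpha>) \<alpha> y *\<^sub>R \<Phi> m y)"
    by (simp add: sum.distrib)
  also have "(\<Sum>\<alpha>\<in>UNIV. \<Sum>m\<in>UNIV. pd (\<lambda>y. Jac y * Eh \<tau> y $ m $ \<alpha>) \<alpha> y *\<^sub>R \<Phi> m y)
     = (\<Sum>m\<in>UNIV. (\<Sum>\<alpha>\<in>UNIV. pd (\<lambda>y. Jac y * Eh \<tau> y $ m $ \<alpha>) \<alpha> y) *\<^sub>R \<Phi> m y)"
    by (subst sum.swap) (simp add: scaleR_sum_left)
  also have "(\<Sum>\<alpha>\<in>UNIV. \<Sum>m\<in>UNIV. (Jac y * Eh \<tau> y $ m $ \<alpha>) *\<^sub>R pd (\<Phi> m) \<alpha> y)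
     = Jac y *\<^sub>R (\<Sum>m\<in>UNIV. \<Sum>\<alpha>\<in>UNIV. Eh \<tau> y $ m $ \<alpha> *\<^sub>R pd (\<Phi> m) \<alpha> y)"
    by (subst sum.swap) (simp add: scaleR_sum_right)
  finally show ?thesis unfolding div_Eh by simp
qed

text \<open>In the stereographic chart the given frame is rotated into the frame B E; the rotation
  lifts to SU(2), and \<open>u\<close> is the eigenspinor rotated pointwise, hence of the same norm.
  The equation is multiplied by a test row cut off by \<open>chi N\<close>, integrated by parts, and
  the cutoff is removed at the end. \<open>G\<close> is separate from \<open>gram\<close> because
  the Gram matrix matters only on the sphere, while the transposed operator differentiates functions
  defined off the origin.\<close>

lemma weak_dirac:
  assumes \<tau>: "\<tau> = 1 \<or> \<tau> = -1" and g: "riemannian_metric g" and e: "pos_orthonormal_frame g e"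
    and dir: "dirac g e v (\<lambda>x. lam *\<^sub>R v x)"
    and sB: "\<And>i j. Cinf_on (\<lambda>x. B x $ i $ j) (- {0})" and dB: "\<And>x. x \<in> S3 \<Longrightarrow> det (B x) > 0"
    and oB: "\<And>x. x \<in> S3 \<Longrightarrow> B x ** gram g \<tau> x ** transpose (B x) = mat 1"
    and sG: "\<And>i j. Cinf_on (\<lambda>x. G x $ i $ j) (- {0})" and G: "\<And>x. x \<in> S3 \<Longrightarrow> G x = gram g \<tau> x"
  obtains u where "u \<in> borel_measurable lebesgue" "integrable Mst (\<lambda>y. (norm (u y))\<^sup>2)"
    "\<And>y. norm (u y) = norm (v (stereo y))"
    "\<And>\<eta>. Cinf_on \<eta> (- {0}) \<Longrightarrow> (LINT y|Mst. pair (Wt \<tau> B G lam \<eta> (stereo y)) (u y)) = 0"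
proof -
  have pm: "pointwise_metric g" using g by (simp add: riemannian_metric_def)
  have H: "H1_S3 v" using dir by (simp add: dirac_def)
  have nz: "stereo y \<noteq> 0" for y using norm_stereo[of y] by auto
  define F where "F = frame_comp e stereo"
  define M where "M = metric_comp g stereo"
  define X where "X y = B (stereo y) ** Eh \<tau> y" for y
  have symM: "transpose (M z) = M z" for z unfolding M_def by (rule metric_comp_stereo_sym[OF pm])
  have sM: "Cinf_on (\<lambda>y. M y $ i $ j) UNIV" for i j
    using g pos_coords_stereo unfolding riemannian_metric_def M_def by blast
  have sF: "Cinf_on (\<lambda>y. F y $ i $ j) UNIV" and dF: "det (F y) > 0" for i j y
    using e pos_coords_stereo unfolding pos_orthonormal_frame_def F_def by blast+
  have sBs: "Cinf_on (\<lambda>y. B (stereo y) $ i $ j) UNIV" for i j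
    by (rule Cinf_on_compose[OF _ _ sB Cinf_stereo]) (use nz in auto)
  have sX: "Cinf_on (\<lambda>y. X y $ i $ j) UNIV" for i j
    unfolding X_def mm3_nth by (intro Cinf_on_add Cinf_on_mult sBs Cinf_Eh open_UNIV)
  have sm: "Cinf_on M UNIV" "Cinf_on F UNIV" "Cinf_on X UNIV" by (intro Cinf_on_vec open_UNIV sM sF sX)+
  have dm: "M differentiable at y" "F differentiable at y" "X differentiable at y" for y
    by (rule Cinf_on_differentiable[OF _ UNIV_I], rule sm)+
  have oF: "F y ** M y ** transpose (F y) = mat 1" for y
    unfolding F_def M_def by (rule frame_comp_orthonormal[OF pm e])
  have oX: "X y ** M y ** transpose (X y) = mat 1" for y
  proof -
    have "X y ** M y ** transpose (X y) = B (stereo y) ** (Eh \<tau> y ** M y ** transpose (Eh \<tau> y)) ** transpose (B (stereo y))"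
      unfolding X_def by (simp add: matrix_transpose_mul matrix_mul_assoc)
    then show ?thesis unfolding M_def gram_stereo[OF pm] using oB[OF stereo_S3] by simp
  qed
  have dX: "det (X y) > 0" for y
    unfolding X_def det_mul det_Eh[OF \<tau>] using dB[OF stereo_S3] one_plus_inner[of y] by simp
  have dM: "det (M y) \<noteq> 0" for y
    using arg_cong[OF oF[of y], of det] by (auto simp: det_mul)
  have inv: "invertible (M y)" for y using dM by (simp add: invertible_det_nz)
  have FM: "M y ** transpose (F y) ** F y = mat 1" for y
    using oF[of y] by (metis matrix_left_right_inverse matrix_mul_assoc)
  \<comment> \<open>The rotation from the given frame \<open>F\<close> to \<open>X\<close>:
    orthogonal since both are orthonormal, and of determinant 1 since both are positively
    oriented.\<close>
  define A where "A y = X y ** M y ** transpose (F y)" for y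
  have AF: "A y ** F y = X y" for y
  proof -
    have "A y ** F y = X y ** (M y ** transpose (F y) ** F y)" unfolding A_def by (simp only: matrix_mul_assoc)
    then show ?thesis unfolding FM by simp
  qed
  have oA: "A y ** transpose (A y) = mat 1" for y
  proof -
    have "A y ** transpose (A y) = (A y ** F y) ** M y ** transpose (X y)"
      unfolding A_def by (simp add: matrix_transpose_mul matrix_mul_assoc symM)
    then show ?thesis unfolding AF oX .
  qed
  have "det (A y) = 1" for y
  proof -
    have "det (A y) * det (F y) = det (X y)" unfolding AF[symmetric] by (simp add: det_mul)
    then have "det (A y) > 0" using dF[of y] dX[of y] by (metis mult_less_0_iff not_less_iff_gr_or_eq mult_zero_left)
    moreover have "(det (A y))\<^sup>2 = 1" using arg_cong[OF oA[of y], of det] by (simp add: det_mul power2_eq_square)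
    ultimately show ?thesis by (simp add: power2_eq_1_iff)
  qed
  moreover have "Cinf_on (\<lambda>y. A y $ i $ j) UNIV" for i j
    unfolding A_def mm3_nth transpose_def vec_lambda_beta by (intro Cinf_on_add Cinf_on_mult sX sM sF open_UNIV)
  ultimately obtain q where sq: "Cinf_on q UNIV" and nq: "\<And>y. norm (q y) = 1" and qA: "\<And>y. Rot (q y) = A y"
    using rotation_lift[of A] oA by blast
  define R where "R y = Rm (q y)" for y
  have blR: "bounded_linear Rm" using Rm_linear linear_conv_bounded_linear by blast
  have sR: "Cinf_on R UNIV" unfolding R_def by (rule Cinf_on_linear_compose[OF blR open_UNIV sq])
  define w where "w = v \<circ> stereo"
  define u where "u y = R y *v w y" for y
  have Lw: "loc_L2 UNIV w" using H pos_coords_stereo unfolding H1_S3_def w_def by blast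
  have mw: "w \<in> borel_measurable lebesgue" using Lw by (simp add: loc_L2_def lebesgue_on_UNIV_eq)
  have mu: "u \<in> borel_measurable lebesgue"
    unfolding u_def by (rule borel_measurable_bilinear[OF bounded_bilinear_matrix_vector_mult continuous_borel_lebesgue[OF Cinf_on_continuous[OF sR]] mw])
  have nu: "norm (u y) = norm (v (stereo y))" for y unfolding u_def R_def w_def by (simp add: norm_Rm nq)
  have iu: "integrable Mst (\<lambda>y. (norm (u y))\<^sup>2)" unfolding nu by (rule L2_sphere(2)[OF H])
  define Z where "Z \<alpha> y = spin (Gam g stereo F \<alpha> y)" for \<alpha> y
  define Z' where "Z' \<alpha> y = spin (Gam g stereo X \<alpha> y)" for \<alpha> y
  have gs: "Z' \<alpha> y ** R y + pd R \<alpha> y = R y ** Z \<alpha> y" and gg: "R y ** sig F \<alpha> y = sig X \<alpha> y ** R y" for \<alpha> y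
    using gauge_spin[where X'=X and q=q and y=y and \<alpha>=\<alpha>, OF nq Cinf_on_differentiable[OF sq UNIV_I] dm(2) oF[unfolded M_def]]
      gauge_sig[where X'=X and q=q and y=y and \<alpha>=\<alpha>, OF nq Cinf_on_differentiable[OF sq UNIV_I] dm(2) oF[unfolded M_def]]
    unfolding Z_def Z'_def R_def qA AF by auto
  have "\<exists>p. weak_pd UNIV \<alpha> w p" for \<alpha> using H pos_coords_stereo unfolding H1_S3_def w_def by blast
  then obtain p where p: "\<And>\<alpha>. weak_pd UNIV \<alpha> w (p \<alpha>)" by metis
  have eqn: "AE y in lebesgue. lam *\<^sub>R w y = (- \<i>) *s (\<Sum>\<alpha>\<in>UNIV. sig F \<alpha> y *v (p \<alpha> y + Z \<alpha> y *v w y))"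
  proof -
    have "AE y in lebesgue_on UNIV. lam *\<^sub>R v (stereo y) = dirac_expr g e stereo y (v (stereo y)) (\<lambda>\<alpha>. p \<alpha> y)"
      using dir pos_coords_stereo p unfolding dirac_def w_def by blast
    then have "AE y in lebesgue. lam *\<^sub>R w y = dirac_expr g e stereo y (w y) (\<lambda>\<alpha>. p \<alpha> y)"
      unfolding lebesgue_on_UNIV_eq w_def o_def .
    then show ?thesis
      by eventually_elim (simp add: dirac_expr_spin[OF dm(2)[unfolded F_def] symM[unfolded M_def]] F_def Z_def)
  qed
  have main: "(LINT y|Mst. pair (Wt \<tau> B G lam \<eta> (stereo y)) (u y)) = 0" if \<eta>: "Cinf_on \<eta> (- {0})" for \<eta>
  proof -
    define h where "h y = \<eta> (stereo y)" for y
    define \<kappa> where "\<kappa> m x = \<i> *s (\<eta> x v* Sm B m x)" for m x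
    have o0: "open (- {0::real^4})" by (simp add: open_Compl)
    have s\<eta>S: "Cinf_on (\<lambda>x. \<eta> x v* Sm B m x) (- {0})" for m by (intro Cinf_on_bilinear[OF bb_vm] o0 \<eta> Cinf_Sm sB)
    have s\<kappa>: "Cinf_on (\<kappa> m) (- {0})" for m unfolding \<kappa>_def[abs_def]
      by (rule Cinf_on_linear_compose[OF bounded_linear_smult o0 s\<eta>S])
    have s\<kappa>s: "Cinf_on (\<lambda>y. \<kappa> m (stereo y)) UNIV" for m
      by (rule Cinf_on_compose[OF _ _ s\<kappa> Cinf_stereo]) (use nz in auto)
    have sh: "Cinf_on h UNIV" unfolding h_def by (rule Cinf_on_compose[OF _ _ \<eta> Cinf_stereo]) (use nz in auto)
    have E\<kappa>: "Ed \<tau> m (\<kappa> m) x = \<i> *s Ed \<tau> m (\<lambda>x. \<eta> x v* Sm B m x) x" if "x \<in> S3" for m x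
      unfolding \<kappa>_def[abs_def] by (rule Ed_linear[OF bounded_linear_smult Cinf_on_differentiable[OF s\<eta>S]]) (use that S3_nonzero in auto)
    have sWt: "Cinf_on (Wt \<tau> B G lam \<eta>) (- {0})" by (intro Cinf_Wt o0 sB sG \<eta>)
    have cWt: "continuous_on S3 (Wt \<tau> B G lam \<eta>)" by (rule continuous_on_subset[OF Cinf_on_continuous[OF sWt] S3_nonzero])
    define T where "T N y = chi N y *\<^sub>R pair (Wt \<tau> B G lam \<eta> (stereo y)) (u y) + (\<Sum>m\<in>UNIV. dchi \<tau> N m y *\<^sub>R pair (\<kappa> m (stereo y)) (u y))" for N y
    have mT: "T N \<in> borel_measurable lebesgue" for N
      unfolding T_def
      by (intro borel_measurable_add borel_measurable_sum borel_measurable_scaleR continuous_borel_lebesgue[OF continuous_chi] continuous_borel_lebesgue[OF continuous_dchi]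
         borel_measurable_bilinear[OF bounded_bilinear_pair _ mu] stereo_measurable_comp[OF cWt] continuous_borel_lebesgue[OF Cinf_on_continuous[OF s\<kappa>s]])
    have zero: "(LINT y|Mst. T N y) = 0" for N
    proof -
      define K where "K = cball (0::real^3) (sqrt (2 * real (Suc N)))"
      define ps where "ps y = Jac y * chi N y" for y
      have cK: "compact K" unfolding K_def by simp
      have chiK: "chi N y = 0" if "y \<notin> K" for y using chi_support[of y N] that unfolding K_def by blast
      have sps: "Cinf_on ps UNIV" unfolding ps_def[abs_def] by (intro Cinf_on_mult Cinf_Jac Cinf_chi open_UNIV)
      define a where "a \<alpha> y = ps y *\<^sub>R ((\<i> *s h y) v* sig X \<alpha> y)" for \<alpha> y
      define \<Theta> where "\<Theta> \<alpha> y = a \<alpha> y v* R y" for \<alpha> y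
      have ssig: "Cinf_on (sig X \<alpha>) UNIV" for \<alpha> unfolding sig_def[abs_def] by (intro Cinf_on_sum Cinf_on_scaleR sX Cinf_on_const open_UNIV)
      have sa: "Cinf_on (a \<alpha>) UNIV" for \<alpha> unfolding a_def[abs_def]
        by (intro Cinf_on_scaleR Cinf_on_bilinear[OF bb_vm] Cinf_on_linear_compose[OF bounded_linear_smult] sps sh ssig open_UNIV)
      have s\<Theta>: "Cinf_on (\<Theta> \<alpha>) UNIV" for \<alpha> unfolding \<Theta>_def[abs_def] by (rule Cinf_on_bilinear[OF bb_vm open_UNIV sa sR])
      have z\<Theta>: "\<Theta> \<alpha> y = 0" if "y \<notin> K" for \<alpha> y using chiK[OF that] by (simp add: \<Theta>_def a_def ps_def vm.zero_left)
      note row = weak_pd_row[OF Lw p s\<Theta> cK z\<Theta>]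
      \<comment> \<open>By the intertwining relation \<open>gg\<close> the test row is also a row
        times the symbol of the given frame, so pairing with it reproduces the eigenvalue equation
        exactly as given.\<close>
      have \<Theta>F: "\<Theta> \<alpha> y = (\<i> *s (ps y *\<^sub>R (h y v* R y))) v* sig F \<alpha> y" for \<alpha> y
        unfolding \<Theta>_def a_def row_smult vm.scaleR_left smult_scaleR row_mult gg by simp
      \<comment> \<open>A pointwise identity from the product rule, the gauge relation
        \<open>gs\<close> and the equation itself. By \<open>weak_pd_row\<close> the two summands on
        the right have opposite integrals for each index, which gives \<open>zero\<close>.\<close>
      have AEq: "AE y in lebesgue. Jac y *\<^sub>R T N y = (\<Sum>\<alpha>\<in>UNIV. pair (pd (\<Theta> \<alpha>) \<alpha> y) (w y) + pair (\<Theta> \<alpha> y) (p \<alpha> y))"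
        using eqn
      proof eventually_elim
        case (elim y)
        define t where "t = ps y *\<^sub>R (h y v* R y)"
        have "pair t (lam *\<^sub>R w y) = - (\<Sum>\<alpha>\<in>UNIV. pair (\<Theta> \<alpha> y) (p \<alpha> y + Z \<alpha> y *v w y))"
          unfolding elim pair_dirac \<Theta>F t_def ..
        then have 1: "(\<Sum>\<alpha>\<in>UNIV. pair (\<Theta> \<alpha> y) (p \<alpha> y)) = - pair t (lam *\<^sub>R w y) - (\<Sum>\<alpha>\<in>UNIV. pair (\<Theta> \<alpha> y) (Z \<alpha> y *v w y))"
          by (simp add: pair.add_right sum.distrib)
        have dd: "a \<alpha> differentiable at y" "R differentiable at y" for \<alpha>
          using Cinf_on_differentiable[OF sa UNIV_I] Cinf_on_differentiable[OF sR UNIV_I] by auto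
        have 2: "pair (pd (\<Theta> \<alpha>) \<alpha> y) (w y) = pair (pd (a \<alpha>) \<alpha> y) (u y) + pair (a \<alpha> y) (pd R \<alpha> y *v w y)" for \<alpha>
          unfolding \<Theta>_def[abs_def] pd_bilinear[OF bb_vm dd] pair.add_left pair_row u_def by simp
        have 3: "pair (\<Theta> \<alpha> y) (Z \<alpha> y *v w y) = pair (a \<alpha> y v* Z' \<alpha> y) (u y) + pair (a \<alpha> y) (pd R \<alpha> y *v w y)" for \<alpha>
        proof -
          have "R y *v (Z \<alpha> y *v w y) = Z' \<alpha> y *v (R y *v w y) + pd R \<alpha> y *v w y"
            unfolding matrix_vector_mul_assoc gs[symmetric] by (simp add: matrix_vector_mult_add_rdistrib)
          then show ?thesis unfolding \<Theta>_def pair_row u_def by (simp add: pair.add_right)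
        qed
        have t: "pair t (lam *\<^sub>R w y) = pair ((lam * ps y) *\<^sub>R h y) (u y)"
          unfolding t_def u_def by (simp add: pair.scaleR_left pair.scaleR_right pair_row mult_ac)
        have Q: "- (\<Sum>\<alpha>\<in>UNIV. a \<alpha> y v* Z' \<alpha> y) = ps y *\<^sub>R (h y v* Qc (cst \<tau> B G (stereo y)))"
        proof -
          have "Qmat g stereo X y = Qc (brk g stereo X y)"
            by (rule Qmat_eq_Qc) (use inv symM dm oX in \<open>simp_all add: M_def\<close>)
          also have "brk g stereo X y = cst \<tau> B (gram g \<tau>) (stereo y)"
            by (intro ext brk_eq_cst[OF \<tau> pm sB]) (simp add: X_def)
          also have "\<dots> = cst \<tau> B G (stereo y)" using G[OF stereo_S3, of y] by (intro ext) (simp add: cst_def)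
          finally have "Qc (cst \<tau> B G (stereo y)) = cmul (- \<i>) (\<Sum>\<alpha>\<in>UNIV. sig X \<alpha> y ** Z' \<alpha> y)" unfolding Qmat_def Z'_def ..
          then have "h y v* Qc (cst \<tau> B G (stereo y)) = - (\<Sum>\<alpha>\<in>UNIV. ((\<i> *s h y) v* sig X \<alpha> y) v* Z' \<alpha> y)"
            by (simp only: row_Qmat_sum)
          then show ?thesis unfolding a_def vm.scaleR_left by (simp add: scaleR_sum_right)
        qed
        define \<Phi> where "\<Phi> m y = chi N y *\<^sub>R \<kappa> m (stereo y)" for m y
        have d\<Phi>: "chi N differentiable at y" "(\<lambda>y. \<kappa> m (stereo y)) differentiable at y" for m
          using Cinf_on_differentiable[OF Cinf_chi UNIV_I] Cinf_on_differentiable[OF s\<kappa>s UNIV_I] by auto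
        have aE: "a \<alpha> y = (\<Sum>m\<in>UNIV. (Jac y * Eh \<tau> y $ m $ \<alpha>) *\<^sub>R \<Phi> m y)" for \<alpha> y
          unfolding a_def X_def[abs_def] sig_Eh \<Phi>_def \<kappa>_def h_def ps_def
          by (simp add: vm.sum_right vm.scaleR_right row_smult scaleR_sum_right mult_ac)
        have \<Phi>E: "(\<Sum>\<alpha>\<in>UNIV. Eh \<tau> y $ m $ \<alpha> *\<^sub>R pd (\<Phi> m) \<alpha> y) = chi N y *\<^sub>R Ed \<tau> m (\<kappa> m) (stereo y) + dchi \<tau> N m y *\<^sub>R \<kappa> m (stereo y)" for m
        proof -
          have "pd (\<Phi> m) \<alpha> y = chi N y *\<^sub>R pd (\<lambda>y. \<kappa> m (stereo y)) \<alpha> y + pd (chi N) \<alpha> y *\<^sub>R \<kappa> m (stereo y)" for \<alpha>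
            unfolding \<Phi>_def[abs_def] by (rule pd_bilinear[OF bounded_bilinear_scaleR d\<Phi>])
          then show ?thesis
            using Ed_stereo[OF Cinf_on_differentiable[OF s\<kappa>], of y \<tau> m m] nz[of y]
            by (simp add: dchi_def scaleR_sum_left scaleR_sum_right scaleR_add_right sum.distrib mult_ac)
        qed
        have "(\<Sum>\<alpha>\<in>UNIV. pd (a \<alpha>) \<alpha> y) = Jac y *\<^sub>R (\<Sum>m\<in>UNIV. \<Sum>\<alpha>\<in>UNIV. Eh \<tau> y $ m $ \<alpha> *\<^sub>R pd (\<Phi> m) \<alpha> y)"
          by (rule div_combination[OF _ aE]) (unfold \<Phi>_def, intro differentiable_bilinear[OF bounded_bilinear_scaleR] d\<Phi>)
        also have "\<dots> = Jac y *\<^sub>R (\<Sum>m\<in>UNIV. chi N y *\<^sub>R Ed \<tau> m (\<kappa> m) (stereo y) + dchi \<tau> N m y *\<^sub>R \<kappa> m (stereo y))"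
          unfolding \<Phi>E ..
        finally have 4: "(\<Sum>\<alpha>\<in>UNIV. pd (a \<alpha>) \<alpha> y) = ps y *\<^sub>R (\<i> *s (\<Sum>m\<in>UNIV. Ed \<tau> m (\<lambda>x. \<eta> x v* Sm B m x) (stereo y)))
            + Jac y *\<^sub>R (\<Sum>m\<in>UNIV. dchi \<tau> N m y *\<^sub>R \<kappa> m (stereo y))"
          unfolding E\<kappa>[OF stereo_S3] ps_def
          by (simp add: sum.distrib scaleR_add_right scaleR_sum_right vector_add_ldistrib sum_3)
        have "(\<Sum>\<alpha>\<in>UNIV. pair (pd (\<Theta> \<alpha>) \<alpha> y) (w y) + pair (\<Theta> \<alpha> y) (p \<alpha> y))
           = pair (\<Sum>\<alpha>\<in>UNIV. pd (a \<alpha>) \<alpha> y) (u y) + pair (- (\<Sum>\<alpha>\<in>UNIV. a \<alpha> y v* Z' \<alpha> y)) (u y) - pair ((lam * ps y) *\<^sub>R h y) (u y)"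
          unfolding sum.distrib 1 2 3 t pair.sum_left pair.minus_left by simp
        also have "\<dots> = pair (ps y *\<^sub>R Wt \<tau> B G lam \<eta> (stereo y) + Jac y *\<^sub>R (\<Sum>m\<in>UNIV. dchi \<tau> N m y *\<^sub>R \<kappa> m (stereo y))) (u y)"
          unfolding Q 4 Wt_def h_def
          by (simp add: pair.add_left pair.diff_left pair.scaleR_left scaleR_add_right scaleR_diff_right algebra_simps)
        also have "\<dots> = Jac y *\<^sub>R T N y"
          unfolding T_def ps_def by (simp add: pair.add_left pair.sum_left pair.scaleR_left scaleR_add_right mult_ac)
        finally show ?case ..
      qed
      have "(LINT y|Mst. T N y) = (LINT y|lebesgue. Jac y *\<^sub>R T N y)" by (rule integral_Mst[OF mT])
      also have "\<dots> = (LINT y|lebesgue. (\<Sum>\<alpha>\<in>UNIV. pair (pd (\<Theta> \<alpha>) \<alpha> y) (w y) + pair (\<Theta> \<alpha> y) (p \<alpha> y)))"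
      proof (rule integral_cong_AE[OF _ _ AEq])
        show "(\<lambda>y. Jac y *\<^sub>R T N y) \<in> borel_measurable lebesgue" using mT by (intro borel_measurable_scaleR Jac_measurable)
        show "(\<lambda>y. \<Sum>\<alpha>\<in>UNIV. pair (pd (\<Theta> \<alpha>) \<alpha> y) (w y) + pair (\<Theta> \<alpha> y) (p \<alpha> y)) \<in> borel_measurable lebesgue"
          by (intro borel_measurable_sum borel_measurable_add borel_measurable_integrable[OF row(1)] borel_measurable_integrable[OF row(2)])
      qed
      also have "\<dots> = (\<Sum>\<alpha>\<in>UNIV. LINT y|lebesgue. pair (pd (\<Theta> \<alpha>) \<alpha> y) (w y) + pair (\<Theta> \<alpha> y) (p \<alpha> y))"
        by (rule Bochner_Integration.integral_sum) (intro Bochner_Integration.integrable_add row)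
      also have "\<dots> = 0"
        by (rule sum.neutral) (simp add: Bochner_Integration.integral_add[OF row(1,2)] row(3))
      finally show ?thesis .
    qed
    obtain Cp where Cp: "Cp > 0" "\<And>a b. norm (pair a b) \<le> norm a * norm b * Cp" using pair.pos_bounded by blast
    have "(\<lambda>N. LINT y|Mst. T N y) \<longlonglongrightarrow> (LINT y|Mst. pair (Wt \<tau> B G lam \<eta> (stereo y)) (u y))"
      unfolding T_def
    proof (rule cutoff_limit)
      have sq: "integrable Mst (\<lambda>y. (norm (pair (f (stereo y)) (u y)))\<^sup>2)" if cf: "continuous_on S3 f" for f
      proof -
        obtain C where C: "C \<ge> 0" "\<And>y. norm (f (stereo y)) \<le> C" using stereo_bounded[OF cf] by blast
        have "integrable Mst (\<lambda>y. (C * Cp)\<^sup>2 * (norm (u y))\<^sup>2)" using iu by simp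
        then show ?thesis
        proof (rule Bochner_Integration.integrable_bound)
          show "(\<lambda>y. (norm (pair (f (stereo y)) (u y)))\<^sup>2) \<in> borel_measurable Mst"
            using borel_measurable_bilinear[OF bounded_bilinear_pair stereo_measurable_comp[OF cf] mu] by simp
          show "AE y in Mst. norm ((norm (pair (f (stereo y)) (u y)))\<^sup>2) \<le> norm ((C * Cp)\<^sup>2 * (norm (u y))\<^sup>2)"
          proof (rule AE_I2)
            fix y
            have "norm (pair (f (stereo y)) (u y)) \<le> norm (f (stereo y)) * norm (u y) * Cp" by (rule Cp(2))
            also have "\<dots> \<le> C * norm (u y) * Cp" using C Cp(1) by (intro mult_right_mono) auto
            finally have "(norm (pair (f (stereo y)) (u y)))\<^sup>2 \<le> (C * norm (u y) * Cp)\<^sup>2" by (intro power_mono) auto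
            then show "norm ((norm (pair (f (stereo y)) (u y)))\<^sup>2) \<le> norm ((C * Cp)\<^sup>2 * (norm (u y))\<^sup>2)"
              by (simp add: power_mult_distrib mult_ac)
          qed
        qed
      qed
      have mp: "(\<lambda>y. pair (f (stereo y)) (u y)) \<in> borel_measurable lebesgue" if cf: "continuous_on S3 f" for f
        by (rule borel_measurable_bilinear[OF bounded_bilinear_pair stereo_measurable_comp[OF cf] mu])
      have c\<kappa>: "continuous_on S3 (\<kappa> m)" for m by (rule continuous_on_subset[OF Cinf_on_continuous[OF s\<kappa>] S3_nonzero])
      show "(\<lambda>y. pair (\<kappa> m (stereo y)) (u y)) \<in> borel_measurable lebesgue" for m by (rule mp[OF c\<kappa>])
      show "integrable Mst (\<lambda>y. (norm (pair (\<kappa> m (stereo y)) (u y)))\<^sup>2)" for m by (rule sq[OF c\<kappa>])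
      have "integrable Mst (\<lambda>y. norm (pair (Wt \<tau> B G lam \<eta> (stereo y)) (u y)))"
        using square_integrable_imp_integrable[of "\<lambda>y. norm (pair (Wt \<tau> B G lam \<eta> (stereo y)) (u y))"] mp[OF cWt] sq[OF cWt] by simp
      then show "integrable Mst (\<lambda>y. pair (Wt \<tau> B G lam \<eta> (stereo y)) (u y))"
        using mp[OF cWt] by (simp add: integrable_norm_iff)
    qed
    then show ?thesis unfolding zero by (simp add: LIMSEQ_const_iff)
  qed
  show ?thesis by (rule that[OF mu iu nu main])
qed

section \<open>Orthonormal frames depending smoothly on the metric\<close>

definition minor2 :: "real^3^3 \<Rightarrow> real"
  where "minor2 G = G$1$1 * G$2$2 - G$1$2 * G$1$2"

text \<open>Gram-Schmidt: the rows of \<open>chol G\<close> are orthonormal for the inner product with Gram matrix \<open>G\<close>.\<close>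

definition chol :: "real^3^3 \<Rightarrow> real^3^3"
  where "chol G = vector
    [vector [1 / sqrt (G$1$1), 0, 0],
     vector [- G$1$2 / sqrt (G$1$1 * minor2 G), G$1$1 / sqrt (G$1$1 * minor2 G), 0],
     vector [(G$1$2 * G$2$3 - G$1$3 * G$2$2) / sqrt (minor2 G * det G),
       (G$1$2 * G$1$3 - G$1$1 * G$2$3) / sqrt (minor2 G * det G), minor2 G / sqrt (minor2 G * det G)]]"

lemma chol_nth:
  "chol G $ 1 $ 1 = 1 / sqrt (G$1$1)" "chol G $ 1 $ 2 = 0" "chol G $ 1 $ 3 = 0"
  "chol G $ 2 $ 1 = - G$1$2 / sqrt (G$1$1 * minor2 G)" "chol G $ 2 $ 2 = G$1$1 / sqrt (G$1$1 * minor2 G)" "chol G $ 2 $ 3 = 0"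
  "chol G $ 3 $ 1 = (G$1$2 * G$2$3 - G$1$3 * G$2$2) / sqrt (minor2 G * det G)"
  "chol G $ 3 $ 2 = (G$1$2 * G$1$3 - G$1$1 * G$2$3) / sqrt (minor2 G * det G)"
  "chol G $ 3 $ 3 = minor2 G / sqrt (minor2 G * det G)"
  by (simp_all add: chol_def vector_3)

lemma chol_mat_1: "chol (mat 1) = mat 1"
proof -
  have "minor2 (mat 1) = 1" by (simp add: minor2_def mat_def)
  then show ?thesis unfolding vec_eq_iff forall_3 chol_nth det_I by (simp add: mat_def)
qed

lemma transpose_nth_eq: "transpose G = G \<Longrightarrow> G $ i $ j = G $ j $ i"
proof -
  assume "transpose G = G"
  then have "G $ i $ j = transpose G $ i $ j" by simp
  then show ?thesis by (simp add: transpose_def)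
qed

lemma chol_orthonormal:
  assumes sym: "transpose G = G" and pos: "G$1$1 > 0" "minor2 G > 0" "det G > 0"
  shows "chol G ** G ** transpose (chol G) = mat 1" "det (chol G) > 0"
proof -
  define a b c where "a = 1 / sqrt (G$1$1)" and "b = 1 / sqrt (G$1$1 * minor2 G)" and "c = 1 / sqrt (minor2 G * det G)"
  have abc: "a > 0" "b > 0" "c > 0" using pos by (simp_all add: a_def b_def c_def)
  have p: "G$1$1 * minor2 G > 0" "minor2 G * det G > 0" using pos by simp_all
  have sq: "a * a * G$1$1 = 1" "b * b * (G$1$1 * minor2 G) = 1" "c * c * (minor2 G * det G) = 1"
    using pos p by (simp_all add: a_def b_def c_def del: real_sqrt_mult_self flip: real_sqrt_mult)
  have n: "chol G $ 1 $ 1 = a" "chol G $ 1 $ 2 = 0" "chol G $ 1 $ 3 = 0"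
    "chol G $ 2 $ 1 = - G$1$2 * b" "chol G $ 2 $ 2 = G$1$1 * b" "chol G $ 2 $ 3 = 0"
    "chol G $ 3 $ 1 = (G$1$2 * G$2$3 - G$1$3 * G$2$2) * c" "chol G $ 3 $ 2 = (G$1$2 * G$1$3 - G$1$1 * G$2$3) * c"
    "chol G $ 3 $ 3 = minor2 G * c"
    by (simp_all add: chol_nth a_def b_def c_def)
  have s: "G$2$1 = G$1$2" "G$3$1 = G$1$3" "G$3$2 = G$2$3" by (rule transpose_nth_eq[OF sym])+
  have d: "det G = G$1$1 * G$2$2 * G$3$3 + 2 * G$1$2 * G$1$3 * G$2$3 - G$1$1 * G$2$3 * G$2$3 - G$1$2 * G$1$2 * G$3$3 - G$1$3 * G$1$3 * G$2$2"
    unfolding det_3 s by (simp add: algebra_simps)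
  have e: "(chol G ** G ** transpose (chol G)) $ 1 $ 1 = a * a * G$1$1"
    "(chol G ** G ** transpose (chol G)) $ 2 $ 2 = b * b * (G$1$1 * minor2 G)"
    "(chol G ** G ** transpose (chol G)) $ 3 $ 3 = c * c * (minor2 G * det G)"
    unfolding d minor2_def by (simp_all add: mm3_nth transpose_def n s minor2_def algebra_simps)
  let ?P = "chol G ** G ** transpose (chol G)"
  have z: "?P $ 1 $ 2 = 0" "?P $ 1 $ 3 = 0" "?P $ 2 $ 1 = 0" "?P $ 2 $ 3 = 0" "?P $ 3 $ 1 = 0" "?P $ 3 $ 2 = 0"
    by (simp_all add: mm3_nth transpose_def n s minor2_def algebra_simps)
  show "?P = mat 1"
    unfolding vec_eq_iff forall_3 e z sq by (simp add: mat_def)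
  have "det (chol G) = a * (G$1$1 * b) * (minor2 G * c)" unfolding det_3 n by simp
  then show "det (chol G) > 0" using abc pos by simp
qed

text \<open>The test vectors are the rows of \<open>chol G\<close> before normalisation. On them the
  quadratic form takes the values G_11, G_11 times the second minor, and the second minor times the
  determinant.\<close>

lemma posdef_minors:
  fixes G :: "real^3^3"
  assumes sym: "transpose G = G" and pos: "\<And>a::real^3. a \<noteq> 0 \<Longrightarrow> (\<Sum>j\<in>UNIV. a $ j * (\<Sum>k\<in>UNIV. a $ k * G $ j $ k)) > 0"
  shows "G$1$1 > 0" "minor2 G > 0" "det G > 0"
proof -
  have s: "G$2$1 = G$1$2" "G$3$1 = G$1$3" "G$3$2 = G$2$3" by (rule transpose_nth_eq[OF sym])+
  have ne: "vector [a, b, c] \<noteq> (0::real^3)" if "a \<noteq> 0 \<or> b \<noteq> 0 \<or> c \<noteq> 0" for a b c :: real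
    using that by (auto simp: vec_eq_iff forall_3 vector_3)
  show 1: "G$1$1 > 0" using pos[OF ne[of 1 0 0]] by (simp add: sum_3 vector_3)
  have "G$1$1 * minor2 G > 0"
    using pos[OF ne[of "- G$1$2" "G$1$1" 0]] 1 by (simp add: sum_3 vector_3 s minor2_def algebra_simps)
  then show 2: "minor2 G > 0" using 1 by (simp add: zero_less_mult_iff)
  let ?u = "G$1$2 * G$2$3 - G$1$3 * G$2$2" and ?v = "G$1$2 * G$1$3 - G$1$1 * G$2$3"
  have d: "det G = G$1$1 * G$2$2 * G$3$3 + 2 * G$1$2 * G$1$3 * G$2$3 - G$1$1 * G$2$3 * G$2$3 - G$1$2 * G$1$2 * G$3$3 - G$1$3 * G$1$3 * G$2$2"
    unfolding det_3 s by (simp add: algebra_simps)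
  have r: "?u * G$1$1 + ?v * G$1$2 + minor2 G * G$1$3 = 0" "?u * G$1$2 + ?v * G$2$2 + minor2 G * G$2$3 = 0"
    "?u * G$1$3 + ?v * G$2$3 + minor2 G * G$3$3 = det G"
    unfolding d minor2_def by (simp_all add: algebra_simps)
  have "?u * (?u * G$1$1 + ?v * G$1$2 + minor2 G * G$1$3) + ?v * (?u * G$1$2 + ?v * G$2$2 + minor2 G * G$2$3)
     + minor2 G * (?u * G$1$3 + ?v * G$2$3 + minor2 G * G$3$3) > 0"
    using pos[OF ne[of ?u ?v "minor2 G"]] 2 unfolding sum_3 vector_3 s by simp
  then have "minor2 G * det G > 0" unfolding r by simp
  then show "det G > 0" using 2 by (simp add: zero_less_mult_iff)
qed

lemma Cinf_chol:
  assumes o: "open S" and M: "\<And>i j. Cinf_on (\<lambda>x. M x $ i $ j) S"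
    and pos: "\<And>x. x \<in> S \<Longrightarrow> M x $ 1 $ 1 > 0" "\<And>x. x \<in> S \<Longrightarrow> minor2 (M x) > 0" "\<And>x. x \<in> S \<Longrightarrow> det (M x) > 0"
  shows "Cinf_on (\<lambda>x. chol (M x) $ i $ j) S"
proof -
  have m: "Cinf_on (\<lambda>x. minor2 (M x)) S" unfolding minor2_def by (intro Cinf_on_diff Cinf_on_mult M o)
  have d: "Cinf_on (\<lambda>x. det (M x)) S" unfolding det_3 by (intro Cinf_on_diff Cinf_on_add Cinf_on_mult M o)
  have r: "Cinf_on (\<lambda>x. sqrt (M x $ 1 $ 1)) S" "Cinf_on (\<lambda>x. sqrt (M x $ 1 $ 1 * minor2 (M x))) S" "Cinf_on (\<lambda>x. sqrt (minor2 (M x) * det (M x))) S"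
    by (intro Cinf_on_sqrt Cinf_on_mult M m d o; simp add: pos)+
  have nz: "sqrt (M x $ 1 $ 1) \<noteq> 0" "sqrt (M x $ 1 $ 1 * minor2 (M x)) \<noteq> 0" "sqrt (minor2 (M x) * det (M x)) \<noteq> 0" if "x \<in> S" for x
    using pos[OF that] by simp_all
  have c: "Cinf_on (\<lambda>x. chol (M x) $ 1 $ 1) S" "Cinf_on (\<lambda>x. chol (M x) $ 1 $ 2) S" "Cinf_on (\<lambda>x. chol (M x) $ 1 $ 3) S"
    "Cinf_on (\<lambda>x. chol (M x) $ 2 $ 1) S" "Cinf_on (\<lambda>x. chol (M x) $ 2 $ 2) S" "Cinf_on (\<lambda>x. chol (M x) $ 2 $ 3) S"
    "Cinf_on (\<lambda>x. chol (M x) $ 3 $ 1) S" "Cinf_on (\<lambda>x. chol (M x) $ 3 $ 2) S" "Cinf_on (\<lambda>x. chol (M x) $ 3 $ 3) S"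
    unfolding chol_nth
    by (intro Cinf_on_divide Cinf_on_diff Cinf_on_minus Cinf_on_mult Cinf_on_const M m r o nz; assumption)+
  show ?thesis using exhaust_3[of i] exhaust_3[of j] c by auto
qed

lemma gram_chart:
  assumes g: "pointwise_metric g" and x: "x \<in> S3" and t: "\<And>\<alpha>::3. t \<alpha> \<in> tangent_S3 x"
    and E: "\<And>m. Ef \<tau> m x = (\<Sum>\<alpha>\<in>UNIV. X $ m $ \<alpha> *\<^sub>R t \<alpha>)"
  shows "gram g \<tau> x $ j $ k = (\<Sum>\<alpha>\<in>UNIV. X $ j $ \<alpha> * (\<Sum>\<beta>\<in>UNIV. X $ k $ \<beta> * g x (t \<alpha>) (t \<beta>)))"
proof -
  have s: "g x (t \<alpha>) (Ef \<tau> k x) = (\<Sum>\<beta>\<in>UNIV. X $ k $ \<beta> * g x (t \<alpha>) (t \<beta>))" for \<alpha>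
  proof -
    have "g x (t \<alpha>) (Ef \<tau> k x) = g x (Ef \<tau> k x) (t \<alpha>)" by (rule metric_symmetric[OF g x t Ef_tangent])
    also have "\<dots> = (\<Sum>\<beta>\<in>UNIV. X $ k $ \<beta> * g x (t \<beta>) (t \<alpha>))" unfolding E by (rule metric_linear[OF g x t t])
    also have "\<dots> = (\<Sum>\<beta>\<in>UNIV. X $ k $ \<beta> * g x (t \<alpha>) (t \<beta>))"
      by (intro sum.cong refl arg_cong2[where f="(*)"] metric_symmetric[OF g x t t])
    finally show ?thesis .
  qed
  have "gram g \<tau> x $ j $ k = g x (\<Sum>\<alpha>\<in>UNIV. X $ j $ \<alpha> *\<^sub>R t \<alpha>) (Ef \<tau> k x)" by (simp add: gram_def E[of j])
  also have "\<dots> = (\<Sum>\<alpha>\<in>UNIV. X $ j $ \<alpha> * g x (t \<alpha>) (Ef \<tau> k x))" by (rule metric_linear[OF g x t Ef_tangent])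
  finally show ?thesis unfolding s .
qed

lemma gram_transpose: "pointwise_metric g \<Longrightarrow> x \<in> S3 \<Longrightarrow> transpose (gram g \<tau> x) = gram g \<tau> x"
  by (auto simp: vec_eq_iff transpose_def gram_def intro!: metric_symmetric Ef_tangent)

lemma gram_minors:
  assumes \<tau>: "\<tau> = 1 \<or> \<tau> = -1" and g: "pointwise_metric g" and x: "x \<in> S3"
  shows "gram g \<tau> x $ 1 $ 1 > 0" "minor2 (gram g \<tau> x) > 0" "det (gram g \<tau> x) > 0"
proof -
  have "(\<Sum>j\<in>UNIV. a $ j * (\<Sum>k\<in>UNIV. a $ k * gram g \<tau> x $ j $ k)) > 0" if a: "a \<noteq> 0" for a :: "real^3"
  proof -
    define w where "w = (\<Sum>m\<in>UNIV. a $ m *\<^sub>R Ef \<tau> m x)"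
    have n: "norm x = 1" using x by (simp add: S3_def)
    have wt: "w \<in> tangent_S3 x" unfolding w_def by (intro tangent_sum3 Ef_tangent)
    have "w \<bullet> Ef \<tau> k x = a $ k" for k
      unfolding w_def by (simp add: inner_sum_left Ef_inner_Ef[OF \<tau> n] if_distrib cong: if_cong)
    then have "a = 0" if "w = 0" using that by (simp add: vec_eq_iff)
    then have "w \<noteq> 0" using a by blast
    then have "g x w w > 0" using g x wt unfolding pointwise_metric_def by blast
    also have "g x w w = (\<Sum>j\<in>UNIV. a $ j * g x (Ef \<tau> j x) w)"
      using metric_linear[where t="\<lambda>j. Ef \<tau> j x" and a="\<lambda>j. a $ j", OF g x Ef_tangent wt] by (simp add: w_def)
    also have "\<dots> = (\<Sum>j\<in>UNIV. a $ j * (\<Sum>k\<in>UNIV. a $ k * gram g \<tau> x $ j $ k))"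
    proof (intro sum.cong refl arg_cong2[where f="(*)"])
      fix j
      have "g x (Ef \<tau> j x) w = g x w (Ef \<tau> j x)" by (rule metric_symmetric[OF g x Ef_tangent wt])
      also have "\<dots> = (\<Sum>k\<in>UNIV. a $ k * g x (Ef \<tau> k x) (Ef \<tau> j x))"
        unfolding w_def by (rule metric_linear[OF g x Ef_tangent Ef_tangent])
      also have "\<dots> = (\<Sum>k\<in>UNIV. a $ k * gram g \<tau> x $ j $ k)"
        unfolding gram_def vec_lambda_beta by (intro sum.cong refl arg_cong2[where f="(*)"] metric_symmetric[OF g x Ef_tangent Ef_tangent])
      finally show "g x (Ef \<tau> j x) w = (\<Sum>k\<in>UNIV. a $ k * gram g \<tau> x $ j $ k)" .
    qed
    finally show ?thesis .
  qed
  from posdef_minors[OF gram_transpose[OF g x] this]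
  show "gram g \<tau> x $ 1 $ 1 > 0" "minor2 (gram g \<tau> x) > 0" "det (gram g \<tau> x) > 0" by auto
qed

lemma Cinf_sgn: "Cinf_on (sgn :: real^4 \<Rightarrow> real^4) (- {0})"
proof -
  have o: "open (- {0::real^4})" by (simp add: open_Compl)
  have id: "Cinf_on (\<lambda>x::real^4. x) (- {0})" by (rule Cinf_on_ident[OF o])
  have "Cinf_on (\<lambda>x::real^4. (1 / sqrt (x \<bullet> x)) *\<^sub>R x) (- {0})"
    by (intro Cinf_on_scaleR Cinf_on_divide Cinf_on_sqrt Cinf_on_inner Cinf_on_const id o) auto
  then show ?thesis by (rule Cinf_on_cong[OF o, rotated]) (simp add: sgn_div_norm norm_eq_sqrt_inner inverse_eq_divide)
qed

lemma compact_linear_bound: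
  fixes H :: "'a::euclidean_space \<times> real \<Rightarrow> real"
  assumes H: "Cinf_on H (S \<times> {-e<..<e})" and S: "open S" "K \<subseteq> S" "compact K" and d: "0 < d" "d < e" and z: "\<And>x. x \<in> K \<Longrightarrow> H (x, 0) = 0"
  shows "\<exists>C. \<forall>x\<in>K. \<forall>t. \<bar>t\<bar> \<le> d \<longrightarrow> \<bar>H (x, t)\<bar> \<le> C * \<bar>t\<bar>"
proof -
  let ?D = "S \<times> {-e<..<e}" and ?K = "K \<times> {-d..d}"
  define H' where "H' p = frechet_derivative H (at p) (0, 1)" for p
  have o: "open ?D" using S(1) by (intro open_Times) auto
  have KD: "?K \<subseteq> ?D" using S(2) d by auto
  have "continuous_on ?D H'"
    unfolding H'_def by (intro Cinf_on_continuous Cinf_on_frechet o H Cinf_on_const)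
  then have "bounded (H' ` ?K)"
    by (intro compact_imp_bounded compact_continuous_image compact_Times S(3) continuous_on_subset[OF _ KD]) auto
  then obtain C where C: "\<And>p. p \<in> ?K \<Longrightarrow> norm (H' p) \<le> C" by (auto simp: bounded_iff)
  have "\<bar>H (x, t)\<bar> \<le> C * \<bar>t\<bar>" if x: "x \<in> K" and t: "\<bar>t\<bar> \<le> d" for x t
  proof -
    have "norm (H (x, t) - H (x, 0)) \<le> C * norm (t - 0)"
    proof (rule field_differentiable_bound[where S="{-d..d}" and f="\<lambda>t. H (x, t)" and f'="\<lambda>t. H' (x, t)"])
      fix s assume s: "s \<in> {-d..d}"
      then have sD: "(x, s) \<in> ?D" using subsetD[OF KD, of "(x, s)"] x by simp
      have h: "(H has_derivative frechet_derivative H (at (x, s))) (at (x, s))"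
        by (rule Cinf_on_has_derivative[OF H sD])
      have p: "((\<lambda>t. (x, t)) has_derivative (\<lambda>h. (0, h))) (at s)"
        by (intro has_derivative_Pair has_derivative_const has_derivative_ident)
      have "((\<lambda>t. H (x, t)) has_derivative (\<lambda>k. frechet_derivative H (at (x, s)) (0, k))) (at s)"
        using has_derivative_compose[OF p h] by simp
      moreover have "frechet_derivative H (at (x, s)) (0, k) = H' (x, s) * k" for k
        using linear_cmul[OF has_derivative_linear[OF h], of k "(0, 1)"] by (simp add: H'_def)
      ultimately have "((\<lambda>t. H (x, t)) has_field_derivative H' (x, s)) (at s)"
        by (simp add: has_field_derivative_def)
      then show "((\<lambda>t. H (x, t)) has_field_derivative H' (x, s)) (at s within {-d..d})"
        by (rule has_field_derivative_at_within)
      show "norm (H' (x, s)) \<le> C" using C[of "(x, s)"] x s by simp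
    qed (use t d in auto)
    then show ?thesis using z[OF x] by simp
  qed
  then show ?thesis by blast
qed

section \<open>The family of metrics in the invariant frame, with uniform orders in the
  parameter\<close>

locale metric_perturbation =
  fixes \<tau> \<epsilon>0 :: real and g :: "real \<Rightarrow> metric"
  assumes \<tau>: "\<tau> = 1 \<or> \<tau> = -1" and eps0: "\<epsilon>0 > 0" and family: "smooth_metric_family \<epsilon>0 g" and std: "is_standard_metric (g 0)"
begin

abbreviation Dom :: "((real^4) \<times> real) set" where "Dom \<equiv> (- {0}) \<times> {-\<epsilon>0<..<\<epsilon>0}"

text \<open>Extended to be homogeneous of degree 0 in the space variable.\<close>

definition GG :: "(real^4) \<times> real \<Rightarrow> real^3^3" where "GG p = gram (g (snd p)) \<tau> (sgn (fst p))"

definition BB :: "(real^4) \<times> real \<Rightarrow> real^3^3" where "BB p = chol (GG p)"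

lemma open_Dom: "open Dom" by (intro open_Times open_greaterThanLessThan) (simp add: open_Compl)

lemma metric_eps: "\<bar>\<epsilon>\<bar> < \<epsilon>0 \<Longrightarrow> riemannian_metric (g \<epsilon>)" "\<bar>\<epsilon>\<bar> < \<epsilon>0 \<Longrightarrow> pointwise_metric (g \<epsilon>)"
  using family unfolding smooth_metric_family_def riemannian_metric_def by blast+

lemma sgn_S3: "x \<noteq> 0 \<Longrightarrow> sgn (x::real^4) \<in> S3" by (simp add: S3_def norm_sgn)

lemma Dom_D: "p \<in> Dom \<Longrightarrow> pointwise_metric (g (snd p))" "p \<in> Dom \<Longrightarrow> sgn (fst p) \<in> S3"
  by (auto intro!: metric_eps sgn_S3)

lemma Cinf_sgn_fst: "Cinf_on (\<lambda>p. sgn (fst p)) Dom"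
proof (rule Cinf_on_compose[OF open_Dom _ Cinf_sgn])
  show "Cinf_on (fst :: (real^4) \<times> real \<Rightarrow> real^4) Dom" by (rule Cinf_on_bounded_linear[OF open_Dom bounded_linear_fst])
qed (auto simp: open_Compl)

text \<open>Smoothness of the family is given only in charts. The antipodal charts s = 1 and s = -1
  have the same components \<open>Eh\<close>, because the invariant fields are odd, and their
  domains, extended along rays, cover the space without the origin.\<close>

lemma Cinf_GG_chart:
  assumes s: "s = 1 \<or> s = (-1::real)"
  defines "T \<equiv> Dom \<inter> (\<lambda>p. 1 + s * sgn (fst p) $ 1) -` {0<..}"
  shows "open T" "Cinf_on (\<lambda>p. GG p $ j $ k) T"
proof -
  define \<phi> where "\<phi> y = s *\<^sub>R stereo y" for y
  have ss: "s * s = 1" using s by auto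
  have c: "Cinf_on (\<lambda>p. 1 + s * sgn (fst p) $ 1) Dom"
    by (intro Cinf_on_add Cinf_on_mult Cinf_on_const Cinf_on_vec_nth Cinf_sgn_fst open_Dom)
  show oT: "open T" unfolding T_def by (rule continuous_open_preimage[OF Cinf_on_continuous[OF c] open_Dom]) auto
  have TD: "T \<subseteq> Dom" by (auto simp: T_def)
  have pc: "pos_coords \<phi> UNIV" unfolding \<phi>_def[abs_def] using s pos_coords_stereo pos_coords_minus_stereo by auto
  have pd\<phi>: "pd \<phi> \<alpha> y = s *\<^sub>R pd stereo \<alpha> y" for \<alpha> y
    unfolding \<phi>_def[abs_def] by (rule pd_linear[OF bounded_linear_scaleR_right stereo_differentiable])
  have tan: "pd \<phi> \<alpha> y \<in> tangent_S3 (\<phi> y)" for \<alpha> y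
    using pd_stereo_tangent[of \<alpha> y] unfolding pd\<phi> \<phi>_def by (simp add: tangent_S3_def)
  have E: "Ef \<tau> m (\<phi> y) = (\<Sum>\<alpha>\<in>UNIV. Eh \<tau> y $ m $ \<alpha> *\<^sub>R pd \<phi> \<alpha> y)" for m y
    unfolding pd\<phi> \<phi>_def Ef_scaleR Ef_stereo by (simp add: scaleR_sum_right mult.commute)
  have S3\<phi>: "\<phi> y \<in> S3" for y using s stereo_S3 minus_stereo_S3 by (auto simp: \<phi>_def)
  define Y where "Y p = unstereo (s *\<^sub>R sgn (fst p))" for p :: "(real^4) \<times> real"
  have oH: "open {x::real^4. 1 + x$1 > 0}" by (intro open_Collect_less continuous_intros)
  have sY: "Cinf_on Y T" unfolding Y_def[abs_def]
  proof (rule Cinf_on_compose[OF oT oH Cinf_unstereo])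
    show "Cinf_on (\<lambda>p. s *\<^sub>R sgn (fst p)) T" by (intro Cinf_on_scaleR Cinf_on_const oT Cinf_on_subset[OF Cinf_sgn_fst TD])
  qed (auto simp: T_def)
  have fam: "Cinf_on (\<lambda>(y, \<epsilon>). metric_comp (g \<epsilon>) \<phi> y $ \<alpha> $ \<beta>) (UNIV \<times> {-\<epsilon>0<..<\<epsilon>0})" for \<alpha> \<beta>
    using family pc unfolding smooth_metric_family_def by blast
  have oI: "open ((UNIV :: (real^3) set) \<times> {-\<epsilon>0<..<\<epsilon>0})" by (intro open_Times) auto
  have sP: "Cinf_on (\<lambda>p. (Y p, snd p)) T"
    by (intro Cinf_on_Pair oT sY Cinf_on_bounded_linear bounded_linear_snd)
  have sM: "Cinf_on (\<lambda>p. (\<lambda>(y, \<epsilon>). metric_comp (g \<epsilon>) \<phi> y $ \<alpha> $ \<beta>) (Y p, snd p)) T" for \<alpha> \<beta>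
    by (rule Cinf_on_compose[OF oT oI fam sP]) (use TD in auto)
  have sE: "Cinf_on (\<lambda>p. Eh \<tau> (Y p) $ m $ \<alpha>) T" for m \<alpha>
    by (rule Cinf_on_compose[OF oT open_UNIV Cinf_Eh sY]) simp
  have "Cinf_on (\<lambda>p. \<Sum>\<alpha>\<in>UNIV. Eh \<tau> (Y p) $ j $ \<alpha> * (\<Sum>\<beta>\<in>UNIV. Eh \<tau> (Y p) $ k $ \<beta> * (\<lambda>(y, \<epsilon>). metric_comp (g \<epsilon>) \<phi> y $ \<alpha> $ \<beta>) (Y p, snd p))) T"
    by (intro Cinf_on_sum Cinf_on_mult oT sE sM)
  then show "Cinf_on (\<lambda>p. GG p $ j $ k) T"
  proof (rule Cinf_on_cong[OF oT, rotated])
    fix p assume p: "p \<in> T"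
    have S: "s *\<^sub>R sgn (fst p) \<in> S3" "sgn (fst p) \<in> S3" using Dom_D(2)[OF subsetD[OF TD p]] s by (auto simp: S3_def)
    have "s *\<^sub>R sgn (fst p) \<noteq> - pole" using p by (auto simp: T_def vec_eq_iff axis_def dest: spec[of _ 1])
    then have "stereo (Y p) = s *\<^sub>R sgn (fst p)" unfolding Y_def by (rule stereo_unstereo[OF S(1)])
    then have \<phi>Y: "\<phi> (Y p) = sgn (fst p)" by (simp add: \<phi>_def ss)
    have pm: "pointwise_metric (g (snd p))" using p TD Dom_D(1) by blast
    show "(\<Sum>\<alpha>\<in>UNIV. Eh \<tau> (Y p) $ j $ \<alpha> * (\<Sum>\<beta>\<in>UNIV. Eh \<tau> (Y p) $ k $ \<beta> * (\<lambda>(y, \<epsilon>). metric_comp (g \<epsilon>) \<phi> y $ \<alpha> $ \<beta>) (Y p, snd p))) = GG p $ j $ k"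
      using gram_chart[OF pm S3\<phi> tan E, of "Y p" j k] unfolding GG_def \<phi>Y by (simp add: metric_comp_def \<phi>Y)
  qed
qed

lemma Cinf_GG: "Cinf_on (\<lambda>p. GG p $ j $ k) Dom"
proof (rule Cinf_on_local)
  fix p assume p: "p \<in> Dom"
  show "\<exists>T. open T \<and> p \<in> T \<and> Cinf_on (\<lambda>p. GG p $ j $ k) T"
  proof (cases "sgn (fst p) $ 1 \<ge> 0")
    case True
    then show ?thesis using Cinf_GG_chart[of 1] p by (intro exI[of _ "Dom \<inter> (\<lambda>p. 1 + 1 * sgn (fst p) $ 1) -` {0<..}"]) auto
  next
    case False
    then show ?thesis using Cinf_GG_chart[of "-1"] p by (intro exI[of _ "Dom \<inter> (\<lambda>p. 1 + -1 * sgn (fst p) $ 1) -` {0<..}"]) auto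
  qed
qed

lemma GG_props: "p \<in> Dom \<Longrightarrow> transpose (GG p) = GG p" "p \<in> Dom \<Longrightarrow> GG p $ 1 $ 1 > 0" "p \<in> Dom \<Longrightarrow> minor2 (GG p) > 0" "p \<in> Dom \<Longrightarrow> det (GG p) > 0"
  unfolding GG_def by (rule gram_transpose gram_minors; use Dom_D \<tau> in blast)+

lemma GG_0: "x \<noteq> 0 \<Longrightarrow> GG (x, 0) = mat 1"
proof -
  assume x: "x \<noteq> 0"
  have n: "norm (sgn x) = 1" using x by (simp add: norm_sgn)
  have "g 0 (sgn x) (Ef \<tau> j (sgn x)) (Ef \<tau> k (sgn x)) = Ef \<tau> j (sgn x) \<bullet> Ef \<tau> k (sgn x)" for j k
    using std sgn_S3[OF x] Ef_tangent unfolding is_standard_metric_def by blast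
  then show ?thesis by (simp add: GG_def gram_def vec_eq_iff mat_def Ef_inner_Ef[OF \<tau> n])
qed

lemma BB_0: "x \<noteq> 0 \<Longrightarrow> BB (x, 0) = mat 1"
  by (simp add: BB_def GG_0 chol_mat_1)

lemma Cinf_BB: "Cinf_on (\<lambda>p. BB p $ i $ j) Dom"
  unfolding BB_def by (rule Cinf_chol[OF open_Dom Cinf_GG]) (rule GG_props; assumption)+

lemma BB_orthonormal: "p \<in> Dom \<Longrightarrow> BB p ** GG p ** transpose (BB p) = mat 1" "p \<in> Dom \<Longrightarrow> det (BB p) > 0"
  unfolding BB_def by (intro chol_orthonormal GG_props; assumption)+

lemma Cinf_slice:
  fixes H :: "(real^4) \<times> real \<Rightarrow> 'b::real_normed_vector"
  assumes "Cinf_on H Dom" "\<bar>t\<bar> < \<epsilon>0" shows "Cinf_on (\<lambda>x. H (x, t)) (- {0})"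
proof -
  have o: "open (- {0::real^4})" by (simp add: open_Compl)
  have c: "Cinf_on (\<lambda>x. (x, t)) (- {0::real^4})" by (rule Cinf_on_Pair[OF o Cinf_on_ident[OF o] Cinf_on_const])
  show ?thesis by (rule Cinf_on_compose[OF o open_Dom assms(1) c]) (use assms(2) in auto)
qed

lemma Ed_slice:
  assumes H: "Cinf_on H Dom" and p: "(x, t) \<in> Dom"
  shows "Ed \<tau> m (\<lambda>x. H (x, t)) x = frechet_derivative H (at (x, t)) (Ef \<tau> m x, 0)"
proof (rule Ed_eq)
  have 1: "((\<lambda>x. (x, t)) has_derivative (\<lambda>h. (h, 0))) (at x)"
    by (intro has_derivative_Pair has_derivative_const has_derivative_ident)
  show "((\<lambda>x. H (x, t)) has_derivative (\<lambda>h. frechet_derivative H (at (x, t)) (h, 0))) (at x)"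
    using has_derivative_compose[OF 1 Cinf_on_has_derivative[OF H p]] by simp
qed

text \<open>Order t^k, uniformly on the sphere. Half of the parameter interval is used so that the
  parameters range over a compact set.\<close>

definition uO :: "nat \<Rightarrow> (real^4 \<Rightarrow> real \<Rightarrow> real) \<Rightarrow> bool"
  where "uO k f \<longleftrightarrow> (\<exists>C. \<forall>x\<in>S3. \<forall>t. \<bar>t\<bar> \<le> \<epsilon>0 / 2 \<longrightarrow> \<bar>f x t\<bar> \<le> C * \<bar>t\<bar> ^ k)"

lemma uO_I: "(\<And>x t. x \<in> S3 \<Longrightarrow> \<bar>t\<bar> \<le> \<epsilon>0 / 2 \<Longrightarrow> \<bar>f x t\<bar> \<le> C * \<bar>t\<bar> ^ k) \<Longrightarrow> uO k f"
  unfolding uO_def by blast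

lemma uO_cong: "uO k f \<Longrightarrow> (\<And>x t. x \<in> S3 \<Longrightarrow> \<bar>t\<bar> \<le> \<epsilon>0 / 2 \<Longrightarrow> f x t = h x t) \<Longrightarrow> uO k h"
  unfolding uO_def by simp

lemma uO_add: "uO k f \<Longrightarrow> uO k h \<Longrightarrow> uO k (\<lambda>x t. f x t + h x t)"
proof -
  assume "uO k f" "uO k h"
  then obtain C D where C: "\<And>x t. x \<in> S3 \<Longrightarrow> \<bar>t\<bar> \<le> \<epsilon>0 / 2 \<Longrightarrow> \<bar>f x t\<bar> \<le> C * \<bar>t\<bar> ^ k"
    and D: "\<And>x t. x \<in> S3 \<Longrightarrow> \<bar>t\<bar> \<le> \<epsilon>0 / 2 \<Longrightarrow> \<bar>h x t\<bar> \<le> D * \<bar>t\<bar> ^ k" unfolding uO_def by metis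
  show ?thesis by (rule uO_I[of _ "C + D"]) (use C D abs_triangle_ineq in \<open>fastforce simp: distrib_right intro: order_trans[OF abs_triangle_ineq add_mono]\<close>)
qed

lemma uO_mult: "uO j f \<Longrightarrow> uO k h \<Longrightarrow> uO (j + k) (\<lambda>x t. f x t * h x t)"
proof -
  assume "uO j f" "uO k h"
  then obtain C D where C: "\<And>x t. x \<in> S3 \<Longrightarrow> \<bar>t\<bar> \<le> \<epsilon>0 / 2 \<Longrightarrow> \<bar>f x t\<bar> \<le> C * \<bar>t\<bar> ^ j"
    and D: "\<And>x t. x \<in> S3 \<Longrightarrow> \<bar>t\<bar> \<le> \<epsilon>0 / 2 \<Longrightarrow> \<bar>h x t\<bar> \<le> D * \<bar>t\<bar> ^ k" unfolding uO_def by metis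
  show ?thesis
  proof (rule uO_I[of _ "C * D"])
    fix x t assume a: "x \<in> S3" "\<bar>t\<bar> \<le> \<epsilon>0 / 2"
    have "\<bar>f x t\<bar> * \<bar>h x t\<bar> \<le> (C * \<bar>t\<bar> ^ j) * (D * \<bar>t\<bar> ^ k)"
      using C[OF a] D[OF a] by (intro mult_mono) auto
    then show "\<bar>f x t * h x t\<bar> \<le> C * D * \<bar>t\<bar> ^ (j + k)" by (simp add: abs_mult power_add mult_ac)
  qed
qed

lemma uO_const: "uO 0 (\<lambda>x t. c)" by (rule uO_I[of _ "\<bar>c\<bar>"]) simp

lemma uO_cmult: "uO k f \<Longrightarrow> uO k (\<lambda>x t. c * f x t)" using uO_mult[OF uO_const, of k f c] by simp

lemma uO_minus: "uO k f \<Longrightarrow> uO k (\<lambda>x t. - f x t)" using uO_cmult[of k f "-1"] by simp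

lemma uO_diff: "uO k f \<Longrightarrow> uO k h \<Longrightarrow> uO k (\<lambda>x t. f x t - h x t)" using uO_add[OF _ uO_minus, of k f h] by simp

lemma uO_zero: "uO k (\<lambda>x t. 0)" by (rule uO_I[of _ 0]) simp

lemma uO_sum: "finite I \<Longrightarrow> (\<And>i. i \<in> I \<Longrightarrow> uO k (f i)) \<Longrightarrow> uO k (\<lambda>x t. \<Sum>i\<in>I. f i x t)"
  by (induction I rule: finite_induct) (auto intro: uO_zero uO_add)

lemma uO_Suc: "uO (Suc k) f \<Longrightarrow> uO k f"
proof -
  assume "uO (Suc k) f"
  moreover have "uO k (\<lambda>x t. \<bar>f x t\<bar>)" if h: "uO (Suc k) f"
  proof -
    obtain C where C: "\<And>x t. x \<in> S3 \<Longrightarrow> \<bar>t\<bar> \<le> \<epsilon>0 / 2 \<Longrightarrow> \<bar>f x t\<bar> \<le> C * \<bar>t\<bar> ^ Suc k" using h unfolding uO_def by blast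
    show ?thesis
    proof (rule uO_I[of _ "\<bar>C\<bar> * (\<epsilon>0 / 2)"])
      fix x t assume a: "x \<in> S3" "\<bar>t\<bar> \<le> \<epsilon>0 / 2"
      have "\<bar>f x t\<bar> \<le> C * \<bar>t\<bar> ^ Suc k" by (rule C[OF a])
      also have "\<dots> \<le> \<bar>C\<bar> * (\<bar>t\<bar> * \<bar>t\<bar> ^ k)" by (simp add: mult_right_mono)
      also have "\<dots> \<le> \<bar>C\<bar> * ((\<epsilon>0 / 2) * \<bar>t\<bar> ^ k)" using a by (intro mult_left_mono mult_right_mono) auto
      finally show "\<bar>\<bar>f x t\<bar>\<bar> \<le> \<bar>C\<bar> * (\<epsilon>0 / 2) * \<bar>t\<bar> ^ k" by simp
    qed
  qed
  ultimately show ?thesis unfolding uO_def by simp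
qed

lemma uO_1: assumes "Cinf_on H Dom" "\<And>x. x \<in> S3 \<Longrightarrow> H (x, 0) = 0" shows "uO 1 (\<lambda>x t. H (x, t))"
  using compact_linear_bound[OF assms(1) _ S3_nonzero compact_S3 _ _ assms(2), of "\<epsilon>0 / 2"] eps0
  unfolding uO_def by (simp add: open_Compl)

lemma uO_0: assumes "continuous_on Dom H" shows "uO 0 (\<lambda>x t. H (x, t))"
proof -
  have "bounded (H ` (S3 \<times> {-(\<epsilon>0/2)..\<epsilon>0/2}))"
    by (intro compact_imp_bounded compact_continuous_image compact_Times compact_S3 continuous_on_subset[OF assms])
      (use eps0 S3_nonzero in auto)
  then obtain C where "\<And>p. p \<in> S3 \<times> {-(\<epsilon>0/2)..\<epsilon>0/2} \<Longrightarrow> norm (H p) \<le> C" by (auto simp: bounded_iff)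
  moreover have "(x, t) \<in> S3 \<times> {-(\<epsilon>0/2)..\<epsilon>0/2}" if "x \<in> S3" "\<bar>t\<bar> \<le> \<epsilon>0 / 2" for x t
  proof -
    have "-(\<epsilon>0/2) \<le> t" "t \<le> \<epsilon>0/2" using that(2) by linarith+
    then show ?thesis using that(1) by simp
  qed
  ultimately show ?thesis by (intro uO_I[of _ C]) simp
qed

lemma S3_ne: "x \<in> S3 \<Longrightarrow> x \<noteq> 0" using S3_nonzero by blast

lemma uO_b: "uO 1 (\<lambda>x t. BB (x, t) $ i $ j - (mat 1 :: real^3^3) $ i $ j)"
  by (rule uO_1[of "\<lambda>p. BB p $ i $ j - (mat 1 :: real^3^3) $ i $ j"])
    (auto intro!: Cinf_on_diff Cinf_BB Cinf_on_const open_Dom simp: BB_0 S3_ne)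

text \<open>The space derivative is itself jointly smooth in the point and the parameter, and it
  vanishes at t = 0, where the frame coefficients are constant; so \<open>uO_1\<close> applies to it
  as well.\<close>

lemma uO_Edb: "uO 1 (\<lambda>x t. Ed \<tau> m (\<lambda>x. BB (x, t) $ i $ j) x)"
proof -
  let ?H = "\<lambda>p. BB p $ i $ j"
  define E where "E p = frechet_derivative ?H (at p) (Ef \<tau> m (fst p), 0)" for p
  have l: "bounded_linear (\<lambda>p::(real^4) \<times> real. (Ef \<tau> m (fst p), 0::real))"
    by (intro bounded_linear_Pair bounded_linear_compose[OF Ef_bounded_linear bounded_linear_fst] bounded_linear_zero)
  have "uO 1 (\<lambda>x t. E (x, t))"
  proof (rule uO_1)
    show "Cinf_on E Dom" unfolding E_def by (rule Cinf_on_frechet[OF open_Dom Cinf_BB Cinf_on_bounded_linear[OF open_Dom l]])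
    fix x :: "real^4" assume "x \<in> S3"
    then have x: "x \<in> - {0}" using S3_nonzero by blast
    have "((\<lambda>x. (mat 1 :: real^3^3) $ i $ j) has_derivative (\<lambda>h. 0)) (at x)" by simp
    then have "((\<lambda>x. ?H (x, 0)) has_derivative (\<lambda>h. 0)) (at x)"
      by (rule has_derivative_transform_within_open[of _ _ _ "UNIV" "- {0}"]) (use x in \<open>auto simp: BB_0 open_Compl\<close>)
    then have "Ed \<tau> m (\<lambda>x. ?H (x, 0)) x = 0" by (rule Ed_eq)
    then show "E (x, 0) = 0" using Ed_slice[OF Cinf_BB, of x 0 m i j] x eps0 by (simp add: E_def)
  qed
  then show ?thesis
  proof (rule uO_cong)
    fix x :: "real^4" and t :: real assume "x \<in> S3" "\<bar>t\<bar> \<le> \<epsilon>0 / 2"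
    then have "(x, t) \<in> Dom" using S3_nonzero eps0 by auto
    then show "E (x, t) = Ed \<tau> m (\<lambda>x. BB (x, t) $ i $ j) x" using Ed_slice[OF Cinf_BB] by (simp add: E_def)
  qed
qed

end

section \<open>Linearisation in the small parameter\<close>

lemma sum_mat_1_mult: "(\<Sum>m\<in>UNIV. ((mat 1 :: real^3^3) $ j $ m + \<beta> m) * X m) = X j + (\<Sum>m\<in>UNIV. \<beta> m * X m)"
  using exhaust_3[of j] by (auto simp: sum_3 mat_def algebra_simps)

lemma sum_mat_1_scaleR:
  fixes X :: "3 \<Rightarrow> 'a::real_vector"
  shows "(\<Sum>j\<in>UNIV. ((mat 1 :: real^3^3) $ j $ m + \<beta> j) *\<^sub>R X j) = X m + (\<Sum>j\<in>UNIV. \<beta> j *\<^sub>R X j)"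
  using exhaust_3[of m] by (auto simp: sum_3 mat_def scaleR_add_left)

text \<open>It acts on rows, as \<open>Wt\<close> does. At t = 0 the transposed operator is
  \<open>Dop\<close> minus lam + 3 \<tau> / 2, and \<open>Dop\<close> annihilates constants; hence
  the eigenvalue - 3 \<tau> / 2.\<close>

definition Dop :: "real \<Rightarrow> (real^4 \<Rightarrow> complex^2) \<Rightarrow> real^4 \<Rightarrow> complex^2"
  where "Dop \<tau> \<eta> x = \<i> *s (\<Sum>m\<in>UNIV. Ed \<tau> m \<eta> x v* pauli m)"

lemma row_Qc: "\<theta> v* Qc c = (\<Sum>k\<in>UNIV. (\<Sum>j\<in>UNIV. c j j k) *\<^sub>R (\<theta> v* cmul (- \<i> / 2) (pauli k)))
    + (1/8 * (\<Sum>j\<in>UNIV. \<Sum>l\<in>UNIV. \<Sum>k\<in>UNIV. eps3 j l k * c l j k)) *\<^sub>R \<theta>"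
  unfolding Qc_def vm.add_right vm.sum_right vm.scaleR_right by (simp add: vector_matrix_mul_rid)

context metric_perturbation begin

definition bm :: "3 \<Rightarrow> 3 \<Rightarrow> real^4 \<Rightarrow> real \<Rightarrow> real"
  where "bm i j x t = BB (x, t) $ i $ j - (mat 1 :: real^3^3) $ i $ j"

definition Em :: "3 \<Rightarrow> 3 \<Rightarrow> 3 \<Rightarrow> real^4 \<Rightarrow> real \<Rightarrow> real"
  where "Em m i j x t = Ed \<tau> m (\<lambda>x. BB (x, t) $ i $ j) x"

definition Pm :: "3 \<Rightarrow> 3 \<Rightarrow> real^4 \<Rightarrow> real \<Rightarrow> real"
  where "Pm i j x t = (BB (x, t) ** GG (x, t)) $ i $ j - (mat 1 :: real^3^3) $ i $ j"

definition cs :: "3 \<Rightarrow> 3 \<Rightarrow> 3 \<Rightarrow> real^4 \<Rightarrow> real \<Rightarrow> real"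
  where "cs l j k x t = cst \<tau> (\<lambda>x. BB (x, t)) (\<lambda>x. GG (x, t)) x l j k"

definition nc :: "3 \<Rightarrow> 3 \<Rightarrow> 3 \<Rightarrow> real^4 \<Rightarrow> real \<Rightarrow> real"
  where "nc j k n x t = Nc \<tau> (\<lambda>x. BB (x, t)) j k n x"

lemma BB_eq: "BB (x, t) $ i $ j = (mat 1 :: real^3^3) $ i $ j + bm i j x t" by (simp add: bm_def)

lemma uO_bm: "uO 1 (bm i j)" using uO_b unfolding bm_def[abs_def] .

lemma uO_Em: "uO 1 (Em m i j)" using uO_Edb unfolding Em_def[abs_def] .

lemma S3_Dom: "x \<in> S3 \<Longrightarrow> \<bar>t\<bar> \<le> \<epsilon>0 / 2 \<Longrightarrow> (x, t) \<in> Dom" using S3_nonzero eps0 by auto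

lemma uO_mult_1_1: "uO 1 f \<Longrightarrow> uO 1 h \<Longrightarrow> uO 2 (\<lambda>x t. f x t * h x t)"
  using uO_mult[of 1 f 1 h] by (simp add: numeral_2_eq_2)

lemma uO_2_1: "uO 2 f \<Longrightarrow> uO 1 f" using uO_Suc[of 1 f] by (simp add: numeral_2_eq_2)

lemma Pm_eq: "x \<in> S3 \<Longrightarrow> \<bar>t\<bar> \<le> \<epsilon>0 / 2 \<Longrightarrow> Pm l n x t = - (\<Sum>k\<in>UNIV. (BB (x, t) ** GG (x, t)) $ l $ k * bm n k x t)"
proof -
  assume a: "x \<in> S3" "\<bar>t\<bar> \<le> \<epsilon>0 / 2"
  have "(mat 1 :: real^3^3) $ l $ n = (BB (x, t) ** GG (x, t) ** transpose (BB (x, t))) $ l $ n"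
    using BB_orthonormal(1)[OF S3_Dom[OF a]] by simp
  also have "\<dots> = (\<Sum>k\<in>UNIV. ((mat 1 :: real^3^3) $ n $ k + bm n k x t) * (BB (x, t) ** GG (x, t)) $ l $ k)"
    unfolding BB_eq[symmetric] matrix_matrix_mult_def[of "BB (x, t) ** GG (x, t)"] by (simp add: transpose_def mult.commute)
  finally show ?thesis unfolding sum_mat_1_mult Pm_def by (simp add: mult.commute)
qed

lemma uO_BG: "uO 0 (\<lambda>x t. (BB (x, t) ** GG (x, t)) $ i $ j)"
  by (rule uO_0[of "\<lambda>p. (BB p ** GG p) $ i $ j"])
    (unfold mm3_nth, intro Cinf_on_continuous Cinf_on_add Cinf_on_mult Cinf_BB Cinf_GG open_Dom)

text \<open>B ** G is the inverse transpose of B, so to first order its deviation from the identity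
  is minus the transpose of that of B.\<close>

lemma uO_Pm: "uO 1 (Pm l n)" and uO_Pm_bm: "uO 2 (\<lambda>x t. Pm l n x t + bm n l x t)"
proof -
  show 1: "uO 1 (Pm l n)" for l n
  proof (rule uO_cong)
    show "uO 1 (\<lambda>x t. - (\<Sum>k\<in>UNIV. (BB (x, t) ** GG (x, t)) $ l $ k * bm n k x t))"
      using uO_mult[OF uO_BG uO_bm] by (intro uO_minus uO_sum) auto
  qed (simp add: Pm_eq)
  show "uO 2 (\<lambda>x t. Pm l n x t + bm n l x t)"
  proof (rule uO_cong)
    show "uO 2 (\<lambda>x t. - (\<Sum>k\<in>UNIV. Pm l k x t * bm n k x t))"
      by (intro uO_minus uO_sum uO_mult_1_1 1 uO_bm) auto
    fix x t assume a: "x \<in> S3" "\<bar>t\<bar> \<le> \<epsilon>0 / 2"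
    have "(\<Sum>k\<in>UNIV. (BB (x, t) ** GG (x, t)) $ l $ k * bm n k x t) = (\<Sum>k\<in>UNIV. ((mat 1 :: real^3^3) $ l $ k + Pm l k x t) * bm n k x t)"
      by (simp add: Pm_def)
    then show "- (\<Sum>k\<in>UNIV. Pm l k x t * bm n k x t) = Pm l n x t + bm n l x t"
      unfolding sum_mat_1_mult Pm_eq[OF a] by simp
  qed
qed

text \<open>\<open>N1\<close> and \<open>N2\<close> are the parts of the structure functions that
  are linear and quadratic in the deviation of the frame and its derivatives.\<close>

definition N1 :: "3 \<Rightarrow> 3 \<Rightarrow> 3 \<Rightarrow> real^4 \<Rightarrow> real \<Rightarrow> real"
  where "N1 j k n x t = Em j k n x t - Em k j n x t + (\<Sum>a\<in>UNIV. bm j a x t * (2 * \<tau> * eps3 a k n)) + (\<Sum>b\<in>UNIV. bm k b x t * (2 * \<tau> * eps3 j b n))"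

definition N2 :: "3 \<Rightarrow> 3 \<Rightarrow> 3 \<Rightarrow> real^4 \<Rightarrow> real \<Rightarrow> real"
  where "N2 j k n x t = (\<Sum>m\<in>UNIV. bm j m x t * Em m k n x t) - (\<Sum>m\<in>UNIV. bm k m x t * Em m j n x t)
     + (\<Sum>a\<in>UNIV. bm j a x t * (\<Sum>b\<in>UNIV. bm k b x t * (2 * \<tau> * eps3 a b n)))"

lemma nc_eq: "nc j k n x t = 2 * \<tau> * eps3 j k n + N1 j k n x t + N2 j k n x t"
proof -
  have 1: "(\<Sum>m\<in>UNIV. BB (x, t) $ j $ m * Em m k n x t - BB (x, t) $ k $ m * Em m j n x t)
     = Em j k n x t + (\<Sum>m\<in>UNIV. bm j m x t * Em m k n x t) - (Em k j n x t + (\<Sum>m\<in>UNIV. bm k m x t * Em m j n x t))"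
    unfolding sum_subtractf BB_eq sum_mat_1_mult ..
  have 2: "(\<Sum>a\<in>UNIV. \<Sum>b\<in>UNIV. BB (x, t) $ j $ a * BB (x, t) $ k $ b * (2 * \<tau> * eps3 a b n))
     = (2 * \<tau> * eps3 j k n + (\<Sum>b\<in>UNIV. bm k b x t * (2 * \<tau> * eps3 j b n)))
      + (\<Sum>a\<in>UNIV. bm j a x t * (2 * \<tau> * eps3 a k n + (\<Sum>b\<in>UNIV. bm k b x t * (2 * \<tau> * eps3 a b n))))"
    unfolding mult.assoc sum_distrib_left[symmetric] BB_eq sum_mat_1_mult ..
  show ?thesis
    unfolding nc_def Nc_def Em_def[symmetric] 1 2 N1_def N2_def by (simp add: sum.distrib distrib_left)
qed

lemma uO_N1: "uO 1 (N1 j k n)"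
  unfolding N1_def[abs_def] mult.commute[of "bm _ _ _ _"] by (intro uO_add uO_diff uO_sum uO_cmult uO_Em uO_bm) auto

lemma uO_multc: "uO k f \<Longrightarrow> uO k (\<lambda>x t. f x t * c)" using uO_cmult[of k f c] by (simp add: mult.commute)

lemma uO_N2: "uO 2 (N2 j k n)"
  unfolding N2_def[abs_def]
  by (intro uO_add uO_diff uO_sum uO_mult_1_1 uO_multc uO_Em uO_bm finite)

lemma uO_nc: "uO 1 (\<lambda>x t. nc j k n x t - 2 * \<tau> * eps3 j k n)"
  unfolding nc_eq using uO_add[OF uO_N1 uO_2_1[OF uO_N2], of j k n j k n] by simp

definition L1 :: "3 \<Rightarrow> 3 \<Rightarrow> 3 \<Rightarrow> real^4 \<Rightarrow> real \<Rightarrow> real"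
  where "L1 l j k x t = N1 j k l x t - (\<Sum>n\<in>UNIV. (2 * \<tau> * eps3 j k n) * bm n l x t)"

lemma uO_cs: "uO 2 (\<lambda>x t. cs l j k x t - (2 * \<tau> * eps3 j k l + L1 l j k x t))"
proof (rule uO_cong)
  show "uO 2 (\<lambda>x t. N2 j k l x t + (\<Sum>n\<in>UNIV. Pm l n x t * (nc j k n x t - 2 * \<tau> * eps3 j k n) + (2 * \<tau> * eps3 j k n) * (Pm l n x t + bm n l x t)))"
    by (intro uO_add uO_N2 uO_sum uO_mult_1_1 uO_cmult uO_Pm_bm uO_Pm uO_nc) auto
  fix x t
  have "cs l j k x t = (\<Sum>n\<in>UNIV. ((mat 1 :: real^3^3) $ l $ n + Pm l n x t) * nc j k n x t)"
    unfolding cs_def cst_def nc_def Pm_def by simp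
  then have "cs l j k x t = nc j k l x t + (\<Sum>n\<in>UNIV. Pm l n x t * nc j k n x t)" unfolding sum_mat_1_mult .
  then show "N2 j k l x t + (\<Sum>n\<in>UNIV. Pm l n x t * (nc j k n x t - 2 * \<tau> * eps3 j k n) + (2 * \<tau> * eps3 j k n) * (Pm l n x t + bm n l x t))
      = cs l j k x t - (2 * \<tau> * eps3 j k l + L1 l j k x t)"
    unfolding L1_def nc_eq[of j k l] by (simp add: sum_3 algebra_simps)
qed

definition Aq :: "3 \<Rightarrow> real^4 \<Rightarrow> real \<Rightarrow> real" where "Aq k x t = (\<Sum>j\<in>UNIV. cs j j k x t)"

definition Sq :: "real^4 \<Rightarrow> real \<Rightarrow> real" where "Sq x t = (\<Sum>j\<in>UNIV. \<Sum>l\<in>UNIV. \<Sum>k\<in>UNIV. eps3 j l k * cs l j k x t)"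

definition trb :: "real^4 \<Rightarrow> real \<Rightarrow> real" where "trb x t = (\<Sum>i\<in>UNIV. bm i i x t)"

lemma uO_Aq: "uO 2 (\<lambda>x t. Aq k x t - (\<Sum>j\<in>UNIV. Em j k j x t - Em k j j x t))"
proof (rule uO_cong)
  show "uO 2 (\<lambda>x t. \<Sum>j\<in>UNIV. cs j j k x t - (2 * \<tau> * eps3 j k j + L1 j j k x t))"
    by (intro uO_sum uO_cs) auto
  fix x t
  have "(\<Sum>j\<in>UNIV. 2 * \<tau> * eps3 j k j + L1 j j k x t) = (\<Sum>j\<in>UNIV. Em j k j x t - Em k j j x t)"
    unfolding L1_def N1_def sum_3 using exhaust_3[of k] by (auto simp: eps3_def algebra_simps)
  then show "(\<Sum>j\<in>UNIV. cs j j k x t - (2 * \<tau> * eps3 j k j + L1 j j k x t)) = Aq k x t - (\<Sum>j\<in>UNIV. Em j k j x t - Em k j j x t)"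
    unfolding sum_subtractf Aq_def by simp
qed

text \<open>The constant is 2 \<tau> times the contraction of \<open>eps3\<close> with its
  transpose, which is -6. In the linear part each bracket factor contributes -4 \<tau> times the
  trace and the correction of the dual frame contributes +4 \<tau>. Divided by 8, these become the
  eigenvalue shift 3 \<tau> / 2 and the term \<tau> / 2 times the trace in the first
  variation.\<close>

lemma uO_Sq: "uO 2 (\<lambda>x t. Sq x t - (- 12 * \<tau> - 4 * \<tau> * trb x t + (\<Sum>j\<in>UNIV. \<Sum>l\<in>UNIV. \<Sum>k\<in>UNIV. eps3 j l k * (Em j k l x t - Em k j l x t))))"
proof (rule uO_cong)
  show "uO 2 (\<lambda>x t. \<Sum>j\<in>UNIV. \<Sum>l\<in>UNIV. \<Sum>k\<in>UNIV. eps3 j l k * (cs l j k x t - (2 * \<tau> * eps3 j k l + L1 l j k x t)))"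
    by (intro uO_sum uO_cmult uO_cs) auto
  fix x t
  show "(\<Sum>j\<in>UNIV. \<Sum>l\<in>UNIV. \<Sum>k\<in>UNIV. eps3 j l k * (cs l j k x t - (2 * \<tau> * eps3 j k l + L1 l j k x t)))
     = Sq x t - (- 12 * \<tau> - 4 * \<tau> * trb x t + (\<Sum>j\<in>UNIV. \<Sum>l\<in>UNIV. \<Sum>k\<in>UNIV. eps3 j l k * (Em j k l x t - Em k j l x t)))"
    unfolding Sq_def trb_def L1_def N1_def sum_3 by (simp add: eps3_def algebra_simps)
qed

lemma uO_trb: "uO 1 trb" unfolding trb_def[abs_def] by (intro uO_sum uO_bm) auto

lemma uO_1_Aq: "uO 1 (Aq k)"
proof (rule uO_cong)
  show "uO 1 (\<lambda>x t. (Aq k x t - (\<Sum>j\<in>UNIV. Em j k j x t - Em k j j x t)) + (\<Sum>j\<in>UNIV. Em j k j x t - Em k j j x t))"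
    by (intro uO_add uO_2_1 uO_Aq uO_sum uO_diff uO_Em finite)
qed simp

lemma uO_1_Sq: "uO 1 (\<lambda>x t. Sq x t + 12 * \<tau>)"
proof (rule uO_cong)
  let ?S = "\<lambda>x t. (\<Sum>j\<in>UNIV. \<Sum>l\<in>UNIV. \<Sum>k\<in>UNIV. eps3 j l k * (Em j k l x t - Em k j l x t))"
  show "uO 1 (\<lambda>x t. (Sq x t - (- 12 * \<tau> - 4 * \<tau> * trb x t + ?S x t)) + (?S x t - 4 * \<tau> * trb x t))"
    by (intro uO_add uO_diff uO_cmult uO_trb uO_2_1[OF uO_Sq] uO_sum uO_Em) auto
qed simp

text \<open>Everything in \<open>Wt\<close> beyond the round operator, without approximation. Adding
  12 \<tau> removes the round value of \<open>Sq\<close>, so each coefficient is of first order in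
  \<open>t\<close>.\<close>

definition Rem :: "(real^4 \<Rightarrow> complex^2) \<Rightarrow> real^4 \<Rightarrow> real \<Rightarrow> complex^2"
  where "Rem \<eta> x t = \<i> *s (\<Sum>m\<in>UNIV. \<Sum>j\<in>UNIV. bm j m x t *\<^sub>R (Ed \<tau> m \<eta> x v* pauli j) + Em m j m x t *\<^sub>R (\<eta> x v* pauli j))
     + (\<Sum>k\<in>UNIV. Aq k x t *\<^sub>R (\<eta> x v* cmul (- \<i> / 2) (pauli k))) + (1/8 * (Sq x t + 12 * \<tau>)) *\<^sub>R \<eta> x"

lemma Wt_expand:
  assumes \<eta>: "Cinf_on \<eta> (- {0})" and p: "(x, t) \<in> Dom"
  shows "Wt \<tau> (\<lambda>x. BB (x, t)) (\<lambda>x. GG (x, t)) lam \<eta> x = Dop \<tau> \<eta> x - (lam + 3 * \<tau> / 2) *\<^sub>R \<eta> x + Rem \<eta> x t"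
proof -
  have t: "\<bar>t\<bar> < \<epsilon>0" and x: "x \<in> - {0}" using p by auto
  note sB = Cinf_slice[OF Cinf_BB t]
  have dB: "(\<lambda>x. BB (x, t) $ i $ j) differentiable at x" for i j by (rule Cinf_on_differentiable[OF sB x])
  have o: "open (- {0::real^4})" by (simp add: open_Compl)
  have dS: "Sm (\<lambda>x. BB (x, t)) m differentiable at x" for m
    by (rule Cinf_on_differentiable[OF Cinf_Sm[OF sB o] x])
  have blp: "bounded_linear (\<lambda>r. r *\<^sub>R pauli j)" for j by (rule bounded_linear_scaleR_left)
  have ES: "Ed \<tau> m (Sm (\<lambda>x. BB (x, t)) m) x = (\<Sum>j\<in>UNIV. Em m j m x t *\<^sub>R pauli j)" for m
  proof -
    have "Ed \<tau> m (Sm (\<lambda>x. BB (x, t)) m) x = (\<Sum>j\<in>UNIV. Ed \<tau> m (\<lambda>x. BB (x, t) $ j $ m *\<^sub>R pauli j) x)"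
      unfolding Sm_def[abs_def] by (rule Ed_sum) (auto intro: differentiable_linear_compose[OF blp] dB)
    then show ?thesis unfolding Em_def by (simp add: Ed_linear[OF blp dB])
  qed
  have E: "Ed \<tau> m (\<lambda>x. \<eta> x v* Sm (\<lambda>x. BB (x, t)) m x) x
     = Ed \<tau> m \<eta> x v* pauli m + (\<Sum>j\<in>UNIV. bm j m x t *\<^sub>R (Ed \<tau> m \<eta> x v* pauli j) + Em m j m x t *\<^sub>R (\<eta> x v* pauli j))" for m
  proof -
    have "Ed \<tau> m (\<lambda>x. \<eta> x v* Sm (\<lambda>x. BB (x, t)) m x) x
       = \<eta> x v* (\<Sum>j\<in>UNIV. Em m j m x t *\<^sub>R pauli j) + Ed \<tau> m \<eta> x v* (\<Sum>j\<in>UNIV. ((mat 1 :: real^3^3) $ j $ m + bm j m x t) *\<^sub>R pauli j)"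
      unfolding ES[symmetric] BB_eq[symmetric] using Ed_bilinear[OF bb_vm Cinf_on_differentiable[OF \<eta> x] dS] by (simp add: Sm_def)
    then show ?thesis unfolding sum_mat_1_scaleR by (simp add: vm.add_right vm.sum_right vm.scaleR_right sum.distrib)
  qed
  have Q: "\<eta> x v* Qc (cst \<tau> (\<lambda>x. BB (x, t)) (\<lambda>x. GG (x, t)) x) = (\<Sum>k\<in>UNIV. Aq k x t *\<^sub>R (\<eta> x v* cmul (- \<i> / 2) (pauli k))) + (1/8 * Sq x t) *\<^sub>R \<eta> x"
    unfolding row_Qc cs_def[symmetric] Aq_def Sq_def ..
  show ?thesis
    unfolding Wt_def E Q Dop_def Rem_def sum.distrib[of "\<lambda>m. Ed \<tau> m \<eta> x v* pauli m"] vector_add_ldistrib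
    by (simp add: algebra_simps scaleR_add_left)
qed

lemma uO_abs: "uO k f \<Longrightarrow> uO k (\<lambda>x t. \<bar>f x t\<bar>)" unfolding uO_def by simp

lemma norm_i_smult: "norm (\<i> *s (v :: complex^2)) = norm v"
  by (simp add: norm_vec_def norm_mult)

lemma Rem_bound: "\<exists>C\<ge>0. \<forall>\<eta>. \<forall>x\<in>S3. \<forall>t. \<bar>t\<bar> \<le> \<epsilon>0 / 2 \<longrightarrow> norm (Rem \<eta> x t) \<le> C * \<bar>t\<bar> * (norm (\<eta> x) + (\<Sum>m\<in>UNIV. norm (Ed \<tau> m \<eta> x)))"
proof -
  obtain K where K: "K > 0" "\<And>(\<theta>::complex^2) (A::complex^2^2). norm (\<theta> v* A) \<le> norm \<theta> * norm A * K" using vm.pos_bounded by blast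
  define L where "L = K * (\<Sum>j\<in>UNIV. norm (pauli j) + norm (cmul (- \<i> / 2) (pauli j))) + 1"
  have L: "norm (\<theta> v* pauli j) \<le> L * norm \<theta>" "norm (\<theta> v* cmul (- \<i> / 2) (pauli j)) \<le> L * norm \<theta>" for \<theta> :: "complex^2" and j
  proof -
    have m: "norm (pauli j) + norm (cmul (- \<i> / 2) (pauli j)) \<le> (\<Sum>j\<in>UNIV. norm (pauli j) + norm (cmul (- \<i> / 2) (pauli j)))"
      by (rule member_le_sum) auto
    have "K * norm (pauli j) \<le> L" "K * norm (cmul (- \<i> / 2) (pauli j)) \<le> L"
      unfolding L_def using m K(1) by (smt (verit) mult_left_mono norm_ge_zero)+
    then have "K * norm (pauli j) * norm \<theta> \<le> L * norm \<theta>" "K * norm (cmul (- \<i> / 2) (pauli j)) * norm \<theta> \<le> L * norm \<theta>"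
      by (intro mult_right_mono; simp)+
    then show "norm (\<theta> v* pauli j) \<le> L * norm \<theta>" "norm (\<theta> v* cmul (- \<i> / 2) (pauli j)) \<le> L * norm \<theta>"
      using K(2)[of \<theta> "pauli j"] K(2)[of \<theta> "cmul (- \<i> / 2) (pauli j)"] by (simp_all add: mult_ac)
  qed
  have L1: "L \<ge> 1" unfolding L_def using K(1) by (simp add: sum_nonneg)
  define \<Phi> where "\<Phi> x t = (\<Sum>m\<in>UNIV. \<Sum>j\<in>UNIV. \<bar>bm j m x t\<bar> + \<bar>Em m j m x t\<bar>) + (\<Sum>k\<in>UNIV. \<bar>Aq k x t\<bar>) + \<bar>Sq x t + 12 * \<tau>\<bar>" for x t
  have "uO 1 \<Phi>" unfolding \<Phi>_def by (intro uO_add uO_sum uO_abs uO_bm uO_Em uO_1_Aq uO_1_Sq) auto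
  then obtain C where C: "\<And>x t. x \<in> S3 \<Longrightarrow> \<bar>t\<bar> \<le> \<epsilon>0 / 2 \<Longrightarrow> \<bar>\<Phi> x t\<bar> \<le> C * \<bar>t\<bar>" unfolding uO_def by auto
  have "norm (Rem \<eta> x t) \<le> (\<bar>C\<bar> * L) * \<bar>t\<bar> * (norm (\<eta> x) + (\<Sum>m\<in>UNIV. norm (Ed \<tau> m \<eta> x)))" if a: "x \<in> S3" "\<bar>t\<bar> \<le> \<epsilon>0 / 2" for \<eta> x t
  proof -
    define N where "N = norm (\<eta> x) + (\<Sum>m\<in>UNIV. norm (Ed \<tau> m \<eta> x))"
    have N0: "norm (\<eta> x) \<le> N" unfolding N_def by (simp add: sum_nonneg)
    have Nm: "norm (Ed \<tau> m \<eta> x) \<le> N" for m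
      unfolding N_def using member_le_sum[of m UNIV "\<lambda>m. norm (Ed \<tau> m \<eta> x)"] by (simp add: add_increasing)
    have Np: "N \<ge> 0" using N0 norm_ge_zero order_trans by blast
    have s: "norm (r *\<^sub>R (\<theta> v* pauli j)) \<le> \<bar>r\<bar> * (L * N)" "norm (r *\<^sub>R (\<theta> v* cmul (- \<i> / 2) (pauli j))) \<le> \<bar>r\<bar> * (L * N)"
      if "norm \<theta> \<le> N" for r j and \<theta> :: "complex^2"
    proof -
      have "L * norm \<theta> \<le> L * N" using that L1 by (intro mult_left_mono) auto
      then show "norm (r *\<^sub>R (\<theta> v* pauli j)) \<le> \<bar>r\<bar> * (L * N)" "norm (r *\<^sub>R (\<theta> v* cmul (- \<i> / 2) (pauli j))) \<le> \<bar>r\<bar> * (L * N)"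
        using L[of \<theta> j] by (simp_all add: mult_left_mono)
    qed
    have "norm (Rem \<eta> x t) \<le> (\<Sum>m\<in>UNIV. \<Sum>j\<in>UNIV. (\<bar>bm j m x t\<bar> + \<bar>Em m j m x t\<bar>) * (L * N)) + (\<Sum>k\<in>UNIV. \<bar>Aq k x t\<bar> * (L * N)) + \<bar>Sq x t + 12 * \<tau>\<bar> * (L * N)"
      unfolding Rem_def
    proof (intro order_trans[OF norm_triangle_ineq] add_mono)
      show "norm (\<i> *s (\<Sum>m\<in>UNIV. \<Sum>j\<in>UNIV. bm j m x t *\<^sub>R (Ed \<tau> m \<eta> x v* pauli j) + Em m j m x t *\<^sub>R (\<eta> x v* pauli j)))
         \<le> (\<Sum>m\<in>UNIV. \<Sum>j\<in>UNIV. (\<bar>bm j m x t\<bar> + \<bar>Em m j m x t\<bar>) * (L * N))"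
        unfolding norm_i_smult distrib_right
        by (intro sum_norm_le order_trans[OF norm_triangle_ineq] add_mono s Nm N0)
      show "norm (\<Sum>k\<in>UNIV. Aq k x t *\<^sub>R (\<eta> x v* cmul (- \<i> / 2) (pauli k))) \<le> (\<Sum>k\<in>UNIV. \<bar>Aq k x t\<bar> * (L * N))"
        by (intro sum_norm_le s N0)
      have "norm (\<eta> x) \<le> L * N" using N0 L1 Np by (smt (verit) mult_le_cancel_right1)
      then have "\<bar>Sq x t + 12 * \<tau>\<bar> * norm (\<eta> x) \<le> \<bar>Sq x t + 12 * \<tau>\<bar> * (L * N)" by (intro mult_left_mono) auto
      moreover have "norm ((1/8 * (Sq x t + 12 * \<tau>)) *\<^sub>R \<eta> x) \<le> \<bar>Sq x t + 12 * \<tau>\<bar> * norm (\<eta> x)"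
        by (simp add: abs_mult mult_right_mono)
      ultimately show "norm ((1/8 * (Sq x t + 12 * \<tau>)) *\<^sub>R \<eta> x) \<le> \<bar>Sq x t + 12 * \<tau>\<bar> * (L * N)" by linarith
    qed
    also have "\<dots> = \<Phi> x t * (L * N)" unfolding \<Phi>_def by (simp add: sum_distrib_right distrib_right)
    also have "\<dots> \<le> (\<bar>C\<bar> * \<bar>t\<bar>) * (L * N)"
    proof (rule mult_right_mono)
      have "\<Phi> x t \<le> C * \<bar>t\<bar>" using C[OF a] by linarith
      also have "\<dots> \<le> \<bar>C\<bar> * \<bar>t\<bar>" by (intro mult_right_mono) auto
      finally show "\<Phi> x t \<le> \<bar>C\<bar> * \<bar>t\<bar>" .
      show "0 \<le> L * N" using L1 Np by simp
    qed
    finally show ?thesis unfolding N_def by (simp add: mult_ac)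
  qed
  then show ?thesis using L1 by (intro exI[of _ "\<bar>C\<bar> * L"]) auto
qed

end

section \<open>The eigenvalue to first order\<close>

lemma discriminant_le:
  fixes a b c :: real
  assumes "\<And>z. a * z\<^sup>2 + 2 * b * z + c \<ge> 0" "a \<ge> 0" shows "b\<^sup>2 \<le> a * c"
proof (cases "a = 0")
  case True
  have "b = 0"
  proof (rule ccontr)
    assume b: "b \<noteq> 0"
    have "2 * b * (- (c + 1) / (2 * b)) = - (c + 1)" using b by simp
    then show False using assms(1)[of "- (c + 1) / (2 * b)"] True by simp
  qed
  then show ?thesis using True by simp
next
  case False
  then have a: "a > 0" using assms(2) by simp
  have "0 \<le> a * (a * (- b / a)\<^sup>2 + 2 * b * (- b / a) + c)" using a assms(1)[of "- b / a"] by simp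
  also have "\<dots> = a * c - b\<^sup>2" using a by (simp add: field_simps power2_eq_square)
  finally show ?thesis by simp
qed

lemma Cauchy_Schwarz_Mst:
  fixes u v :: "real^3 \<Rightarrow> real"
  assumes m: "u \<in> borel_measurable lebesgue" "v \<in> borel_measurable lebesgue"
    and i: "integrable Mst (\<lambda>y. (u y)\<^sup>2)" "integrable Mst (\<lambda>y. (v y)\<^sup>2)"
  shows "integrable Mst (\<lambda>y. u y * v y)"
    and "(LINT y|Mst. u y * v y) \<le> sqrt (LINT y|Mst. (u y)\<^sup>2) * sqrt (LINT y|Mst. (v y)\<^sup>2)"
proof -
  show uv: "integrable Mst (\<lambda>y. u y * v y)"
  proof (rule Bochner_Integration.integrable_bound)
    show "integrable Mst (\<lambda>y. (u y)\<^sup>2 + (v y)\<^sup>2)" using i by simp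
    show "(\<lambda>y. u y * v y) \<in> borel_measurable Mst" using m by simp
    show "AE y in Mst. norm (u y * v y) \<le> norm ((u y)\<^sup>2 + (v y)\<^sup>2)"
    proof (rule AE_I2)
      fix y
      have "2 * (\<bar>u y\<bar> * \<bar>v y\<bar>) \<le> (u y)\<^sup>2 + (v y)\<^sup>2" using sum_squares_bound[of "\<bar>u y\<bar>" "\<bar>v y\<bar>"] by simp
      moreover have "0 \<le> \<bar>u y\<bar> * \<bar>v y\<bar>" by simp
      ultimately have "\<bar>u y\<bar> * \<bar>v y\<bar> \<le> (u y)\<^sup>2 + (v y)\<^sup>2" by linarith
      then show "norm (u y * v y) \<le> norm ((u y)\<^sup>2 + (v y)\<^sup>2)" by (simp add: abs_mult)
    qed
  qed
  have "(LINT y|Mst. u y * v y)\<^sup>2 \<le> (LINT y|Mst. (u y)\<^sup>2) * (LINT y|Mst. (v y)\<^sup>2)"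
  proof (rule discriminant_le)
    fix z
    have "0 \<le> (LINT y|Mst. (z * u y + v y)\<^sup>2)" by (rule Bochner_Integration.integral_nonneg) simp
    also have "\<dots> = (LINT y|Mst. z\<^sup>2 * (u y)\<^sup>2 + ((2 * z) * (u y * v y) + (v y)\<^sup>2))"
      by (simp add: power2_eq_square algebra_simps)
    also have "\<dots> = (LINT y|Mst. (u y)\<^sup>2) * z\<^sup>2 + 2 * (LINT y|Mst. u y * v y) * z + (LINT y|Mst. (v y)\<^sup>2)"
      using i uv by simp
    finally show "0 \<le> (LINT y|Mst. (u y)\<^sup>2) * z\<^sup>2 + 2 * (LINT y|Mst. u y * v y) * z + (LINT y|Mst. (v y)\<^sup>2)" .
  qed (simp add: Bochner_Integration.integral_nonneg)
  then have "sqrt ((LINT y|Mst. u y * v y)\<^sup>2) \<le> sqrt ((LINT y|Mst. (u y)\<^sup>2) * (LINT y|Mst. (v y)\<^sup>2))" by (rule real_sqrt_le_mono)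
  then show "(LINT y|Mst. u y * v y) \<le> sqrt (LINT y|Mst. (u y)\<^sup>2) * sqrt (LINT y|Mst. (v y)\<^sup>2)"
    by (simp add: real_sqrt_mult)
qed

text \<open>\<open>(D - 2 \<tau>) (\<psi> \<theta>)\<close> for the Dirac-type operator \<open>D = Dop \<tau>\<close>; note that \<open>D (D - 2 \<tau>) = - Lap\<close>.\<close>

definition pe :: "real \<Rightarrow> complex^2 \<Rightarrow> (real^4 \<Rightarrow> real) \<Rightarrow> real^4 \<Rightarrow> complex^2"
  where "pe \<tau> \<theta> \<psi> x = (\<Sum>m\<in>UNIV. Ed \<tau> m \<psi> x *\<^sub>R (\<i> *s (\<theta> v* pauli m))) - \<psi> x *\<^sub>R ((2 * \<tau>) *\<^sub>R \<theta>)"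

lemma Ed_pe:
  assumes \<psi>: "real_polynomial_function \<psi>"
  shows "Ed \<tau> n (pe \<tau> \<theta> \<psi>) x = (\<Sum>m\<in>UNIV. Ed \<tau> n (Ed \<tau> m \<psi>) x *\<^sub>R (\<i> *s (\<theta> v* pauli m))) - Ed \<tau> n \<psi> x *\<^sub>R ((2 * \<tau>) *\<^sub>R \<theta>)"
proof -
  have d: "\<psi> differentiable at x" "Ed \<tau> m \<psi> differentiable at x" for m
    by (intro poly_differentiable poly_Ed \<psi>)+
  have l: "bounded_linear (\<lambda>r. r *\<^sub>R (v :: complex^2))" for v by (rule bounded_linear_scaleR_left)
  have dd: "(\<lambda>x. Ed \<tau> m \<psi> x *\<^sub>R (\<i> *s (\<theta> v* pauli m))) differentiable at x" "(\<lambda>x. \<psi> x *\<^sub>R ((2 * \<tau>) *\<^sub>R \<theta>)) differentiable at x" for m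
    by (rule differentiable_linear_compose[OF l d(2)], rule differentiable_linear_compose[OF l d(1)])
  have "Ed \<tau> n (pe \<tau> \<theta> \<psi>) x = Ed \<tau> n (\<lambda>x. \<Sum>m\<in>UNIV. Ed \<tau> m \<psi> x *\<^sub>R (\<i> *s (\<theta> v* pauli m))) x - Ed \<tau> n (\<lambda>x. \<psi> x *\<^sub>R ((2 * \<tau>) *\<^sub>R \<theta>)) x"
    unfolding pe_def[abs_def] by (rule Ed_diff[OF differentiable_sum dd(2)]) (auto intro: dd)
  also have "Ed \<tau> n (\<lambda>x. \<Sum>m\<in>UNIV. Ed \<tau> m \<psi> x *\<^sub>R (\<i> *s (\<theta> v* pauli m))) x = (\<Sum>m\<in>UNIV. Ed \<tau> n (\<lambda>x. Ed \<tau> m \<psi> x *\<^sub>R (\<i> *s (\<theta> v* pauli m))) x)"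
    by (rule Ed_sum) (auto intro: dd)
  finally show ?thesis unfolding Ed_linear[OF l d(1)] Ed_linear[OF l d(2)] .
qed

lemma Cinf_pe: "real_polynomial_function \<psi> \<Longrightarrow> Cinf_on (pe \<tau> \<theta> \<psi>) (- {0})"
proof -
  assume \<psi>: "real_polynomial_function \<psi>"
  have c: "Cinf_on p (- {0})" if "real_polynomial_function p" for p :: "real^4 \<Rightarrow> real"
    by (rule Cinf_on_subset[OF Cinf_poly[OF that]]) simp
  show ?thesis unfolding pe_def[abs_def]
    by (intro Cinf_on_diff Cinf_on_sum Cinf_on_scaleR Cinf_on_const c poly_Ed \<psi>) (auto simp: open_Compl)
qed

text \<open>Products of Pauli matrices split the second derivatives into a symmetric part, the
  Laplacian, and an antisymmetric part, which by the commutators is 2 \<tau> times a first-order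
  operator. The term - 2 \<tau> \<psi> \<theta> in \<open>pe\<close> cancels the latter.\<close>

lemma Dop_pe:
  assumes \<tau>: "\<tau> = 1 \<or> \<tau> = -1" and \<psi>: "real_polynomial_function \<psi>"
  shows "Dop \<tau> (pe \<tau> \<theta> \<psi>) x = (- Lap \<tau> \<psi> x) *\<^sub>R \<theta>"
proof -
  define E where "E n m = Ed \<tau> n (Ed \<tau> m \<psi>) x" for n m
  define e where "e n = Ed \<tau> n \<psi> x" for n
  have c: "E 1 2 = E 2 1 + 2 * \<tau> * e 3" "E 2 3 = E 3 2 + 2 * \<tau> * e 1" "E 3 1 = E 1 3 + 2 * \<tau> * e 2"
    using poly_Ed_commutator[OF \<tau> \<psi>, of 1 2 x] poly_Ed_commutator[OF \<tau> \<psi>, of 2 3 x] poly_Ed_commutator[OF \<tau> \<psi>, of 3 1 x]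
    by (simp_all add: E_def e_def sum_3 eps3_def)
  have "Dop \<tau> (pe \<tau> \<theta> \<psi>) x = \<i> *s (\<Sum>n\<in>UNIV. ((\<Sum>m\<in>UNIV. E n m *\<^sub>R (\<i> *s (\<theta> v* pauli m))) - e n *\<^sub>R ((2 * \<tau>) *\<^sub>R \<theta>)) v* pauli n)"
    unfolding Dop_def Ed_pe[OF \<psi>] E_def e_def ..
  also have "\<dots> = (- (E 1 1 + E 2 2 + E 3 3)) *\<^sub>R \<theta>"
    unfolding sum_3
    by (intro vec2_eqI; simp add: vm2_nth pauli_nth c complex_eq_iff algebra_simps)
  finally show ?thesis by (simp add: Lap_def E_def sum_3)
qed

definition zi :: "(real^4 \<Rightarrow> 'b::{banach, second_countable_topology}) \<Rightarrow> bool"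
  where "zi f \<longleftrightarrow> integrable Mst (\<lambda>y. f (stereo y)) \<and> (LINT y|Mst. f (stereo y)) = 0"

lemma zi_add: "zi f \<Longrightarrow> zi h \<Longrightarrow> zi (\<lambda>x. f x + h x)" by (simp add: zi_def)

lemma zi_diff: "zi f \<Longrightarrow> zi h \<Longrightarrow> zi (\<lambda>x. f x - h x)" by (simp add: zi_def)

lemma zi_sum: "(\<And>i. i \<in> I \<Longrightarrow> zi (f i)) \<Longrightarrow> zi (\<lambda>x. \<Sum>i\<in>I. f i x)" by (simp add: zi_def)

lemma zi_linear: "bounded_linear T \<Longrightarrow> zi f \<Longrightarrow> zi (\<lambda>x. T (f x))"
  unfolding zi_def using integrable_bounded_linear[of T] integral_bounded_linear[of T] linear_0[OF bounded_linear.linear] by metis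

lemma pair_integrable:
  assumes mu: "u \<in> borel_measurable lebesgue" and iu: "integrable Mst (\<lambda>y. (norm (u y))\<^sup>2)" and F: "continuous_on S3 F"
  shows "integrable Mst (\<lambda>y. pair (F (stereo y)) (u y))"
proof -
  obtain Cp where Cp: "Cp > 0" "\<And>a b. norm (pair a b) \<le> norm a * norm b * Cp" using pair.pos_bounded by blast
  obtain C where C: "C \<ge> 0" "\<And>y. norm (F (stereo y)) \<le> C" using stereo_bounded[OF F] by blast
  have "integrable Mst (\<lambda>y. norm (u y))" by (rule square_integrable_imp_integrable) (use mu iu in auto)
  then have "integrable Mst (\<lambda>y. C * Cp * norm (u y))" by simp
  then show ?thesis
  proof (rule Bochner_Integration.integrable_bound)
    show "(\<lambda>y. pair (F (stereo y)) (u y)) \<in> borel_measurable Mst"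
      using borel_measurable_bilinear[OF bounded_bilinear_pair stereo_measurable_comp[OF F] mu] by simp
    show "AE y in Mst. norm (pair (F (stereo y)) (u y)) \<le> norm (C * Cp * norm (u y))"
    proof (rule AE_I2)
      fix y
      have "norm (pair (F (stereo y)) (u y)) \<le> norm (F (stereo y)) * norm (u y) * Cp" by (rule Cp(2))
      also have "\<dots> \<le> C * norm (u y) * Cp" using C Cp(1) by (intro mult_right_mono) auto
      finally show "norm (pair (F (stereo y)) (u y)) \<le> norm (C * Cp * norm (u y))" using C(1) Cp(1) by (simp add: abs_mult mult_ac)
    qed
  qed
qed

lemma norm_integral_le:
  fixes f :: "'a \<Rightarrow> 'b::{banach, second_countable_topology}"
  assumes "integrable M f" "integrable M h" "\<And>y. norm (f y) \<le> h y"
  shows "norm (LINT y|M. f y) \<le> (LINT y|M. h y)"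
  using integral_norm_bound[of M f] Bochner_Integration.integral_mono[OF integrable_norm[OF assms(1)] assms(2)] assms(3)
  by (meson order_trans)

lemma weighted_norm_bound:
  assumes mu: "u \<in> borel_measurable lebesgue" and iu: "integrable Mst (\<lambda>y. (norm (u y :: complex^2))\<^sup>2)" 
    and q: "real_polynomial_function q" and le: "pint (\<lambda>x. (q x)\<^sup>2) \<le> P"
  shows "integrable Mst (\<lambda>y. \<bar>q (stereo y)\<bar> * norm (u y))"
    "(LINT y|Mst. \<bar>q (stereo y)\<bar> * norm (u y)) \<le> sqrt P * sqrt (LINT y|Mst. (norm (u y))\<^sup>2)"
proof -
  have m: "(\<lambda>y. \<bar>q (stereo y)\<bar>) \<in> borel_measurable lebesgue"
    by (intro borel_measurable_abs stereo_measurable_comp poly_continuous q)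
  have i: "integrable Mst (\<lambda>y. \<bar>q (stereo y)\<bar>\<^sup>2)" using poly_integrable[OF poly_square[OF q]] by simp
  have mu': "(\<lambda>y. norm (u y)) \<in> borel_measurable lebesgue" using mu by simp
  show "integrable Mst (\<lambda>y. \<bar>q (stereo y)\<bar> * norm (u y))" by (rule Cauchy_Schwarz_Mst(1)[OF m mu' i iu])
  have "(LINT y|Mst. \<bar>q (stereo y)\<bar> * norm (u y)) \<le> sqrt (LINT y|Mst. \<bar>q (stereo y)\<bar>\<^sup>2) * sqrt (LINT y|Mst. (norm (u y))\<^sup>2)"
    by (rule Cauchy_Schwarz_Mst(2)[OF m mu' i iu])
  also have "\<dots> \<le> sqrt P * sqrt (LINT y|Mst. (norm (u y))\<^sup>2)"
    using le by (intro mult_right_mono real_sqrt_le_mono) (simp_all add: pint_def Bochner_Integration.integral_nonneg)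
  finally show "(LINT y|Mst. \<bar>q (stereo y)\<bar> * norm (u y)) \<le> sqrt P * sqrt (LINT y|Mst. (norm (u y))\<^sup>2)" .
qed

context metric_perturbation begin

definition weak_solution :: "real \<Rightarrow> real \<Rightarrow> (real^3 \<Rightarrow> complex^2) \<Rightarrow> bool"
  where "weak_solution t lam u \<longleftrightarrow> u \<in> borel_measurable lebesgue \<and> integrable Mst (\<lambda>y. (norm (u y))\<^sup>2) \<and>
    (\<forall>\<eta>. Cinf_on \<eta> (- {0}) \<longrightarrow> (LINT y|Mst. pair (Wt \<tau> (\<lambda>x. BB (x, t)) (\<lambda>x. GG (x, t)) lam \<eta> (stereo y)) (u y)) = 0)"

definition L2n :: "(real^3 \<Rightarrow> complex^2) \<Rightarrow> real" where "L2n u = sqrt (LINT y|Mst. (norm (u y))\<^sup>2)"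

lemma L2n_nonneg: "L2n u \<ge> 0" unfolding L2n_def by (simp add: Bochner_Integration.integral_nonneg)

lemma L2n_sq: "(L2n u)\<^sup>2 = (LINT y|Mst. (norm (u y))\<^sup>2)" unfolding L2n_def by (simp add: Bochner_Integration.integral_nonneg)

lemma continuous_Wt: "\<bar>t\<bar> < \<epsilon>0 \<Longrightarrow> Cinf_on \<eta> (- {0}) \<Longrightarrow> continuous_on S3 (Wt \<tau> (\<lambda>x. BB (x, t)) (\<lambda>x. GG (x, t)) lam \<eta>)"
  by (rule continuous_on_subset[OF Cinf_on_continuous[OF Cinf_Wt] S3_nonzero])
    (auto intro: Cinf_slice[OF Cinf_BB] Cinf_slice[OF Cinf_GG] simp: open_Compl)

text \<open>Testing with \<open>(D - 2 \<tau>) (\<psi> \<theta>)\<close>, where \<open>- Lap \<psi> = f\<close>, shows that \<open>u\<close> is nearly orthogonal to all functions of mean zero.\<close>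

lemma weak_solution_mean_zero_bound:
  assumes Cl: "Cl \<ge> 0"
  shows "\<exists>C\<ge>0. \<forall>t lam u f k. \<bar>t\<bar> \<le> \<epsilon>0 / 2 \<and> \<bar>lam + 3 * \<tau> / 2\<bar> \<le> Cl * \<bar>t\<bar> \<and> weak_solution t lam u \<and> ridge f \<and> pint f = 0 \<longrightarrow>
     norm (LINT y|Mst. f (stereo y) *\<^sub>R (u y $ k)) \<le> C * \<bar>t\<bar> * sqrt (pint (\<lambda>x. (f x)\<^sup>2)) * L2n u"
proof -
  obtain CR where CR: "CR \<ge> 0" and Rb: "\<And>\<eta> x t. x \<in> S3 \<Longrightarrow> \<bar>t\<bar> \<le> \<epsilon>0 / 2 \<Longrightarrow> norm (Rem \<eta> x t) \<le> CR * \<bar>t\<bar> * (norm (\<eta> x) + (\<Sum>m\<in>UNIV. norm (Ed \<tau> m \<eta> x)))"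
    using Rem_bound by blast
  obtain Cp where Cp: "Cp > 0" "\<And>a b. norm (pair a b) \<le> norm a * norm b * Cp" using pair.pos_bounded by blast
  obtain K where K: "K > 0" "\<And>(\<theta>::complex^2) (A::complex^2^2). norm (\<theta> v* A) \<le> norm \<theta> * norm A * K" using vm.pos_bounded by blast
  define M where "M = (\<Sum>m\<in>UNIV. norm (pauli m)) * K + 2"
  have M2: "M \<ge> 2" unfolding M_def using K(1) by (simp add: sum_nonneg)
  have Mp: "norm (\<i> *s ((axis k 1 :: complex^2) v* pauli m)) \<le> M" for k m
  proof -
    have "norm ((axis k 1 :: complex^2) v* pauli m) \<le> norm (pauli m) * K" using K(2)[of "axis k 1" "pauli m"] by (simp add: norm_axis_1)
    also have "\<dots> \<le> (\<Sum>m\<in>UNIV. norm (pauli m)) * K" using K(1) by (intro mult_right_mono member_le_sum) auto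
    finally show ?thesis unfolding norm_i_smult M_def by simp
  qed
  define C3 where "C3 = (Cl + CR) * (2 * M)"
  have C3: "C3 \<ge> 0" unfolding C3_def using Cl CR M2 by simp
  have "norm (LINT y|Mst. f (stereo y) *\<^sub>R (u y $ k)) \<le> (Cp * C3 * 13) * \<bar>t\<bar> * sqrt (pint (\<lambda>x. (f x)\<^sup>2)) * L2n u"
    if t: "\<bar>t\<bar> \<le> \<epsilon>0 / 2" and lam: "\<bar>lam + 3 * \<tau> / 2\<bar> \<le> Cl * \<bar>t\<bar>" and u: "weak_solution t lam u" and f: "ridge f" "pint f = 0" for t lam u f k
  proof -
    have t': "\<bar>t\<bar> < \<epsilon>0" using t eps0 by linarith
    have mu: "u \<in> borel_measurable lebesgue" and iu: "integrable Mst (\<lambda>y. (norm (u y))\<^sup>2)" using u by (auto simp: weak_solution_def)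
    obtain \<psi> where \<psi>: "real_polynomial_function \<psi>" and fL: "\<And>x. norm x = 1 \<Longrightarrow> f x = - Lap \<tau> \<psi> x"
      and b: "pint (\<lambda>x. (\<psi> x)\<^sup>2) \<le> pint (\<lambda>x. (f x)\<^sup>2)"
        "\<And>i. pint (\<lambda>x. (Ed \<tau> i \<psi> x)\<^sup>2) \<le> pint (\<lambda>x. (f x)\<^sup>2)"
        "\<And>i j. pint (\<lambda>x. (Ed \<tau> i (Ed \<tau> j \<psi>) x)\<^sup>2) \<le> pint (\<lambda>x. (f x)\<^sup>2)"
      using ridge_poisson_estimate[OF \<tau> f] by blast
    let ?P = "pint (\<lambda>x. (f x)\<^sup>2)"
    define \<theta> where "\<theta> = (axis k 1 :: complex^2)"
    define \<eta> where "\<eta> = pe \<tau> \<theta> \<psi>"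
    define W where "W = Wt \<tau> (\<lambda>x. BB (x, t)) (\<lambda>x. GG (x, t)) lam \<eta>"
    have n\<theta>: "norm \<theta> = 1" by (simp add: \<theta>_def norm_axis_1)
    have p\<theta>: "pair \<theta> w = w $ k" for w unfolding \<theta>_def pair_def using exhaust_2[of k] by (auto simp: sum_2 axis_def)
    have s\<eta>: "Cinf_on \<eta> (- {0})" unfolding \<eta>_def by (rule Cinf_pe[OF \<psi>])
    \<comment> \<open>One value, three first and nine second derivatives of \<psi>. Each has square
      integral at most \<open>?P\<close>, hence the factor 13 below.\<close>
    define N where "N x = \<bar>\<psi> x\<bar> + (\<Sum>m\<in>UNIV. \<bar>Ed \<tau> m \<psi> x\<bar>) + (\<Sum>n\<in>UNIV. \<Sum>m\<in>UNIV. \<bar>Ed \<tau> n (Ed \<tau> m \<psi>) x\<bar>)" for x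
    have \<tau>2: "\<bar>2 * \<tau>\<bar> \<le> M" using \<tau> M2 by auto
    have comb: "norm ((\<Sum>m\<in>UNIV. a m *\<^sub>R (\<i> *s (\<theta> v* pauli m))) - r *\<^sub>R ((2 * \<tau>) *\<^sub>R \<theta>)) \<le> M * ((\<Sum>m\<in>UNIV. \<bar>a m\<bar>) + \<bar>r\<bar>)" for a :: "3 \<Rightarrow> real" and r
    proof -
      have "norm (\<Sum>m\<in>UNIV. a m *\<^sub>R (\<i> *s (\<theta> v* pauli m))) \<le> (\<Sum>m\<in>UNIV. \<bar>a m\<bar> * M)"
        by (rule sum_norm_le) (use Mp[of k] in \<open>simp add: \<theta>_def mult_left_mono\<close>)
      moreover have "norm (r *\<^sub>R ((2 * \<tau>) *\<^sub>R \<theta>)) \<le> \<bar>r\<bar> * M"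
        using \<tau>2 mult_left_mono[of "\<bar>2 * \<tau>\<bar>" M "\<bar>r\<bar>"] by (simp add: n\<theta> abs_mult)
      ultimately show ?thesis
        using norm_triangle_ineq4[of "\<Sum>m\<in>UNIV. a m *\<^sub>R (\<i> *s (\<theta> v* pauli m))" "r *\<^sub>R ((2 * \<tau>) *\<^sub>R \<theta>)"]
        by (simp add: distrib_left sum_distrib_left mult.commute)
    qed
    have \<eta>N: "norm (\<eta> x) + (\<Sum>n\<in>UNIV. norm (Ed \<tau> n \<eta> x)) \<le> 2 * M * N x" for x
    proof -
      have "norm (\<eta> x) \<le> M * ((\<Sum>m\<in>UNIV. \<bar>Ed \<tau> m \<psi> x\<bar>) + \<bar>\<psi> x\<bar>)" unfolding \<eta>_def pe_def by (rule comb)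
      moreover have "(\<Sum>n\<in>UNIV. norm (Ed \<tau> n \<eta> x)) \<le> (\<Sum>n\<in>UNIV. M * ((\<Sum>m\<in>UNIV. \<bar>Ed \<tau> n (Ed \<tau> m \<psi>) x\<bar>) + \<bar>Ed \<tau> n \<psi> x\<bar>))"
        unfolding \<eta>_def Ed_pe[OF \<psi>] by (intro sum_mono comb)
      moreover have "\<dots> = M * ((\<Sum>n\<in>UNIV. \<Sum>m\<in>UNIV. \<bar>Ed \<tau> n (Ed \<tau> m \<psi>) x\<bar>) + (\<Sum>n\<in>UNIV. \<bar>Ed \<tau> n \<psi> x\<bar>))"
        by (simp add: sum_distrib_left sum.distrib distrib_left)
      moreover have "0 \<le> M * \<bar>\<psi> x\<bar>" "0 \<le> M * (\<Sum>n\<in>UNIV. \<Sum>m\<in>UNIV. \<bar>Ed \<tau> n (Ed \<tau> m \<psi>) x\<bar>)" using M2 by (simp_all add: sum_nonneg)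
      ultimately show ?thesis unfolding N_def by (simp add: algebra_simps)
    qed
    have Nint: "integrable Mst (\<lambda>y. N (stereo y) * norm (u y))" "(LINT y|Mst. N (stereo y) * norm (u y)) \<le> 13 * (sqrt ?P * L2n u)"
    proof -
      note w1 = weighted_norm_bound[OF mu iu \<psi> b(1)] and w2 = weighted_norm_bound[OF mu iu poly_Ed[OF \<psi>] b(2)]
        and w3 = weighted_norm_bound[OF mu iu poly_Ed[OF poly_Ed[OF \<psi>]] b(3)]
      show "integrable Mst (\<lambda>y. N (stereo y) * norm (u y))"
        unfolding N_def distrib_right sum_distrib_right by (intro Bochner_Integration.integrable_add Bochner_Integration.integrable_sum w1 w2 w3)
      have "(LINT y|Mst. N (stereo y) * norm (u y)) = (LINT y|Mst. \<bar>\<psi> (stereo y)\<bar> * norm (u y)) + (\<Sum>m\<in>UNIV. LINT y|Mst. \<bar>Ed \<tau> m \<psi> (stereo y)\<bar> * norm (u y))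
         + (\<Sum>n\<in>UNIV. \<Sum>m\<in>UNIV. LINT y|Mst. \<bar>Ed \<tau> n (Ed \<tau> m \<psi>) (stereo y)\<bar> * norm (u y))"
        unfolding N_def distrib_right sum_distrib_right by (simp add: w1(1) w2(1) w3(1))
      also have "\<dots> \<le> sqrt ?P * L2n u + (\<Sum>m\<in>(UNIV::3 set). sqrt ?P * L2n u) + (\<Sum>n\<in>(UNIV::3 set). \<Sum>m\<in>(UNIV::3 set). sqrt ?P * L2n u)"
        unfolding L2n_def by (intro add_mono sum_mono w1(2) w2(2) w3(2))
      finally show "(LINT y|Mst. N (stereo y) * norm (u y)) \<le> 13 * (sqrt ?P * L2n u)" by (simp add: sum_3 mult_ac)
    qed
    have iW: "integrable Mst (\<lambda>y. pair (W (stereo y)) (u y))"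
      unfolding W_def by (rule pair_integrable[OF mu iu continuous_Wt[OF t' s\<eta>]])
    have cf: "continuous_on S3 (\<lambda>x. f x *\<^sub>R \<theta>)" by (intro continuous_intros poly_continuous ridge_poly f)
    have if': "integrable Mst (\<lambda>y. f (stereo y) *\<^sub>R (u y $ k))"
      using pair_integrable[OF mu iu cf] by (simp add: pair.scaleR_left p\<theta>)
    have "norm (LINT y|Mst. pair (W (stereo y)) (u y) - f (stereo y) *\<^sub>R (u y $ k)) \<le> (LINT y|Mst. (Cp * C3 * \<bar>t\<bar>) * (N (stereo y) * norm (u y)))"
    proof (rule norm_integral_le)
      show "integrable Mst (\<lambda>y. pair (W (stereo y)) (u y) - f (stereo y) *\<^sub>R (u y $ k))" using iW if' by simp
      show "integrable Mst (\<lambda>y. (Cp * C3 * \<bar>t\<bar>) * (N (stereo y) * norm (u y)))" using Nint(1) by simp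
      fix y
      let ?x = "stereo y"
      define r where "r = Rem \<eta> ?x t - (lam + 3 * \<tau> / 2) *\<^sub>R \<eta> ?x"
      have "W ?x = Dop \<tau> \<eta> ?x - (lam + 3 * \<tau> / 2) *\<^sub>R \<eta> ?x + Rem \<eta> ?x t"
        unfolding W_def by (rule Wt_expand[OF s\<eta> S3_Dom[OF stereo_S3 t]])
      also have "Dop \<tau> \<eta> ?x = f ?x *\<^sub>R \<theta>" unfolding \<eta>_def Dop_pe[OF \<tau> \<psi>] using fL[of ?x] norm_stereo by simp
      finally have "W ?x = f ?x *\<^sub>R \<theta> + r" by (simp add: r_def)
      then have e: "pair (W ?x) (u y) - f ?x *\<^sub>R (u y $ k) = pair r (u y)" by (simp add: pair.add_left pair.scaleR_left p\<theta>)
      define S where "S = norm (\<eta> ?x) + (\<Sum>n\<in>UNIV. norm (Ed \<tau> n \<eta> ?x))"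
      have S: "norm (\<eta> ?x) \<le> S" "S \<le> 2 * M * N ?x" unfolding S_def using \<eta>N[of ?x] by (auto simp: sum_nonneg)
      have "norm r \<le> norm (Rem \<eta> ?x t) + norm ((lam + 3 * \<tau> / 2) *\<^sub>R \<eta> ?x)" unfolding r_def by (rule norm_triangle_ineq4)
      also have "\<dots> \<le> CR * \<bar>t\<bar> * S + (Cl * \<bar>t\<bar>) * S"
      proof (rule add_mono)
        show "norm (Rem \<eta> ?x t) \<le> CR * \<bar>t\<bar> * S" unfolding S_def by (rule Rb[OF stereo_S3 t])
        have "\<bar>lam + 3 * \<tau> / 2\<bar> * norm (\<eta> ?x) \<le> (Cl * \<bar>t\<bar>) * S" using lam S(1) Cl by (intro mult_mono) auto
        then show "norm ((lam + 3 * \<tau> / 2) *\<^sub>R \<eta> ?x) \<le> (Cl * \<bar>t\<bar>) * S" by simp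
      qed
      also have "\<dots> = (Cl + CR) * \<bar>t\<bar> * S" by (simp add: algebra_simps)
      also have "\<dots> \<le> (Cl + CR) * \<bar>t\<bar> * (2 * M * N ?x)" using S(2) Cl CR by (intro mult_left_mono) auto
      also have "\<dots> = C3 * \<bar>t\<bar> * N ?x" by (simp add: C3_def)
      finally have r: "norm r \<le> C3 * \<bar>t\<bar> * N ?x" .
      have "norm (pair r (u y)) \<le> norm r * norm (u y) * Cp" by (rule Cp(2))
      also have "\<dots> \<le> (C3 * \<bar>t\<bar> * N ?x) * norm (u y) * Cp" using r Cp(1) by (intro mult_right_mono) auto
      finally show "norm (pair (W ?x) (u y) - f ?x *\<^sub>R (u y $ k)) \<le> (Cp * C3 * \<bar>t\<bar>) * (N ?x * norm (u y))"
        unfolding e by (simp add: mult_ac)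
    qed
    also have "\<dots> = (Cp * C3 * \<bar>t\<bar>) * (LINT y|Mst. N (stereo y) * norm (u y))" by simp
    also have "\<dots> \<le> (Cp * C3 * \<bar>t\<bar>) * (13 * (sqrt ?P * L2n u))"
      using Nint(2) Cp(1) C3 by (intro mult_left_mono) auto
    finally have le: "norm (LINT y|Mst. pair (W (stereo y)) (u y) - f (stereo y) *\<^sub>R (u y $ k)) \<le> (Cp * C3 * \<bar>t\<bar>) * (13 * (sqrt ?P * L2n u))" .
    have "(LINT y|Mst. pair (W (stereo y)) (u y)) = 0" using u s\<eta> by (simp add: weak_solution_def W_def)
    then have "(LINT y|Mst. pair (W (stereo y)) (u y) - f (stereo y) *\<^sub>R (u y $ k)) = - (LINT y|Mst. f (stereo y) *\<^sub>R (u y $ k))"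
      using iW if' by simp
    then show ?thesis using le by (simp add: mult_ac)
  qed
  then show ?thesis using Cp(1) C3 by (intro exI[of _ "Cp * C3 * 13"]) auto
qed

end

section \<open>Distance of an eigenspinor from its mean\<close>

lemma norm_vec2_sq: "(norm (v :: complex^2))\<^sup>2 = (\<Sum>k\<in>UNIV. (Re (v$k))\<^sup>2 + (Im (v$k))\<^sup>2)"
  unfolding norm_vec_def L2_set_def by (simp add: sum_2 cmod_power2 sum_nonneg)

definition mean :: "(real^3 \<Rightarrow> complex^2) \<Rightarrow> complex^2" where "mean u = (1 / (2 * pi\<^sup>2)) *\<^sub>R (LINT y|Mst. u y)"

text \<open>The constant term is not assumed to vanish; comparing \<open>t\<close> with
  \<open>- t\<close> eliminates it.\<close>

lemma affine_slope_zero: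
  fixes a b C \<delta> :: real
  assumes d: "\<delta> > 0" and h: "\<And>t. t \<noteq> 0 \<Longrightarrow> \<bar>t\<bar> < \<delta> \<Longrightarrow> \<bar>a + b * t\<bar> \<le> C * t\<^sup>2"
  shows "b = 0"
proof (rule ccontr)
  assume b: "b \<noteq> 0"
  define t where "t = min (\<delta> / 2) (\<bar>b\<bar> / (2 * (\<bar>C\<bar> + 1)))"
  have t: "t > 0" "t < \<delta>" "t \<le> \<bar>b\<bar> / (2 * (\<bar>C\<bar> + 1))" using d b by (auto simp: t_def min_less_iff_disj)
  have "\<bar>a + b * t\<bar> \<le> C * t\<^sup>2" "\<bar>a - b * t\<bar> \<le> C * t\<^sup>2" using h[of t] h[of "- t"] t by auto
  then have "\<bar>b * t\<bar> \<le> C * t\<^sup>2" by linarith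
  then have "\<bar>b\<bar> * t \<le> (C * t) * t" using t by (simp add: abs_mult power2_eq_square)
  then have "\<bar>b\<bar> \<le> C * t" using t(1) by simp
  also have "\<dots> \<le> (\<bar>C\<bar> + 1) * t" using t(1) by (intro mult_right_mono) auto
  also have "\<dots> \<le> \<bar>b\<bar> / 2" using t(3) by (simp add: field_simps)
  finally show False using b by simp
qed

lemma norm_integrable:
  assumes "u \<in> borel_measurable lebesgue" "integrable Mst (\<lambda>y. (norm (u y :: complex^2))\<^sup>2)"
  shows "integrable Mst (\<lambda>y. norm (u y))" "integrable Mst u"
proof -
  show "integrable Mst (\<lambda>y. norm (u y))" by (rule square_integrable_imp_integrable) (use assms in auto)
  then show "integrable Mst u" using assms(1) by (simp add: integrable_norm_iff)
qed

lemma square_integrable_diff_const: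
  assumes "u \<in> borel_measurable lebesgue" "integrable Mst (\<lambda>y. (norm (u y :: complex^2))\<^sup>2)"
  shows "integrable Mst (\<lambda>y. (norm (u y - c))\<^sup>2)"
proof (rule Bochner_Integration.integrable_bound)
  show "integrable Mst (\<lambda>y. 2 * (norm (u y))\<^sup>2 + 2 * (norm c)\<^sup>2)" using assms(2) by simp
  show "(\<lambda>y. (norm (u y - c))\<^sup>2) \<in> borel_measurable Mst" using assms(1) by simp
  show "AE y in Mst. norm ((norm (u y - c))\<^sup>2) \<le> norm (2 * (norm (u y))\<^sup>2 + 2 * (norm c)\<^sup>2)"
  proof (rule AE_I2)
    fix y
    have "(norm (u y - c))\<^sup>2 \<le> (norm (u y) + norm c)\<^sup>2" by (intro power_mono norm_triangle_ineq4) simp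
    also have "\<dots> \<le> 2 * (norm (u y))\<^sup>2 + 2 * (norm c)\<^sup>2" using sum_squares_bound[of "norm (u y)" "norm c"] by (simp add: power2_sum)
    finally show "norm ((norm (u y - c))\<^sup>2) \<le> norm (2 * (norm (u y))\<^sup>2 + 2 * (norm c)\<^sup>2)" by simp
  qed
qed

lemma pi_square_bounds: "1 \<le> 2 * pi\<^sup>2" "2 * pi\<^sup>2 \<le> 36"
proof -
  have "1\<^sup>2 \<le> pi\<^sup>2" using pi_gt3 by (intro power_mono) auto
  moreover have "pi\<^sup>2 \<le> 4\<^sup>2" using pi_less_4 by (intro power_mono) auto
  ultimately show "1 \<le> 2 * pi\<^sup>2" "2 * pi\<^sup>2 \<le> 36" by auto
qed

context metric_perturbation begin

text \<open>Cauchy-Schwarz against the constant 1. The volume 2 pi^2 is at most 36, hence the factor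
  6.\<close>

lemma L1_le_L2n:
  assumes "u \<in> borel_measurable lebesgue" "integrable Mst (\<lambda>y. (norm (u y :: complex^2))\<^sup>2)"
  shows "(LINT y|Mst. norm (u y)) \<le> 6 * L2n u"
proof -
  have "(LINT y|Mst. \<bar>1\<bar> * norm (u y)) \<le> sqrt 36 * sqrt (LINT y|Mst. (norm (u y))\<^sup>2)"
    by (rule weighted_norm_bound(2)[OF assms rpf_const]) (use pi_square_bounds in \<open>simp add: pint_const\<close>)
  moreover have "sqrt 36 = (6::real)" by (rule real_sqrt_unique) auto
  ultimately show ?thesis by (simp add: L2n_def)
qed

text \<open>\<open>ridge_dual_bound\<close> is applied to the real and imaginary parts of both
  components of \<open>u\<close> minus its mean. Four contributions K^2 add up to (2 K)^2.\<close>

lemma weak_solution_oscillation: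
  assumes Cl: "Cl \<ge> 0"
  shows "\<exists>C\<ge>0. \<forall>t lam u. \<bar>t\<bar> \<le> \<epsilon>0 / 2 \<and> \<bar>lam + 3 * \<tau> / 2\<bar> \<le> Cl * \<bar>t\<bar> \<and> weak_solution t lam u \<longrightarrow>
     L2n (\<lambda>y. u y - mean u) \<le> C * \<bar>t\<bar> * L2n u"
proof -
  obtain C where C: "C \<ge> 0" and bd: "\<And>t lam u f k. \<bar>t\<bar> \<le> \<epsilon>0 / 2 \<Longrightarrow> \<bar>lam + 3 * \<tau> / 2\<bar> \<le> Cl * \<bar>t\<bar> \<Longrightarrow> weak_solution t lam u \<Longrightarrow> ridge f \<Longrightarrow> pint f = 0 \<Longrightarrow>
     norm (LINT y|Mst. f (stereo y) *\<^sub>R (u y $ k)) \<le> C * \<bar>t\<bar> * sqrt (pint (\<lambda>x. (f x)\<^sup>2)) * L2n u"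
    using weak_solution_mean_zero_bound[OF Cl] by blast
  have "L2n (\<lambda>y. u y - mean u) \<le> (2 * C) * \<bar>t\<bar> * L2n u"
    if h: "\<bar>t\<bar> \<le> \<epsilon>0 / 2" "\<bar>lam + 3 * \<tau> / 2\<bar> \<le> Cl * \<bar>t\<bar>" "weak_solution t lam u" for t lam u
  proof -
    have mu: "u \<in> borel_measurable lebesgue" and iu: "integrable Mst (\<lambda>y. (norm (u y))\<^sup>2)" using h(3) by (auto simp: weak_solution_def)
    define K where "K = C * \<bar>t\<bar> * L2n u"
    have K: "K \<ge> 0" using C L2n_nonneg by (simp add: K_def)
    note iu1 = norm_integrable(2)[OF mu iu]
    have iw: "integrable Mst (\<lambda>y. (norm (u y - mean u))\<^sup>2)" by (rule square_integrable_diff_const[OF mu iu])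
    have part: "(LINT y|Mst. (T (u y $ k - mean u $ k))\<^sup>2) \<le> K\<^sup>2" "integrable Mst (\<lambda>y. (T (u y $ k - mean u $ k))\<^sup>2)"
      if T: "bounded_linear T" "\<And>z. \<bar>T z\<bar> \<le> norm z" for T :: "complex \<Rightarrow> real" and k
    proof -
      have blk: "bounded_linear (\<lambda>v::complex^2. v $ k)" by (rule bounded_linear_vec_nth)
      have blT: "bounded_linear (\<lambda>v::complex^2. T (v $ k))" by (rule bounded_linear_compose[OF T(1) blk])
      have mr: "(\<lambda>y. T (u y $ k - mean u $ k)) \<in> borel_measurable lebesgue"
      proof -
        have "(\<lambda>y. T ((u y - mean u) $ k)) \<in> borel_measurable lebesgue"
          by (rule borel_measurable_continuous_onI[OF linear_continuous_on[OF blT], THEN measurable_compose[rotated]]) (use mu in simp)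
        then show ?thesis by simp
      qed
      have le: "\<bar>T (u y $ k - mean u $ k)\<bar> \<le> norm (u y - mean u)" for y
        using order_trans[OF T(2)[of "(u y - mean u) $ k"] Finite_Cartesian_Product.norm_nth_le] by simp
      show ir: "integrable Mst (\<lambda>y. (T (u y $ k - mean u $ k))\<^sup>2)"
      proof (rule Bochner_Integration.integrable_bound[OF iw])
        show "(\<lambda>y. (T (u y $ k - mean u $ k))\<^sup>2) \<in> borel_measurable Mst" using mr by simp
        show "AE y in Mst. norm ((T (u y $ k - mean u $ k))\<^sup>2) \<le> norm ((norm (u y - mean u))\<^sup>2)"
          using le by (intro AE_I2) (simp add: abs_le_square_iff[symmetric])
      qed
      show "(LINT y|Mst. (T (u y $ k - mean u $ k))\<^sup>2) \<le> K\<^sup>2"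
      proof (rule ridge_dual_bound[OF mr ir _ K])
        fix f assume f: "ridge f"
        \<comment> \<open>\<open>u\<close> minus its mean annihilates constants, so \<open>f\<close>
          may be replaced by its part of mean zero, whose L2 norm is no larger.\<close>
        define f0 where "f0 x = f x + - (pint f / (2 * pi\<^sup>2))" for x
        have rf0: "ridge f0" unfolding f0_def[abs_def] by (intro ridge.add f ridge_const)
        have pf: "real_polynomial_function f" "real_polynomial_function f0" by (rule ridge_poly[OF f], rule ridge_poly[OF rf0])
        have "pint f0 = pint f + pint (\<lambda>x. - (pint f / (2 * pi\<^sup>2)))" unfolding f0_def[abs_def] by (rule pint_add[OF pf(1) rpf_const])
        then have p0: "pint f0 = 0" unfolding pint_const by simp
        have sq: "pint (\<lambda>x. (f0 x)\<^sup>2) \<le> pint (\<lambda>x. (f x)\<^sup>2)"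
        proof -
          let ?c = "pint f / (2 * pi\<^sup>2)"
          have "pint (\<lambda>x. (f0 x)\<^sup>2) = pint (\<lambda>x. (f x)\<^sup>2 + ((- 2 * ?c) * f x + ?c\<^sup>2))"
            by (rule pint_cong) (simp add: f0_def power2_eq_square algebra_simps)
          also have "\<dots> = pint (\<lambda>x. (f x)\<^sup>2) + pint (\<lambda>x. (- 2 * ?c) * f x + ?c\<^sup>2)"
            by (intro pint_add poly_square rpf_add rpf_mult rpf_const pf)
          also have "pint (\<lambda>x. (- 2 * ?c) * f x + ?c\<^sup>2) = pint (\<lambda>x. (- 2 * ?c) * f x) + pint (\<lambda>x. ?c\<^sup>2)"
            by (intro pint_add rpf_mult rpf_const pf)
          also have "\<dots> = - (2 * pi\<^sup>2) * ?c\<^sup>2" unfolding pint_cmult pint_const by (simp add: power2_eq_square field_simps)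
          finally show ?thesis by simp
        qed
        have i1: "integrable Mst (\<lambda>y. f (stereo y) *\<^sub>R (u y $ k))"
        proof -
          have c: "continuous_on S3 (\<lambda>x. f x *\<^sub>R (axis k 1 :: complex^2))" by (intro continuous_intros poly_continuous pf)
          have "pair (axis k 1) w = w $ k" for w unfolding pair_def using exhaust_2[of k] by (auto simp: sum_2 axis_def)
          then show ?thesis using pair_integrable[OF mu iu c] by (simp add: pair.scaleR_left)
        qed
        have i2: "integrable Mst (\<lambda>y. f (stereo y) *\<^sub>R (mean u $ k))" "integrable Mst (\<lambda>y. f (stereo y))"
          using poly_integrable[OF pf(1)] by auto
        have i3: "integrable Mst (\<lambda>y. u y $ k)" by (rule integrable_bounded_linear[OF blk iu1])
        have mk: "mean u $ k = (1 / (2 * pi\<^sup>2)) *\<^sub>R (LINT y|Mst. u y $ k)"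
          unfolding mean_def using integral_bounded_linear[OF blk iu1] by simp
        have "(LINT y|Mst. f0 (stereo y) *\<^sub>R (u y $ k)) = (LINT y|Mst. f (stereo y) *\<^sub>R (u y $ k) + (- (pint f / (2 * pi\<^sup>2))) *\<^sub>R (u y $ k))"
          unfolding f0_def scaleR_add_left ..
        also have "\<dots> = (LINT y|Mst. f (stereo y) *\<^sub>R (u y $ k)) + (LINT y|Mst. (- (pint f / (2 * pi\<^sup>2))) *\<^sub>R (u y $ k))"
          by (rule Bochner_Integration.integral_add[OF i1 integrable_scaleR_right[OF i3]])
        also have "(LINT y|Mst. (- (pint f / (2 * pi\<^sup>2))) *\<^sub>R (u y $ k)) = - (pint f *\<^sub>R (mean u $ k))"
          unfolding mk by simp
        also have "(LINT y|Mst. f (stereo y) *\<^sub>R (u y $ k)) + - (pint f *\<^sub>R (mean u $ k)) = (LINT y|Mst. f (stereo y) *\<^sub>R (u y $ k) - f (stereo y) *\<^sub>R (mean u $ k))"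
          unfolding Bochner_Integration.integral_diff[OF i1 i2(1)] pint_def using i2 by simp
        finally have e: "(LINT y|Mst. f (stereo y) *\<^sub>R (u y $ k) - f (stereo y) *\<^sub>R (mean u $ k)) = (LINT y|Mst. f0 (stereo y) *\<^sub>R (u y $ k))" by simp
        have "(LINT y|Mst. f (stereo y) * T (u y $ k - mean u $ k)) = (LINT y|Mst. T (f (stereo y) *\<^sub>R (u y $ k) - f (stereo y) *\<^sub>R (mean u $ k)))"
          using linear_cmul[OF bounded_linear.linear[OF T(1)]] by (simp add: scaleR_diff_right[symmetric])
        also have "\<dots> = T (LINT y|Mst. f0 (stereo y) *\<^sub>R (u y $ k))"
          unfolding e[symmetric] by (rule integral_bounded_linear[OF T(1)]) (intro Bochner_Integration.integrable_diff i1 i2)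
        finally have "\<bar>LINT y|Mst. f (stereo y) * T (u y $ k - mean u $ k)\<bar> \<le> norm (LINT y|Mst. f0 (stereo y) *\<^sub>R (u y $ k))"
          using T(2) by simp
        also have "\<dots> \<le> C * \<bar>t\<bar> * sqrt (pint (\<lambda>x. (f0 x)\<^sup>2)) * L2n u" by (rule bd[OF h rf0 p0])
        also have "\<dots> = K * sqrt (pint (\<lambda>x. (f0 x)\<^sup>2))" by (simp add: K_def)
        also have "\<dots> \<le> K * sqrt (pint (\<lambda>x. (f x)\<^sup>2))" using sq K by (intro mult_left_mono real_sqrt_le_mono)
        finally show "\<bar>LINT y|Mst. f (stereo y) * T (u y $ k - mean u $ k)\<bar> \<le> K * sqrt (pint (\<lambda>x. (f x)\<^sup>2))" .
      qed
    qed
    note re = part[OF bounded_linear_Re abs_Re_le_cmod] and im = part[OF bounded_linear_Im abs_Im_le_cmod]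
    have "(L2n (\<lambda>y. u y - mean u))\<^sup>2 = (LINT y|Mst. (\<Sum>k\<in>UNIV. (Re (u y $ k - mean u $ k))\<^sup>2 + (Im (u y $ k - mean u $ k))\<^sup>2))"
      unfolding L2n_sq norm_vec2_sq by (simp only: vector_minus_component)
    also have "\<dots> = (\<Sum>k\<in>UNIV. (LINT y|Mst. (Re (u y $ k - mean u $ k))\<^sup>2) + (LINT y|Mst. (Im (u y $ k - mean u $ k))\<^sup>2))"
      by (simp only: Bochner_Integration.integral_sum[OF Bochner_Integration.integrable_add[OF re(2) im(2)]] Bochner_Integration.integral_add[OF re(2) im(2)])
    also have "\<dots> \<le> (\<Sum>k\<in>(UNIV::2 set). K\<^sup>2 + K\<^sup>2)" by (intro sum_mono add_mono re(1) im(1))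
    also have "\<dots> = (2 * K)\<^sup>2" unfolding sum_2 by (simp add: power2_eq_square)
    finally have le: "(L2n (\<lambda>y. u y - mean u))\<^sup>2 \<le> (2 * K)\<^sup>2" .
    have "L2n (\<lambda>y. u y - mean u) \<le> 2 * K" by (rule power2_le_imp_le[OF le]) (use K in linarith)
    then show ?thesis by (simp add: K_def mult_ac)
  qed
  then show ?thesis using C by (intro exI[of _ "2 * C"]) auto
qed

text \<open>The terms of \<open>Rem\<close> that are linear in the derivatives of the frame; they integrate to zero.\<close>

definition Dv :: "complex^2 \<Rightarrow> real \<Rightarrow> real^4 \<Rightarrow> complex^2"
  where "Dv \<theta> t x = \<i> *s (\<Sum>m\<in>UNIV. \<Sum>j\<in>UNIV. Em m j m x t *\<^sub>R (\<theta> v* pauli j))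
    + (\<Sum>k\<in>UNIV. (\<Sum>j\<in>UNIV. Em j k j x t - Em k j j x t) *\<^sub>R (\<theta> v* cmul (- \<i> / 2) (pauli k)))
    + (\<Sum>j\<in>UNIV. \<Sum>l\<in>UNIV. \<Sum>k\<in>UNIV. eps3 j l k * (Em j k l x t - Em k j l x t)) *\<^sub>R ((1/8) *\<^sub>R \<theta>)"

lemma zi_Em: "\<bar>t\<bar> < \<epsilon>0 \<Longrightarrow> zi (\<lambda>x. Em m i j x t)"
proof -
  assume t: "\<bar>t\<bar> < \<epsilon>0"
  note s = Cinf_slice[OF Cinf_BB t, of i j]
  have "continuous_on S3 (Ed \<tau> m (\<lambda>x. BB (x, t) $ i $ j))"
    by (rule continuous_on_subset[OF Cinf_on_continuous[OF Cinf_Ed[OF _ s]] S3_nonzero]) (simp add: open_Compl)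
  then show ?thesis unfolding zi_def Em_def using stereo_integrable integral_Ed_zero[OF s] by blast
qed

lemma zi_Dv: "\<bar>t\<bar> < \<epsilon>0 \<Longrightarrow> zi (Dv \<theta> t)"
proof -
  assume t: "\<bar>t\<bar> < \<epsilon>0"
  have l: "bounded_linear (\<lambda>r::real. r *\<^sub>R v)" for v :: "complex^2" by (rule bounded_linear_scaleR_left)
  have m: "bounded_linear (\<lambda>r::real. e * r)" for e by (rule bounded_linear_mult_right)
  have 1: "zi (\<lambda>x. \<i> *s (\<Sum>m\<in>UNIV. \<Sum>j\<in>UNIV. Em m j m x t *\<^sub>R (\<theta> v* pauli j)))"
    by (rule zi_linear[OF bounded_linear_smult]) (intro zi_sum zi_linear[OF l] zi_Em t)
  have 2: "zi (\<lambda>x. \<Sum>k\<in>UNIV. (\<Sum>j\<in>UNIV. Em j k j x t - Em k j j x t) *\<^sub>R (\<theta> v* cmul (- \<i> / 2) (pauli k)))"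
    by (intro zi_sum zi_linear[OF l] zi_diff zi_Em t)
  have 3: "zi (\<lambda>x. (\<Sum>j\<in>UNIV. \<Sum>l\<in>UNIV. \<Sum>k\<in>UNIV. eps3 j l k * (Em j k l x t - Em k j l x t)) *\<^sub>R ((1/8) *\<^sub>R \<theta>))"
    by (rule zi_linear[OF l]) (intro zi_sum zi_linear[OF m] zi_diff zi_Em t)
  show ?thesis unfolding Dv_def[abs_def] by (intro zi_add 1 2 3)
qed

text \<open>For a constant row only the derivatives of the frame and its trace survive to first
  order. The former are collected in \<open>Dv\<close>, so that after integration only the trace is
  left.\<close>

lemma Rem_const:
  "\<exists>C\<ge>0. \<forall>\<theta> t. \<forall>x\<in>S3. \<bar>t\<bar> \<le> \<epsilon>0 / 2 \<longrightarrow> norm (Rem (\<lambda>_. \<theta>) x t - (Dv \<theta> t x - (\<tau> / 2 * trb x t) *\<^sub>R \<theta>)) \<le> C * t\<^sup>2 * norm \<theta>"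
proof -
  obtain K where K: "K > 0" "\<And>(\<theta>::complex^2) (A::complex^2^2). norm (\<theta> v* A) \<le> norm \<theta> * norm A * K" using vm.pos_bounded by blast
  define a where "a k x t = Aq k x t - (\<Sum>j\<in>UNIV. Em j k j x t - Em k j j x t)" for k x t
  define b where "b x t = Sq x t - (- 12 * \<tau> - 4 * \<tau> * trb x t + (\<Sum>j\<in>UNIV. \<Sum>l\<in>UNIV. \<Sum>k\<in>UNIV. eps3 j l k * (Em j k l x t - Em k j l x t)))" for x t
  define \<Phi> where "\<Phi> x t = (\<Sum>k\<in>UNIV. (norm (cmul (- \<i> / 2) (pauli k)) * K) * \<bar>a k x t\<bar>) + \<bar>b x t\<bar>" for x t
  have "uO 2 \<Phi>" unfolding \<Phi>_def by (intro uO_add uO_sum uO_cmult uO_abs) (use uO_Aq uO_Sq in \<open>auto simp: a_def b_def\<close>)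
  then obtain C where C: "\<And>x t. x \<in> S3 \<Longrightarrow> \<bar>t\<bar> \<le> \<epsilon>0 / 2 \<Longrightarrow> \<bar>\<Phi> x t\<bar> \<le> C * \<bar>t\<bar>\<^sup>2" unfolding uO_def by blast
  have "norm (Rem (\<lambda>_. \<theta>) x t - (Dv \<theta> t x - (\<tau> / 2 * trb x t) *\<^sub>R \<theta>)) \<le> \<bar>C\<bar> * t\<^sup>2 * norm \<theta>" if h: "x \<in> S3" "\<bar>t\<bar> \<le> \<epsilon>0 / 2" for \<theta> x t
  proof -
    have "Rem (\<lambda>_. \<theta>) x t - (Dv \<theta> t x - (\<tau> / 2 * trb x t) *\<^sub>R \<theta>) = (\<Sum>k\<in>UNIV. a k x t *\<^sub>R (\<theta> v* cmul (- \<i> / 2) (pauli k))) + (b x t / 8) *\<^sub>R \<theta>"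
    proof -
      define S where "S = (\<Sum>j\<in>UNIV. \<Sum>l\<in>UNIV. \<Sum>k\<in>UNIV. eps3 j l k * (Em j k l x t - Em k j l x t))"
      define A1 where "A1 = \<i> *s (\<Sum>m\<in>UNIV. \<Sum>j\<in>UNIV. Em m j m x t *\<^sub>R (\<theta> v* pauli j))"
      define A2 where "A2 = (\<Sum>k\<in>UNIV. (\<Sum>j\<in>UNIV. Em j k j x t - Em k j j x t) *\<^sub>R (\<theta> v* cmul (- \<i> / 2) (pauli k)))"
      have R: "Rem (\<lambda>_. \<theta>) x t = A1 + (\<Sum>k\<in>UNIV. Aq k x t *\<^sub>R (\<theta> v* cmul (- \<i> / 2) (pauli k))) + (1/8 * (Sq x t + 12 * \<tau>)) *\<^sub>R \<theta>"
        unfolding Rem_def A1_def Ed_const vm.zero_left by simp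
      have A: "(\<Sum>k\<in>UNIV. Aq k x t *\<^sub>R (\<theta> v* cmul (- \<i> / 2) (pauli k))) = A2 + (\<Sum>k\<in>UNIV. a k x t *\<^sub>R (\<theta> v* cmul (- \<i> / 2) (pauli k)))"
        unfolding A2_def a_def sum.distrib[symmetric] scaleR_add_left[symmetric] by simp
      have e: "1/8 * (Sq x t + 12 * \<tau>) = S * (1/8) - \<tau> / 2 * trb x t + b x t / 8"
        unfolding b_def S_def[symmetric] by (simp add: field_simps)
      have k: "(1/8 * (Sq x t + 12 * \<tau>)) *\<^sub>R \<theta> = S *\<^sub>R ((1/8) *\<^sub>R \<theta>) - (\<tau> / 2 * trb x t) *\<^sub>R \<theta> + (b x t / 8) *\<^sub>R \<theta>"
        unfolding e scaleR_add_left scaleR_diff_left scaleR_scaleR ..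
      have grp: "(p + (q + r) + (s - z + w)) - ((p + q + s) - z) = r + w" for p q r s z w :: "complex^2"
        by (simp add: algebra_simps)
      show ?thesis unfolding R A k Dv_def A1_def[symmetric] A2_def[symmetric] S_def[symmetric] by (rule grp)
    qed
    also have "norm \<dots> \<le> (\<Sum>k\<in>UNIV. \<bar>a k x t\<bar> * (norm \<theta> * norm (cmul (- \<i> / 2) (pauli k)) * K)) + \<bar>b x t\<bar> * norm \<theta>"
    proof (intro order_trans[OF norm_triangle_ineq] add_mono sum_norm_le)
      show "norm (a k x t *\<^sub>R (\<theta> v* cmul (- \<i> / 2) (pauli k))) \<le> \<bar>a k x t\<bar> * (norm \<theta> * norm (cmul (- \<i> / 2) (pauli k)) * K)" for k
        using K(2)[of \<theta> "cmul (- \<i> / 2) (pauli k)"] by (simp add: mult_left_mono)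
      show "norm ((b x t / 8) *\<^sub>R \<theta>) \<le> \<bar>b x t\<bar> * norm \<theta>" by (simp add: mult_right_mono)
    qed
    also have "\<dots> = \<Phi> x t * norm \<theta>" unfolding \<Phi>_def distrib_right sum_distrib_right
      by (intro arg_cong2[where f="(+)"] sum.cong refl) (simp add: mult_ac)
    also have "\<dots> \<le> (\<bar>C\<bar> * t\<^sup>2) * norm \<theta>"
    proof (rule mult_right_mono)
      have "\<Phi> x t \<le> C * t\<^sup>2" using C[OF h] by simp
      also have "\<dots> \<le> \<bar>C\<bar> * t\<^sup>2" by (intro mult_right_mono) auto
      finally show "\<Phi> x t \<le> \<bar>C\<bar> * t\<^sup>2" .
    qed simp
    finally show ?thesis .
  qed
  then show ?thesis by (intro exI[of _ "\<bar>C\<bar>"]) auto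
qed

lemma continuous_trb: "\<bar>t\<bar> < \<epsilon>0 \<Longrightarrow> continuous_on S3 (\<lambda>x. trb x t)"
  unfolding trb_def bm_def
  by (rule continuous_on_subset[OF _ S3_nonzero])
    (intro continuous_on_sum continuous_on_diff Cinf_on_continuous[OF Cinf_slice[OF Cinf_BB]] continuous_on_const)

text \<open>Test with a constant row \<theta> and split \<open>u\<close> into its mean and
  \<open>w\<close>. The image \<open>V\<close> of the test row and \<open>w\<close> are both O(t),
  so their pairing is of second order. The integral of \<open>V\<close> is minus the quantity to be
  estimated times \<theta>, again up to second order. Choosing \<theta> along a component of the
  mean that is comparable with the norm of \<open>u\<close> allows the division.\<close>

lemma weak_solution_eigenvalue:
  assumes Cl: "Cl \<ge> 0"
  shows "\<exists>C. \<exists>\<delta>>0. \<forall>t lam u. \<bar>t\<bar> \<le> \<epsilon>0 / 2 \<and> \<bar>t\<bar> \<le> \<delta> \<and> \<bar>lam + 3 * \<tau> / 2\<bar> \<le> Cl * \<bar>t\<bar> \<and> weak_solution t lam u \<and> L2n u > 0 \<longrightarrow>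
     \<bar>(lam + 3 * \<tau> / 2) * (2 * pi\<^sup>2) + \<tau> / 2 * (LINT y|Mst. trb (stereo y) t)\<bar> \<le> C * t\<^sup>2"
proof -
  obtain C where C: "C \<ge> 0" and osc: "\<And>t lam u. \<bar>t\<bar> \<le> \<epsilon>0 / 2 \<Longrightarrow> \<bar>lam + 3 * \<tau> / 2\<bar> \<le> Cl * \<bar>t\<bar> \<Longrightarrow> weak_solution t lam u \<Longrightarrow>
     L2n (\<lambda>y. u y - mean u) \<le> C * \<bar>t\<bar> * L2n u" using weak_solution_oscillation[OF Cl] by blast
  obtain CR where CR: "CR \<ge> 0" and Rb: "\<And>\<eta> x t. x \<in> S3 \<Longrightarrow> \<bar>t\<bar> \<le> \<epsilon>0 / 2 \<Longrightarrow> norm (Rem \<eta> x t) \<le> CR * \<bar>t\<bar> * (norm (\<eta> x) + (\<Sum>m\<in>UNIV. norm (Ed \<tau> m \<eta> x)))"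
    using Rem_bound by blast
  obtain Cq where Cq: "Cq \<ge> 0" and Qb: "\<And>\<theta> x t. x \<in> S3 \<Longrightarrow> \<bar>t\<bar> \<le> \<epsilon>0 / 2 \<Longrightarrow> norm (Rem (\<lambda>_. \<theta>) x t - (Dv \<theta> t x - (\<tau> / 2 * trb x t) *\<^sub>R \<theta>)) \<le> Cq * t\<^sup>2 * norm \<theta>"
    using Rem_const by blast
  obtain Cp where Cp: "Cp > 0" "\<And>a b. norm (pair a b) \<le> norm a * norm b * Cp" using pair.pos_bounded by blast
  define C4 where "C4 = Cl + CR"
  \<comment> \<open>For such \<open>t\<close> the factor C |t| is at most 1/2, so \<open>w\<close>
    has at most half the norm of \<open>u\<close>.\<close>
  define \<delta> where "\<delta> = 1 / (2 * (C + 1))"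
  define D where "D = 16 * (Cp * C4 * (6 * C) + Cq * 36 * 6 * Cp)"
  have C4: "C4 \<ge> 0" using Cl CR by (simp add: C4_def)
  have "\<bar>(lam + 3 * \<tau> / 2) * (2 * pi\<^sup>2) + \<tau> / 2 * (LINT y|Mst. trb (stereo y) t)\<bar> \<le> D * t\<^sup>2"
    if h: "\<bar>t\<bar> \<le> \<epsilon>0 / 2" "\<bar>t\<bar> \<le> \<delta>" "\<bar>lam + 3 * \<tau> / 2\<bar> \<le> Cl * \<bar>t\<bar>" "weak_solution t lam u" "L2n u > 0" for t lam u
  proof -
    have t': "\<bar>t\<bar> < \<epsilon>0" using h(1) eps0 by linarith
    have mu: "u \<in> borel_measurable lebesgue" and iu: "integrable Mst (\<lambda>y. (norm (u y))\<^sup>2)" using h(4) by (auto simp: weak_solution_def)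
    define U where "U = L2n u"
    define \<mu> where "\<mu> = mean u"
    define w where "w y = u y - \<mu>" for y
    have mw: "w \<in> borel_measurable lebesgue" unfolding w_def[abs_def] using mu by simp
    have iw: "integrable Mst (\<lambda>y. (norm (w y))\<^sup>2)" unfolding w_def by (rule square_integrable_diff_const[OF mu iu])
    have wU: "L2n w \<le> C * \<bar>t\<bar> * U" using osc[OF h(1,3,4)] by (simp add: w_def[abs_def] \<mu>_def U_def)
    note iu1 = norm_integrable[OF mu iu] and iw1 = norm_integrable[OF mw iw]
    have U: "U > 0" using h(5) by (simp add: U_def)
    have n\<mu>: "norm \<mu> \<le> 6 * U"
    proof -
      have "norm (LINT y|Mst. u y) \<le> 6 * U" unfolding U_def by (rule order_trans[OF integral_norm_bound L1_le_L2n[OF mu iu]])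
      moreover have "norm \<mu> \<le> norm (LINT y|Mst. u y)"
        unfolding \<mu>_def mean_def using pi_square_bounds(1) mult_right_mono[of "1 / (2 * pi\<^sup>2)" 1 "norm (LINT y|Mst. u y)"] by simp
      ultimately show ?thesis by linarith
    qed
    \<comment> \<open>Otherwise 128 |\<mu>|^2 < U^2. But U^2 <= 2 (U/2)^2 + 2 |\<mu>|^2 * 2 pi^2,
      and with 2 pi^2 <= 32 the right-hand side is at most U^2 / 2 + 64 |\<mu>|^2, a
      contradiction.\<close>
    have "\<exists>k. U \<le> 16 * norm (\<mu> $ k)"
    proof (rule ccontr)
      assume "\<not> ?thesis"
      then have k: "16 * norm (\<mu> $ k) < U" for k by (auto simp: not_le)
      have "(16 * norm (\<mu> $ k))\<^sup>2 < U\<^sup>2" for k using k by (intro power_strict_mono) auto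
      then have k2: "256 * (norm (\<mu> $ k))\<^sup>2 < U\<^sup>2" for k by (simp add: power_mult_distrib)
      have "(norm \<mu>)\<^sup>2 = (norm (\<mu> $ 1))\<^sup>2 + (norm (\<mu> $ 2))\<^sup>2" unfolding norm_vec2_sq by (simp add: sum_2 cmod_power2)
      then have s: "128 * (norm \<mu>)\<^sup>2 < U\<^sup>2" using k2[of 1] k2[of 2] by linarith
      have "U\<^sup>2 \<le> (LINT y|Mst. 2 * (norm (w y))\<^sup>2 + 2 * (norm \<mu>)\<^sup>2)"
        unfolding U_def L2n_sq
      proof (rule Bochner_Integration.integral_mono[OF iu])
        show "integrable Mst (\<lambda>y. 2 * (norm (w y))\<^sup>2 + 2 * (norm \<mu>)\<^sup>2)" using iw by simp
        fix y
        have "(norm (u y))\<^sup>2 \<le> (norm (w y) + norm \<mu>)\<^sup>2" using norm_triangle_ineq[of "w y" \<mu>] by (intro power_mono) (auto simp: w_def)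
        also have "\<dots> \<le> 2 * (norm (w y))\<^sup>2 + 2 * (norm \<mu>)\<^sup>2" using sum_squares_bound[of "norm (w y)" "norm \<mu>"] by (simp add: power2_sum)
        finally show "(norm (u y))\<^sup>2 \<le> 2 * (norm (w y))\<^sup>2 + 2 * (norm \<mu>)\<^sup>2" .
      qed
      also have "\<dots> = 2 * (L2n w)\<^sup>2 + 2 * (norm \<mu>)\<^sup>2 * (2 * pi\<^sup>2)" using iw measure_Mst by (simp add: L2n_sq)
      also have "\<dots> \<le> 2 * (U / 2)\<^sup>2 + 2 * (norm \<mu>)\<^sup>2 * 32"
      proof (intro add_mono mult_left_mono power_mono)
        have "C * \<bar>t\<bar> \<le> C * \<delta>" using h(2) C by (intro mult_left_mono)
        also have "\<dots> \<le> 1 / 2" unfolding \<delta>_def using C by (simp add: field_simps)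
        finally have "C * \<bar>t\<bar> * U \<le> 1 / 2 * U" using U by (intro mult_right_mono) auto
        then show "L2n w \<le> U / 2" using wU by simp
        have "pi\<^sup>2 \<le> 4\<^sup>2" using pi_less_4 by (intro power_mono) auto
        then show "2 * pi\<^sup>2 \<le> 32" by simp
      qed (auto simp: L2n_nonneg)
      finally show False using s by (simp add: power_divide)
    qed
    then obtain k where k: "U \<le> 16 * norm (\<mu> $ k)" by blast
    define \<theta> where "\<theta> = (axis k 1 :: complex^2)"
    have n\<theta>: "norm \<theta> = 1" by (simp add: \<theta>_def norm_axis_1)
    have p\<theta>: "pair \<theta> v = v $ k" for v unfolding \<theta>_def pair_def using exhaust_2[of k] by (auto simp: sum_2 axis_def)
    have s\<theta>: "Cinf_on (\<lambda>_::real^4. \<theta>) (- {0})" by (rule Cinf_on_const)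
    define V where "V = Wt \<tau> (\<lambda>x. BB (x, t)) (\<lambda>x. GG (x, t)) lam (\<lambda>_. \<theta>)"
    have V: "V x = Rem (\<lambda>_. \<theta>) x t - (lam + 3 * \<tau> / 2) *\<^sub>R \<theta>" if "x \<in> S3" for x
      unfolding V_def Wt_expand[OF s\<theta> S3_Dom[OF that h(1)]] Dop_def Ed_const vm.zero_left by simp
    have cV: "continuous_on S3 V" unfolding V_def by (rule continuous_Wt[OF t' s\<theta>])
    have bV: "norm (V x) \<le> C4 * \<bar>t\<bar>" if "x \<in> S3" for x
    proof -
      have "norm (V x) \<le> norm (Rem (\<lambda>_. \<theta>) x t) + norm ((lam + 3 * \<tau> / 2) *\<^sub>R \<theta>)" unfolding V[OF that] by (rule norm_triangle_ineq4)
      then show ?thesis using Rb[OF that h(1), of "\<lambda>_. \<theta>"] h(3) by (simp add: Ed_const n\<theta> C4_def distrib_right)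
    qed
    \<comment> \<open>What is left of \<open>V\<close> after removing the derivative terms, which
      integrate to zero, and the scalar terms, which integrate to \<open>?Z\<close>. It is of second
      order.\<close>
    define \<rho> where "\<rho> x = V x - Dv \<theta> t x + (lam + 3 * \<tau> / 2 + \<tau> / 2 * trb x t) *\<^sub>R \<theta>" for x
    have b\<rho>: "norm (\<rho> x) \<le> Cq * t\<^sup>2" if "x \<in> S3" for x
      using Qb[OF that h(1), of \<theta>] unfolding \<rho>_def V[OF that] by (simp add: n\<theta> algebra_simps)
    have iV: "integrable Mst (\<lambda>y. V (stereo y))" by (rule stereo_integrable[OF cV])
    have itr: "integrable Mst (\<lambda>y. trb (stereo y) t)" by (rule stereo_integrable[OF continuous_trb[OF t']])
    note iD = zi_Dv[OF t', of \<theta>, unfolded zi_def]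
    have ic: "integrable Mst (\<lambda>y. (lam + 3 * \<tau> / 2 + \<tau> / 2 * trb (stereo y) t) *\<^sub>R \<theta>)" using itr by (intro integrable_scaleR_left) simp
    have i\<rho>: "integrable Mst (\<lambda>y. \<rho> (stereo y))" unfolding \<rho>_def using iV iD ic by (intro Bochner_Integration.integrable_add Bochner_Integration.integrable_diff) auto
    let ?Z = "(lam + 3 * \<tau> / 2) * (2 * pi\<^sup>2) + \<tau> / 2 * (LINT y|Mst. trb (stereo y) t)"
    have IV: "(LINT y|Mst. V (stereo y)) = (LINT y|Mst. \<rho> (stereo y)) - ?Z *\<^sub>R \<theta>"
    proof -
      have "(LINT y|Mst. \<rho> (stereo y)) = (LINT y|Mst. V (stereo y) - Dv \<theta> t (stereo y)) + (LINT y|Mst. (lam + 3 * \<tau> / 2 + \<tau> / 2 * trb (stereo y) t) *\<^sub>R \<theta>)"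
        unfolding \<rho>_def using iV iD ic by (intro Bochner_Integration.integral_add Bochner_Integration.integrable_diff) auto
      also have "(LINT y|Mst. (lam + 3 * \<tau> / 2 + \<tau> / 2 * trb (stereo y) t) *\<^sub>R \<theta>) = (LINT y|Mst. lam + 3 * \<tau> / 2 + \<tau> / 2 * trb (stereo y) t) *\<^sub>R \<theta>"
        using itr by (intro integral_scaleR_left) simp
      also have "(LINT y|Mst. lam + 3 * \<tau> / 2 + \<tau> / 2 * trb (stereo y) t) = ?Z"
        using itr measure_Mst by (simp add: mult.commute)
      finally show ?thesis using iV iD by simp
    qed
    have bl: "bounded_linear (\<lambda>v. pair v \<mu>)" by (rule pair.bounded_linear_left)
    have "0 = (LINT y|Mst. pair (V (stereo y)) (u y))" using h(4) s\<theta> unfolding weak_solution_def V_def by simp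
    also have "\<dots> = (LINT y|Mst. pair (V (stereo y)) (w y) + pair (V (stereo y)) \<mu>)"
      unfolding w_def pair.diff_right by simp
    also have "\<dots> = (LINT y|Mst. pair (V (stereo y)) (w y)) + pair (LINT y|Mst. V (stereo y)) \<mu>"
      unfolding Bochner_Integration.integral_add[OF pair_integrable[OF mw iw cV] integrable_bounded_linear[OF bl iV]] integral_bounded_linear[OF bl iV] ..
    also have "\<dots> = (LINT y|Mst. pair (V (stereo y)) (w y)) + pair (LINT y|Mst. \<rho> (stereo y)) \<mu> - ?Z *\<^sub>R (\<mu> $ k)"
      unfolding IV pair.diff_left pair.scaleR_left p\<theta> by simp
    finally have z: "0 = (LINT y|Mst. pair (V (stereo y)) (w y)) + pair (LINT y|Mst. \<rho> (stereo y)) \<mu> - ?Z *\<^sub>R (\<mu> $ k)" .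
    have "?Z *\<^sub>R (\<mu> $ k) = (LINT y|Mst. pair (V (stereo y)) (w y)) + pair (LINT y|Mst. \<rho> (stereo y)) \<mu>"
      by (rule right_minus_eq[THEN iffD1, OF z[symmetric], symmetric])
    then have "\<bar>?Z\<bar> * norm (\<mu> $ k) = norm ((LINT y|Mst. pair (V (stereo y)) (w y)) + pair (LINT y|Mst. \<rho> (stereo y)) \<mu>)"
      unfolding norm_scaleR[symmetric] by (rule arg_cong)
    then have Zk: "\<bar>?Z\<bar> * norm (\<mu> $ k) \<le> norm (LINT y|Mst. pair (V (stereo y)) (w y)) + norm (pair (LINT y|Mst. \<rho> (stereo y)) \<mu>)"
      using norm_triangle_ineq by (rule ord_eq_le_trans)
    have A: "norm (LINT y|Mst. pair (V (stereo y)) (w y)) \<le> (Cp * C4 * (6 * C)) * t\<^sup>2 * U"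
    proof -
      have "norm (LINT y|Mst. pair (V (stereo y)) (w y)) \<le> (LINT y|Mst. (Cp * C4 * \<bar>t\<bar>) * norm (w y))"
      proof (rule norm_integral_le[OF pair_integrable[OF mw iw cV]])
        show "integrable Mst (\<lambda>y. (Cp * C4 * \<bar>t\<bar>) * norm (w y))" using iw1(1) by simp
        fix y
        have "norm (pair (V (stereo y)) (w y)) \<le> norm (V (stereo y)) * norm (w y) * Cp" by (rule Cp(2))
        also have "\<dots> \<le> (C4 * \<bar>t\<bar>) * norm (w y) * Cp" using bV[OF stereo_S3] Cp(1) by (intro mult_right_mono) auto
        finally show "norm (pair (V (stereo y)) (w y)) \<le> (Cp * C4 * \<bar>t\<bar>) * norm (w y)" by (simp add: mult_ac)
      qed
      also have "\<dots> = (Cp * C4 * \<bar>t\<bar>) * (LINT y|Mst. norm (w y))" by simp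
      also have "\<dots> \<le> (Cp * C4 * \<bar>t\<bar>) * (6 * (C * \<bar>t\<bar> * U))"
        using L1_le_L2n[OF mw iw] wU Cp(1) C4 by (intro mult_left_mono) auto
      also have "\<dots> = (Cp * C4 * (6 * C)) * (\<bar>t\<bar> * \<bar>t\<bar>) * U" by simp
      finally show ?thesis by (simp add: power2_eq_square)
    qed
    have B: "norm (pair (LINT y|Mst. \<rho> (stereo y)) \<mu>) \<le> (Cq * 36 * 6 * Cp) * t\<^sup>2 * U"
    proof -
      have "norm (LINT y|Mst. \<rho> (stereo y)) \<le> (LINT y|Mst. Cq * t\<^sup>2)"
        by (rule norm_integral_le[OF i\<rho>]) (auto intro: b\<rho> stereo_S3)
      also have "\<dots> = (Cq * t\<^sup>2) * (2 * pi\<^sup>2)" using measure_Mst by (simp add: mult.commute)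
      also have "\<dots> \<le> (Cq * t\<^sup>2) * 36" using pi_square_bounds(2) Cq by (intro mult_left_mono) auto
      finally have "norm (LINT y|Mst. \<rho> (stereo y)) \<le> Cq * t\<^sup>2 * 36" .
      then have "norm (LINT y|Mst. \<rho> (stereo y)) * norm \<mu> * Cp \<le> (Cq * t\<^sup>2 * 36) * (6 * U) * Cp"
        using n\<mu> Cp(1) Cq less_imp_le[OF U] by (intro mult_mono) (auto intro!: mult_nonneg_nonneg)
      then show ?thesis using Cp(2)[of "LINT y|Mst. \<rho> (stereo y)" \<mu>] by (simp add: mult_ac)
    qed
    have "\<bar>?Z\<bar> * U \<le> 16 * (\<bar>?Z\<bar> * norm (\<mu> $ k))" using mult_left_mono[OF k, of "\<bar>?Z\<bar>"] by simp
    also have "\<dots> \<le> 16 * ((Cp * C4 * (6 * C)) * t\<^sup>2 * U + (Cq * 36 * 6 * Cp) * t\<^sup>2 * U)"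
      by (rule mult_left_mono[OF order_trans[OF Zk add_mono[OF A B]]]) simp
    also have "\<dots> = (D * t\<^sup>2) * U" unfolding D_def by (simp add: algebra_simps)
    finally show ?thesis using U by simp
  qed
  moreover have "\<delta> > 0" using C by (simp add: \<delta>_def)
  ultimately show ?thesis by (intro exI[of _ D] exI[of _ \<delta>]) auto
qed

end

section \<open>The volume to first order\<close>

lemma pd_spherical: "pd spherical \<alpha> y = vector
     [- sin (y$1) * axis \<alpha> 1 $ 1,
      cos (y$1) * cos (y$2) * axis \<alpha> 1 $ 1 - sin (y$1) * sin (y$2) * axis \<alpha> 1 $ 2,
      cos (y$1) * sin (y$2) * cos (y$3) * axis \<alpha> 1 $ 1 + sin (y$1) * cos (y$2) * cos (y$3) * axis \<alpha> 1 $ 2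
        - sin (y$1) * sin (y$2) * sin (y$3) * axis \<alpha> 1 $ 3,
      cos (y$1) * sin (y$2) * sin (y$3) * axis \<alpha> 1 $ 1 + sin (y$1) * cos (y$2) * sin (y$3) * axis \<alpha> 1 $ 2
        + sin (y$1) * sin (y$2) * cos (y$3) * axis \<alpha> 1 $ 3]"
  unfolding pd_def frechet_derivative_at[OF spherical_has_derivative, symmetric] ..

lemma pd_spherical_tangent: "pd spherical \<alpha> y \<in> tangent_S3 (spherical y)"
proof -
  have d: "spherical differentiable at z" for z using spherical_has_derivative by (auto simp: differentiable_def)
  have "pd (\<lambda>y. spherical y \<bullet> spherical y) \<alpha> y = spherical y \<bullet> pd spherical \<alpha> y + pd spherical \<alpha> y \<bullet> spherical y"
    by (rule pd_bilinear[OF bounded_bilinear_inner d d])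
  moreover have "spherical z \<bullet> spherical z = 1" for z using norm_spherical by (simp add: norm_eq_1)
  ultimately show ?thesis by (simp add: tangent_S3_def inner_commute)
qed

lemma pd_spherical_inner:
  "pd spherical \<alpha> y \<bullet> pd spherical \<beta> y = (if \<alpha> \<noteq> \<beta> then 0 else if \<alpha> = 1 then 1 else if \<alpha> = 2 then (sin (y$1))\<^sup>2 else (sin (y$1) * sin (y$2))\<^sup>2)"
proof -
  define a1 b1 a2 b2 a3 b3 where ab: "a1 = sin (y$1)" "b1 = cos (y$1)" "a2 = sin (y$2)"
    "b2 = cos (y$2)" "a3 = sin (y$3)" "b3 = cos (y$3)"
  have sq: "b1^2 = 1 - a1^2" "b2^2 = 1 - a2^2" "b3^2 = 1 - a3^2"
    by (auto simp: ab cos_squared_eq)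
  have ax: "(axis 1 1 :: real^3) $ 1 = 1" "(axis 1 1 :: real^3) $ 2 = 0" "(axis 1 1 :: real^3) $ 3 = 0" "(axis 2 1 :: real^3) $ 1 = 0" "(axis 2 1 :: real^3) $ 2 = 1"
    "(axis 2 1 :: real^3) $ 3 = 0" "(axis 3 1 :: real^3) $ 1 = 0" "(axis 3 1 :: real^3) $ 2 = 0" "(axis 3 1 :: real^3) $ 3 = 1"
    by (simp_all add: axis_def)
  have e: "pd spherical 1 y \<bullet> pd spherical 1 y = 1" "pd spherical 2 y \<bullet> pd spherical 2 y = a1^2" "pd spherical 3 y \<bullet> pd spherical 3 y = (a1 * a2)^2"
    "pd spherical 1 y \<bullet> pd spherical 2 y = 0" "pd spherical 1 y \<bullet> pd spherical 3 y = 0" "pd spherical 2 y \<bullet> pd spherical 3 y = 0"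
    unfolding pd_spherical inner_4 vector_4 ab[symmetric] ax using sq by algebra+
  show ?thesis
    using exhaust_3[of \<alpha>] exhaust_3[of \<beta>] e inner_commute[of "pd spherical 2 y" "pd spherical 1 y"] inner_commute[of "pd spherical 3 y" "pd spherical 1 y"] inner_commute[of "pd spherical 3 y" "pd spherical 2 y"]
    by (auto simp: ab)
qed

lemma metric_tangent_matrix:
  fixes p :: "3 \<Rightarrow> real^4"
  assumes \<tau>: "\<tau> = 1 \<or> \<tau> = -1" and g: "pointwise_metric g" and x: "x \<in> S3" and t: "\<And>\<alpha>. p \<alpha> \<in> tangent_S3 x"
    and C: "C = (\<chi> \<alpha> m. p \<alpha> \<bullet> Ef \<tau> m x)"
  shows "(\<chi> \<alpha> \<beta>. g x (p \<alpha>) (p \<beta>)) = C ** gram g \<tau> x ** transpose C"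
proof -
  have n: "norm x = 1" using x by (simp add: S3_def)
  have ex: "p \<alpha> = (\<Sum>m\<in>UNIV. C $ \<alpha> $ m *\<^sub>R Ef \<tau> m x)" for \<alpha>
    using tangent_expand[OF \<tau> n t[of \<alpha>]] by (simp add: C)
  have 1: "g x (Ef \<tau> m x) (p \<beta>) = (\<Sum>k\<in>UNIV. C $ \<beta> $ k * gram g \<tau> x $ m $ k)" for m \<beta>
  proof -
    have "g x (Ef \<tau> m x) (p \<beta>) = g x (p \<beta>) (Ef \<tau> m x)" by (rule metric_symmetric[OF g x Ef_tangent t])
    also have "\<dots> = (\<Sum>k\<in>UNIV. C $ \<beta> $ k * g x (Ef \<tau> k x) (Ef \<tau> m x))"
      unfolding ex by (rule metric_linear[OF g x Ef_tangent Ef_tangent])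
    also have "\<dots> = (\<Sum>k\<in>UNIV. C $ \<beta> $ k * gram g \<tau> x $ m $ k)"
      unfolding gram_def vec_lambda_beta by (intro sum.cong refl arg_cong2[where f="(*)"] metric_symmetric[OF g x Ef_tangent Ef_tangent])
    finally show ?thesis .
  qed
  have "g x (p \<alpha>) (p \<beta>) = (\<Sum>m\<in>UNIV. C $ \<alpha> $ m * g x (Ef \<tau> m x) (p \<beta>))" for \<alpha> \<beta>
    using metric_linear[where t="\<lambda>m. Ef \<tau> m x" and a="\<lambda>m. C $ \<alpha> $ m", OF g x Ef_tangent t] by (simp add: ex[of \<alpha>])
  then show ?thesis unfolding 1 by (simp add: vec_eq_iff mm3_nth transpose_def sum_3 algebra_simps)
qed

lemma inner_tangent_matrix:
  fixes p :: "3 \<Rightarrow> real^4"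
  assumes \<tau>: "\<tau> = 1 \<or> \<tau> = -1" and x: "x \<in> S3" and t: "\<And>\<alpha>. p \<alpha> \<in> tangent_S3 x"
    and C: "C = (\<chi> \<alpha> m. p \<alpha> \<bullet> Ef \<tau> m x)"
  shows "(\<chi> \<alpha> \<beta>. p \<alpha> \<bullet> p \<beta>) = C ** transpose C"
proof -
  have n: "norm x = 1" using x by (simp add: S3_def)
  have "p \<alpha> \<bullet> p \<beta> = (\<Sum>m\<in>UNIV. (p \<alpha> \<bullet> Ef \<tau> m x) * (p \<beta> \<bullet> Ef \<tau> m x))" for \<alpha> \<beta>
  proof -
    have "p \<alpha> \<bullet> p \<beta> = (\<Sum>m\<in>UNIV. (p \<alpha> \<bullet> Ef \<tau> m x) *\<^sub>R Ef \<tau> m x) \<bullet> p \<beta>"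
      by (rule arg_cong[where f="\<lambda>v. v \<bullet> p \<beta>", OF tangent_expand[OF \<tau> n t]])
    also have "\<dots> = (\<Sum>m\<in>UNIV. (p \<alpha> \<bullet> Ef \<tau> m x) * (p \<beta> \<bullet> Ef \<tau> m x))"
      unfolding inner_sum_left inner_scaleR_left by (intro sum.cong refl arg_cong2[where f="(*)"] inner_commute)
    finally show ?thesis .
  qed
  then show ?thesis by (simp add: C vec_eq_iff mm3_nth transpose_def sum_3)
qed

lemma Jsph_nonneg: "y \<in> spherical_domain \<Longrightarrow> Jsph y \<ge> 0"
  using sin_gt_zero[of "y$2"] by (simp add: spherical_domain_def Jsph_def)

text \<open>\<open>C\<close> expresses the coordinate vectors in the invariant frame. Only the
  square of its determinant enters, and the round metric identifies it as the square of
  \<open>Jsph\<close>.\<close>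

lemma sqrt_det_metric_spherical:
  assumes \<tau>: "\<tau> = 1 \<or> \<tau> = -1" and g: "pointwise_metric g" and y: "y \<in> spherical_domain"
  shows "sqrt (det (metric_comp g spherical y)) = Jsph y * sqrt (det (gram g \<tau> (spherical y)))"
proof -
  define C where "C = (\<chi> \<alpha> m. pd spherical \<alpha> y \<bullet> Ef \<tau> m (spherical y))"
  have "det (C ** transpose C) = (Jsph y)\<^sup>2"
    unfolding inner_tangent_matrix[OF \<tau> spherical_S3 pd_spherical_tangent C_def, symmetric] pd_spherical_inner det_3
    by (simp add: Jsph_def power2_eq_square)
  then have d: "(det C)\<^sup>2 = (Jsph y)\<^sup>2" by (simp add: det_mul power2_eq_square)
  have "metric_comp g spherical y = C ** gram g \<tau> (spherical y) ** transpose C"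
    unfolding metric_comp_def by (rule metric_tangent_matrix[OF \<tau> g spherical_S3 pd_spherical_tangent C_def])
  then have "det (metric_comp g spherical y) = (Jsph y)\<^sup>2 * det (gram g \<tau> (spherical y))"
    unfolding d[symmetric] by (simp add: det_mul power2_eq_square)
  then show ?thesis using Jsph_nonneg[OF y] by (simp add: real_sqrt_mult)
qed

context metric_perturbation begin

lemma sgn_id: "x \<in> S3 \<Longrightarrow> sgn x = x" by (simp add: S3_def sgn_div_norm)

lemma GG_S3: "x \<in> S3 \<Longrightarrow> GG (x, t) = gram (g t) \<tau> x" by (simp add: GG_def sgn_id)

lemma Cinf_det_GG: "Cinf_on (\<lambda>p. sqrt (det (GG p))) Dom"
  by (rule Cinf_on_sqrt[OF open_Dom]) (unfold det_3, intro Cinf_on_diff Cinf_on_add Cinf_on_mult Cinf_GG open_Dom, fold det_3, rule GG_props)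

lemma volume_eq: "\<bar>t\<bar> < \<epsilon>0 \<Longrightarrow> riemannian_volume (g t) = (LINT y|Mst. sqrt (det (GG (stereo y, t))))"
proof -
  assume t: "\<bar>t\<bar> < \<epsilon>0"
  have c: "continuous_on S3 (\<lambda>x. sqrt (det (GG (x, t))))"
    by (rule continuous_on_subset[OF Cinf_on_continuous[OF Cinf_slice[OF Cinf_det_GG t]] S3_nonzero])
  have "riemannian_volume (g t) = (LINT y:spherical_domain|lborel. Jsph y * sqrt (det (GG (spherical y, t))))"
    unfolding riemannian_volume_def
    by (rule set_lebesgue_integral_cong) (use sets_spherical_domain in \<open>auto simp: sqrt_det_metric_spherical[OF \<tau> metric_eps(2)[OF t]] GG_S3[OF spherical_S3]\<close>)
  then show ?thesis unfolding spherical_integral_Mst[OF c] .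
qed

lemma det_BB_GG: "p \<in> Dom \<Longrightarrow> det (BB p) * sqrt (det (GG p)) = 1"
proof -
  assume p: "p \<in> Dom"
  have "det (BB p ** GG p ** transpose (BB p)) = 1" unfolding BB_orthonormal(1)[OF p] by simp
  then have "(det (BB p) * sqrt (det (GG p)))\<^sup>2 = 1"
    using GG_props(4)[OF p] by (simp add: det_mul power2_eq_square power_mult_distrib mult_ac)
  moreover have "det (BB p) * sqrt (det (GG p)) > 0" using BB_orthonormal(2)[OF p] GG_props(4)[OF p] by simp
  ultimately show ?thesis by (simp add: power2_eq_1_iff)
qed

text \<open>The Gram-Schmidt matrix is triangular, so its determinant is 1 + T + q, with T the trace
  of the deviation and q of second order. For F = 1 / (1 + T + q) one has exactly F - 1 + T = F (T^2
  + T q - q).\<close>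

lemma uO_volume: "uO 2 (\<lambda>x t. sqrt (det (GG (x, t))) - 1 + trb x t)"
proof -
  define q where "q x t = bm 1 1 x t * bm 2 2 x t + (bm 1 1 x t + bm 2 2 x t + bm 1 1 x t * bm 2 2 x t) * bm 3 3 x t" for x t
  have b2: "uO 2 (\<lambda>x t. bm i i x t * bm j j x t)" for i j by (intro uO_mult_1_1 uO_bm)
  have q: "uO 2 q" unfolding q_def by (intro uO_add uO_mult_1_1 uO_bm uO_2_1[OF b2])
  have d: "det (BB (x, t)) = 1 + trb x t + q x t" for x t
  proof -
    have z: "BB (x, t) $ 1 $ 2 = 0" "BB (x, t) $ 1 $ 3 = 0" "BB (x, t) $ 2 $ 3 = 0" by (simp_all add: BB_def chol_nth)
    have o: "BB (x, t) $ 1 $ 1 = 1 + bm 1 1 x t" "BB (x, t) $ 2 $ 2 = 1 + bm 2 2 x t" "BB (x, t) $ 3 $ 3 = 1 + bm 3 3 x t"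
      by (simp_all add: bm_def mat_def)
    show ?thesis unfolding det_3 z o q_def trb_def sum_3 by (simp add: algebra_simps)
  qed
  have F: "uO 0 (\<lambda>x t. sqrt (det (GG (x, t))))" by (rule uO_0[OF Cinf_on_continuous[OF Cinf_det_GG]])
  have r: "uO 2 (\<lambda>x t. trb x t * trb x t + trb x t * q x t - q x t)"
    by (intro uO_add uO_diff uO_mult_1_1 uO_trb uO_2_1[OF q] q)
  show ?thesis
  proof (rule uO_cong)
    show "uO 2 (\<lambda>x t. sqrt (det (GG (x, t))) * (trb x t * trb x t + trb x t * q x t - q x t))" using uO_mult[OF F r] by (simp only: add_0)
    fix x t assume "x \<in> S3" "\<bar>t\<bar> \<le> \<epsilon>0 / 2"
    then have "(1 + trb x t + q x t) * sqrt (det (GG (x, t))) = 1" using det_BB_GG[OF S3_Dom] unfolding d by blast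
    then show "sqrt (det (GG (x, t))) * (trb x t * trb x t + trb x t * q x t - q x t) = sqrt (det (GG (x, t))) - 1 + trb x t" by algebra
  qed
qed

lemma volume_expansion:
  "\<exists>C. \<forall>t. \<bar>t\<bar> \<le> \<epsilon>0 / 2 \<longrightarrow> \<bar>riemannian_volume (g t) - 2 * pi\<^sup>2 + (LINT y|Mst. trb (stereo y) t)\<bar> \<le> C * t\<^sup>2"
proof -
  obtain C where C: "\<And>x t. x \<in> S3 \<Longrightarrow> \<bar>t\<bar> \<le> \<epsilon>0 / 2 \<Longrightarrow> \<bar>sqrt (det (GG (x, t))) - 1 + trb x t\<bar> \<le> C * \<bar>t\<bar>\<^sup>2"
    using uO_volume unfolding uO_def by blast
  have "\<bar>riemannian_volume (g t) - 2 * pi\<^sup>2 + (LINT y|Mst. trb (stereo y) t)\<bar> \<le> (C * (2 * pi\<^sup>2)) * t\<^sup>2" if t: "\<bar>t\<bar> \<le> \<epsilon>0 / 2" for t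
  proof -
    have t': "\<bar>t\<bar> < \<epsilon>0" using t eps0 by linarith
    have i1: "integrable Mst (\<lambda>y. sqrt (det (GG (stereo y, t))))"
      by (rule stereo_integrable[of "\<lambda>x. sqrt (det (GG (x, t)))"], rule continuous_on_subset[OF Cinf_on_continuous[OF Cinf_slice[OF Cinf_det_GG t']] S3_nonzero])
    have i2: "integrable Mst (\<lambda>y. trb (stereo y) t)" by (rule stereo_integrable[OF continuous_trb[OF t']])
    have "(LINT y|Mst. sqrt (det (GG (stereo y, t))) - 1 + trb (stereo y) t) = riemannian_volume (g t) - 2 * pi\<^sup>2 + (LINT y|Mst. trb (stereo y) t)"
      unfolding volume_eq[OF t'] using i1 i2 measure_Mst by simp
    moreover have "norm (LINT y|Mst. sqrt (det (GG (stereo y, t))) - 1 + trb (stereo y) t) \<le> (LINT y|Mst. C * t\<^sup>2)"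
      by (rule norm_integral_le) (use i1 i2 C[OF stereo_S3 t] in auto)
    ultimately show ?thesis using measure_Mst by (simp add: mult_ac)
  qed
  then show ?thesis by blast
qed

section \<open>First variation of the eigenvalue\<close>

text \<open>A nontrivial eigenfunction has positive norm already in the stereographic chart, by
  \<open>ae_zero_S3_from_stereo\<close>.\<close>

lemma dirac_weak_solution:
  assumes t: "\<bar>t\<bar> < \<epsilon>0" and e: "pos_orthonormal_frame (g t) e" and v: "\<not> ae_zero_S3 v" "dirac (g t) e v (\<lambda>x. lam *\<^sub>R v x)"
  obtains u where "weak_solution t lam u" "L2n u > 0"
proof -
  have D: "(x, t) \<in> Dom" if "x \<in> S3" for x using that t S3_ne by auto
  have oB: "BB (x, t) ** gram (g t) \<tau> x ** transpose (BB (x, t)) = mat 1" if "x \<in> S3" for x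
    using BB_orthonormal(1)[OF D[OF that]] GG_S3[OF that] by simp
  obtain u where u: "u \<in> borel_measurable lebesgue" "integrable Mst (\<lambda>y. (norm (u y))\<^sup>2)" "\<And>y. norm (u y) = norm (v (stereo y))"
    "\<And>\<eta>. Cinf_on \<eta> (- {0}) \<Longrightarrow> (LINT y|Mst. pair (Wt \<tau> (\<lambda>x. BB (x, t)) (\<lambda>x. GG (x, t)) lam \<eta> (stereo y)) (u y)) = 0"
    using weak_dirac[OF \<tau> metric_eps(1)[OF t] e v(2) Cinf_slice[OF Cinf_BB t] BB_orthonormal(2)[OF D] oB Cinf_slice[OF Cinf_GG t] GG_S3]
    by blast
  have "L2n u \<noteq> 0"
  proof
    assume "L2n u = 0"
    then have "(LINT y|Mst. (norm (u y))\<^sup>2) = 0" unfolding L2n_sq[symmetric] by simp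
    then have "AE y in Mst. (norm (u y))\<^sup>2 = 0" using u(2) by (subst (asm) integral_nonneg_eq_0_iff_AE) auto
    then have "AE y in lebesgue. v (stereo y) = 0" unfolding AE_Mst by (simp add: u(3))
    then show False using ae_zero_S3_from_stereo v(1) by blast
  qed
  then have "L2n u > 0" using L2n_nonneg[of u] by linarith
  moreover have "weak_solution t lam u" unfolding weak_solution_def using u(1,2,4) by blast
  ultimately show ?thesis using that by blast
qed

text \<open>The integrated trace occurs in the first-order relations for both eigenvalue and volume.
  Eliminating it leaves a relation between the two expansions, and comparing slopes gives the
  formula. The expansion of \<open>lam\<close> also furnishes the a priori closeness to - 3 \<tau> /
  2 that the estimates require.\<close>

lemma eigenvalue_derivative:
  assumes frames: "\<And>t. \<bar>t\<bar> < \<epsilon>0 \<Longrightarrow> pos_orthonormal_frame (g t) (e t)"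
    and eig: "\<And>t. \<bar>t\<bar> < \<epsilon>0 \<Longrightarrow> dirac_eigenvalue (g t) (e t) (lam t)"
    and lam: "(\<lambda>t. lam t - (- (3 * \<tau> / 2) + l1 * t + l2 * t^2)) \<in> O[at 0](\<lambda>t. t^3)"
    and vol: "(\<lambda>t. riemannian_volume (g t) - (V0 + V1 * t)) \<in> O[at 0](\<lambda>t. t^2)"
  shows "l1 = \<tau> / (4 * pi\<^sup>2) * V1"
proof -
  obtain c where c: "c > 0" "eventually (\<lambda>t. norm (lam t - (- (3 * \<tau> / 2) + l1 * t + l2 * t^2)) \<le> c * norm (t^3)) (at 0)"
    using lam by (elim landau_o.bigE)
  obtain k where k: "k > 0" "eventually (\<lambda>t. norm (riemannian_volume (g t) - (V0 + V1 * t)) \<le> k * norm (t^2)) (at 0)"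
    using vol by (elim landau_o.bigE)
  obtain d1 where d1: "d1 > 0" "\<And>t. t \<noteq> 0 \<Longrightarrow> \<bar>t\<bar> < d1 \<Longrightarrow> \<bar>lam t - (- (3 * \<tau> / 2) + l1 * t + l2 * t^2)\<bar> \<le> c * \<bar>t\<bar>^3 \<and> \<bar>riemannian_volume (g t) - (V0 + V1 * t)\<bar> \<le> k * t^2"
    using eventually_conj[OF c(2) k(2)] unfolding eventually_at by (auto simp: dist_real_def power_abs)
  \<comment> \<open>For |t| <= 1 all powers of \<open>t\<close> in the expansion are bounded by
    |t|.\<close>
  define Cl where "Cl = \<bar>l1\<bar> + \<bar>l2\<bar> + c"
  have Cl: "Cl \<ge> 0" using c(1) by (simp add: Cl_def)
  obtain C1 \<delta> where \<delta>: "\<delta> > 0" and C1: "\<And>t lam u. \<bar>t\<bar> \<le> \<epsilon>0 / 2 \<Longrightarrow> \<bar>t\<bar> \<le> \<delta> \<Longrightarrow> \<bar>lam + 3 * \<tau> / 2\<bar> \<le> Cl * \<bar>t\<bar> \<Longrightarrow> weak_solution t lam u \<Longrightarrow> L2n u > 0 \<Longrightarrow>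
     \<bar>(lam + 3 * \<tau> / 2) * (2 * pi\<^sup>2) + \<tau> / 2 * (LINT y|Mst. trb (stereo y) t)\<bar> \<le> C1 * t\<^sup>2"
    using weak_solution_eigenvalue[OF Cl] by blast
  obtain C2 where C2: "\<And>t. \<bar>t\<bar> \<le> \<epsilon>0 / 2 \<Longrightarrow> \<bar>riemannian_volume (g t) - 2 * pi\<^sup>2 + (LINT y|Mst. trb (stereo y) t)\<bar> \<le> C2 * t\<^sup>2"
    using volume_expansion by blast
  define d where "d = Min {d1, \<delta>, \<epsilon>0 / 2, 1}"
  have d: "d > 0" "d \<le> d1" "d \<le> \<delta>" "d \<le> \<epsilon>0 / 2" "d \<le> 1" using d1(1) \<delta> eps0 by (simp_all add: d_def)
  have "\<bar>\<tau> / 2 * (2 * pi\<^sup>2 - V0) + (l1 * (2 * pi\<^sup>2) - \<tau> / 2 * V1) * t\<bar> \<le> (C1 + C2 + k + (\<bar>l2\<bar> + c) * (2 * pi\<^sup>2)) * t\<^sup>2"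
    if t: "t \<noteq> 0" "\<bar>t\<bar> < d" for t
  proof -
    have t': "\<bar>t\<bar> \<le> \<epsilon>0 / 2" "\<bar>t\<bar> \<le> \<delta>" "\<bar>t\<bar> < d1" "\<bar>t\<bar> \<le> 1" "\<bar>t\<bar> < \<epsilon>0" using t d eps0 by linarith+
    define \<Lambda> where "\<Lambda> = lam t + 3 * \<tau> / 2"
    define T where "T = (LINT y|Mst. trb (stereo y) t)"
    define V where "V = riemannian_volume (g t)"
    have "\<bar>t\<bar>^3 \<le> \<bar>t\<bar>^2" using t'(4) by (intro power_decreasing) auto
    then have "c * \<bar>t\<bar>^3 \<le> c * t\<^sup>2" using c(1) by (intro mult_left_mono) auto
    then have 1: "\<bar>\<Lambda> - l1 * t - l2 * t\<^sup>2\<bar> \<le> c * t\<^sup>2" "\<bar>V - (V0 + V1 * t)\<bar> \<le> k * t\<^sup>2"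
      using d1(2)[OF t(1) t'(3)] by (auto simp: \<Lambda>_def V_def algebra_simps)
    have l2: "\<bar>l2 * t\<^sup>2\<bar> = \<bar>l2\<bar> * t\<^sup>2" by (simp add: abs_mult)
    have 2: "\<bar>\<Lambda> - l1 * t\<bar> \<le> (\<bar>l2\<bar> + c) * t\<^sup>2" using 1(1) l2 by (simp add: distrib_right)
    have tt: "t\<^sup>2 \<le> \<bar>t\<bar>" using t'(4) mult_left_mono[of "\<bar>t\<bar>" 1 "\<bar>t\<bar>"] by (simp add: power2_eq_square)
    have "(\<bar>l2\<bar> + c) * t\<^sup>2 \<le> (\<bar>l2\<bar> + c) * \<bar>t\<bar>" using tt c(1) by (intro mult_left_mono) auto
    then have 3: "\<bar>lam t + 3 * \<tau> / 2\<bar> \<le> Cl * \<bar>t\<bar>"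
      using 2 abs_mult[of l1 t] unfolding \<Lambda>_def Cl_def distrib_right by linarith
    obtain v where v: "\<not> ae_zero_S3 v" "dirac (g t) (e t) v (\<lambda>x. lam t *\<^sub>R v x)" using eig[OF t'(5)] unfolding dirac_eigenvalue_def by blast
    obtain u where u: "weak_solution t (lam t) u" "L2n u > 0" using dirac_weak_solution[OF t'(5) frames[OF t'(5)] v] by blast
    have 4: "\<bar>\<Lambda> * (2 * pi\<^sup>2) + \<tau> / 2 * T\<bar> \<le> C1 * t\<^sup>2" unfolding \<Lambda>_def T_def by (rule C1[OF t'(1,2) 3 u])
    have 5: "\<bar>V - 2 * pi\<^sup>2 + T\<bar> \<le> C2 * t\<^sup>2" unfolding V_def T_def by (rule C2[OF t'(1)])
    have \<tau>1: "\<bar>\<tau> / 2\<bar> \<le> 1" using \<tau> by auto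
    have 6: "\<bar>\<tau> / 2 * (V - 2 * pi\<^sup>2 + T)\<bar> \<le> C2 * t\<^sup>2"
      using mult_mono[OF \<tau>1 5] by (simp add: abs_mult)
    have 7: "\<bar>\<tau> / 2 * (V - (V0 + V1 * t))\<bar> \<le> k * t\<^sup>2"
      using mult_mono[OF \<tau>1 1(2)] by (simp add: abs_mult)
    have 8: "\<bar>(\<Lambda> - l1 * t) * (2 * pi\<^sup>2)\<bar> \<le> ((\<bar>l2\<bar> + c) * t\<^sup>2) * (2 * pi\<^sup>2)"
      unfolding abs_mult using 2 by (intro mult_mono) auto
    \<comment> \<open>The integral \<open>T\<close> cancels between the first two brackets on the
      right, and each of the four terms there is of second order.\<close>
    have "\<tau> / 2 * (2 * pi\<^sup>2 - V0) + (l1 * (2 * pi\<^sup>2) - \<tau> / 2 * V1) * t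
       = (\<Lambda> * (2 * pi\<^sup>2) + \<tau> / 2 * T) - \<tau> / 2 * (V - 2 * pi\<^sup>2 + T) + \<tau> / 2 * (V - (V0 + V1 * t)) - (\<Lambda> - l1 * t) * (2 * pi\<^sup>2)"
      by (simp add: field_simps)
    then have "\<bar>\<tau> / 2 * (2 * pi\<^sup>2 - V0) + (l1 * (2 * pi\<^sup>2) - \<tau> / 2 * V1) * t\<bar> \<le> C1 * t\<^sup>2 + C2 * t\<^sup>2 + k * t\<^sup>2 + ((\<bar>l2\<bar> + c) * t\<^sup>2) * (2 * pi\<^sup>2)"
      using 4 6 7 8 by linarith
    then show ?thesis by (simp add: algebra_simps)
  qed
  from affine_slope_zero[OF d(1) this] have "l1 * (2 * pi\<^sup>2) = \<tau> / 2 * V1" by simp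
  then show ?thesis by (simp add: field_simps)
qed

end

theorem theorem2p1:
  fixes g :: "real \<Rightarrow> metric" and e :: "real \<Rightarrow> frame"
    and \<epsilon>0 :: real
    and lam_pos lam_neg :: "real \<Rightarrow> real"
    and lam_pos1 lam_pos2 lam_neg1 lam_neg2 V0 V1 :: real
  assumes eps0_pos: "\<epsilon>0 > 0"
    and metrics: "smooth_metric_family \<epsilon>0 g"
    and standard: "is_standard_metric (g 0)"
    and frames: "\<And>\<epsilon>. \<bar>\<epsilon>\<bar> < \<epsilon>0 \<Longrightarrow> pos_orthonormal_frame (g \<epsilon>) (e \<epsilon>)"
    and lowest_pos: "\<And>\<epsilon>. \<bar>\<epsilon>\<bar> < \<epsilon>0 \<Longrightarrow> lowest_pos_eigenvalue (g \<epsilon>) (e \<epsilon>) (lam_pos \<epsilon>)"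
    and lowest_neg: "\<And>\<epsilon>. \<bar>\<epsilon>\<bar> < \<epsilon>0 \<Longrightarrow> lowest_neg_eigenvalue (g \<epsilon>) (e \<epsilon>) (lam_neg \<epsilon>)"
    and expansion_pos:
      "(\<lambda>\<epsilon>. lam_pos \<epsilon> - (3/2 + lam_pos1 * \<epsilon> + lam_pos2 * \<epsilon>^2)) \<in> O[at 0](\<lambda>\<epsilon>. \<epsilon>^3)"
    and expansion_neg:
      "(\<lambda>\<epsilon>. lam_neg \<epsilon> - (- 3/2 + lam_neg1 * \<epsilon> + lam_neg2 * \<epsilon>^2)) \<in> O[at 0](\<lambda>\<epsilon>. \<epsilon>^3)"
    and expansion_volume:
      "(\<lambda>\<epsilon>. riemannian_volume (g \<epsilon>) - (V0 + V1 * \<epsilon>)) \<in> O[at 0](\<lambda>\<epsilon>. \<epsilon>^2)"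
  shows "lam_pos1 = - (1 / (4 * pi^2)) * V1 \<and> lam_neg1 = 1 / (4 * pi^2) * V1"
proof
  \<comment> \<open>Constant spinors have eigenvalue - 3 \<tau> / 2, so \<tau> = -1 serves the
    positive eigenvalue and \<tau> = 1 the negative one.\<close>
  interpret p: metric_perturbation "-1" \<epsilon>0 g by unfold_locales (use eps0_pos metrics standard in auto)
  interpret n: metric_perturbation 1 \<epsilon>0 g by unfold_locales (use eps0_pos metrics standard in auto)
  have "lam_pos1 = - 1 / (4 * pi\<^sup>2) * V1"
    by (rule p.eigenvalue_derivative[OF frames _ _ expansion_volume, where lam=lam_pos and ?l2.0=lam_pos2])
      (use lowest_pos expansion_pos in \<open>auto simp: lowest_pos_eigenvalue_def\<close>)
  then show "lam_pos1 = - (1 / (4 * pi^2)) * V1" by simp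
  show "lam_neg1 = 1 / (4 * pi^2) * V1"
    by (rule n.eigenvalue_derivative[OF frames _ _ expansion_volume, where lam=lam_neg and ?l2.0=lam_neg2])
      (use lowest_neg expansion_neg in \<open>auto simp: lowest_neg_eigenvalue_def\<close>)
qed

end
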